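(* Let $\nabla$ be a flat affine connection on $M$. If $M$ is a compact manifold, then the Lie group $\mathsf{Aff}(M,\nabla)$ is endowed with a flat affine bi-invariant connection $\widetilde{\nabla}$ inherited from $\nabla$.
   Context: $M$ is a connected real $n$-dimensional manifold. A linear connection $\nabla$ is flat affine if its curvature and torsion both vanish. $\mathsf{Aff}(M,\nabla)$ is the Lie group of diffeomorphisms of $M$ preserving $\nabla$. Its Lie algebra is the space of complete infinitesimal affine transformations of $(M,\nabla)$ (an infinitesimal affine transformation is a vector field whose local flows are local affine transformations). A flat affine bi-invariant connection on a Lie group is a linear connection invariant under left and right translations with vanishing curvature and torsion. "Inherited from $\nabla$" means that it is determined by the product $XY:=\nabla_XY$ on the Lie algebra of infinitesimal affine transformations of $(M,\nabla)$. *)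

theory Defs
  imports "HOL-Analysis.Analysis" "HOL-Algebra.Bij"
begin

section \<open>Smooth manifolds\<close>

text \<open>
  \<open>Ck_on k S f\<close> is meant for an open subset \<open>S\<close> of a finite-dimensional space: all iterated
  directional derivatives of order at most \<open>k\<close> exist, with Frechet differentiability up to
  order \<open>k - 1\<close>, and are continuous.
\<close>

primrec Ck_on ::
  "nat \<Rightarrow> 'a::real_normed_vector set \<Rightarrow> ('a \<Rightarrow> 'b::real_normed_vector) \<Rightarrow> bool" where
  "Ck_on 0 S f \<longleftrightarrow> continuous_on S f"
| "Ck_on (Suc k) S f \<longleftrightarrow>
     (\<forall>x\<in>S. f differentiable (at x)) \<and>
     (\<forall>v. Ck_on k S (\<lambda>x. frechet_derivative f (at x) v))"

definition smooth_on ::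
  "'a::real_normed_vector set \<Rightarrow> ('a \<Rightarrow> 'b::real_normed_vector) \<Rightarrow> bool" where
  "smooth_on S f \<longleftrightarrow> (\<forall>k. Ck_on k S f)"

text \<open>
  A chart is a pair of its domain and its coordinate map. The model space is a type \<open>'e\<close> of
  class \<open>real_inner\<close>, required below to have dimension \<open>n\<close>; the class \<open>euclidean_space\<close> is not
  used because it excludes dimension \<open>0\<close>, which does occur for affine groups of compact flat
  affine manifolds. The atlas need not be maximal.
\<close>

record ('a, 'e) manifold =
  mtop :: "'a topology"
  atlas :: "('a set \<times> ('a \<Rightarrow> 'e)) set"

abbreviation pts :: "('a, 'e) manifold \<Rightarrow> 'a set" where
  "pts M \<equiv> topspace (mtop M)"

definition smooth_manifold :: "nat \<Rightarrow> ('a, 'e::real_inner) manifold \<Rightarrow> bool" where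
  "smooth_manifold n M \<longleftrightarrow>
     (\<exists>B::'e set. finite B \<and> card B = n \<and> independent B \<and> span B = UNIV) \<and>
     Hausdorff_space (mtop M) \<and> second_countable (mtop M) \<and>
     (\<Union>(U, \<phi>) \<in> atlas M. U) = pts M \<and>
     (\<forall>(U, \<phi>) \<in> atlas M. openin (mtop M) U \<and> open (\<phi> ` U) \<and>
        homeomorphic_map (subtopology (mtop M) U) (top_of_set (\<phi> ` U)) \<phi>) \<and>
     (\<forall>(U, \<phi>) \<in> atlas M. \<forall>(V, \<psi>) \<in> atlas M. smooth_on (\<phi> ` (U \<inter> V)) (\<psi> \<circ> inv_into U \<phi>))"

definition open_submanifold :: "('a, 'e) manifold \<Rightarrow> 'a set \<Rightarrow> ('a, 'e) manifold" where
  "open_submanifold M W =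
     \<lparr>mtop = subtopology (mtop M) W, atlas = (\<lambda>(U, \<phi>). (U \<inter> W, \<phi>)) ` atlas M\<rparr>"

definition prod_manifold ::
  "('a, 'e) manifold \<Rightarrow> ('b, 'f) manifold \<Rightarrow> ('a \<times> 'b, 'e \<times> 'f) manifold" where
  "prod_manifold M N =
     \<lparr>mtop = prod_topology (mtop M) (mtop N),
      atlas = (\<lambda>((U, \<phi>), (V, \<psi>)). (U \<times> V, map_prod \<phi> \<psi>)) ` (atlas M \<times> atlas N)\<rparr>"

definition smooth_map ::
  "('a, 'e::real_inner) manifold \<Rightarrow> ('b, 'f::real_inner) manifold \<Rightarrow> ('a \<Rightarrow> 'b) \<Rightarrow> bool" where
  "smooth_map M N F \<longleftrightarrow>
     continuous_map (mtop M) (mtop N) F \<and>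
     (\<forall>(U, \<phi>) \<in> atlas M. \<forall>(V, \<psi>) \<in> atlas N.
        smooth_on (\<phi> ` (U \<inter> F -` V)) (\<psi> \<circ> F \<circ> inv_into U \<phi>))"

definition diffeo ::
  "('a, 'e::real_inner) manifold \<Rightarrow> ('b, 'f::real_inner) manifold \<Rightarrow> ('a \<Rightarrow> 'b) \<Rightarrow> bool" where
  "diffeo M N F \<longleftrightarrow>
     bij_betw F (pts M) (pts N) \<and> smooth_map M N F \<and> smooth_map N M (inv_into (pts M) F)"

section \<open>Functions and vector fields\<close>

text \<open>
  Smooth functions are extensional outside the manifold, and vector fields are the derivations
  of the algebra of smooth functions, extensional outside this algebra; so HOL equality is
  equality of functions and of vector fields.
\<close>

definition smooth_funs :: "('a, 'e::real_inner) manifold \<Rightarrow> ('a \<Rightarrow> real) set" where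
  "smooth_funs M =
     {f \<in> extensional (pts M). \<forall>(U, \<phi>) \<in> atlas M. smooth_on (\<phi> ` U) (f \<circ> inv_into U \<phi>)}"

type_synonym 'a vfield = "('a \<Rightarrow> real) \<Rightarrow> 'a \<Rightarrow> real"

definition vfields :: "('a, 'e::real_inner) manifold \<Rightarrow> 'a vfield set" where
  "vfields M =
     {X \<in> smooth_funs M \<rightarrow>\<^sub>E smooth_funs M.
        (\<forall>f\<in>smooth_funs M. \<forall>g\<in>smooth_funs M. \<forall>a::real.
           X (\<lambda>p\<in>pts M. a * f p + g p) = (\<lambda>p\<in>pts M. a * X f p + X g p)) \<and>
        (\<forall>f\<in>smooth_funs M. \<forall>g\<in>smooth_funs M.
           X (\<lambda>p\<in>pts M. f p * g p) = (\<lambda>p\<in>pts M. X f p * g p + f p * X g p))}"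

definition vf_zero :: "('a, 'e::real_inner) manifold \<Rightarrow> 'a vfield" where
  "vf_zero M = (\<lambda>f\<in>smooth_funs M. \<lambda>p\<in>pts M. 0)"

definition vf_add :: "('a, 'e::real_inner) manifold \<Rightarrow> 'a vfield \<Rightarrow> 'a vfield \<Rightarrow> 'a vfield" where
  "vf_add M X Y = (\<lambda>f\<in>smooth_funs M. \<lambda>p\<in>pts M. X f p + Y f p)"

definition vf_diff :: "('a, 'e::real_inner) manifold \<Rightarrow> 'a vfield \<Rightarrow> 'a vfield \<Rightarrow> 'a vfield" where
  "vf_diff M X Y = (\<lambda>f\<in>smooth_funs M. \<lambda>p\<in>pts M. X f p - Y f p)"

definition vf_scale ::
  "('a, 'e::real_inner) manifold \<Rightarrow> ('a \<Rightarrow> real) \<Rightarrow> 'a vfield \<Rightarrow> 'a vfield" where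
  "vf_scale M h X = (\<lambda>f\<in>smooth_funs M. \<lambda>p\<in>pts M. h p * X f p)"

definition vf_bracket ::
  "('a, 'e::real_inner) manifold \<Rightarrow> 'a vfield \<Rightarrow> 'a vfield \<Rightarrow> 'a vfield" where
  "vf_bracket M X Y = (\<lambda>f\<in>smooth_funs M. \<lambda>p\<in>pts M. X (Y f) p - Y (X f) p)"

definition pushforward ::
  "('a, 'e::real_inner) manifold \<Rightarrow> ('a \<Rightarrow> 'a) \<Rightarrow> 'a vfield \<Rightarrow> 'a vfield" where
  "pushforward M F X =
     (\<lambda>f\<in>smooth_funs M. \<lambda>q\<in>pts M. X (\<lambda>p\<in>pts M. f (F p)) (inv_into (pts M) F q))"

text \<open>
  For a map \<open>F\<close> defined on an open set \<open>W\<close>: \<open>X'\<close> at \<open>F p\<close> is the image of \<open>X\<close> at \<open>p\<close> under the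
  differential of \<open>F\<close>, for all \<open>p\<close> in \<open>W\<close>. As \<open>g \<circ> F\<close> is defined on \<open>W\<close> only, it is replaced by
  any global smooth function \<open>h\<close> with the same germ; every germ has such an \<open>h\<close>.
\<close>

definition related_on ::
  "('a, 'e::real_inner) manifold \<Rightarrow> 'a set \<Rightarrow> ('a \<Rightarrow> 'a) \<Rightarrow> 'a vfield \<Rightarrow> 'a vfield \<Rightarrow> bool" where
  "related_on M W F X X' \<longleftrightarrow>
     (\<forall>g\<in>smooth_funs M. \<forall>h\<in>smooth_funs M. \<forall>V.
        openin (mtop M) V \<and> V \<subseteq> W \<and> (\<forall>q\<in>V. h q = g (F q)) \<longrightarrow>
        (\<forall>p\<in>V. X h p = X' g (F p)))"

definition integral_curve ::
  "('a, 'e::real_inner) manifold \<Rightarrow> 'a vfield \<Rightarrow> real set \<Rightarrow> (real \<Rightarrow> 'a) \<Rightarrow> bool" where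
  "integral_curve M X I \<gamma> \<longleftrightarrow>
     \<gamma> ` I \<subseteq> pts M \<and>
     (\<forall>f\<in>smooth_funs M. \<forall>t\<in>I. ((\<lambda>s. f (\<gamma> s)) has_real_derivative X f (\<gamma> t)) (at t))"

definition complete_vf :: "('a, 'e::real_inner) manifold \<Rightarrow> 'a vfield \<Rightarrow> bool" where
  "complete_vf M X \<longleftrightarrow> (\<forall>p\<in>pts M. \<exists>\<gamma>. \<gamma> 0 = p \<and> integral_curve M X UNIV \<gamma>)"

text \<open>Joint smoothness in \<open>t\<close> and \<open>p\<close> is automatic, since integral curves are unique.\<close>

definition local_flow ::
  "('a, 'e::real_inner) manifold \<Rightarrow> 'a vfield \<Rightarrow> real \<Rightarrow> 'a set \<Rightarrow> (real \<Rightarrow> 'a \<Rightarrow> 'a) \<Rightarrow> bool" where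
  "local_flow M X \<epsilon> U \<phi> \<longleftrightarrow>
     \<epsilon> > 0 \<and> openin (mtop M) U \<and>
     (\<forall>p\<in>U. \<phi> 0 p = p \<and> integral_curve M X {-\<epsilon><..<\<epsilon>} (\<lambda>t. \<phi> t p))"

section \<open>Linear connections and affine transformations\<close>

type_synonym 'a connection = "'a vfield \<Rightarrow> 'a vfield \<Rightarrow> 'a vfield"

definition linear_connection :: "('a, 'e::real_inner) manifold \<Rightarrow> 'a connection \<Rightarrow> bool" where
  "linear_connection M D \<longleftrightarrow>
     (\<forall>X\<in>vfields M. \<forall>Y\<in>vfields M. D X Y \<in> vfields M) \<and>
     (\<forall>X\<in>vfields M. \<forall>Y\<in>vfields M. \<forall>Z\<in>vfields M.
        D (vf_add M X Y) Z = vf_add M (D X Z) (D Y Z) \<and>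
        D X (vf_add M Y Z) = vf_add M (D X Y) (D X Z)) \<and>
     (\<forall>X\<in>vfields M. \<forall>Y\<in>vfields M. \<forall>h\<in>smooth_funs M.
        D (vf_scale M h X) Y = vf_scale M h (D X Y) \<and>
        D X (vf_scale M h Y) = vf_add M (vf_scale M (X h) Y) (vf_scale M h (D X Y)))"

definition curvature ::
  "('a, 'e::real_inner) manifold \<Rightarrow> 'a connection \<Rightarrow> 'a vfield \<Rightarrow> 'a vfield \<Rightarrow> 'a vfield \<Rightarrow> 'a vfield"
  where
  "curvature M D X Y Z =
     vf_diff M (vf_diff M (D X (D Y Z)) (D Y (D X Z))) (D (vf_bracket M X Y) Z)"

definition torsion ::
  "('a, 'e::real_inner) manifold \<Rightarrow> 'a connection \<Rightarrow> 'a vfield \<Rightarrow> 'a vfield \<Rightarrow> 'a vfield" where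
  "torsion M D X Y = vf_diff M (vf_diff M (D X Y) (D Y X)) (vf_bracket M X Y)"

definition flat_affine_connection :: "('a, 'e::real_inner) manifold \<Rightarrow> 'a connection \<Rightarrow> bool" where
  "flat_affine_connection M D \<longleftrightarrow>
     linear_connection M D \<and>
     (\<forall>X\<in>vfields M. \<forall>Y\<in>vfields M. \<forall>Z\<in>vfields M. curvature M D X Y Z = vf_zero M) \<and>
     (\<forall>X\<in>vfields M. \<forall>Y\<in>vfields M. torsion M D X Y = vf_zero M)"

definition preserves_connection ::
  "('a, 'e::real_inner) manifold \<Rightarrow> 'a connection \<Rightarrow> ('a \<Rightarrow> 'a) \<Rightarrow> bool" where
  "preserves_connection M D F \<longleftrightarrow>
     (\<forall>X\<in>vfields M. \<forall>Y\<in>vfields M.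
        pushforward M F (D X Y) = D (pushforward M F X) (pushforward M F Y))"

text \<open>
  A vector field on \<open>U\<close> extends to \<open>M\<close> only after shrinking \<open>U\<close>; this is why preservation of the
  connection is tested on all open subsets \<open>W\<close> of \<open>U\<close>.
\<close>

definition local_affine ::
  "('a, 'e::real_inner) manifold \<Rightarrow> 'a connection \<Rightarrow> 'a set \<Rightarrow> ('a \<Rightarrow> 'a) \<Rightarrow> bool" where
  "local_affine M D U F \<longleftrightarrow>
     openin (mtop M) U \<and> openin (mtop M) (F ` U) \<and>
     diffeo (open_submanifold M U) (open_submanifold M (F ` U)) F \<and>
     (\<forall>W. openin (mtop M) W \<and> W \<subseteq> U \<longrightarrow>
        (\<forall>X\<in>vfields M. \<forall>Y\<in>vfields M. \<forall>X'\<in>vfields M. \<forall>Y'\<in>vfields M.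
           related_on M W F X X' \<and> related_on M W F Y Y' \<longrightarrow>
           related_on M W F (D X Y) (D X' Y')))"

definition inf_affine :: "('a, 'e::real_inner) manifold \<Rightarrow> 'a connection \<Rightarrow> 'a vfield set" where
  "inf_affine M D =
     {X \<in> vfields M. \<forall>\<epsilon> U \<phi>. local_flow M X \<epsilon> U \<phi> \<longrightarrow>
        (\<forall>t\<in>{-\<epsilon><..<\<epsilon>}. local_affine M D U (\<phi> t))}"

definition Aff :: "('a, 'e::real_inner) manifold \<Rightarrow> 'a connection \<Rightarrow> ('a \<Rightarrow> 'a) set" where
  "Aff M D = {F \<in> Bij (pts M). diffeo M M F \<and> preserves_connection M D F}"

definition Aff_group :: "('a, 'e::real_inner) manifold \<Rightarrow> 'a connection \<Rightarrow> ('a \<Rightarrow> 'a) monoid" where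
  "Aff_group M D = BijGroup (pts M)\<lparr>carrier := Aff M D\<rparr>"

section \<open>Lie groups\<close>

definition lie_group ::
  "nat \<Rightarrow> ('g, 'f::real_inner) manifold \<Rightarrow> ('g, 'b) monoid_scheme \<Rightarrow> bool" where
  "lie_group k G \<Gamma> \<longleftrightarrow>
     smooth_manifold k G \<and> group \<Gamma> \<and> pts G = carrier \<Gamma> \<and>
     smooth_map (prod_manifold G G) G (\<lambda>(x, y). x \<otimes>\<^bsub>\<Gamma>\<^esub> y) \<and>
     smooth_map G G (\<lambda>x. inv\<^bsub>\<Gamma>\<^esub> x)"

definition left_translation :: "('g, 'b) monoid_scheme \<Rightarrow> 'g \<Rightarrow> 'g \<Rightarrow> 'g" where
  "left_translation \<Gamma> a = (\<lambda>x\<in>carrier \<Gamma>. a \<otimes>\<^bsub>\<Gamma>\<^esub> x)"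

definition right_translation :: "('g, 'b) monoid_scheme \<Rightarrow> 'g \<Rightarrow> 'g \<Rightarrow> 'g" where
  "right_translation \<Gamma> a = (\<lambda>x\<in>carrier \<Gamma>. x \<otimes>\<^bsub>\<Gamma>\<^esub> a)"

definition bi_invariant ::
  "('g, 'f::real_inner) manifold \<Rightarrow> ('g, 'b) monoid_scheme \<Rightarrow> 'g connection \<Rightarrow> bool" where
  "bi_invariant G \<Gamma> D \<longleftrightarrow>
     (\<forall>a\<in>carrier \<Gamma>. preserves_connection G D (left_translation \<Gamma> a) \<and>
                     preserves_connection G D (right_translation \<Gamma> a))"

definition right_invariant_vfields ::
  "('g, 'f::real_inner) manifold \<Rightarrow> ('g, 'b) monoid_scheme \<Rightarrow> 'g vfield set" where
  "right_invariant_vfields G \<Gamma> =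
     {\<xi> \<in> vfields G. \<forall>a\<in>carrier \<Gamma>. pushforward G (right_translation \<Gamma> a) \<xi> = \<xi>}"

section \<open>The Lie group of affine transformations\<close>

text \<open>
  The vector field on \<open>M\<close> induced by a vector field \<open>\<xi>\<close> on a group \<open>G\<close> of transformations of \<open>M\<close>:
  its value at \<open>p\<close> is the image of \<open>\<xi>\<close> at the identity under the differential of the orbit map
  that sends \<open>g\<close> to \<open>g p\<close>. If \<open>\<xi>\<close> is right invariant, then \<open>\<xi>\<close> and the induced field are related
  by every orbit map, and the flow of the induced field is the one-parameter group
  \<open>t \<mapsto> exp (t \<xi>)\<close>. So \<open>\<xi> \<mapsto> induced_vfield M G \<xi>\<close> preserves Lie brackets on right
  invariant fields; on left invariant fields it would reverse them.
\<close>

definition induced_vfield ::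
  "('a, 'e::real_inner) manifold \<Rightarrow> ('a \<Rightarrow> 'a, 'f::real_inner) manifold \<Rightarrow>
   ('a \<Rightarrow> 'a) vfield \<Rightarrow> 'a vfield" where
  "induced_vfield M G \<xi> = (\<lambda>f\<in>smooth_funs M. \<lambda>p\<in>pts M. \<xi> (\<lambda>g\<in>pts G. f (g p)) (\<lambda>x\<in>pts M. x))"

text \<open>
  \<open>G\<close> is the Lie group structure on \<open>Aff M D\<close>: it acts smoothly on \<open>M\<close> and its Lie algebra is the
  space of complete infinitesimal affine transformations. There is only one such smooth
  structure, since the exponential map is prescribed: it is the time-one flow.
\<close>

definition affine_lie_group ::
  "nat \<Rightarrow> ('a, 'e::real_inner) manifold \<Rightarrow> 'a connection \<Rightarrow>
   ('a \<Rightarrow> 'a, 'f::real_inner) manifold \<Rightarrow> bool" where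
  "affine_lie_group k M D G \<longleftrightarrow>
     lie_group k G (Aff_group M D) \<and>
     smooth_map (prod_manifold G M) M (\<lambda>(g, p). g p) \<and>
     bij_betw (induced_vfield M G) (right_invariant_vfields G (Aff_group M D))
       {X \<in> inf_affine M D. complete_vf M X}"

text \<open>
  The connection \<open>D'\<close> on \<open>G\<close> is given on the Lie algebra by the product \<open>X Y = D X Y\<close> of
  infinitesimal affine transformations: every \<open>X\<close> and \<open>Y\<close> come from elements \<open>\<xi>\<close> and \<open>\<eta>\<close> of the
  Lie algebra of \<open>G\<close>, and \<open>D' \<xi> \<eta>\<close> is the element corresponding to \<open>D X Y\<close>. Right invariant
  fields form a global frame, so this determines \<open>D'\<close>.
\<close>

definition inherited_connection ::
  "('a, 'e::real_inner) manifold \<Rightarrow> 'a connection \<Rightarrow>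
   ('a \<Rightarrow> 'a, 'f::real_inner) manifold \<Rightarrow> ('a \<Rightarrow> 'a) connection \<Rightarrow> bool" where
  "inherited_connection M D G D' \<longleftrightarrow>
     (\<forall>X\<in>inf_affine M D. \<forall>Y\<in>inf_affine M D.
        \<exists>\<xi>\<in>right_invariant_vfields G (Aff_group M D).
        \<exists>\<eta>\<in>right_invariant_vfields G (Aff_group M D).
          induced_vfield M G \<xi> = X \<and> induced_vfield M G \<eta> = Y \<and>
          D' \<xi> \<eta> \<in> right_invariant_vfields G (Aff_group M D) \<and>
          induced_vfield M G (D' \<xi> \<eta>) = D X Y)"

end

theory Submission
  imports Defs
begin

text \<open>
  In a chart, a field \<open>f\<close> is an infinitesimal affine transformation if and only if it solves a
  linear second order equation. As torsion and curvature vanish, this equation says that the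
  endomorphism \<open>A\<^sub>f : u \<mapsto> \<nabla>\<^sub>u f\<close> is parallel; since then \<open>A\<close> of \<open>\<nabla>\<^sub>X Y\<close> is the composition of \<open>A\<^sub>Y\<close> and \<open>A\<^sub>X\<close>,
  the solutions are closed under the product \<open>\<nabla>\<^sub>X Y\<close>. On a compact manifold every field is complete, and the flow
  of a solution consists of affine transformations: along an integral curve both sides of the equation
  for affine maps satisfy the same linear differential equation. So the solutions are exactly the Lie
  algebra of \<open>Aff(M, \<nabla>)\<close>, and the product defines \<open>\<nabla>'\<close> on right invariant fields.
  These form a global frame, so \<open>\<nabla>'\<close> extends to a unique connection. Torsion and curvature are
  tensors and vanish on the frame because they vanish on \<open>M\<close>. Right translations fix the frame, and
  left translation by \<open>a\<close> corresponds to the action of \<open>a\<close> on fields on \<open>M\<close>, which preserves \<open>\<nabla>\<close>.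
\<close>

section \<open>Smooth functions of several variables\<close>

text \<open>The definition of \<open>inf_affine\<close> quantifies over local flows and supplies
  none, so the second order equation is not read off from a flow. The bijection in
  \<open>affine_lie_group\<close> is used instead: a complete field comes from a right invariant
  field on \<open>G\<close>, hence from a curve through the identity in a chart of \<open>G\<close>
  whose points are affine maps, and differentiating the equation of affine maps along this curve
  gives the equation of the field. In the other direction the flow has to be smooth in the initial
  point. Only its first derivative, and the derivative of that, are obtained from estimates; the
  equation of affine maps expresses all further derivatives through lower ones. The flow is treated
  in a chart for short times only: compactness makes the time uniform, and long times are reached by
  composing in the group. The model space is merely of class \<open>real_inner\<close>: coordinates
  go through an explicit orthonormal basis, and the completeness that the fixed point theorem
  requires is borrowed from the dual space.\<close>

abbreviation fd :: "('a::real_normed_vector \<Rightarrow> 'b::real_normed_vector) \<Rightarrow> 'a \<Rightarrow> 'a \<Rightarrow> 'b" where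
  "fd f x \<equiv> frechet_derivative f (at x)"

lemma fd_eq: "(f has_derivative f') (at x) \<Longrightarrow> fd f x = f'"
  by (rule frechet_derivative_at[symmetric])

lemma fd_works: "f differentiable (at x) \<Longrightarrow> (f has_derivative fd f x) (at x)"
  by (simp add: frechet_derivative_works[symmetric])

lemma fd_bounded_linear: "f differentiable (at x) \<Longrightarrow> bounded_linear (fd f x)"
  using fd_works has_derivative_bounded_linear by blast

lemma fd_cong_open:
  assumes "open S" "x \<in> S" "\<And>y. y \<in> S \<Longrightarrow> f y = g y"
  shows "fd f x = fd g x"
proof -
  have "(f has_derivative F) (at x) \<longleftrightarrow> (g has_derivative F) (at x)" for F
    using assms by (metis has_derivative_transform_within_open)
  then show ?thesis unfolding frechet_derivative_def by simp
qed

lemma Ck_on_cong: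
  assumes "open S" "\<And>x. x \<in> S \<Longrightarrow> f x = g x" "Ck_on k S f"
  shows "Ck_on k S g"
  using assms(2,3)
proof (induction k arbitrary: f g)
  case 0
  then show ?case using continuous_on_cong by auto
next
  case (Suc k)
  have "g differentiable (at x)" if "x \<in> S" for x
    using Suc.prems that assms(1) unfolding differentiable_def
    by (metis Ck_on.simps(2) differentiable_def has_derivative_transform_within_open)
  moreover have "Ck_on k S (\<lambda>x. fd g x v)" for v
    using Suc.IH[of "\<lambda>x. fd f x v" "\<lambda>x. fd g x v"] Suc.prems fd_cong_open[OF assms(1)]
    by (metis Ck_on.simps(2))
  ultimately show ?case by simp
qed

lemma Ck_on_subset: "Ck_on k S f \<Longrightarrow> T \<subseteq> S \<Longrightarrow> Ck_on k T f"
  by (induction k arbitrary: f) (auto intro: continuous_on_subset)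

lemma differentiable_imp_cont_on: "(\<And>x. x \<in> S \<Longrightarrow> f differentiable (at x)) \<Longrightarrow> continuous_on S f"
  by (meson continuous_at_imp_continuous_on differentiable_imp_continuous_within)

lemma Ck_on_SucD: "Ck_on (Suc k) S f \<Longrightarrow> Ck_on k S f"
proof (induction k arbitrary: f)
  case 0
  then show ?case using differentiable_imp_cont_on by auto
next
  case (Suc k)
  then show ?case by (metis Ck_on.simps(2))
qed

lemma Ck_on_local:
  assumes "\<And>x. x \<in> S \<Longrightarrow> \<exists>T. open T \<and> x \<in> T \<and> Ck_on k T f"
  shows "Ck_on k S f"
  using assms
proof (induction k arbitrary: f)
  case 0
  then show ?case
    by (metis Ck_on.simps(1) continuous_at_imp_continuous_on continuous_on_interior interior_open)
next
  case (Suc k)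
  then show ?case by (metis Ck_on.simps(2))
qed

lemma Ck_on_const [simp]: "Ck_on k S (\<lambda>x. c)"
  by (induction k arbitrary: c) auto

lemma Ck_on_linear: "bounded_linear L \<Longrightarrow> Ck_on k S L"
proof (cases k)
  case 0
  assume "bounded_linear L"
  then show ?thesis using 0 by (simp add: linear_continuous_on)
next
  case (Suc j)
  assume L: "bounded_linear L"
  then have "(L has_derivative L) (at x)" for x by (rule bounded_linear_imp_has_derivative)
  then have "fd L x = L" "L differentiable (at x)" for x
    by (auto intro: fd_eq differentiableI)
  then show ?thesis by (simp add: Suc)
qed

lemma Ck_on_add:
  assumes "open S" "Ck_on k S f" "Ck_on k S g"
  shows "Ck_on k S (\<lambda>x. f x + g x)"
  using assms(2,3)
proof (induction k arbitrary: f g)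
  case 0
  then show ?case by (auto intro: continuous_intros)
next
  case (Suc k)
  have "fd (\<lambda>x. f x + g x) x v = fd f x v + fd g x v" if "x \<in> S" for x v
  proof -
    have "((\<lambda>x. f x + g x) has_derivative (\<lambda>v. fd f x v + fd g x v)) (at x)"
      using Suc.prems that by (intro has_derivative_add fd_works) auto
    then show ?thesis by (simp add: fd_eq)
  qed
  moreover have "Ck_on k S (\<lambda>x. fd f x v + fd g x v)" for v
    using Suc.prems by (intro Suc.IH) simp_all
  ultimately have "Ck_on k S (\<lambda>x. fd (\<lambda>x. f x + g x) x v)" for v
    by (metis (no_types, lifting) Ck_on_cong[OF assms(1)])
  then show ?case using Suc.prems by auto
qed

lemma Ck_on_sum:
  assumes "open S" "\<And>i. i \<in> I \<Longrightarrow> Ck_on k S (f i)"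
  shows "Ck_on k S (\<lambda>x. \<Sum>i\<in>I. f i x)"
  using assms(2)
  by (induction I rule: infinite_finite_induct) (auto intro: Ck_on_add[OF assms(1)])

text \<open>The product rule yields two terms of the same shape, each with one factor differentiated
  and the other one order smoother than required; hence the induction over \<open>k\<close> with
  both factors arbitrary.\<close>

lemma Ck_on_bilinear:
  assumes "open S" "bounded_bilinear m" "Ck_on k S f" "Ck_on k S g"
  shows "Ck_on k S (\<lambda>x. m (f x) (g x))"
  using assms(3,4)
proof (induction k arbitrary: f g)
  case 0
  then show ?case using bounded_bilinear.continuous_on[OF assms(2)] by auto
next
  case (Suc k)
  have D: "((\<lambda>x. m (f x) (g x)) has_derivative (\<lambda>v. m (f x) (fd g x v) + m (fd f x v) (g x))) (at x)"
    if "x \<in> S" for x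
    using Suc.prems that by (intro bounded_bilinear.FDERIV[OF assms(2)] fd_works) auto
  have "Ck_on k S (\<lambda>x. m (f x) (fd g x v) + m (fd f x v) (g x))" for v
    using Suc.prems Ck_on_SucD[OF Suc.prems(1)] Ck_on_SucD[OF Suc.prems(2)]
    by (intro Ck_on_add[OF assms(1)] Suc.IH) simp_all
  then have "Ck_on k S (\<lambda>x. fd (\<lambda>x. m (f x) (g x)) x v)" for v
    by (rule Ck_on_cong[OF assms(1), rotated]) (simp add: fd_eq[OF D])
  then show ?case using D by (auto intro: differentiableI)
qed

lemma Ck_on_linear_compose:
  assumes "open S" "bounded_linear L" "Ck_on k S f"
  shows "Ck_on k S (\<lambda>x. L (f x))"
  using assms(3)
proof (induction k arbitrary: f)
  case 0
  then show ?case using bounded_linear.continuous_on[OF assms(2)] by auto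
next
  case (Suc k)
  have D: "((\<lambda>x. L (f x)) has_derivative (\<lambda>v. L (fd f x v))) (at x)" if "x \<in> S" for x
    using Suc.prems that by (intro bounded_linear.has_derivative[OF assms(2)] fd_works) auto
  have "Ck_on k S (\<lambda>x. L (fd f x v))" for v
    using Suc.prems by (intro Suc.IH) simp
  then have "Ck_on k S (\<lambda>x. fd (\<lambda>x. L (f x)) x v)" for v
    by (rule Ck_on_cong[OF assms(1), rotated]) (simp add: fd_eq[OF D])
  then show ?case using D by (auto intro: differentiableI)
qed

text \<open>The class \<open>euclidean_space\<close> excludes dimension \<open>0\<close>, so an orthonormal basis is carried along
  explicitly.\<close>

definition orthobasis :: "'e::real_inner set \<Rightarrow> bool" where
  "orthobasis B \<longleftrightarrow> finite B \<and> (\<forall>a\<in>B. \<forall>b\<in>B. a \<bullet> b = (if a = b then 1 else 0)) \<and>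
     (\<forall>x. (\<Sum>b\<in>B. (x \<bullet> b) *\<^sub>R b) = x)"

lemma orthobasis_finite: "orthobasis B \<Longrightarrow> finite B"
  by (simp add: orthobasis_def)

lemma orthobasis_expand: "orthobasis B \<Longrightarrow> (\<Sum>b\<in>B. (x \<bullet> b) *\<^sub>R b) = x"
  by (simp add: orthobasis_def)

lemma orthobasis_inner: "orthobasis B \<Longrightarrow> a \<in> B \<Longrightarrow> b \<in> B \<Longrightarrow> a \<bullet> b = (if a = b then 1 else 0)"
  by (simp add: orthobasis_def)

lemma orthobasis_eqI:
  assumes "orthobasis B" "\<And>b. b \<in> B \<Longrightarrow> x \<bullet> b = y \<bullet> b"
  shows "x = y"
proof -
  have "(\<Sum>b\<in>B. (x \<bullet> b) *\<^sub>R b) = (\<Sum>b\<in>B. (y \<bullet> b) *\<^sub>R b)"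
    using assms(2) by (auto intro: sum.cong)
  then show ?thesis using assms(1) by (simp add: orthobasis_expand)
qed

lemma orthobasis_linear:
  fixes L :: "'e::real_inner \<Rightarrow> 'b::real_normed_vector" and B :: "'e set"
  assumes "orthobasis B" "linear L"
  shows "L x = (\<Sum>b\<in>B. (x \<bullet> b) *\<^sub>R L b)"
proof -
  have "L x = L (\<Sum>b\<in>B. (x \<bullet> b) *\<^sub>R b)" using assms(1) by (simp add: orthobasis_expand)
  then show ?thesis using assms(2) by (simp add: linear_sum linear_scale)
qed

text \<open>In finite dimension linearity implies continuity: the map is a finite sum of coordinate
  functionals times fixed vectors.\<close>

lemma orthobasis_bounded_linear:
  fixes L :: "'e::real_inner \<Rightarrow> 'b::real_normed_vector" and B :: "'e set"
  assumes "orthobasis B" "linear L"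
  shows "bounded_linear L"
proof -
  have "bounded_linear (\<lambda>x. \<Sum>b\<in>B. (x \<bullet> b) *\<^sub>R L b)"
    by (intro bounded_linear_sum bounded_linear_scaleR_const bounded_linear_inner_left)
  moreover have "(\<lambda>x. \<Sum>b\<in>B. (x \<bullet> b) *\<^sub>R L b) = L"
    by (rule ext) (rule orthobasis_linear[OF assms, symmetric])
  ultimately show ?thesis by (rule back_subst)
qed

lemma orthobasis_sum:
  assumes "orthobasis B" "b \<in> B"
  shows "(\<Sum>c\<in>B. f c *\<^sub>R c) \<bullet> b = f b"
proof -
  have "(\<Sum>c\<in>B. f c *\<^sub>R c) \<bullet> b = (\<Sum>c\<in>B. f c * (c \<bullet> b))"
    by (simp add: inner_sum_left)
  also have "\<dots> = (\<Sum>c\<in>B. if c = b then f c else 0)"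
    using assms by (intro sum.cong) (auto simp: orthobasis_inner)
  finally show ?thesis using assms by (simp add: orthobasis_finite)
qed

text \<open>Gram-Schmidt (\<open>basis_orthogonal\<close>) followed by normalisation. The zero
  vector, which an orthogonal family may contain, is dropped first; in dimension 0 this leaves the
  empty basis.\<close>

lemma orthobasis_exists:
  fixes A :: "'e::real_inner set"
  assumes "finite A" "span A = UNIV"
  shows "\<exists>B::'e set. orthobasis B"
proof -
  obtain C :: "'e set" where C: "finite C" "span C = UNIV" "pairwise orthogonal C"
    using basis_orthogonal[OF assms(1)] assms(2) by auto
  define B where "B = (\<lambda>c. c /\<^sub>R norm c) ` (C - {0})"
  have fin: "finite B" using C by (simp add: B_def)
  have inn: "a \<bullet> b = (if a = b then 1 else 0)" if "a \<in> B" "b \<in> B" for a b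
  proof -
    obtain c d where c: "c \<in> C" "c \<noteq> 0" "a = c /\<^sub>R norm c" and d: "d \<in> C" "d \<noteq> 0" "b = d /\<^sub>R norm d"
      using \<open>a \<in> B\<close> \<open>b \<in> B\<close> by (auto simp: B_def)
    show ?thesis
    proof (cases "c = d")
      case True
      then show ?thesis using c d by (simp add: power2_norm_eq_inner[symmetric] power2_eq_square)
    next
      case False
      then have "c \<bullet> d = 0" using C(3) c d by (auto simp: pairwise_def orthogonal_def)
      then have "a \<bullet> b = 0" using c d by simp
      moreover have "a \<bullet> a \<noteq> 0" using c by simp
      ultimately show ?thesis by auto
    qed
  qed
  have sp: "span B = UNIV"
  proof -
    have "C \<subseteq> span B"
    proof
      fix c assume "c \<in> C"
      show "c \<in> span B"
      proof (cases "c = 0")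
        case False
        then have "c = norm c *\<^sub>R (c /\<^sub>R norm c)" by simp
        moreover have "c /\<^sub>R norm c \<in> span B" using False \<open>c \<in> C\<close> by (auto simp: B_def intro: span_base)
        ultimately show ?thesis by (metis span_scale)
      qed (simp add: span_zero)
    qed
    then show ?thesis using C(2) by (metis span_mono span_span top.extremum_uniqueI)
  qed
  \<comment> \<open>Both sides are linear in \<open>x\<close> and agree on \<open>B\<close>, hence
    on its span.\<close>
  have "(\<Sum>b\<in>B. (x \<bullet> b) *\<^sub>R b) = x" for x
  proof -
    have lin: "linear (\<lambda>x. \<Sum>b\<in>B. (x \<bullet> b) *\<^sub>R b)"
      by (intro bounded_linear.linear bounded_linear_sum bounded_linear_scaleR_const bounded_linear_inner_left)
    have "(\<Sum>b\<in>B. (c \<bullet> b) *\<^sub>R b) = id c" if "c \<in> B" for c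
    proof -
      have "(\<Sum>b\<in>B. (c \<bullet> b) *\<^sub>R b) = (\<Sum>b\<in>B. if b = c then b else 0)"
        using that inn by (intro sum.cong) auto
      then show ?thesis using that fin by simp
    qed
    then show ?thesis
      using linear_eq_on_span[OF lin linear_id, of B x] sp by auto
  qed
  then show ?thesis using fin inn unfolding orthobasis_def by blast
qed

lemma orthobasis_Times:
  assumes "orthobasis A" "orthobasis B"
  shows "orthobasis ((\<lambda>a. (a, 0)) ` A \<union> (\<lambda>b. (0, b)) ` B)"
proof -
  let ?A = "(\<lambda>a. (a, 0::'b)) ` A" and ?B = "(\<lambda>b. (0::'a, b)) ` B"
  have fin: "finite ?A" "finite ?B" using assms by (auto simp: orthobasis_finite)
  have z: "0 \<notin> A" "0 \<notin> B" using assms orthobasis_inner by force+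
  then have disj: "?A \<inter> ?B = {}" by auto
  have "(\<Sum>b\<in>?A \<union> ?B. (x \<bullet> b) *\<^sub>R b) = x" for x
  proof -
    have "(\<Sum>b\<in>?A \<union> ?B. (x \<bullet> b) *\<^sub>R b) = (\<Sum>b\<in>?A. (x \<bullet> b) *\<^sub>R b) + (\<Sum>b\<in>?B. (x \<bullet> b) *\<^sub>R b)"
      using fin disj by (rule sum.union_disjoint)
    also have "\<dots> = (\<Sum>a\<in>A. (fst x \<bullet> a) *\<^sub>R (a, 0)) + (\<Sum>b\<in>B. (snd x \<bullet> b) *\<^sub>R (0, b))"
      by (subst (1 2) sum.reindex) (auto simp: inj_on_def inner_prod_def)
    also have "\<dots> = x"
      using orthobasis_expand[OF assms(1), of "fst x"] orthobasis_expand[OF assms(2), of "snd x"]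
      by (cases x) (simp add: sum_prod)
    finally show ?thesis .
  qed
  moreover have "a \<bullet> b = (if a = b then 1 else 0)" if "a \<in> ?A \<union> ?B" "b \<in> ?A \<union> ?B" for a b
    using that assms z by (auto simp: orthobasis_inner split: if_splits)
  ultimately show ?thesis using fin unfolding orthobasis_def by blast
qed

lemma orthobasis_real: "orthobasis {1::real}"
  by (simp add: orthobasis_def)

section \<open>Chain rule and smoothness at a point\<close>

lemma fd_compose:
  assumes "f differentiable (at x)" "g differentiable (at (f x))"
  shows "fd (\<lambda>x. g (f x)) x v = fd g (f x) (fd f x v)"
    "(\<lambda>x. g (f x)) differentiable (at x)"
  using diff_chain_at[OF fd_works[OF assms(1)] fd_works[OF assms(2)]]
  by (auto simp: o_def fd_eq intro: differentiableI)

text \<open>Since \<open>Ck_on\<close> speaks of derivatives in fixed directions only, the chain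
  rule is expanded in a basis of the middle space; the induction hypothesis then applies to the
  partial derivatives of \<open>g\<close>, composed with the same \<open>f\<close>.\<close>

lemma Ck_on_compose:
  fixes f :: "'a::real_normed_vector \<Rightarrow> 'f::real_inner" and g :: "'f \<Rightarrow> 'b::real_normed_vector"
    and B :: "'f set"
  assumes "orthobasis B" "open S" "open T" "\<And>x. x \<in> S \<Longrightarrow> f x \<in> T" "Ck_on k S f" "Ck_on k T g"
  shows "Ck_on k S (\<lambda>x. g (f x))"
  using assms(5,6)
proof (induction k arbitrary: g)
  case 0
  then show ?case using continuous_on_compose2[of T g S f] assms(4) by auto
next
  case (Suc k)
  have eq: "fd (\<lambda>x. g (f x)) x v = (\<Sum>b\<in>B. (fd f x v \<bullet> b) *\<^sub>R fd g (f x) b)" if "x \<in> S" for x v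
  proof -
    have d: "f differentiable (at x)" "g differentiable (at (f x))" using Suc.prems that assms(4) by auto
    show ?thesis
      using orthobasis_linear[OF assms(1) bounded_linear.linear[OF fd_bounded_linear[OF d(2)]], of "fd f x v"]
        fd_compose[OF d] by simp
  qed
  have "Ck_on k S (\<lambda>x. \<Sum>b\<in>B. (fd f x v \<bullet> b) *\<^sub>R fd g (f x) b)" for v
    using Suc.prems Ck_on_SucD[OF Suc.prems(1)]
    by (intro Ck_on_sum[OF assms(2)] Ck_on_bilinear[OF assms(2) bounded_bilinear_scaleR]
        Ck_on_linear_compose[OF assms(2) bounded_linear_inner_left] Suc.IH) auto
  then have "Ck_on k S (\<lambda>x. fd (\<lambda>x. g (f x)) x v)" for v
    by (rule Ck_on_cong[OF assms(2), rotated]) (simp add: eq)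
  moreover have "(\<lambda>x. g (f x)) differentiable (at x)" if "x \<in> S" for x
    by (rule fd_compose(2)) (use Suc.prems that assms(4) in simp_all)
  ultimately show ?case by simp
qed

text \<open>Smoothness of a germ: the neighbourhood may shrink tacitly, so that the calculus rules
  need not keep track of domains. On open sets \<open>smooth_on_iff\<close> leads back to
  \<open>smooth_on\<close>.\<close>

definition smooth_at :: "('a::real_normed_vector \<Rightarrow> 'b::real_normed_vector) \<Rightarrow> 'a \<Rightarrow> bool" where
  "smooth_at f x \<longleftrightarrow> (\<exists>N. open N \<and> x \<in> N \<and> smooth_on N f)"

lemma smooth_on_iff: "open S \<Longrightarrow> smooth_on S f \<longleftrightarrow> (\<forall>x\<in>S. smooth_at f x)"
  unfolding smooth_at_def smooth_on_def
  by (metis Ck_on_local)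

lemma smooth_at_open: "smooth_at f x \<Longrightarrow> \<exists>N. open N \<and> x \<in> N \<and> (\<forall>y\<in>N. smooth_at f y)"
  unfolding smooth_at_def by blast

lemma smooth_at_cong:
  assumes "open N" "x \<in> N" "\<And>y. y \<in> N \<Longrightarrow> f y = g y" "smooth_at f x"
  shows "smooth_at g x"
proof -
  obtain N' where N': "open N'" "x \<in> N'" "smooth_on N' f" using assms(4) by (auto simp: smooth_at_def)
  have "smooth_on (N \<inter> N') g" unfolding smooth_on_def
  proof
    fix k
    have "Ck_on k (N \<inter> N') f" using N'(3) Ck_on_subset[of k N' f "N \<inter> N'"] by (auto simp: smooth_on_def)
    then show "Ck_on k (N \<inter> N') g"
      using assms N' by (auto intro: Ck_on_cong[of "N \<inter> N'" f])
  qed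
  then show ?thesis unfolding smooth_at_def using assms N' by (intro exI[of _ "N \<inter> N'"]) auto
qed

lemma smooth_on_differentiable: "smooth_on S f \<Longrightarrow> x \<in> S \<Longrightarrow> f differentiable (at x)"
  by (metis smooth_on_def Ck_on.simps(2))

lemma smooth_on_fd: "smooth_on S f \<Longrightarrow> smooth_on S (\<lambda>x. fd f x v)"
  by (metis smooth_on_def Ck_on.simps(2))

lemma smooth_at_differentiable: "smooth_at f x \<Longrightarrow> f differentiable (at x)"
  using smooth_on_differentiable by (auto simp: smooth_at_def)

lemma smooth_at_isCont: "smooth_at f x \<Longrightarrow> isCont f x"
  using smooth_at_differentiable differentiable_imp_continuous_within by blast

lemma smooth_at_fd: "smooth_at f x \<Longrightarrow> smooth_at (\<lambda>y. fd f y v) x"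
  using smooth_on_fd by (auto simp: smooth_at_def)

lemma smooth_at_has_derivative: "smooth_at f x \<Longrightarrow> (f has_derivative fd f x) (at x)"
  by (intro fd_works smooth_at_differentiable)

lemma smooth_at_linear_fd: "smooth_at f x \<Longrightarrow> linear (fd f x)"
  by (intro linear_frechet_derivative smooth_at_differentiable)

lemma smooth_at_const [simp]: "smooth_at (\<lambda>x. c) x"
  unfolding smooth_at_def smooth_on_def by (intro exI[of _ UNIV]) auto

lemma smooth_at_linear: "bounded_linear L \<Longrightarrow> smooth_at L x"
  unfolding smooth_at_def smooth_on_def by (intro exI[of _ UNIV]) (auto intro: Ck_on_linear)

lemma smooth_at_ident [simp]: "smooth_at (\<lambda>x. x) x"
  by (rule smooth_at_linear) (rule bounded_linear_ident)

lemma smooth_at2: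
  assumes "smooth_at f x" "smooth_at g x"
  obtains N where "open N" "x \<in> N" "smooth_on N f" "smooth_on N g"
proof -
  obtain S T where "open S" "x \<in> S" "smooth_on S f" "open T" "x \<in> T" "smooth_on T g"
    using assms unfolding smooth_at_def by blast
  then show ?thesis using that[of "S \<inter> T"] unfolding smooth_on_def
    by (metis Ck_on_subset Int_iff Int_lower1 Int_lower2 open_Int)
qed

lemma smooth_at_bilinear:
  assumes "bounded_bilinear m" "smooth_at f x" "smooth_at g x"
  shows "smooth_at (\<lambda>x. m (f x) (g x)) x"
proof -
  obtain N where N: "open N" "x \<in> N" "smooth_on N f" "smooth_on N g" using smooth_at2[OF assms(2,3)] .
  then have "smooth_on N (\<lambda>x. m (f x) (g x))" by (simp add: smooth_on_def Ck_on_bilinear[OF _ assms(1)])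
  then show ?thesis using N unfolding smooth_at_def by blast
qed

lemmas smooth_at_mult = smooth_at_bilinear[OF bounded_bilinear_mult]
lemmas smooth_at_scaleR = smooth_at_bilinear[OF bounded_bilinear_scaleR]
lemmas smooth_at_inner = smooth_at_bilinear[OF bounded_bilinear_inner]

lemma smooth_at_add:
  assumes "smooth_at f x" "smooth_at g x"
  shows "smooth_at (\<lambda>x. f x + g x) x"
proof -
  obtain N where N: "open N" "x \<in> N" "smooth_on N f" "smooth_on N g" using smooth_at2[OF assms] .
  then have "smooth_on N (\<lambda>x. f x + g x)" by (simp add: smooth_on_def Ck_on_add)
  then show ?thesis using N unfolding smooth_at_def by blast
qed

lemma smooth_at_linear_compose:
  assumes "bounded_linear L" "smooth_at f x"
  shows "smooth_at (\<lambda>x. L (f x)) x"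
proof -
  obtain N where N: "open N" "x \<in> N" "smooth_on N f" using assms(2) by (auto simp: smooth_at_def)
  then have "smooth_on N (\<lambda>x. L (f x))" by (simp add: smooth_on_def Ck_on_linear_compose assms(1))
  then show ?thesis using N unfolding smooth_at_def by blast
qed

lemma smooth_at_uminus: "smooth_at f x \<Longrightarrow> smooth_at (\<lambda>x. - f x) x"
  by (rule smooth_at_linear_compose[of uminus]) (auto intro: bounded_linear_minus bounded_linear_ident)

lemma smooth_at_diff: "smooth_at f x \<Longrightarrow> smooth_at g x \<Longrightarrow> smooth_at (\<lambda>x. f x - g x) x"
  using smooth_at_add[OF _ smooth_at_uminus, of f x g] by simp

lemma smooth_at_sum: "(\<And>i. i \<in> I \<Longrightarrow> smooth_at (f i) x) \<Longrightarrow> smooth_at (\<lambda>x. \<Sum>i\<in>I. f i x) x"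
  by (induction I rule: infinite_finite_induct) (auto intro: smooth_at_add)

lemma smooth_at_compose:
  fixes f :: "'a::real_normed_vector \<Rightarrow> 'f::real_inner" and g :: "'f \<Rightarrow> 'b::real_normed_vector"
    and B :: "'f set"
  assumes B: "orthobasis B" and f: "smooth_at f x" and g: "smooth_at g (f x)"
  shows "smooth_at (\<lambda>x. g (f x)) x"
proof -
  obtain S where S: "open S" "x \<in> S" "smooth_on S f" using f unfolding smooth_at_def by blast
  obtain T where T: "open T" "f x \<in> T" "smooth_on T g" using g unfolding smooth_at_def by blast
  have "continuous_on S f" using S by (metis Ck_on.simps(1) smooth_on_def)
  then have o: "open (S \<inter> f -` T)"
    using S T continuous_open_preimage by blast
  have "smooth_on (S \<inter> f -` T) (\<lambda>x. g (f x))"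
    unfolding smooth_on_def
  proof
    fix k
    show "Ck_on k (S \<inter> f -` T) (\<lambda>x. g (f x))"
      using S T Ck_on_subset[of k S f "S \<inter> f -` T"]
      by (auto simp: smooth_on_def intro: Ck_on_compose[OF B o T(1)])
  qed
  then show ?thesis unfolding smooth_at_def using o S(2) T(2) by (intro exI[of _ "S \<inter> f -` T"]) simp
qed

lemma smooth_at_prod:
  assumes "smooth_at f x" "smooth_at g x"
  shows "smooth_at (\<lambda>x. (f x, g x)) x"
proof -
  have 1: "smooth_at (\<lambda>x. (f x, 0)) x"
    by (rule smooth_at_linear_compose[OF bounded_linear_Pair[OF bounded_linear_ident bounded_linear_zero] assms(1)])
  have 2: "smooth_at (\<lambda>x. (0, g x)) x"
    by (rule smooth_at_linear_compose[OF bounded_linear_Pair[OF bounded_linear_zero bounded_linear_ident] assms(2)])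
  from smooth_at_add[OF 1 2] show ?thesis by simp
qed

text \<open>The direction varies with \<open>x\<close>, so it is resolved into the fixed basis
  directions, to which \<open>smooth_at_fd\<close> applies.\<close>

lemma smooth_at_fd_linear:
  fixes g h :: "'a::real_normed_vector \<Rightarrow> 'f::real_inner" and f :: "'f \<Rightarrow> 'b::real_normed_vector"
    and B :: "'f set"
  assumes "orthobasis B" "smooth_at f (g x)" "smooth_at g x" "smooth_at h x"
  shows "smooth_at (\<lambda>x. fd f (g x) (h x)) x"
proof -
  obtain N where N: "open N" "g x \<in> N" "\<And>y. y \<in> N \<Longrightarrow> smooth_at f y" using smooth_at_open[OF assms(2)] by blast
  obtain S where S: "open S" "x \<in> S" "smooth_on S g" using assms(3) by (auto simp: smooth_at_def)
  have o: "open (S \<inter> g -` N)"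
    using S N by (metis continuous_open_preimage Ck_on.simps(1) smooth_on_def)
  have "smooth_at (\<lambda>x. \<Sum>b\<in>B. (h x \<bullet> b) *\<^sub>R fd f (g x) b) x"
    using assms by (intro smooth_at_sum smooth_at_scaleR smooth_at_inner smooth_at_compose[OF assms(1) assms(3)] smooth_at_fd) auto
  then show ?thesis
    by (rule smooth_at_cong[OF o, rotated 2])
       (use S N assms in \<open>auto simp: orthobasis_linear[OF assms(1) smooth_at_linear_fd, symmetric]\<close>)
qed

lemma smooth_on_subset: "smooth_on S f \<Longrightarrow> T \<subseteq> S \<Longrightarrow> smooth_on T f"
  by (meson smooth_on_def Ck_on_subset)

section \<open>Second differences and the symmetry of second derivatives\<close>

lemma line_derivative:
  assumes "f differentiable (at (a + s *\<^sub>R u))"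
  shows "((\<lambda>s. f (a + s *\<^sub>R u)) has_vector_derivative fd f (a + s *\<^sub>R u) u) (at s)"
proof -
  have "((\<lambda>s. a + s *\<^sub>R u) has_vector_derivative u) (at s)"
    by (auto intro!: derivative_eq_intros)
  from vector_derivative_diff_chain_within[OF this, of f "fd f (a + s *\<^sub>R u)"]
  show ?thesis using has_derivative_at_withinI[OF fd_works[OF assms]] by (simp add: o_def)
qed

text \<open>Two applications of the mean value theorem, along \<open>u\<close> to \<open>p\<close>
  and then along \<open>v\<close> to \<open>q\<close>. The bound on \<open>h\<close> keeps the whole
  parallelogram inside the ball.\<close>

lemma second_difference:
  fixes f :: "'a::real_normed_vector \<Rightarrow> real"
  assumes f: "\<And>y. y \<in> ball x r \<Longrightarrow> smooth_at f y" and h: "0 < h" "h * (norm u + norm v) < r"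
  shows "\<exists>y\<in>ball x r. f (x + h *\<^sub>R u + h *\<^sub>R v) - f (x + h *\<^sub>R u) - f (x + h *\<^sub>R v) + f x
           = h * h * fd (\<lambda>z. fd f z u) y v"
proof -
  have inb: "x + s *\<^sub>R u + t *\<^sub>R v \<in> ball x r" if "0 \<le> s" "s \<le> h" "0 \<le> t" "t \<le> h" for s t
  proof -
    have "norm (s *\<^sub>R u + t *\<^sub>R v) \<le> s * norm u + t * norm v"
      using that norm_triangle_ineq[of "s *\<^sub>R u" "t *\<^sub>R v"] by simp
    also have "\<dots> \<le> h * norm u + h * norm v"
      using that by (intro add_mono mult_right_mono) auto
    finally show ?thesis using h(2) by (simp add: dist_norm algebra_simps norm_minus_commute)
  qed
  define p where "p = (\<lambda>s. f (x + h *\<^sub>R v + s *\<^sub>R u) - f (x + s *\<^sub>R u))"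
  have dp: "(p has_real_derivative (fd f (x + h *\<^sub>R v + s *\<^sub>R u) u - fd f (x + s *\<^sub>R u) u)) (at s)"
    if "0 \<le> s" "s \<le> h" for s
    unfolding p_def has_real_derivative_iff_has_vector_derivative
    using inb[of s h] inb[of s 0] that h
    by (intro has_vector_derivative_diff line_derivative smooth_at_differentiable f) (auto simp: algebra_simps)
  obtain s where s: "0 < s" "s < h" "p h - p 0 = (h - 0) * (fd f (x + h *\<^sub>R v + s *\<^sub>R u) u - fd f (x + s *\<^sub>R u) u)"
    using MVT2[OF h(1), of p, OF dp] by auto
  define q where "q = (\<lambda>t. fd f (x + s *\<^sub>R u + t *\<^sub>R v) u)"
  have dq: "(q has_real_derivative fd (\<lambda>z. fd f z u) (x + s *\<^sub>R u + t *\<^sub>R v) v) (at t)" if "0 \<le> t" "t \<le> h" for t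
    unfolding q_def has_real_derivative_iff_has_vector_derivative
    using inb[of s t] that s
    by (intro line_derivative[where f="\<lambda>z. fd f z u"] smooth_at_differentiable smooth_at_fd f) auto
  obtain t where t: "0 < t" "t < h" "q h - q 0 = (h - 0) * fd (\<lambda>z. fd f z u) (x + s *\<^sub>R u + t *\<^sub>R v) v"
    using MVT2[OF h(1), of q, OF dq] by auto
  have "p h - p 0 = h * (q h - q 0)" using s(3) by (simp add: q_def algebra_simps)
  then have "p h - p 0 = h * h * fd (\<lambda>z. fd f z u) (x + s *\<^sub>R u + t *\<^sub>R v) v" using t(3) by simp
  moreover have "p h - p 0 = f (x + h *\<^sub>R u + h *\<^sub>R v) - f (x + h *\<^sub>R u) - f (x + h *\<^sub>R v) + f x"
    by (simp add: p_def algebra_simps)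
  ultimately show ?thesis using inb[of s t] s t by (intro bexI[of _ "x + s *\<^sub>R u + t *\<^sub>R v"]) auto
qed

text \<open>Schwarz's theorem. The second difference is symmetric in \<open>u\<close> and
  \<open>v\<close>, so the two mixed derivatives take a common value at some points \<open>y\<close>
  and \<open>z\<close> of a small ball; continuity at \<open>x\<close> excludes a gap between
  them.\<close>

lemma fd_symmetric_real:
  fixes f :: "'a::real_normed_vector \<Rightarrow> real"
  assumes "smooth_at f x"
  shows "fd (\<lambda>z. fd f z u) x v = fd (\<lambda>z. fd f z v) x u"
proof (rule ccontr)
  let ?p = "\<lambda>y. fd (\<lambda>z. fd f z u) y v" and ?q = "\<lambda>y. fd (\<lambda>z. fd f z v) y u"
  assume ne: "?p x \<noteq> ?q x"
  \<comment> \<open>Half of the gap, so that a common value cannot lie within \<open>e\<close> of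
    both.\<close>
  define e where "e = dist (?p x) (?q x) / 2"
  have e: "e > 0" using ne by (simp add: e_def)
  obtain r0 where r0: "r0 > 0" "\<And>y. y \<in> ball x r0 \<Longrightarrow> smooth_at f y"
    using smooth_at_open[OF assms] by (metis openE subsetD)
  have "isCont ?p x" "isCont ?q x" using assms by (auto intro!: smooth_at_isCont smooth_at_fd)
  then have "\<forall>\<^sub>F y in nhds x. dist (?p y) (?p x) < e" "\<forall>\<^sub>F y in nhds x. dist (?q y) (?q x) < e"
    using e unfolding eventually_nhds_metric continuous_at_eps_delta by blast+
  then have "\<forall>\<^sub>F y in nhds x. dist (?p y) (?p x) < e \<and> dist (?q y) (?q x) < e"
    by (rule eventually_conj)
  then obtain r1 where r1: "r1 > 0" "\<And>y. dist y x < r1 \<Longrightarrow> dist (?p y) (?p x) < e \<and> dist (?q y) (?q x) < e"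
    unfolding eventually_nhds_metric by blast
  define r where "r = min r0 r1"
  have r: "r > 0" using r0 r1 by (simp add: r_def)
  have nn: "0 < norm u + norm v + 1" using norm_ge_zero[of u] norm_ge_zero[of v] by linarith
  \<comment> \<open>The summand 1 in the denominator covers \<open>u = v = 0\<close> and makes the
    inequality required of \<open>h\<close> strict.\<close>
  define h where "h = r / (norm u + norm v + 1)"
  have h: "0 < h" using r nn by (simp add: h_def)
  have "h * (norm u + norm v + 1) = r" using nn by (simp add: h_def)
  then have hr: "h * (norm u + norm v) < r" using h by (simp add: algebra_simps)
  have sm: "\<And>y. y \<in> ball x r \<Longrightarrow> smooth_at f y" using r0 by (auto simp: r_def)
  obtain y where y: "y \<in> ball x r"
    "f (x + h *\<^sub>R u + h *\<^sub>R v) - f (x + h *\<^sub>R u) - f (x + h *\<^sub>R v) + f x = h * h * ?p y"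
    using second_difference[OF sm h hr] by blast
  have hr': "h * (norm v + norm u) < r" using hr by (simp add: add.commute)
  obtain z where z: "z \<in> ball x r"
    "f (x + h *\<^sub>R v + h *\<^sub>R u) - f (x + h *\<^sub>R v) - f (x + h *\<^sub>R u) + f x = h * h * ?q z"
    using second_difference[OF sm h hr'] by blast
  have "h * h * ?p y = h * h * ?q z" using y(2) z(2) by (simp add: algebra_simps)
  then have eq: "?p y = ?q z" using h by simp
  have "dist (?p y) (?p x) < e" "dist (?q z) (?q x) < e"
    using r1(2)[of y] r1(2)[of z] y z by (auto simp: r_def dist_commute)
  then have "dist (?p x) (?q x) < 2 * e" using eq
    by (metis dist_commute dist_triangle_less_add mult_2)
  then show False by (simp add: e_def)
qed

lemma fd_inner:
  assumes "f differentiable (at x)"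
  shows "fd (\<lambda>z. f z \<bullet> b) x v = fd f x v \<bullet> b"
  using has_derivative_inner_left[OF fd_works[OF assms], of b] by (simp add: fd_eq)

lemma fd_symmetric:
  fixes f :: "'a::real_normed_vector \<Rightarrow> 'b::real_inner"
  assumes "orthobasis (B::'b set)" "smooth_at f x"
  shows "fd (\<lambda>z. fd f z u) x v = fd (\<lambda>z. fd f z v) x u"
proof (rule orthobasis_eqI[OF assms(1)])
  fix b
  obtain N where N: "open N" "x \<in> N" "\<And>y. y \<in> N \<Longrightarrow> smooth_at f y" using smooth_at_open[OF assms(2)] by blast
  have *: "fd (\<lambda>z. fd f z u) x v \<bullet> b = fd (\<lambda>z. fd (\<lambda>z. f z \<bullet> b) z u) x v" for u v
  proof -
    have "fd (\<lambda>z. fd f z u) x v \<bullet> b = fd (\<lambda>z. fd f z u \<bullet> b) x v"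
      using assms(2) by (intro fd_inner[symmetric] smooth_at_differentiable smooth_at_fd)
    also have "fd (\<lambda>z. fd f z u \<bullet> b) x = fd (\<lambda>z. fd (\<lambda>z. f z \<bullet> b) z u) x"
      using N by (intro fd_cong_open[OF N(1,2)]) (simp add: fd_inner smooth_at_differentiable)
    finally show ?thesis .
  qed
  have "smooth_at (\<lambda>z. f z \<bullet> b) x"
    by (rule smooth_at_linear_compose[OF bounded_linear_inner_left assms(2)])
  then show "fd (\<lambda>z. fd f z u) x v \<bullet> b = fd (\<lambda>z. fd f z v) x u \<bullet> b"
    unfolding * by (rule fd_symmetric_real)
qed

section \<open>Parametric integrals and Hadamard's lemma\<close>

text \<open>Differentiation under the integral sign. The weight \<open>s ^ m\<close> is carried
  along because every derivative in \<open>x\<close> produces one more factor \<open>s\<close>. The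
  Leibniz rule is applied on the dual space, which is a Banach space;
  \<open>blinfun_inner_left\<close> embeds the model space there, and \<open>Pi\<close> states that
  \<open>P\<close> undoes the embedding.\<close>

lemma integral_derivative:
  fixes g :: "'e::real_inner \<Rightarrow> real" and B :: "'e set"
  assumes B: "orthobasis B" and g: "Ck_on (Suc 0) (ball x0 r) g" and x: "x \<in> ball x0 r"
  shows "((\<lambda>x. integral {0..1} (\<lambda>s. s ^ m * g (x0 + s *\<^sub>R (x - x0)))) has_derivative
     (\<lambda>v. integral {0..1} (\<lambda>s. s ^ Suc m * fd g (x0 + s *\<^sub>R (x - x0)) v))) (at x)"
proof -
  define P :: "('e \<Rightarrow>\<^sub>L real) \<Rightarrow> 'e" where "P = (\<lambda>y. \<Sum>b\<in>B. blinfun_apply y b *\<^sub>R b)"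
  define L where "L = (\<lambda>b. Blinfun (\<lambda>y::'e \<Rightarrow>\<^sub>L real. blinfun_apply y b))"
  have L: "blinfun_apply (L b) y = blinfun_apply y b" for b y
    unfolding L_def by (subst bounded_linear_Blinfun_apply) (auto intro: blinfun.bounded_linear_left)
  have P: "bounded_linear P" unfolding P_def
    by (intro bounded_linear_sum bounded_linear_scaleR_const blinfun.bounded_linear_left)
  have Pi: "P (blinfun_inner_left x) = x" for x
    using orthobasis_expand[OF B, of x] by (simp add: P_def inner_commute[of x])
  define S where "S = ball x0 r"
  have seg: "x0 + s *\<^sub>R (x - x0) \<in> S" if "x \<in> S" "s \<in> {0..1}" for x s
  proof -
    have "(1 - s) *\<^sub>R x0 + s *\<^sub>R x \<in> S"
      using that unfolding S_def
      by (intro convexD[OF convex_ball]) (auto simp: dist_norm intro: le_less_trans[OF norm_ge_zero])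
    then show ?thesis by (simp add: algebra_simps)
  qed
  define U where "U = P -` S"
  have oU: "open U" unfolding U_def S_def
    by (intro open_vimage linear_continuous_on[OF P]) auto
  have cU: "convex U" unfolding U_def S_def
    by (intro convex_linear_vimage[OF bounded_linear.linear[OF P]]) auto
  define F where "F = (\<lambda>y t. t ^ m * g (x0 + t *\<^sub>R (P y - x0)))"
  \<comment> \<open>The derivative has to be a bounded linear form on the dual space, hence the
    evaluations \<open>L b\<close> at the basis vectors.\<close>
  define F' where "F' = (\<lambda>y t. \<Sum>b\<in>B. (t ^ Suc m * fd g (x0 + t *\<^sub>R (P y - x0)) b) *\<^sub>R L b)"
  have gd: "g differentiable (at z)" if "z \<in> S" for z using g that by (simp add: S_def)
  have F'app: "blinfun_apply (F' y t) w = t ^ Suc m * fd g (x0 + t *\<^sub>R (P y - x0)) (P w)"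
    if "y \<in> U" "t \<in> {0..1}" for y t w
  proof -
    have l: "linear (fd g (x0 + t *\<^sub>R (P y - x0)))"
      using gd[OF seg] that by (auto simp: U_def intro: linear_frechet_derivative)
    have Pw: "P w = (\<Sum>b\<in>B. blinfun_apply w b *\<^sub>R b)" by (simp add: P_def)
    have "fd g (x0 + t *\<^sub>R (P y - x0)) (P w) = (\<Sum>b\<in>B. blinfun_apply w b * fd g (x0 + t *\<^sub>R (P y - x0)) b)"
      unfolding Pw using l by (simp add: linear_sum linear_scale)
    then show ?thesis
      by (simp add: F'_def blinfun.sum_left blinfun.scaleR_left L sum_distrib_left algebra_simps)
  qed
  have FF: "((\<lambda>y. F y t) has_derivative blinfun_apply (F' y t)) (at y within U)" if "y \<in> U" "t \<in> cbox 0 1" for y t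
  proof -
    have t: "t \<in> {0..1}" using that by simp
    have "((\<lambda>y. x0 + t *\<^sub>R (P y - x0)) has_derivative (\<lambda>w. t *\<^sub>R P w)) (at y)"
      by (auto intro!: derivative_eq_intros bounded_linear.has_derivative[OF P])
    moreover have gd': "g differentiable (at (x0 + t *\<^sub>R (P y - x0)))"
      using gd[OF seg] that t by (auto simp: U_def)
    ultimately have "((\<lambda>y. g (x0 + t *\<^sub>R (P y - x0))) has_derivative
        (\<lambda>w. fd g (x0 + t *\<^sub>R (P y - x0)) (t *\<^sub>R P w))) (at y)"
      using diff_chain_at[OF _ fd_works] by (force simp: o_def)
    then have "((\<lambda>y. F y t) has_derivative (\<lambda>w. t ^ m * fd g (x0 + t *\<^sub>R (P y - x0)) (t *\<^sub>R P w))) (at y)"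
      unfolding F_def by (rule has_derivative_mult_right)
    moreover have "(\<lambda>w. t ^ m * fd g (x0 + t *\<^sub>R (P y - x0)) (t *\<^sub>R P w)) = blinfun_apply (F' y t)"
      using F'app[OF that(1) t] linear_scale[OF linear_frechet_derivative[OF gd']]
      by (auto simp: mult_ac)
    ultimately show ?thesis by (simp add: has_derivative_at_withinI)
  qed
  have pc: "continuous_on (U \<times> cbox 0 1) (\<lambda>(y, t). x0 + t *\<^sub>R (P y - x0))"
    unfolding split_beta
    by (intro continuous_intros bounded_linear.continuous_on[OF P])
  have cF': "continuous_on (U \<times> cbox 0 1) (\<lambda>(y, t). F' y t)"
  proof -
    have "continuous_on (U \<times> cbox 0 1) (\<lambda>z. fd g (case z of (y, t) \<Rightarrow> x0 + t *\<^sub>R (P y - x0)) b)" for b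
      by (rule continuous_on_compose2[OF _ pc, of S]) (use g seg in \<open>auto simp: U_def S_def\<close>)
    then show ?thesis unfolding F'_def split_beta by (intro continuous_intros)
  qed
  have gc: "continuous_on S g" using gd by (rule differentiable_imp_cont_on)
  have cF: "continuous_on (cbox 0 1) (F y)" if "y \<in> U" for y
  proof -
    have "continuous_on (cbox 0 1) (\<lambda>t. g (x0 + t *\<^sub>R (P y - x0)))"
      by (rule continuous_on_compose2[OF gc]) (use seg that in \<open>auto simp: U_def intro!: continuous_intros\<close>)
    then show ?thesis unfolding F_def by (intro continuous_intros)
  qed
  define y where "y = blinfun_inner_left x"
  have y: "y \<in> U" using x by (simp add: U_def y_def Pi S_def)
  have "((\<lambda>y. integral (cbox 0 1) (F y)) has_derivative integral (cbox 0 1) (F' y)) (at y within U)"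
  proof (rule leibniz_rule[where f=F and fx=F'])
    fix z assume "z \<in> U"
    then show "F z integrable_on cbox 0 1" by (intro integrable_continuous cF)
  qed (fact FF cF' y cU)+
  then have "((\<lambda>y. integral (cbox 0 1) (F y)) has_derivative integral (cbox 0 1) (F' y)) (at (blinfun_inner_left x))"
    unfolding at_within_open[OF y oU] unfolding y_def .
  from diff_chain_at[OF bounded_linear_imp_has_derivative[OF bounded_linear_blinfun_inner_left] this]
  have "((\<lambda>x. integral (cbox 0 1) (F (blinfun_inner_left x))) has_derivative
      (\<lambda>v. blinfun_apply (integral (cbox 0 1) (F' y)) (blinfun_inner_left v))) (at x)"
    by (simp add: o_def)
  moreover have "blinfun_apply (integral (cbox 0 1) (F' y)) (blinfun_inner_left v) =
      integral {0..1} (\<lambda>s. s ^ Suc m * fd g (x0 + s *\<^sub>R (x - x0)) v)" for v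
  proof -
    have "continuous_on (cbox 0 1) (F' y)"
      by (rule continuous_on_compose2[OF cF', of _ "\<lambda>t. (y, t)", simplified])
        (use y in \<open>auto intro!: continuous_intros\<close>)
    then have "F' y integrable_on cbox 0 1" by (rule integrable_continuous)
    then have "blinfun_apply (integral (cbox 0 1) (F' y)) (blinfun_inner_left v) =
       integral (cbox 0 1) (\<lambda>t. blinfun_apply (F' y t) (blinfun_inner_left v))"
      by (rule blinfun_apply_integral)
    also have "\<dots> = integral (cbox 0 1) (\<lambda>s. s ^ Suc m * fd g (x0 + s *\<^sub>R (x - x0)) v)"
      by (rule Henstock_Kurzweil_Integration.integral_cong) (use y in \<open>simp add: F'app Pi y_def\<close>)
    finally show ?thesis by simp
  qed
  ultimately show ?thesis by (simp add: F_def Pi)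
qed

text \<open>The induction keeps \<open>m\<close> arbitrary: by \<open>integral_derivative\<close> a
  derivative of the integral is an integral of the same form with exponent
  \<open>Suc m\<close>.\<close>

lemma Ck_on_integral:
  fixes g :: "'e::real_inner \<Rightarrow> real" and B :: "'e set"
  assumes B: "orthobasis B" and g: "Ck_on k (ball x0 r) g"
  shows "Ck_on k (ball x0 r) (\<lambda>x. integral {0..1} (\<lambda>s. s ^ m * g (x0 + s *\<^sub>R (x - x0))))"
  using g
proof (induction k arbitrary: g m)
  case 0
  have seg: "x0 + s *\<^sub>R (x - x0) \<in> ball x0 r" if "x \<in> ball x0 r" "s \<in> {0..1}" for x s
  proof -
    have "(1 - s) *\<^sub>R x0 + s *\<^sub>R x \<in> ball x0 r"
      using that by (intro convexD[OF convex_ball]) (auto simp: dist_norm intro: le_less_trans[OF norm_ge_zero])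
    then show ?thesis by (simp add: algebra_simps)
  qed
  have "continuous_on (ball x0 r \<times> cbox 0 1) (\<lambda>z. g (x0 + snd z *\<^sub>R (fst z - x0)))"
    by (rule continuous_on_compose2[of "ball x0 r" g]) (use 0 seg in \<open>auto intro!: continuous_intros simp del: mem_ball\<close>)
  then have "continuous_on (ball x0 r \<times> cbox 0 1) (\<lambda>(x, s). s ^ m * g (x0 + s *\<^sub>R (x - x0)))"
    unfolding split_beta by (intro continuous_intros)
  from integral_continuous_on_param[OF this] show ?case by simp
next
  case (Suc k)
  have "Ck_on (Suc 0) (ball x0 r) g" using Suc.prems
    by (induction k) (auto simp del: Ck_on.simps dest: Ck_on_SucD)
  note D = integral_derivative[OF B this, of _ m]
  have "Ck_on k (ball x0 r) (\<lambda>x. integral {0..1} (\<lambda>s. s ^ Suc m * fd g (x0 + s *\<^sub>R (x - x0)) v))" for v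
    using Suc.prems by (intro Suc.IH) simp
  then have "Ck_on k (ball x0 r) (\<lambda>x. fd (\<lambda>x. integral {0..1} (\<lambda>s. s ^ m * g (x0 + s *\<^sub>R (x - x0)))) x v)" for v
    by (rule Ck_on_cong[OF open_ball, rotated]) (use fd_eq[OF D] in simp)
  then show ?case using D by (auto intro: differentiableI simp del: mem_ball)
qed

text \<open>Integrate the derivative of \<open>f\<close> along the segment from \<open>x0\<close> to
  \<open>x\<close> and expand \<open>x - x0\<close> in the basis: \<open>h b\<close> is the mean of
  the partial derivative in direction \<open>b\<close> over this segment, and it is smooth by
  \<open>Ck_on_integral\<close>.\<close>

lemma hadamard:
  fixes f :: "'e::real_inner \<Rightarrow> real" and B :: "'e set"
  assumes B: "orthobasis B" and f: "smooth_at f x0"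
  obtains h N where "open N" "x0 \<in> N" "\<And>b. smooth_at (h b) x0" "\<And>b. h b x0 = fd f x0 b"
    "\<And>x. x \<in> N \<Longrightarrow> f x = f x0 + (\<Sum>b\<in>B. ((x - x0) \<bullet> b) * h b x)"
proof -
  obtain N where "open N" "x0 \<in> N" "smooth_on N f" using f by (auto simp: smooth_at_def)
  then obtain r where r: "r > 0" "ball x0 r \<subseteq> N" by (meson openE)
  have sm: "smooth_on (ball x0 r) f"
    using \<open>smooth_on N f\<close> r(2) by (rule smooth_on_subset)
  \<comment> \<open>The factor \<open>s ^ 0\<close> brings the integrand into the form of
    \<open>Ck_on_integral\<close> with \<open>m = 0\<close>.\<close>
  define h where "h = (\<lambda>b x. integral {0..1} (\<lambda>s. s ^ 0 * fd f (x0 + s *\<^sub>R (x - x0)) b))"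
  have sh: "smooth_at (h b) x0" for b
  proof -
    have "smooth_on (ball x0 r) (h b)"
      using smooth_on_fd[OF sm, of b] unfolding smooth_on_def h_def
      by (intro allI Ck_on_integral[OF B]) simp
    then show ?thesis using r unfolding smooth_at_def by (intro exI[of _ "ball x0 r"]) simp
  qed
  have e: "f x = f x0 + (\<Sum>b\<in>B. ((x - x0) \<bullet> b) * h b x)" if "x \<in> ball x0 r" for x
  proof -
    have seg: "x0 + s *\<^sub>R (x - x0) \<in> ball x0 r" if "s \<in> {0..1}" for s
    proof -
      have "(1 - s) *\<^sub>R x0 + s *\<^sub>R x \<in> ball x0 r"
        using that \<open>x \<in> ball x0 r\<close>
        by (intro convexD[OF convex_ball]) (auto simp: dist_norm intro: le_less_trans[OF norm_ge_zero])
      then show ?thesis by (simp add: algebra_simps)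
    qed
    have d: "f differentiable (at (x0 + s *\<^sub>R (x - x0)))" if "s \<in> {0..1}" for s
      using seg[OF that] sm smooth_on_differentiable by blast
    have "((\<lambda>s. fd f (x0 + s *\<^sub>R (x - x0)) (x - x0)) has_integral
        (f (x0 + 1 *\<^sub>R (x - x0)) - f (x0 + 0 *\<^sub>R (x - x0)))) {0..1}"
      by (rule fundamental_theorem_of_calculus)
        (auto intro!: has_vector_derivative_at_within line_derivative d)
    then have i: "integral {0..1} (\<lambda>s. fd f (x0 + s *\<^sub>R (x - x0)) (x - x0)) = f x - f x0"
      by (simp add: integral_unique)
    have int: "(\<lambda>s. fd f (x0 + s *\<^sub>R (x - x0)) b) integrable_on {0..1}" for b
    proof (rule integrable_continuous_interval)
      have "continuous_on (ball x0 r) (\<lambda>y. fd f y b)"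
        using smooth_on_fd[OF sm, of b] by (metis Ck_on.simps(1) smooth_on_def)
      then show "continuous_on {0..1} (\<lambda>s. fd f (x0 + s *\<^sub>R (x - x0)) b)"
        by (rule continuous_on_compose2) (use seg in \<open>auto intro!: continuous_intros simp del: mem_ball\<close>)
    qed
    have int2: "(\<lambda>s. c * fd f (x0 + s *\<^sub>R (x - x0)) b) integrable_on {0..1}" for c b
      using integrable_cmul[OF int, of c b] by simp
    have "integral {0..1} (\<lambda>s. fd f (x0 + s *\<^sub>R (x - x0)) (x - x0)) =
       integral {0..1} (\<lambda>s. \<Sum>b\<in>B. ((x - x0) \<bullet> b) * fd f (x0 + s *\<^sub>R (x - x0)) b)"
    proof (rule Henstock_Kurzweil_Integration.integral_cong)
      fix s :: real assume "s \<in> {0..1}"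
      from orthobasis_linear[OF B linear_frechet_derivative[OF d[OF this]], of "x - x0"]
      show "fd f (x0 + s *\<^sub>R (x - x0)) (x - x0) = (\<Sum>b\<in>B. ((x - x0) \<bullet> b) * fd f (x0 + s *\<^sub>R (x - x0)) b)"
        by simp
    qed
    also have "\<dots> = (\<Sum>b\<in>B. ((x - x0) \<bullet> b) * h b x)"
      by (subst integral_sum) (simp_all add: h_def orthobasis_finite[OF B] int2)
    finally show ?thesis using i by simp
  qed
  have h0: "h b x0 = fd f x0 b" for b by (simp add: h_def)
  have x0: "x0 \<in> ball x0 r" using r by simp
  show ?thesis by (rule that[OF open_ball x0 sh h0 e])
qed

section \<open>Bump functions\<close>

lemma fd_real: "(f has_real_derivative D) (at t) \<Longrightarrow> fd f t v = D * v"
  unfolding has_field_derivative_def by (simp add: fd_eq)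

lemma has_real_derivative_differentiable: "(f has_real_derivative D) (at t) \<Longrightarrow> f differentiable (at t)"
  unfolding has_field_derivative_def by (rule differentiableI)

lemma Ck_on_inverse: "Ck_on k (- {0}) (inverse :: real \<Rightarrow> real)"
proof (induction k)
  case 0
  show ?case by (auto intro!: continuous_intros)
next
  case (Suc k)
  have o: "open (- {0::real})" by auto
  have D: "(inverse has_real_derivative - (inverse t * inverse t)) (at t)" if "t \<noteq> 0" for t :: real
    using DERIV_inverse[OF that] by (simp add: power2_eq_square)
  have "Ck_on k (- {0}) (\<lambda>t::real. (- v) * (inverse t * inverse t))" for v
    by (intro Ck_on_bilinear[OF o bounded_bilinear_mult] Ck_on_const Suc)
  then have "Ck_on k (- {0}) (\<lambda>t::real. fd inverse t v)" for v
    by (rule Ck_on_cong[OF o, rotated]) (simp add: fd_real[OF D])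
  then show ?case by (auto intro: has_real_derivative_differentiable[OF D])
qed

lemma smooth_at_inverse:
  fixes f :: "'a::real_normed_vector \<Rightarrow> real"
  assumes "smooth_at f x" "f x \<noteq> 0"
  shows "smooth_at (\<lambda>x. inverse (f x)) x"
proof (rule smooth_at_compose[OF orthobasis_real assms(1)])
  show "smooth_at inverse (f x)"
    unfolding smooth_at_def smooth_on_def using assms(2) Ck_on_inverse
    by (intro exI[of _ "- {0}"]) auto
qed

text \<open>For \<open>n = 0\<close> this is the classical function that is flat at 0; the powers of
  \<open>1 / t\<close> make the family closed under differentiation up to linear combinations, so
  that smoothness follows by induction.\<close>

definition flat :: "nat \<Rightarrow> real \<Rightarrow> real" where
  "flat n t = (if t \<le> 0 then 0 else inverse t ^ n * exp (- inverse t))"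

lemma flat_tendsto: "(flat n \<longlongrightarrow> 0) (at 0)"
proof (rule filterlim_split_at)
  show "(flat n \<longlongrightarrow> 0) (at_left 0)"
    by (rule tendsto_eventually) (auto simp: eventually_at_left_field flat_def intro: exI[of _ "-1"])
  have "((\<lambda>t. inverse t ^ n / exp (inverse t)) \<longlongrightarrow> (0::real)) (at_right 0)"
    using filterlim_compose[OF tendsto_power_div_exp_0 filterlim_inverse_at_top_right] .
  moreover have "\<forall>\<^sub>F t in at_right 0. inverse t ^ n / exp (inverse t) = flat n t"
    by (auto simp: eventually_at_right_field flat_def exp_minus field_simps intro: exI[of _ 1])
  ultimately show "(flat n \<longlongrightarrow> 0) (at_right 0)"
    using filterlim_cong by fast
qed

lemma flat_derivative: "(flat n has_real_derivative (flat (n + 2) t - n * flat (n + 1) t)) (at t)"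
proof -
  consider "t < 0" | "t = 0" | "t > 0" by linarith
  then show ?thesis
  proof cases
    case 1
    have "((\<lambda>t. 0) has_real_derivative 0) (at t)" by simp
    then have "(flat n has_real_derivative 0) (at t)"
      by (rule has_field_derivative_transform_within_open[of _ _ _ "{..<0}"]) (use 1 in \<open>auto simp: flat_def\<close>)
    then show ?thesis using 1 by (simp add: flat_def)
  next
    case 2
    \<comment> \<open>The difference quotient of \<open>flat n\<close> at 0 is
      \<open>flat (n + 1)\<close> itself, so \<open>flat_tendsto\<close> gives derivative 0.\<close>
    have "(\<lambda>h. (flat n (0 + h) - flat n 0) / h) = flat (n + 1)"
      by (auto simp: flat_def fun_eq_iff divide_inverse mult_ac)
    then have "(flat n has_real_derivative 0) (at 0)"
      using flat_tendsto[of "n + 1"] by (simp only: DERIV_def)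
    then show ?thesis using 2 by (simp add: flat_def)
  next
    case 3
    \<comment> \<open>For \<open>n = 0\<close> the exponent \<open>n - 1\<close> is truncated, but
      the factor \<open>real n\<close> vanishes.\<close>
    have n: "real n * inverse t ^ (n - 1) * inverse t ^ 2 = real n * inverse t ^ (n + 1)"
      by (cases n) (auto simp: power2_eq_square)
    have "((\<lambda>t. inverse t ^ n * exp (- inverse t)) has_real_derivative
      (inverse t ^ n * (exp (- inverse t) * inverse t ^ 2) - real n * inverse t ^ (n - 1) * inverse t ^ 2 * exp (- inverse t))) (at t)"
      using 3 by (auto intro!: derivative_eq_intros simp: power2_eq_square algebra_simps)
    then have "(flat n has_real_derivative
      (inverse t ^ n * (exp (- inverse t) * inverse t ^ 2) - real n * inverse t ^ (n - 1) * inverse t ^ 2 * exp (- inverse t))) (at t)"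
      by (rule has_field_derivative_transform_within_open[of _ _ _ "{0<..}"]) (use 3 in \<open>auto simp: flat_def\<close>)
    then show ?thesis unfolding n using 3 by (simp add: flat_def power_add power2_eq_square mult_ac)
  qed
qed

lemma Ck_on_flat: "Ck_on k UNIV (flat n)"
proof (induction k arbitrary: n)
  case 0
  show ?case
    using flat_derivative by (auto intro!: DERIV_isCont simp: continuous_on_eq_continuous_at)
next
  case (Suc k)
  have "Ck_on k UNIV (\<lambda>t. v * flat (n + 2) t + (- v * real n) * flat (n + 1) t)" for v
    by (intro Ck_on_add Ck_on_bilinear[OF _ bounded_bilinear_mult] Ck_on_const Suc) auto
  moreover have "(\<lambda>t. fd (flat n) t v) = (\<lambda>t. v * flat (n + 2) t + (- v * real n) * flat (n + 1) t)" for v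
    by (simp add: fd_real[OF flat_derivative] algebra_simps fun_eq_iff)
  ultimately show ?case using has_real_derivative_differentiable[OF flat_derivative] by simp
qed

lemma smooth_at_flat: "smooth_at (flat n) t"
  unfolding smooth_at_def smooth_on_def using Ck_on_flat by (intro exI[of _ UNIV]) auto

text \<open>With \<open>q\<close> the squared distance from \<open>x0\<close> in units of
  \<open>r\<close>, \<open>a\<close> vanishes for \<open>q \<ge> 1\<close> and \<open>b\<close> for
  \<open>q \<le> 1/4\<close>, never both. Hence \<open>a / (a + b)\<close> is smooth, equals 1 where
  \<open>b\<close> vanishes and 0 where \<open>a\<close> vanishes.\<close>

lemma bump_exists:
  fixes x0 :: "'e::real_inner"
  assumes r: "r > 0"
  obtains \<rho> :: "'e \<Rightarrow> real" where "\<And>x. smooth_at \<rho> x" "\<And>x. dist x0 x \<le> r / 2 \<Longrightarrow> \<rho> x = 1"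
    "\<And>x. dist x0 x \<ge> r \<Longrightarrow> \<rho> x = 0"
proof -
  define q where "q = (\<lambda>x. ((x - x0) \<bullet> (x - x0)) * inverse (r * r))"
  have q: "smooth_at q x" for x
    unfolding q_def by (intro smooth_at_mult smooth_at_inner smooth_at_diff) auto
  define a where "a = (\<lambda>x. flat 0 (1 - q x))"
  define b where "b = (\<lambda>x. flat 0 (q x - 1/4))"
  have a: "smooth_at a x" for x unfolding a_def
    by (intro smooth_at_compose[OF orthobasis_real _ smooth_at_flat] smooth_at_diff q) auto
  have b: "smooth_at b x" for x unfolding b_def
    by (intro smooth_at_compose[OF orthobasis_real _ smooth_at_flat] smooth_at_diff q) auto
  have pos: "a x + b x > 0" for x
  proof (cases "q x < 1")
    case True
    then have "a x > 0" "b x \<ge> 0" by (auto simp: a_def b_def flat_def)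
    then show ?thesis by simp
  next
    case False
    then have "b x > 0" "a x \<ge> 0" by (auto simp: a_def b_def flat_def)
    then show ?thesis by simp
  qed
  have qd: "q x = (dist x0 x / r)\<^sup>2" for x
    unfolding q_def by (simp add: dist_norm power2_norm_eq_inner power_divide norm_minus_commute field_simps)
       (simp add: power2_norm_eq_inner[symmetric] norm_minus_commute power2_eq_square)
  show ?thesis
  proof (rule that[of "\<lambda>x. a x * inverse (a x + b x)"])
    show "smooth_at (\<lambda>x. a x * inverse (a x + b x)) x" for x
      using pos[of x] by (intro smooth_at_mult smooth_at_inverse smooth_at_add a b) auto
  next
    fix x assume "dist x0 x \<le> r / 2"
    then have "dist x0 x / r \<le> 1/2" using r by (simp add: field_simps)
    then have "q x \<le> (1/2)\<^sup>2" unfolding qd using r by (intro power_mono) auto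
    then have "b x = 0" by (simp add: b_def flat_def power2_eq_square)
    then show "a x * inverse (a x + b x) = 1" using pos[of x] by simp
  next
    fix x assume "dist x0 x \<ge> r"
    then have "dist x0 x / r \<ge> 1" using r by (simp add: field_simps)
    then have "q x \<ge> 1" unfolding qd using one_le_power by blast
    then show "a x * inverse (a x + b x) = 0" by (simp add: a_def flat_def)
  qed
qed

section \<open>Compact balls and local bounds\<close>

text \<open>Heine-Borel for a space with an orthonormal basis: a bounded sequence has a subsequence
  all of whose coordinates converge, and there are finitely many of them.\<close>

lemma compact_cball_orthobasis:
  fixes B :: "'e::real_inner set"
  assumes B: "orthobasis B"
  shows "compact (cball (x0::'e) r)"
  unfolding compact_eq_seq_compact_metric
proof (rule seq_compactI)
  fix f :: "nat \<Rightarrow> 'e"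
  assume f: "\<forall>n. f n \<in> cball x0 r"
  then have bf: "bounded (range f)" by (meson bounded_cball bounded_subset image_subsetI)
  obtain l r' where r': "strict_mono (r' :: nat \<Rightarrow> nat)"
    and l: "\<forall>e>0. eventually (\<lambda>n. \<forall>i\<in>B. dist (f (r' n) \<bullet> i) (l \<bullet> i) < e) sequentially"
    using compact_lemma_general[of B "(\<bullet>)" f "\<lambda>e. \<Sum>b\<in>B. e b *\<^sub>R b"] B
    by (auto simp: orthobasis_finite orthobasis_sum orthobasis_expand
        intro!: bounded_linear_image[OF bf] bounded_linear_inner_left)
  have "(\<lambda>n. f (r' n) \<bullet> b) \<longlonglongrightarrow> l \<bullet> b" if "b \<in> B" for b
    unfolding tendsto_iff
  proof (intro allI impI)
    fix e :: real assume "e > 0"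
    then have "eventually (\<lambda>n. \<forall>i\<in>B. dist (f (r' n) \<bullet> i) (l \<bullet> i) < e) sequentially" using l by blast
    then show "eventually (\<lambda>n. dist (f (r' n) \<bullet> b) (l \<bullet> b) < e) sequentially"
      by (rule eventually_mono) (use that in blast)
  qed
  then have "(\<lambda>n. \<Sum>b\<in>B. (f (r' n) \<bullet> b) *\<^sub>R b) \<longlonglongrightarrow> (\<Sum>b\<in>B. (l \<bullet> b) *\<^sub>R b)"
    by (intro tendsto_sum tendsto_scaleR tendsto_const) auto
  then have lim: "(f \<circ> r') \<longlonglongrightarrow> l" by (simp add: orthobasis_expand[OF B] o_def)
  moreover have "l \<in> cball x0 r"
    by (rule closed_sequentially[OF closed_cball _ lim]) (use f in auto)
  ultimately show "\<exists>l\<in>cball x0 r. \<exists>r. strict_mono r \<and> (f \<circ> r) \<longlonglongrightarrow> l" using r' by blast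
qed

text \<open>By continuity the finitely many partial derivatives stay below \<open>M\<close> near
  \<open>x0\<close>. Summing over the basis bounds \<open>fd F a\<close>, and the mean value
  inequality on the convex ball turns this into a Lipschitz bound with the same
  \<open>L\<close>.\<close>

lemma fd_locally_bounded:
  fixes B :: "'e::real_inner set" and F :: "'e \<Rightarrow> 'b::real_normed_vector"
  assumes B: "orthobasis B" and F: "smooth_at F x0"
  obtains r L where "r > 0" "L \<ge> 0" "\<And>a. a \<in> ball x0 r \<Longrightarrow> smooth_at F a"
    "\<And>a w. a \<in> ball x0 r \<Longrightarrow> norm (fd F a w) \<le> L * norm w"
    "\<And>a b. a \<in> ball x0 r \<Longrightarrow> b \<in> ball x0 r \<Longrightarrow> norm (F a - F b) \<le> L * norm (a - b)"
proof -
  \<comment> \<open>The summand 1 makes the bound strict at \<open>x0\<close>, so that it persists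
    nearby.\<close>
  define M where "M = (\<Sum>b\<in>B. norm (fd F x0 b)) + 1"
  have "\<forall>\<^sub>F y in nhds x0. norm (fd F y b) < M" if "b \<in> B" for b
  proof -
    have "norm (fd F x0 b) \<le> (\<Sum>b\<in>B. norm (fd F x0 b))"
      using that orthobasis_finite[OF B] by (intro member_le_sum) auto
    then have "norm (fd F x0 b) < M" by (simp add: M_def)
    moreover have "isCont (\<lambda>y. norm (fd F y b)) x0"
      using smooth_at_isCont[OF smooth_at_fd[OF F]] by (intro continuous_norm)
    then have "((\<lambda>y. norm (fd F y b)) \<longlongrightarrow> norm (fd F x0 b)) (nhds x0)"
      unfolding isCont_def using tendsto_at_iff_tendsto_nhds[of "\<lambda>y. norm (fd F y b)" x0] by blast
    ultimately show ?thesis by (intro order_tendstoD(2))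
  qed
  then have "\<forall>\<^sub>F y in nhds x0. \<forall>b\<in>B. norm (fd F y b) < M"
    using orthobasis_finite[OF B] by (simp add: eventually_ball_finite)
  moreover have "\<forall>\<^sub>F y in nhds x0. smooth_at F y"
    using smooth_at_open[OF F] by (auto simp: eventually_nhds)
  ultimately have "\<forall>\<^sub>F y in nhds x0. smooth_at F y \<and> (\<forall>b\<in>B. norm (fd F y b) < M)"
    by (simp add: eventually_conj)
  then obtain r where r: "r > 0" "\<And>y. y \<in> ball x0 r \<Longrightarrow> smooth_at F y"
    "\<And>y b. y \<in> ball x0 r \<Longrightarrow> b \<in> B \<Longrightarrow> norm (fd F y b) < M"
    unfolding eventually_nhds_metric by (auto simp: dist_commute)
  define L where "L = real (card B) * M"
  have M: "M \<ge> 0" unfolding M_def by (intro add_nonneg_nonneg sum_nonneg) auto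
  have L: "L \<ge> 0" using M by (simp add: L_def)
  have nb: "norm (fd F a w) \<le> L * norm w" if a: "a \<in> ball x0 r" for a w
  proof -
    have "norm b = 1" if "b \<in> B" for b
      using orthobasis_inner[OF B that that] by (simp add: norm_eq_sqrt_inner)
    then have *: "\<bar>w \<bullet> b\<bar> \<le> norm w" if "b \<in> B" for b
      using Cauchy_Schwarz_ineq2[of w b] that by simp
    have "norm (fd F a w) = norm (\<Sum>b\<in>B. (w \<bullet> b) *\<^sub>R fd F a b)"
      using orthobasis_linear[OF B smooth_at_linear_fd[OF r(2)[OF a]], of w] by simp
    also have "\<dots> \<le> (\<Sum>b\<in>B. norm w * M)"
      using less_imp_le[OF r(3)[OF a]] * M by (intro sum_norm_le) (auto intro!: mult_mono)
    finally show ?thesis by (simp add: L_def mult_ac)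
  qed
  have "norm (F a - F b) \<le> L * norm (a - b)" if "a \<in> ball x0 r" "b \<in> ball x0 r" for a b
  proof (rule differentiable_bound[OF convex_ball _ _ that])
    fix y assume y: "y \<in> ball x0 r"
    show "(F has_derivative fd F y) (at y within ball x0 r)"
      using smooth_at_has_derivative[OF r(2)[OF y]] by (rule has_derivative_at_withinI)
    show "onorm (fd F y) \<le> L" using nb[OF y] L by (intro onorm_bound)
  qed
  then show ?thesis using that[OF r(1) L r(2) nb] by blast
qed

text \<open>The map \<open>F y - fd F a y\<close> has derivative \<open>fd F y - fd F a\<close> at
  \<open>y\<close>, which is at most \<open>C * norm (y - a)\<close> because the partial derivatives
  of \<open>F\<close> are Lipschitz; the mean value inequality then gives the quadratic
  error.\<close>

lemma taylor_locally_bounded: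
  fixes B :: "'e::real_inner set" and F :: "'e \<Rightarrow> 'b::real_normed_vector"
  assumes B: "orthobasis B" and F: "smooth_at F x0"
  obtains r L C where "r > 0" "L \<ge> 0" "C \<ge> 0" "\<And>a. a \<in> ball x0 r \<Longrightarrow> smooth_at F a"
    "\<And>a w. a \<in> ball x0 r \<Longrightarrow> norm (fd F a w) \<le> L * norm w"
    "\<And>a b. a \<in> ball x0 r \<Longrightarrow> b \<in> ball x0 r \<Longrightarrow> norm (F a - F b) \<le> L * norm (a - b)"
    "\<And>a b. a \<in> ball x0 r \<Longrightarrow> b \<in> ball x0 r \<Longrightarrow> norm (F b - F a - fd F a (b - a)) \<le> C * (norm (b - a))\<^sup>2"
proof -
  obtain r1 L where r1: "r1 > 0" "L \<ge> 0" "\<And>a. a \<in> ball x0 r1 \<Longrightarrow> smooth_at F a"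
    "\<And>a w. a \<in> ball x0 r1 \<Longrightarrow> norm (fd F a w) \<le> L * norm w"
    "\<And>a b. a \<in> ball x0 r1 \<Longrightarrow> b \<in> ball x0 r1 \<Longrightarrow> norm (F a - F b) \<le> L * norm (a - b)"
    using fd_locally_bounded[OF B F] by blast
  have "\<exists>r>0. \<exists>K\<ge>0. \<forall>y\<in>ball x0 r. \<forall>z\<in>ball x0 r. norm (fd F y b - fd F z b) \<le> K * norm (y - z)" for b
    using fd_locally_bounded[OF B smooth_at_fd[OF F, of b]] by (metis (no_types, lifting))
  then obtain rr KK where rK: "\<And>b. rr b > 0" "\<And>b. KK b \<ge> 0"
    "\<And>b y z. y \<in> ball x0 (rr b) \<Longrightarrow> z \<in> ball x0 (rr b) \<Longrightarrow> norm (fd F y b - fd F z b) \<le> KK b * norm (y - z)"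
    by metis
  \<comment> \<open>One radius for \<open>F\<close> and all of its partial derivatives;
    \<open>insert r1\<close> also keeps the set nonempty when the basis is empty.\<close>
  define r where "r = Min (insert r1 (rr ` B))"
  have fin: "finite (insert r1 (rr ` B))" using orthobasis_finite[OF B] by simp
  have r: "r > 0" "r \<le> r1" "\<And>b. b \<in> B \<Longrightarrow> r \<le> rr b"
    unfolding r_def using fin r1(1) rK(1) by (auto simp: Min_gr_iff)
  define C where "C = (\<Sum>b\<in>B. KK b)"
  have C: "C \<ge> 0" unfolding C_def by (intro sum_nonneg rK)
  have dd: "norm (fd F y w - fd F z w) \<le> C * norm (y - z) * norm w"
    if y: "y \<in> ball x0 r" and z: "z \<in> ball x0 r" for y z w
  proof -
    have "norm b = 1" if "b \<in> B" for b
      using orthobasis_inner[OF B that that] by (simp add: norm_eq_sqrt_inner)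
    then have *: "\<bar>w \<bullet> b\<bar> \<le> norm w" if "b \<in> B" for b
      using Cauchy_Schwarz_ineq2[of w b] that by simp
    have s: "smooth_at F y" "smooth_at F z" using y z r r1(3) by auto
    have "fd F y w - fd F z w = (\<Sum>b\<in>B. (w \<bullet> b) *\<^sub>R (fd F y b - fd F z b))"
      using orthobasis_linear[OF B smooth_at_linear_fd[OF s(1)], of w]
        orthobasis_linear[OF B smooth_at_linear_fd[OF s(2)], of w]
      by (simp add: scaleR_diff_right sum_subtractf)
    also have "norm \<dots> \<le> (\<Sum>b\<in>B. norm w * (KK b * norm (y - z)))"
    proof (rule sum_norm_le)
      fix b assume b: "b \<in> B"
      have "norm (fd F y b - fd F z b) \<le> KK b * norm (y - z)"
        using rK(3)[of y b z] y z r(3)[OF b] by auto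
      then show "norm ((w \<bullet> b) *\<^sub>R (fd F y b - fd F z b)) \<le> norm w * (KK b * norm (y - z))"
        using *[OF b] by (auto intro!: mult_mono)
    qed
    finally show ?thesis by (simp add: C_def sum_distrib_left sum_distrib_right mult_ac)
  qed
  have "norm (F b - F a - fd F a (b - a)) \<le> C * (norm (b - a))\<^sup>2" if a: "a \<in> ball x0 r" and b: "b \<in> ball x0 r" for a b
  proof -
    \<comment> \<open>Intersecting with the ball about \<open>a\<close> through \<open>b\<close>
      ensures \<open>norm (y - a) \<le> norm (b - a)\<close> and preserves convexity.\<close>
    let ?S = "ball x0 r \<inter> cball a (norm (b - a))"
    have "norm ((F b - fd F a b) - (F a - fd F a a)) \<le> (C * norm (b - a)) * norm (b - a)"
    proof (rule differentiable_bound[of ?S "\<lambda>y. F y - fd F a y" "\<lambda>y v. fd F y v - fd F a v"])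
      show "convex ?S" by (intro convex_Int) auto
      show "b \<in> ?S" "a \<in> ?S" using a b by (auto simp: dist_norm norm_minus_commute)
      fix y assume y: "y \<in> ?S"
      have sy: "smooth_at F y" "smooth_at F a" using y a r r1(3) by auto
      show "((\<lambda>y. F y - fd F a y) has_derivative (\<lambda>v. fd F y v - fd F a v)) (at y within ?S)"
        by (rule has_derivative_at_withinI[OF has_derivative_diff[OF smooth_at_has_derivative[OF sy(1)]
              bounded_linear_imp_has_derivative[OF fd_bounded_linear[OF smooth_at_differentiable[OF sy(2)]]]]])
      show "onorm (\<lambda>v. fd F y v - fd F a v) \<le> C * norm (b - a)"
      proof (rule onorm_bound)
        fix v
        have "norm (fd F y v - fd F a v) \<le> C * norm (y - a) * norm v" using dd[of y a] y a by auto
        also have "\<dots> \<le> C * norm (b - a) * norm v"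
          using y C by (intro mult_right_mono mult_left_mono) (auto simp: dist_norm norm_minus_commute)
        finally show "norm (fd F y v - fd F a v) \<le> C * norm (b - a) * norm v" .
      qed (use C in auto)
    qed
    moreover have "fd F a (b - a) = fd F a b - fd F a a"
      using a r r1(3) by (intro linear_diff smooth_at_linear_fd) auto
    then have "F b - F a - fd F a (b - a) = (F b - fd F a b) - (F a - fd F a a)" by simp
    ultimately show ?thesis by (simp only: power2_eq_square mult.assoc)
  qed
  note tay = this
  have sub: "a \<in> ball x0 r1" if "a \<in> ball x0 r" for a using that r(2) by auto
  show ?thesis
    by (rule that[OF r(1) r1(2) C _ _ _ tay]) (use sub r1 in blast)+
qed

section \<open>Ordinary differential equations\<close>

text \<open>Integrating factor: \<open>v s * exp (- a * s)\<close> has a nonpositive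
  derivative.\<close>

lemma gronwall_forward:
  fixes v :: "real \<Rightarrow> real"
  assumes v: "\<And>s. 0 \<le> s \<Longrightarrow> s < \<tau> \<Longrightarrow> (v has_real_derivative v' s) (at s)"
    and le: "\<And>s. 0 \<le> s \<Longrightarrow> s < \<tau> \<Longrightarrow> v' s \<le> a * v s"
    and t: "0 \<le> t" "t < \<tau>"
  shows "v t \<le> v 0 * exp (a * t)"
proof -
  have "v t * exp (- a * t) \<le> v 0 * exp (- a * 0)"
  proof (rule DERIV_nonpos_imp_nonincreasing[OF t(1)])
    fix s assume s: "0 \<le> s" "s \<le> t"
    have "((\<lambda>s. v s * exp (- a * s)) has_real_derivative (v' s - a * v s) * exp (- a * s)) (at s)"
      using v[of s] s t by (auto intro!: derivative_eq_intros simp: algebra_simps)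
    moreover have "(v' s - a * v s) * exp (- a * s) \<le> 0"
      using le[of s] s t by (intro mult_nonpos_nonneg) auto
    ultimately show "\<exists>y. ((\<lambda>s. v s * exp (- a * s)) has_real_derivative y) (at s) \<and> y \<le> 0" by blast
  qed
  then have "v t * exp (- a * t) * exp (a * t) \<le> v 0 * exp (a * t)"
    by (intro mult_right_mono) auto
  then show ?thesis by (simp add: mult.assoc exp_add[symmetric])
qed

lemma gronwall:
  fixes v :: "real \<Rightarrow> real"
  assumes v: "\<And>s. \<bar>s\<bar> < \<tau> \<Longrightarrow> (v has_real_derivative v' s) (at s)"
    and le: "\<And>s. \<bar>s\<bar> < \<tau> \<Longrightarrow> \<bar>v' s\<bar> \<le> a * v s"
    and t: "\<bar>t\<bar> < \<tau>"
  shows "v t \<le> v 0 * exp (a * \<bar>t\<bar>)"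
proof (cases "t \<ge> 0")
  case True
  show ?thesis using gronwall_forward[of \<tau> v v' a t] v le t True by (simp add: abs_le_iff)
next
  case False
  have *: "((\<lambda>s. v (- s)) has_real_derivative - v' (- s)) (at s)" if "0 \<le> s" "s < \<tau>" for s
  proof -
    have "(v has_real_derivative v' (- s)) (at (- s))" using v[of "- s"] that by simp
    then show ?thesis by (simp add: DERIV_mirror)
  qed
  have "- v' (- s) \<le> a * v (- s)" if "0 \<le> s" "s < \<tau>" for s
    using le[of "- s"] that by simp
  from gronwall_forward[of \<tau> "\<lambda>s. v (- s)" "\<lambda>s. - v' (- s)" a "- t", OF * this]
  show ?thesis using t False by simp
qed

text \<open>Gronwall is applied to the squared norm plus the square of \<open>R\<close>. The square
  is differentiable even where \<open>w\<close> vanishes, and the mixed term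
  \<open>2 * norm (w s) * R\<close> is absorbed by the sum of the squares, whence the constant
  \<open>2 * L + 1\<close>.\<close>

lemma gronwall_norm:
  fixes w :: "real \<Rightarrow> 'b::real_inner"
  assumes w: "\<And>s. \<bar>s\<bar> < \<tau> \<Longrightarrow> (w has_vector_derivative w' s) (at s)"
    and le: "\<And>s. \<bar>s\<bar> < \<tau> \<Longrightarrow> norm (w' s) \<le> L * norm (w s) + R"
    and L: "L \<ge> 0" and R: "R \<ge> 0" and t: "\<bar>t\<bar> < \<tau>"
  shows "(norm (w t))\<^sup>2 \<le> ((norm (w 0))\<^sup>2 + R\<^sup>2) * exp ((2 * L + 1) * \<bar>t\<bar>)"
proof -
  define v where "v = (\<lambda>s. w s \<bullet> w s + R\<^sup>2)"
  have d: "(v has_real_derivative 2 * (w s \<bullet> w' s)) (at s)" if "\<bar>s\<bar> < \<tau>" for s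
  proof -
    have "((\<lambda>s. w s \<bullet> w s) has_vector_derivative (w s \<bullet> w' s + w' s \<bullet> w s)) (at s)"
      using bounded_bilinear.has_vector_derivative[OF bounded_bilinear_inner w[OF that] w[OF that]] .
    then have "((\<lambda>s. w s \<bullet> w s) has_real_derivative 2 * (w s \<bullet> w' s)) (at s)"
      by (simp add: has_real_derivative_iff_has_vector_derivative inner_commute)
    then show ?thesis unfolding v_def by (auto intro!: derivative_eq_intros)
  qed
  have "\<bar>2 * (w s \<bullet> w' s)\<bar> \<le> (2 * L + 1) * v s" if "\<bar>s\<bar> < \<tau>" for s
  proof -
    have "\<bar>w s \<bullet> w' s\<bar> \<le> norm (w s) * norm (w' s)" by (rule Cauchy_Schwarz_ineq2)
    also have "\<dots> \<le> norm (w s) * (L * norm (w s) + R)" using le[OF that] by (intro mult_left_mono) auto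
    finally have 1: "\<bar>2 * (w s \<bullet> w' s)\<bar> \<le> 2 * L * (norm (w s))\<^sup>2 + 2 * norm (w s) * R"
      by (simp add: algebra_simps power2_eq_square)
    have 2: "2 * norm (w s) * R \<le> (norm (w s))\<^sup>2 + R\<^sup>2" by (rule sum_squares_bound)
    have 3: "0 \<le> 2 * L * R\<^sup>2" using L by simp
    show ?thesis using 1 2 3 by (simp add: v_def power2_norm_eq_inner algebra_simps)
  qed
  from gronwall[OF d this t] have "v t \<le> v 0 * exp ((2 * L + 1) * \<bar>t\<bar>)" .
  then have "w t \<bullet> w t + R\<^sup>2 \<le> (w 0 \<bullet> w 0 + R\<^sup>2) * exp ((2 * L + 1) * \<bar>t\<bar>)" by (simp add: v_def)
  moreover have "0 \<le> R\<^sup>2" by simp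
  ultimately show ?thesis unfolding power2_norm_eq_inner by linarith
qed

section \<open>Local existence and dependence on the initial value\<close>

text \<open>Picard-Lindeloef: the integral operator \<open>\<Phi>\<close> is a contraction of the
  complete set \<open>S\<close> of bounded continuous functions with values in the ball. All
  starting points in \<open>ball x0 (r / 2)\<close> share one \<open>\<tau>\<close>, as local flows
  require.\<close>

lemma picard_banach:
  fixes f :: "'b::banach \<Rightarrow> 'b"
  assumes r: "r > 0" and L: "\<And>a b. a \<in> cball x0 r \<Longrightarrow> b \<in> cball x0 r \<Longrightarrow> norm (f a - f b) \<le> L * norm (a - b)"
  obtains \<tau> where "\<tau> > 0" "\<And>x. x \<in> ball x0 (r / 2) \<Longrightarrow>
    \<exists>y. y 0 = x \<and> (\<forall>t. \<bar>t\<bar> < \<tau> \<longrightarrow> y t \<in> cball x0 r \<and> (y has_vector_derivative f (y t)) (at t))"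
proof -
  define L' where "L' = \<bar>L\<bar> + 1"
  have L': "norm (f a - f b) \<le> L' * norm (a - b)" if "a \<in> cball x0 r" "b \<in> cball x0 r" for a b
  proof -
    have "L * norm (a - b) \<le> L' * norm (a - b)" unfolding L'_def by (intro mult_right_mono) auto
    then show ?thesis using L[OF that] by simp
  qed
  have L'0: "L' > 0" by (simp add: L'_def)
  define K where "K = norm (f x0) + L' * r + 1"
  have K: "K > 0" using r L'0 unfolding K_def by (intro add_nonneg_pos add_nonneg_nonneg mult_nonneg_nonneg) auto
  have fK: "norm (f a) \<le> K" if "a \<in> cball x0 r" for a
  proof -
    have "norm (f a) \<le> norm (f x0) + norm (f a - f x0)" by norm
    also have "norm (f a - f x0) \<le> L' * norm (a - x0)" using L'[OF that] r by auto
    also have "\<dots> \<le> L' * r" using that L'0 by (intro mult_left_mono) (auto simp: dist_norm norm_minus_commute)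
    finally show ?thesis by (simp add: K_def)
  qed
  have fc: "continuous_on (cball x0 r) f"
    by (rule lipschitz_on_continuous_on[of L'])
      (use L' L'0 in \<open>auto intro!: lipschitz_onI simp: dist_norm\<close>)
  \<comment> \<open>The first bound keeps the iterates, which start within \<open>r / 2\<close> of
    \<open>x0\<close>, inside the ball; the second gives the contraction factor
    \<open>1/2\<close>.\<close>
  define \<tau> where "\<tau> = min (r / (2 * K)) (1 / (2 * L'))"
  have \<tau>: "\<tau> > 0" "K * \<tau> \<le> r / 2" "L' * \<tau> \<le> 1 / 2"
    using r K L'0 by (auto simp: \<tau>_def min_def field_simps)
  \<comment> \<open>The integral from 0 to \<open>t\<close> for either sign of \<open>t\<close>,
    written as a difference of integrals from the left end.\<close>
  define I where "I = (\<lambda>(g :: real \<Rightarrow> 'b) t. integral {-\<tau>..t} g - integral {-\<tau>..0} g)"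
  have Id: "((I g) has_vector_derivative g t) (at t within {-\<tau>..\<tau>})"
    if "continuous_on {-\<tau>..\<tau>} g" "t \<in> {-\<tau>..\<tau>}" for g t
    unfolding I_def using integral_has_vector_derivative[OF that]
    by (auto intro!: derivative_eq_intros)
  have I0: "I g 0 = 0" for g by (simp add: I_def)
  have Ib: "norm (I g t - I h t) \<le> c * \<tau>"
    if g: "continuous_on {-\<tau>..\<tau>} g" "continuous_on {-\<tau>..\<tau>} h" and t: "t \<in> {-\<tau>..\<tau>}"
      and c: "\<And>s. norm (g s - h s) \<le> c" for g h t c
  proof -
    have c0: "c \<ge> 0" using c[of 0] norm_ge_zero order_trans by blast
    have "norm ((I g t - I h t) - (I g 0 - I h 0)) \<le> c * norm (t - 0)"
    proof (rule differentiable_bound[of "{-\<tau>..\<tau>}" "\<lambda>t. I g t - I h t" "\<lambda>t s. s *\<^sub>R (g t - h t)"])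
      fix s assume "s \<in> {-\<tau>..\<tau>}"
      then show "((\<lambda>t. I g t - I h t) has_derivative (\<lambda>u. u *\<^sub>R (g s - h s))) (at s within {-\<tau>..\<tau>})"
        using has_vector_derivative_diff[OF Id[OF g(1)] Id[OF g(2)]] by (simp add: has_vector_derivative_def)
      show "onorm (\<lambda>u. u *\<^sub>R (g s - h s)) \<le> c"
      proof (rule onorm_bound[OF c0])
        fix u :: real
        have "\<bar>u\<bar> * norm (g s - h s) \<le> \<bar>u\<bar> * c" using c by (intro mult_left_mono) auto
        then show "norm (u *\<^sub>R (g s - h s)) \<le> c * norm u" by (simp add: mult.commute)
      qed
    qed (use t \<tau> in auto)
    also have "\<dots> \<le> c * \<tau>" using t c0 by (intro mult_left_mono) auto
    finally show ?thesis by (simp add: I0)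
  qed
  have Iz: "I (\<lambda>_. 0) t = 0" for t by (simp add: I_def)
  have main: "\<exists>y. y 0 = x \<and> (\<forall>t. \<bar>t\<bar> < \<tau> \<longrightarrow> y t \<in> cball x0 r \<and> (y has_vector_derivative f (y t)) (at t))"
    if x: "x \<in> ball x0 (r / 2)" for x
  proof -
    define S where "S = (PiC UNIV (\<lambda>_. cball x0 r) :: (real \<Rightarrow>\<^sub>C 'b) set)"
    have S: "u \<in> S \<longleftrightarrow> (\<forall>t. apply_bcontfun u t \<in> cball x0 r)" for u
      by (auto simp: S_def mem_PiC_iff)
    have cS: "complete S" unfolding S_def complete_eq_closed by (intro closed_PiC) auto
    have nS: "S \<noteq> {}"
    proof -
      have "const_bcontfun x0 \<in> S" using r by (auto simp: S const_bcontfun.rep_eq)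
      then show ?thesis by blast
    qed
    have fu: "continuous_on {-\<tau>..\<tau>} (\<lambda>s. f (apply_bcontfun u s))" if "u \<in> S" for u
      by (rule continuous_on_compose2[OF fc]) (use that in \<open>auto simp: S\<close>)
    have cont: "continuous_on (cbox (-\<tau>) \<tau>) (\<lambda>t. x + I (\<lambda>s. f (apply_bcontfun u s)) t)" if "u \<in> S" for u
    proof -
      have "continuous_on {-\<tau>..\<tau>} (I (\<lambda>s. f (apply_bcontfun u s)))"
        using Id[OF fu[OF that]]
        by (meson continuous_on_eq_continuous_within has_vector_derivative_continuous)
      then show ?thesis by (auto intro: continuous_intros)
    qed
    \<comment> \<open>Elements of \<open>S\<close> live on the whole line, so the integral on
      \<open>{-\<tau>..\<tau>}\<close> is continued by constants through
      \<open>clamp\<close>.\<close>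
    have "\<exists>v :: real \<Rightarrow>\<^sub>C 'b. \<forall>t. apply_bcontfun v t = x + I (\<lambda>s. f (apply_bcontfun u s)) (clamp (-\<tau>) \<tau> t)"
      if "u \<in> S" for u
    proof -
      obtain g :: "real \<Rightarrow>\<^sub>C 'b" where
        "\<And>t. apply_bcontfun g t = x + I (\<lambda>s. f (apply_bcontfun u s)) (clamp (-\<tau>) \<tau> t)"
        using continuous_on_cbox_bcontfunE[OF cont[OF \<open>u \<in> S\<close>]] by blast
      then show ?thesis by blast
    qed
    then obtain \<Phi> :: "(real \<Rightarrow>\<^sub>C 'b) \<Rightarrow> (real \<Rightarrow>\<^sub>C 'b)" where
      \<Phi>: "\<And>u t. u \<in> S \<Longrightarrow> apply_bcontfun (\<Phi> u) t = x + I (\<lambda>s. f (apply_bcontfun u s)) (clamp (-\<tau>) \<tau> t)"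
      by metis
    have cl: "clamp (-\<tau>) \<tau> t \<in> {-\<tau>..\<tau>}" for t
      using clamp_in_interval[of "-\<tau>" \<tau> t] \<tau> by simp
    have "\<Phi> u \<in> S" if u: "u \<in> S" for u
      unfolding S
    proof
      fix t
      have "norm (I (\<lambda>s. f (apply_bcontfun u s)) (clamp (-\<tau>) \<tau> t) - I (\<lambda>_. 0) (clamp (-\<tau>) \<tau> t)) \<le> K * \<tau>"
        using u S fK by (intro Ib fu cl) auto
      then have "norm (I (\<lambda>s. f (apply_bcontfun u s)) (clamp (-\<tau>) \<tau> t)) \<le> r / 2"
        using \<tau>(2) by (simp add: Iz)
      then have "norm (x + I (\<lambda>s. f (apply_bcontfun u s)) (clamp (-\<tau>) \<tau> t) - x0) \<le> r / 2 + r / 2"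
        using x by (simp add: dist_norm) norm
      then show "apply_bcontfun (\<Phi> u) t \<in> cball x0 r"
        by (simp add: \<Phi>[OF u] dist_norm norm_minus_commute)
    qed
    moreover have "dist (\<Phi> u) (\<Phi> v) \<le> 1/2 * dist u v" if u: "u \<in> S" and v: "v \<in> S" for u v
    proof (rule dist_bound)
      fix t
      have "norm (f (apply_bcontfun u s) - f (apply_bcontfun v s)) \<le> L' * dist u v" for s
      proof -
        have "norm (f (apply_bcontfun u s) - f (apply_bcontfun v s)) \<le> L' * norm (apply_bcontfun u s - apply_bcontfun v s)"
          using u v S by (intro L') auto
        also have "\<dots> \<le> L' * dist u v"
          using dist_bounded[of u s v] L'0 by (intro mult_left_mono) (auto simp: dist_norm)
        finally show ?thesis .
      qed
      then have "dist (apply_bcontfun (\<Phi> u) t) (apply_bcontfun (\<Phi> v) t) \<le> L' * dist u v * \<tau>"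
        using Ib[OF fu[OF u] fu[OF v] cl] by (simp add: \<Phi> u v dist_norm)
      also have "\<dots> \<le> 1/2 * dist u v"
        using mult_right_mono[OF \<tau>(3), of "dist u v"] by (simp add: mult_ac)
      finally show "dist (apply_bcontfun (\<Phi> u) t) (apply_bcontfun (\<Phi> v) t) \<le> 1/2 * dist u v" .
    qed
    ultimately have "\<exists>!u\<in>S. \<Phi> u = u"
      by (intro Banach_fix[OF cS nS, of "1/2"]) auto
    then obtain u where u: "u \<in> S" "\<Phi> u = u" by blast
    have ueq: "apply_bcontfun u t = x + I (\<lambda>s. f (apply_bcontfun u s)) t" if "t \<in> {-\<tau>..\<tau>}" for t
      using \<Phi>[OF u(1), of t] u(2) that clamp_cancel_cbox[of t "-\<tau>" \<tau>] by simp
    have "(apply_bcontfun u has_vector_derivative f (apply_bcontfun u t)) (at t)" if "\<bar>t\<bar> < \<tau>" for t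
    proof -
      have t: "t \<in> {-\<tau>..\<tau>}" "t \<in> {-\<tau><..<\<tau>}" using that by auto
      have "((\<lambda>t. x + I (\<lambda>s. f (apply_bcontfun u s)) t) has_vector_derivative f (apply_bcontfun u t)) (at t within {-\<tau>..\<tau>})"
        using Id[OF fu[OF u(1)] t(1)] by (auto intro!: derivative_eq_intros)
      then have "((\<lambda>t. x + I (\<lambda>s. f (apply_bcontfun u s)) t) has_vector_derivative f (apply_bcontfun u t)) (at t within {-\<tau><..<\<tau>})"
        by (rule has_vector_derivative_within_subset) auto
      then have "((\<lambda>t. x + I (\<lambda>s. f (apply_bcontfun u s)) t) has_vector_derivative f (apply_bcontfun u t)) (at t)"
        using t(2) at_within_open[OF t(2) open_greaterThanLessThan] by metis
      then show ?thesis
        by (rule has_vector_derivative_transform_within_open[OF _ open_greaterThanLessThan t(2)])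
          (simp add: ueq)
    qed
    moreover have "apply_bcontfun u 0 = x" using ueq[of 0] \<tau> by (simp add: I0)
    ultimately show ?thesis using u(1) S by (intro exI[of _ "apply_bcontfun u"]) blast
  qed
  show ?thesis by (rule that[OF \<tau>(1) main])
qed

text \<open>The inner product embeds the model space into its dual by \<open>J\<close>, with left
  inverse \<open>P\<close>. The equation is solved on the dual, which is complete, for the field
  \<open>J o F o P\<close>, and the solution is projected by \<open>P\<close>.\<close>

lemma picard:
  fixes F :: "'e::real_inner \<Rightarrow> 'e" and B :: "'e set"
  assumes B: "orthobasis B" and r: "r > 0"
    and L: "\<And>a b. a \<in> ball x0 r \<Longrightarrow> b \<in> ball x0 r \<Longrightarrow> norm (F a - F b) \<le> L * norm (a - b)"
  obtains \<tau> \<rho> where "\<tau> > 0" "\<rho> > 0" "\<And>x. x \<in> ball x0 \<rho> \<Longrightarrow>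
    \<exists>y. y 0 = x \<and> (\<forall>t. \<bar>t\<bar> < \<tau> \<longrightarrow> y t \<in> ball x0 r \<and> (y has_vector_derivative F (y t)) (at t))"
proof -
  define P :: "('e \<Rightarrow>\<^sub>L real) \<Rightarrow> 'e" where "P = (\<lambda>y. \<Sum>b\<in>B. blinfun_apply y b *\<^sub>R b)"
  define J :: "'e \<Rightarrow> ('e \<Rightarrow>\<^sub>L real)" where "J = blinfun_inner_left"
  have P: "bounded_linear P" unfolding P_def
    by (intro bounded_linear_sum bounded_linear_scaleR_const blinfun.bounded_linear_left)
  have J: "bounded_linear J" unfolding J_def by (rule bounded_linear_blinfun_inner_left)
  have PJ: "P (J x) = x" for x
    using orthobasis_expand[OF B, of x] by (simp add: P_def J_def inner_commute[of x])
  obtain p where p: "p > 0" "\<And>y. norm (P y) \<le> norm y * p" using bounded_linear.pos_bounded[OF P] by blast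
  obtain j where j: "j > 0" "\<And>y. norm (J y) \<le> norm y * j" using bounded_linear.pos_bounded[OF J] by blast
  define R where "R = r / (2 * p)"
  have R: "R > 0" using r p by (simp add: R_def)
  have inb: "P y \<in> ball x0 r" if "y \<in> cball (J x0) R" for y
  proof -
    have "norm (P (y - J x0)) \<le> norm (y - J x0) * p" by (rule p)
    also have "\<dots> \<le> R * p" using that p by (intro mult_right_mono) (auto simp: dist_norm norm_minus_commute)
    also have "\<dots> < r" using p r by (simp add: R_def)
    finally show ?thesis
      by (simp add: linear_diff[OF bounded_linear.linear[OF P]] PJ dist_norm norm_minus_commute)
  qed
  have "norm (J (F (P a)) - J (F (P b))) \<le> (j * \<bar>L\<bar> * p) * norm (a - b)"
    if "a \<in> cball (J x0) R" "b \<in> cball (J x0) R" for a b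
  proof -
    have "norm (J (F (P a)) - J (F (P b))) \<le> norm (F (P a) - F (P b)) * j"
      using j(2)[of "F (P a) - F (P b)"] by (simp add: linear_diff[OF bounded_linear.linear[OF J]])
    also have "norm (F (P a) - F (P b)) \<le> \<bar>L\<bar> * norm (P a - P b)"
      using L[OF inb[OF that(1)] inb[OF that(2)]] by (smt (verit) mult_right_mono norm_ge_zero)
    also have "norm (P a - P b) \<le> norm (a - b) * p"
      using p(2)[of "a - b"] by (simp add: linear_diff[OF bounded_linear.linear[OF P]])
    finally show ?thesis using j(1) by (simp add: mult_right_mono mult_left_mono mult_ac)
  qed
  from picard_banach[OF R this] obtain \<tau> where \<tau>: "\<tau> > 0" and ex: "\<And>x. x \<in> ball (J x0) (R / 2) \<Longrightarrow>
    \<exists>y. y 0 = x \<and> (\<forall>t. \<bar>t\<bar> < \<tau> \<longrightarrow> y t \<in> cball (J x0) R \<and> (y has_vector_derivative J (F (P (y t)))) (at t))"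
    by blast
  define \<rho> where "\<rho> = R / (2 * j)"
  have \<rho>: "\<rho> > 0" using R j by (simp add: \<rho>_def)
  show ?thesis
  proof (rule that[OF \<tau> \<rho>])
    fix x assume x: "x \<in> ball x0 \<rho>"
    have "norm (J x - J x0) \<le> norm (x - x0) * j"
      using j(2)[of "x - x0"] by (simp add: linear_diff[OF bounded_linear.linear[OF J]])
    also have "\<dots> < \<rho> * j" using x j by (intro mult_strict_right_mono) (auto simp: dist_norm norm_minus_commute)
    also have "\<dots> = R / 2" using j by (simp add: \<rho>_def)
    finally have "J x \<in> ball (J x0) (R / 2)" by (simp add: dist_norm norm_minus_commute)
    from ex[OF this] obtain y where y: "y 0 = J x"
      "\<And>t. \<bar>t\<bar> < \<tau> \<Longrightarrow> y t \<in> cball (J x0) R \<and> (y has_vector_derivative J (F (P (y t)))) (at t)" by blast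
    show "\<exists>y. y 0 = x \<and> (\<forall>t. \<bar>t\<bar> < \<tau> \<longrightarrow> y t \<in> ball x0 r \<and> (y has_vector_derivative F (y t)) (at t))"
    proof (intro exI[of _ "\<lambda>t. P (y t)"] conjI allI impI)
      show "P (y 0) = x" by (simp add: y(1) PJ)
      fix t :: real assume t: "\<bar>t\<bar> < \<tau>"
      show "P (y t) \<in> ball x0 r" using y(2)[OF t] inb by blast
      have "((\<lambda>t. P (y t)) has_vector_derivative P (J (F (P (y t))))) (at t)"
        using y(2)[OF t] by (intro bounded_linear.has_vector_derivative[OF P]) auto
      then show "((\<lambda>t. P (y t)) has_vector_derivative F (P (y t))) (at t)" by (simp add: PJ)
    qed
  qed
qed

text \<open>The derivative of \<open>w = y - x - z\<close> is \<open>F' x w\<close> plus the Taylor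
  remainder of \<open>F\<close>. A first use of \<open>gronwall_norm\<close> bounds
  \<open>y - x\<close> by the initial difference, so the remainder is at most the constant
  \<open>R\<close>, quadratic in that difference; a second use, with \<open>w\<close> zero at time
  0, gives the claim.\<close>

lemma flow_variation_bound:
  fixes F :: "'b::real_inner \<Rightarrow> 'b"
  assumes F: "\<And>a b. a \<in> S \<Longrightarrow> b \<in> S \<Longrightarrow> norm (F a - F b) \<le> L * norm (a - b)"
    and F': "\<And>a w. a \<in> S \<Longrightarrow> norm (F' a w) \<le> L * norm w" "\<And>a. a \<in> S \<Longrightarrow> linear (F' a)"
    and T: "\<And>a b. a \<in> S \<Longrightarrow> b \<in> S \<Longrightarrow> norm (F b - F a - F' a (b - a)) \<le> C * (norm (b - a))\<^sup>2"
    and L: "L \<ge> 0" and C: "C \<ge> 0"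
    and y: "\<And>t. \<bar>t\<bar> < \<tau> \<Longrightarrow> y t \<in> S \<and> (y has_vector_derivative F (y t)) (at t)"
    and x: "\<And>t. \<bar>t\<bar> < \<tau> \<Longrightarrow> x t \<in> S \<and> (x has_vector_derivative F (x t)) (at t)"
    and z: "\<And>t. \<bar>t\<bar> < \<tau> \<Longrightarrow> (z has_vector_derivative F' (x t) (z t)) (at t)"
    and i: "y 0 - x 0 = z 0" and t: "\<bar>t\<bar> < \<tau>"
  shows "norm (y t - x t - z t) \<le> C * (exp ((2 * L + 1) * \<tau>))\<^sup>2 * (norm (z 0))\<^sup>2"
proof -
  define E where "E = exp ((2 * L + 1) * \<tau>)"
  have E: "E \<ge> 1" using t L by (simp add: E_def)
  have Ee: "exp ((2 * L + 1) * \<bar>t\<bar>) \<le> E" if "\<bar>t\<bar> < \<tau>" for t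
    using that L by (simp add: E_def mult_left_mono)
  have 1: "(norm (y t - x t))\<^sup>2 \<le> (norm (z 0))\<^sup>2 * E" if t: "\<bar>t\<bar> < \<tau>" for t
  proof -
    have "(norm (y t - x t))\<^sup>2 \<le> ((norm (y 0 - x 0))\<^sup>2 + 0\<^sup>2) * exp ((2 * L + 1) * \<bar>t\<bar>)"
      by (rule gronwall_norm[of \<tau> "\<lambda>t. y t - x t" "\<lambda>t. F (y t) - F (x t)" L 0])
        (use x y F L t in \<open>auto intro!: has_vector_derivative_diff\<close>)
    also have "\<dots> \<le> (norm (z 0))\<^sup>2 * E" using Ee[OF t] by (simp add: i mult_left_mono)
    finally show ?thesis .
  qed
  define R where "R = C * ((norm (z 0))\<^sup>2 * E)"
  have R: "R \<ge> 0" using C E by (simp add: R_def)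
  have "(norm (y t - x t - z t))\<^sup>2 \<le> ((norm (y 0 - x 0 - z 0))\<^sup>2 + R\<^sup>2) * exp ((2 * L + 1) * \<bar>t\<bar>)"
  proof (rule gronwall_norm[of \<tau> _ "\<lambda>t. F (y t) - F (x t) - F' (x t) (z t)" L R])
    fix s assume s: "\<bar>s\<bar> < \<tau>"
    show "((\<lambda>t. y t - x t - z t) has_vector_derivative F (y s) - F (x s) - F' (x s) (z s)) (at s)"
      using x[OF s] y[OF s] z[OF s] by (intro has_vector_derivative_diff) auto
    have "F (y s) - F (x s) - F' (x s) (z s) =
       F' (x s) (y s - x s - z s) + (F (y s) - F (x s) - F' (x s) (y s - x s))"
      using F'(2) x[OF s] by (simp add: linear_diff)
    then have "norm (F (y s) - F (x s) - F' (x s) (z s)) \<le>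
       norm (F' (x s) (y s - x s - z s)) + norm (F (y s) - F (x s) - F' (x s) (y s - x s))"
      using norm_triangle_ineq by metis
    also have "\<dots> \<le> L * norm (y s - x s - z s) + C * (norm (y s - x s))\<^sup>2"
      using F'(1) T x[OF s] y[OF s] by (intro add_mono) auto
    also have "\<dots> \<le> L * norm (y s - x s - z s) + R"
      using 1[OF s] C by (simp add: R_def mult_left_mono)
    finally show "norm (F (y s) - F (x s) - F' (x s) (z s)) \<le> L * norm (y s - x s - z s) + R" .
  qed (use L R t in auto)
  also have "\<dots> = R\<^sup>2 * exp ((2 * L + 1) * \<bar>t\<bar>)" by (simp add: i)
  also have "\<dots> \<le> R\<^sup>2 * E\<^sup>2"
    using Ee[OF t] E by (intro mult_left_mono) (auto intro: order.trans simp: power2_eq_square)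
  finally have "(norm (y t - x t - z t))\<^sup>2 \<le> (R * E)\<^sup>2" by (simp add: power_mult_distrib)
  then have "norm (y t - x t - z t) \<le> R * E" by (rule power2_le_imp_le) (use R E in auto)
  then show ?thesis by (simp add: R_def E_def power2_eq_square mult_ac)
qed

section \<open>Functions and vector fields on a manifold\<close>

text \<open>The working form of \<open>smooth_manifold\<close>: a fixed orthonormal basis
  \<open>B\<close> of the model space stands for its dimension, so that coordinates and frames can
  be written as sums over \<open>B\<close>.\<close>

locale mfld =
  fixes M :: "('a, 'e::real_inner) manifold" and B :: "'e set"
  assumes onb: "orthobasis B" and haus: "Hausdorff_space (mtop M)"
    and cover: "(\<Union>(U, \<phi>) \<in> atlas M. U) = pts M"
    and chart_open: "(U, \<phi>) \<in> atlas M \<Longrightarrow> openin (mtop M) U"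
    and chart_open_image: "(U, \<phi>) \<in> atlas M \<Longrightarrow> open (\<phi> ` U)"
    and chart_homeo: "(U, \<phi>) \<in> atlas M \<Longrightarrow> homeomorphic_map (subtopology (mtop M) U) (top_of_set (\<phi> ` U)) \<phi>"
    and transition: "(U, \<phi>) \<in> atlas M \<Longrightarrow> (V, \<psi>) \<in> atlas M \<Longrightarrow>
      smooth_on (\<phi> ` (U \<inter> V)) (\<psi> \<circ> inv_into U \<phi>)"

lemma smooth_manifold_mfld:
  assumes "smooth_manifold n (M :: ('a, 'e::real_inner) manifold)"
  obtains B where "mfld M B"
proof -
  obtain A :: "'e set" where A: "finite A" "span A = UNIV" using assms by (auto simp: smooth_manifold_def)
  obtain B :: "'e set" where "orthobasis B" using orthobasis_exists[OF A] by blast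
  then have "mfld M B" using assms unfolding smooth_manifold_def mfld_def by fastforce
  then show ?thesis by (rule that)
qed

context mfld
begin

lemma chart_sub: "(U, \<phi>) \<in> atlas M \<Longrightarrow> U \<subseteq> pts M"
  using chart_open openin_subset by blast

lemma chart_exists: "p \<in> pts M \<Longrightarrow> \<exists>U \<phi>. (U, \<phi>) \<in> atlas M \<and> p \<in> U"
  using cover by blast

lemma chart_inj: "(U, \<phi>) \<in> atlas M \<Longrightarrow> inj_on \<phi> U"
  using homeomorphic_imp_injective_map[OF chart_homeo] chart_sub by (fastforce simp: inf_absorb2)

lemma chart_inv [simp]: "(U, \<phi>) \<in> atlas M \<Longrightarrow> p \<in> U \<Longrightarrow> inv_into U \<phi> (\<phi> p) = p"
  by (rule inv_into_f_f[OF chart_inj])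

lemma chart_image_open:
  assumes c: "(U, \<phi>) \<in> atlas M" and W: "openin (mtop M) W" "W \<subseteq> U"
  shows "open (\<phi> ` W)"
proof -
  have "openin (subtopology (mtop M) U) W" using W by (auto simp: openin_open_subtopology[OF chart_open[OF c]])
  then have "openin (top_of_set (\<phi> ` U)) (\<phi> ` W)"
    using homeomorphic_imp_open_map[OF chart_homeo[OF c]] by (simp add: open_map_def)
  then show ?thesis using chart_open_image[OF c] openin_open_trans by blast
qed

lemma chart_preimage_open:
  assumes c: "(U, \<phi>) \<in> atlas M" and N: "open N"
  shows "openin (mtop M) {p \<in> U. \<phi> p \<in> N}"
proof -
  have "continuous_map (subtopology (mtop M) U) euclidean \<phi>"
    using homeomorphic_imp_continuous_map[OF chart_homeo[OF c]] by (simp add: continuous_map_in_subtopology)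
  from openin_continuous_map_preimage[OF this, of N] N
  have "openin (subtopology (mtop M) U) {p \<in> U. \<phi> p \<in> N}"
    using chart_sub[OF c] by (simp add: inf_absorb2)
  then show ?thesis by (simp add: openin_open_subtopology[OF chart_open[OF c]])
qed

definition sfun :: "('a \<Rightarrow> 'b::real_normed_vector) \<Rightarrow> 'a \<Rightarrow> bool" where
  "sfun f p \<longleftrightarrow> (\<exists>U \<phi>. (U, \<phi>) \<in> atlas M \<and> p \<in> U \<and> smooth_at (f \<circ> inv_into U \<phi>) (\<phi> p))"

lemma transition_smooth_at:
  assumes "(U, \<phi>) \<in> atlas M" "(V, \<psi>) \<in> atlas M" "p \<in> U" "p \<in> V"
  shows "smooth_at (\<psi> \<circ> inv_into U \<phi>) (\<phi> p)"
proof -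
  have "open (\<phi> ` (U \<inter> V))" using assms chart_open by (intro chart_image_open) auto
  then show ?thesis using transition[OF assms(1,2)] assms unfolding smooth_at_def by blast
qed

text \<open>One chart decides for all: a change of chart composes with the smooth transition
  map.\<close>

lemma sfun_chart:
  assumes c: "(U, \<phi>) \<in> atlas M" "p \<in> U"
  shows "sfun f p \<longleftrightarrow> smooth_at (f \<circ> inv_into U \<phi>) (\<phi> p)"
proof
  assume "sfun f p"
  then obtain V \<psi> where d: "(V, \<psi>) \<in> atlas M" "p \<in> V" "smooth_at (f \<circ> inv_into V \<psi>) (\<psi> p)"
    by (auto simp: sfun_def)
  have "smooth_at (\<lambda>x. (f \<circ> inv_into V \<psi>) ((\<psi> \<circ> inv_into U \<phi>) x)) (\<phi> p)"
    by (rule smooth_at_compose[OF onb transition_smooth_at[OF c(1) d(1) c(2) d(2)]]) (use c d in \<open>simp add: o_def\<close>)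
  then show "smooth_at (f \<circ> inv_into U \<phi>) (\<phi> p)"
  proof (rule smooth_at_cong[rotated 3])
    show "open (\<phi> ` (U \<inter> V))" using c d chart_open by (intro chart_image_open) auto
    show "\<phi> p \<in> \<phi> ` (U \<inter> V)" using c d by auto
    show "(f \<circ> inv_into V \<psi>) ((\<psi> \<circ> inv_into U \<phi>) y) = (f \<circ> inv_into U \<phi>) y" if "y \<in> \<phi> ` (U \<inter> V)" for y
      using that c d by auto
  qed
qed (use c in \<open>auto simp: sfun_def\<close>)

lemma smooth_funs_iff: "f \<in> smooth_funs M \<longleftrightarrow> f \<in> extensional (pts M) \<and> (\<forall>p\<in>pts M. sfun f p)"
proof -
  have "(\<forall>(U, \<phi>)\<in>atlas M. smooth_on (\<phi> ` U) (f \<circ> inv_into U \<phi>)) \<longleftrightarrow> (\<forall>p\<in>pts M. sfun f p)"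
  proof
    assume *: "\<forall>(U, \<phi>)\<in>atlas M. smooth_on (\<phi> ` U) (f \<circ> inv_into U \<phi>)"
    show "\<forall>p\<in>pts M. sfun f p"
    proof
      fix p assume "p \<in> pts M"
      then obtain U \<phi> where c: "(U, \<phi>) \<in> atlas M" "p \<in> U" using chart_exists by blast
      then have "smooth_on (\<phi> ` U) (f \<circ> inv_into U \<phi>)" using * by blast
      then show "sfun f p" unfolding sfun_chart[OF c] smooth_at_def
        using c chart_open_image by blast
    qed
  next
    assume *: "\<forall>p\<in>pts M. sfun f p"
    have "smooth_on (\<phi> ` U) (f \<circ> inv_into U \<phi>)" if c: "(U, \<phi>) \<in> atlas M" for U \<phi>
      unfolding smooth_on_iff[OF chart_open_image[OF c]]
      using * sfun_chart[OF c] chart_sub[OF c] by blast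
    then show "\<forall>(U, \<phi>)\<in>atlas M. smooth_on (\<phi> ` U) (f \<circ> inv_into U \<phi>)" by blast
  qed
  then show ?thesis by (auto simp: smooth_funs_def)
qed

lemma smooth_funs_sfun: "f \<in> smooth_funs M \<Longrightarrow> p \<in> pts M \<Longrightarrow> sfun f p"
  by (simp add: smooth_funs_iff)

lemma smooth_funs_smooth_at:
  "f \<in> smooth_funs M \<Longrightarrow> (U, \<phi>) \<in> atlas M \<Longrightarrow> p \<in> U \<Longrightarrow> smooth_at (f \<circ> inv_into U \<phi>) (\<phi> p)"
  using sfun_chart smooth_funs_sfun chart_sub by blast

lemma sfun_cong:
  assumes W: "openin (mtop M) W" "p \<in> W" "\<And>q. q \<in> W \<Longrightarrow> f q = g q" and f: "sfun f p"
  shows "sfun g p"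
proof -
  have "p \<in> pts M" using W openin_subset by blast
  then obtain U \<phi> where c: "(U, \<phi>) \<in> atlas M" "p \<in> U" using chart_exists by blast
  have "smooth_at (f \<circ> inv_into U \<phi>) (\<phi> p)" using f by (simp only: sfun_chart[OF c])
  then have "smooth_at (g \<circ> inv_into U \<phi>) (\<phi> p)"
  proof (rule smooth_at_cong[rotated 3])
    show "open (\<phi> ` (U \<inter> W))" using c W chart_open by (intro chart_image_open) auto
    show "\<phi> p \<in> \<phi> ` (U \<inter> W)" using c W by auto
    show "(f \<circ> inv_into U \<phi>) y = (g \<circ> inv_into U \<phi>) y" if "y \<in> \<phi> ` (U \<inter> W)" for y
      using that c W by auto
  qed
  then show ?thesis by (simp only: sfun_chart[OF c])
qed

lemma sfun_coord:
  assumes c: "(U, \<phi>) \<in> atlas M" "p \<in> U" and u: "smooth_at u (\<phi> p)"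
  shows "sfun (\<lambda>q. u (\<phi> q)) p"
proof -
  have "smooth_at ((\<lambda>q. u (\<phi> q)) \<circ> inv_into U \<phi>) (\<phi> p)"
    by (rule smooth_at_cong[OF chart_open_image[OF c(1)] _ _ u]) (use c in auto)
  then show ?thesis by (simp only: sfun_chart[OF c])
qed

lemma sfun_const: "p \<in> pts M \<Longrightarrow> sfun (\<lambda>q. c) p"
  using chart_exists sfun_coord[of _ _ p "\<lambda>_. c"] by fastforce

lemma sfun_bin:
  assumes f: "sfun f p" and g: "sfun g p"
    and h: "\<And>F G x. smooth_at F x \<Longrightarrow> smooth_at G x \<Longrightarrow> smooth_at (\<lambda>x::'e. h (F x) (G x)) x"
  shows "sfun (\<lambda>q. h (f q) (g q)) p"
proof -
  obtain U \<phi> where c: "(U, \<phi>) \<in> atlas M" "p \<in> U" "smooth_at (f \<circ> inv_into U \<phi>) (\<phi> p)"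
    using f by (auto simp: sfun_def)
  then have "smooth_at (g \<circ> inv_into U \<phi>) (\<phi> p)" using g sfun_chart by blast
  then have "smooth_at (\<lambda>x. h ((f \<circ> inv_into U \<phi>) x) ((g \<circ> inv_into U \<phi>) x)) (\<phi> p)"
    by (rule h[OF c(3)])
  then show ?thesis using c by (auto simp: sfun_def o_def)
qed

lemma sfun_add: "sfun f p \<Longrightarrow> sfun g p \<Longrightarrow> sfun (\<lambda>q. f q + g q) p"
  by (rule sfun_bin[of f p g]) (auto intro: smooth_at_add)

lemma sfun_diff: "sfun f p \<Longrightarrow> sfun g p \<Longrightarrow> sfun (\<lambda>q. f q - g q) p"
  by (rule sfun_bin[of f p g]) (auto intro: smooth_at_diff)

lemma sfun_mult: "sfun f p \<Longrightarrow> sfun g p \<Longrightarrow> sfun (\<lambda>q. f q * g q :: real) p"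
  by (rule sfun_bin[of f p g]) (auto intro: smooth_at_mult)

lemma smooth_funs_restrict:
  assumes "\<And>p. p \<in> pts M \<Longrightarrow> sfun f p"
  shows "(\<lambda>p\<in>pts M. f p) \<in> smooth_funs M"
  unfolding smooth_funs_iff
proof (intro conjI ballI)
  fix p assume p: "p \<in> pts M"
  show "sfun (\<lambda>p\<in>pts M. f p) p" by (rule sfun_cong[OF openin_topspace p _ assms[OF p]]) auto
qed auto

text \<open>A bump function in a chart, extended by zero. \<open>K\<close> is the preimage of a
  closed ball; it is compact, hence closed in the Hausdorff space \<open>M\<close>, and this makes
  the extension smooth at points outside the chart as well.\<close>

lemma cutoff:
  assumes W: "openin (mtop M) W" "p \<in> W"
  obtains \<rho> K N where "\<rho> \<in> smooth_funs M" "closedin (mtop M) K" "K \<subseteq> W"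
    "\<And>q. q \<in> pts M - K \<Longrightarrow> \<rho> q = 0" "openin (mtop M) N" "p \<in> N" "N \<subseteq> K" "\<And>q. q \<in> N \<Longrightarrow> \<rho> q = 1"
proof -
  have p: "p \<in> pts M" using W openin_subset by blast
  obtain U \<phi> where c: "(U, \<phi>) \<in> atlas M" "p \<in> U" using chart_exists[OF p] by blast
  have "open (\<phi> ` (U \<inter> W))" using c W chart_open by (intro chart_image_open) auto
  then obtain r where r: "r > 0" "cball (\<phi> p) r \<subseteq> \<phi> ` (U \<inter> W)"
    using c W open_contains_cball by blast
  obtain \<beta> :: "'e \<Rightarrow> real" where \<beta>: "\<And>x. smooth_at \<beta> x" "\<And>x. dist (\<phi> p) x \<le> r / 2 \<Longrightarrow> \<beta> x = 1"
    "\<And>x. dist (\<phi> p) x \<ge> r \<Longrightarrow> \<beta> x = 0" using bump_exists[OF r(1)] by blast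
  define K where "K = {q \<in> U. \<phi> q \<in> cball (\<phi> p) r}"
  have KW: "K \<subseteq> W"
  proof
    fix q assume q: "q \<in> K"
    then have "\<phi> q \<in> \<phi> ` (U \<inter> W)" using r by (auto simp: K_def)
    then show "q \<in> W" using q chart_inj[OF c(1)] by (auto simp: K_def inj_on_def)
  qed
  have KI: "\<phi> ` K = cball (\<phi> p) r" using r by (auto simp: K_def)
  have "compactin (subtopology (mtop M) U) K"
  proof (rule homeomorphic_map_compactness[OF chart_homeo[OF c(1)], THEN iffD1])
    show "K \<subseteq> topspace (subtopology (mtop M) U)" using chart_sub[OF c(1)] by (auto simp: K_def)
    show "compactin (top_of_set (\<phi> ` U)) (\<phi> ` K)"
      using compact_cball_orthobasis[OF onb, of "\<phi> p" r] r(2) unfolding KI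
      by (auto simp: compactin_subtopology)
  qed
  then have Kc: "closedin (mtop M) K"
    by (auto simp: compactin_subtopology intro: compactin_imp_closedin[OF haus])
  define \<rho> where "\<rho> = (\<lambda>q\<in>pts M. if q \<in> U then \<beta> (\<phi> q) else 0)"
  define N where "N = {q \<in> U. \<phi> q \<in> ball (\<phi> p) (r / 2)}"
  have "\<rho> \<in> smooth_funs M" unfolding \<rho>_def
  proof (rule smooth_funs_restrict)
    fix q assume q: "q \<in> pts M"
    show "sfun (\<lambda>q. if q \<in> U then \<beta> (\<phi> q) else 0) q"
    proof (cases "q \<in> U")
      case True
      show ?thesis by (rule sfun_cong[OF chart_open[OF c(1)] True _ sfun_coord[OF c(1) True \<beta>(1)]]) auto
    next
      case False
      have o: "openin (mtop M) (pts M - K)" using Kc by blast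
      have qk: "q \<in> pts M - K" using q False by (auto simp: K_def)
      have e: "0 = (if y \<in> U then \<beta> (\<phi> y) else 0)" if "y \<in> pts M - K" for y
        using that \<beta>(3)[of "\<phi> y"] by (auto simp: K_def)
      show ?thesis by (rule sfun_cong[OF o qk e sfun_const[OF q]])
    qed
  qed
  moreover have "\<rho> q = 0" if "q \<in> pts M - K" for q
    using that \<beta>(3)[of "\<phi> q"] by (auto simp: K_def \<rho>_def)
  moreover have "openin (mtop M) N" unfolding N_def by (intro chart_preimage_open c) auto
  moreover have "p \<in> N" using c r by (auto simp: N_def)
  moreover have "N \<subseteq> K" using r by (auto simp: K_def N_def)
  moreover have "\<rho> q = 1" if "q \<in> N" for q
    using that \<beta>(2)[of "\<phi> q"] chart_sub[OF c(1)] by (auto simp: \<rho>_def N_def)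
  ultimately show ?thesis by (intro that[OF _ Kc KW, of \<rho> N])
qed

text \<open>\<open>W\<close> and the complement of \<open>K\<close> are open and cover
  \<open>M\<close>; on the second of them the function is zero.\<close>

lemma zero_extension:
  assumes W: "openin (mtop M) W" and \<rho>: "\<rho> \<in> smooth_funs M" and K: "closedin (mtop M) K" "K \<subseteq> W"
    and z: "\<And>q. q \<in> pts M - K \<Longrightarrow> \<rho> q = 0" and g: "\<And>q. q \<in> W \<Longrightarrow> sfun g q"
  shows "(\<lambda>q\<in>pts M. if q \<in> W then \<rho> q * g q else 0) \<in> smooth_funs M"
proof (rule smooth_funs_restrict)
  fix q assume q: "q \<in> pts M"
  show "sfun (\<lambda>q. if q \<in> W then \<rho> q * g q else 0) q"
  proof (cases "q \<in> W")
    case True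
    show ?thesis
      by (rule sfun_cong[OF W True _ sfun_mult[OF smooth_funs_sfun[OF \<rho> q] g[OF True]]]) auto
  next
    case False
    have o: "openin (mtop M) (pts M - K)" using K by blast
    have qk: "q \<in> pts M - K" using q False K by auto
    have e: "0 = (if y \<in> W then \<rho> y * g y else 0)" if "y \<in> pts M - K" for y
      using that z[of y] by auto
    show ?thesis by (rule sfun_cong[OF o qk e sfun_const[OF q]])
  qed
qed

text \<open>Vector fields act on global functions only, so every smooth germ has to be realised by a
  global smooth function. A cutoff factor does this.\<close>

lemma extend_fun:
  fixes g :: "'a \<Rightarrow> real"
  assumes W: "openin (mtop M) W" "p \<in> W" and g: "\<And>q. q \<in> W \<Longrightarrow> sfun g q"
  obtains f N where "f \<in> smooth_funs M" "openin (mtop M) N" "p \<in> N" "N \<subseteq> W" "\<And>q. q \<in> N \<Longrightarrow> f q = g q"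
proof -
  obtain \<rho> K N where r: "\<rho> \<in> smooth_funs M" "closedin (mtop M) K" "K \<subseteq> W"
    "\<And>q. q \<in> pts M - K \<Longrightarrow> \<rho> q = 0" "openin (mtop M) N" "p \<in> N" "N \<subseteq> K" "\<And>q. q \<in> N \<Longrightarrow> \<rho> q = 1"
    using cutoff[OF W] by blast
  have N: "N \<subseteq> pts M" using r openin_subset by blast
  show ?thesis
    by (rule that[OF zero_extension[OF W(1) r(1-4) g] r(5,6)]) (use r N in auto)
qed

section \<open>Derivations and their locality\<close>

definition cst :: "real \<Rightarrow> 'a \<Rightarrow> real" where "cst c = (\<lambda>p\<in>pts M. c)"

lemma cst_smooth [simp]: "cst c \<in> smooth_funs M"
  unfolding cst_def by (rule smooth_funs_restrict) (rule sfun_const)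

lemma smooth_funs_ext: "f \<in> smooth_funs M \<Longrightarrow> (\<lambda>p\<in>pts M. f p) = f"
  by (simp add: smooth_funs_iff extensional_restrict)

lemma smooth_funs_eqI: "f \<in> smooth_funs M \<Longrightarrow> g \<in> smooth_funs M \<Longrightarrow> (\<And>p. p \<in> pts M \<Longrightarrow> f p = g p) \<Longrightarrow> f = g"
  by (metis smooth_funs_iff extensionalityI)

lemma smooth_funs_add [simp]: "f \<in> smooth_funs M \<Longrightarrow> g \<in> smooth_funs M \<Longrightarrow> (\<lambda>p\<in>pts M. f p + g p) \<in> smooth_funs M"
  by (intro smooth_funs_restrict sfun_add smooth_funs_sfun)

lemma smooth_funs_diff [simp]: "f \<in> smooth_funs M \<Longrightarrow> g \<in> smooth_funs M \<Longrightarrow> (\<lambda>p\<in>pts M. f p - g p) \<in> smooth_funs M"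
  by (intro smooth_funs_restrict sfun_diff smooth_funs_sfun)

lemma smooth_funs_mult [simp]: "f \<in> smooth_funs M \<Longrightarrow> g \<in> smooth_funs M \<Longrightarrow> (\<lambda>p\<in>pts M. f p * g p) \<in> smooth_funs M"
  by (intro smooth_funs_restrict sfun_mult smooth_funs_sfun)

lemma smooth_funs_lin [simp]: "f \<in> smooth_funs M \<Longrightarrow> g \<in> smooth_funs M \<Longrightarrow> (\<lambda>p\<in>pts M. a * f p + g p) \<in> smooth_funs M"
  by (intro smooth_funs_restrict sfun_add sfun_mult sfun_const smooth_funs_sfun)

lemma vf_smooth [simp]: "X \<in> vfields M \<Longrightarrow> f \<in> smooth_funs M \<Longrightarrow> X f \<in> smooth_funs M"
  by (auto simp: vfields_def)

lemma vf_lin: "X \<in> vfields M \<Longrightarrow> f \<in> smooth_funs M \<Longrightarrow> g \<in> smooth_funs M \<Longrightarrow> p \<in> pts M \<Longrightarrow>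
  X (\<lambda>p\<in>pts M. a * f p + g p) p = a * X f p + X g p"
  by (simp add: vfields_def)

lemma vf_mult: "X \<in> vfields M \<Longrightarrow> f \<in> smooth_funs M \<Longrightarrow> g \<in> smooth_funs M \<Longrightarrow> p \<in> pts M \<Longrightarrow>
  X (\<lambda>p\<in>pts M. f p * g p) p = X f p * g p + f p * X g p"
  by (simp add: vfields_def)

lemma vf_add_fun: "X \<in> vfields M \<Longrightarrow> f \<in> smooth_funs M \<Longrightarrow> g \<in> smooth_funs M \<Longrightarrow> p \<in> pts M \<Longrightarrow>
  X (\<lambda>p\<in>pts M. f p + g p) p = X f p + X g p"
  using vf_lin[of X f g p 1] by simp

lemma vf_diff_fun: "X \<in> vfields M \<Longrightarrow> f \<in> smooth_funs M \<Longrightarrow> g \<in> smooth_funs M \<Longrightarrow> p \<in> pts M \<Longrightarrow>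
  X (\<lambda>p\<in>pts M. f p - g p) p = X f p - X g p"
  using vf_lin[of X g f p "-1"] by simp

lemma vf_cst:
  assumes X: "X \<in> vfields M" and p: "p \<in> pts M"
  shows "X (cst c) p = 0"
proof -
  have "(\<lambda>p\<in>pts M. cst 1 p * cst 1 p) = cst 1" by (auto simp: cst_def fun_eq_iff)
  then have 1: "X (cst 1) p = 0" using vf_mult[OF X cst_smooth cst_smooth p, of 1 1] p by (simp add: cst_def)
  have "(\<lambda>p\<in>pts M. cst 0 p + cst 0 p) = cst 0" by (auto simp: cst_def fun_eq_iff)
  then have 0: "X (cst 0) p = 0" using vf_add_fun[OF X cst_smooth cst_smooth p, of 0 0] by simp
  have "(\<lambda>p\<in>pts M. c * cst 1 p + cst 0 p) = cst c" by (auto simp: cst_def fun_eq_iff)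
  then show ?thesis using vf_lin[OF X cst_smooth cst_smooth p, of c 1 0] 0 1 by simp
qed

lemma vf_sum_fun:
  assumes X: "X \<in> vfields M" and p: "p \<in> pts M" and f: "\<And>i. i \<in> I \<Longrightarrow> f i \<in> smooth_funs M"
  shows "(\<lambda>p\<in>pts M. \<Sum>i\<in>I. f i p) \<in> smooth_funs M \<and> X (\<lambda>p\<in>pts M. \<Sum>i\<in>I. f i p) p = (\<Sum>i\<in>I. X (f i) p)"
  using f
proof (induction I rule: infinite_finite_induct)
  case (insert i I)
  let ?g = "\<lambda>p\<in>pts M. \<Sum>i\<in>I. f i p"
  have g: "?g \<in> smooth_funs M" "X ?g p = (\<Sum>i\<in>I. X (f i) p)" using insert.IH insert.prems by blast+
  have fi: "f i \<in> smooth_funs M" using insert.prems by blast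
  have eq: "(\<lambda>p\<in>pts M. \<Sum>i\<in>insert i I. f i p) = (\<lambda>p\<in>pts M. f i p + ?g p)"
    using insert by (auto simp: fun_eq_iff)
  show ?case
    unfolding eq vf_add_fun[OF X fi g(1) p] g(2)
    using smooth_funs_add[OF fi g(1)] insert.hyps by (auto simp del: restrict_apply)
qed (use vf_cst[OF X p, of 0] cst_smooth[of 0, unfolded cst_def] in \<open>simp_all add: cst_def\<close>)

text \<open>Derivations are local: for a cutoff \<open>\<rho>\<close> supported in \<open>W\<close>
  the product of \<open>\<rho>\<close> and \<open>f - g\<close> is zero, and the Leibniz rule at
  \<open>p\<close>, where \<open>\<rho> p = 1\<close> and \<open>f p = g p\<close>, leaves the
  derivative of \<open>f - g\<close>.\<close>

lemma vf_local:
  assumes X: "X \<in> vfields M" and f: "f \<in> smooth_funs M" and g: "g \<in> smooth_funs M"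
    and W: "openin (mtop M) W" "p \<in> W" "\<And>q. q \<in> W \<Longrightarrow> f q = g q"
  shows "X f p = X g p"
proof -
  have p: "p \<in> pts M" using W openin_subset by blast
  obtain \<rho> K N where r: "\<rho> \<in> smooth_funs M" "closedin (mtop M) K" "K \<subseteq> W"
    "\<And>q. q \<in> pts M - K \<Longrightarrow> \<rho> q = 0" "openin (mtop M) N" "p \<in> N" "N \<subseteq> K" "\<And>q. q \<in> N \<Longrightarrow> \<rho> q = 1"
    using cutoff[OF W(1,2)] by blast
  let ?h = "\<lambda>p\<in>pts M. f p - g p"
  have h: "?h \<in> smooth_funs M" using f g by simp
  have "(\<lambda>p\<in>pts M. \<rho> p * ?h p) = cst 0"
    using r(3,4) W(3) by (fastforce simp: cst_def fun_eq_iff)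
  then have "X (\<lambda>p\<in>pts M. \<rho> p * ?h p) p = 0" using vf_cst[OF X p] by simp
  then have "X \<rho> p * ?h p + \<rho> p * X ?h p = 0" using vf_mult[OF X r(1) h p] by simp
  then have "X ?h p = 0" using W p r(6,8) by simp
  then show ?thesis using vf_diff_fun[OF X f g p] by simp
qed

lemma vf_eqI:
  assumes "X \<in> vfields M" "Y \<in> vfields M" "\<And>f p. f \<in> smooth_funs M \<Longrightarrow> p \<in> pts M \<Longrightarrow> X f p = Y f p"
  shows "X = Y"
proof (rule extensionalityI[of _ "smooth_funs M"])
  show "X f = Y f" if "f \<in> smooth_funs M" for f
    using assms that by (intro smooth_funs_eqI) auto
qed (use assms(1,2) in \<open>simp_all only: vfields_def mem_Collect_eq PiE_iff\<close>)

lemma vfieldsI: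
  assumes "\<And>f. f \<in> smooth_funs M \<Longrightarrow> X f \<in> smooth_funs M" "X \<in> extensional (smooth_funs M)"
    and "\<And>f g a p. f \<in> smooth_funs M \<Longrightarrow> g \<in> smooth_funs M \<Longrightarrow> p \<in> pts M \<Longrightarrow>
      X (\<lambda>p\<in>pts M. a * f p + g p) p = a * X f p + X g p"
    and "\<And>f g p. f \<in> smooth_funs M \<Longrightarrow> g \<in> smooth_funs M \<Longrightarrow> p \<in> pts M \<Longrightarrow>
      X (\<lambda>p\<in>pts M. f p * g p) p = X f p * g p + f p * X g p"
  shows "X \<in> vfields M"
proof -
  have "X (\<lambda>p\<in>pts M. a * f p + g p) = (\<lambda>p\<in>pts M. a * X f p + X g p)"
    if "f \<in> smooth_funs M" "g \<in> smooth_funs M" for f g a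
    using assms that by (intro smooth_funs_eqI) auto
  moreover have "X (\<lambda>p\<in>pts M. f p * g p) = (\<lambda>p\<in>pts M. X f p * g p + f p * X g p)"
    if "f \<in> smooth_funs M" "g \<in> smooth_funs M" for f g
  proof (rule smooth_funs_eqI)
    show "(\<lambda>p\<in>pts M. X f p * g p + f p * X g p) \<in> smooth_funs M"
      using assms(1) that by (intro smooth_funs_restrict sfun_add sfun_mult smooth_funs_sfun) auto
  qed (use assms that in auto)
  ultimately show ?thesis using assms(1,2) unfolding vfields_def PiE_def by auto
qed

end

section \<open>Coordinates of vector fields in charts\<close>

lemma smooth_at_cong_ev:
  assumes "\<forall>\<^sub>F y in nhds x. f y = g y" "smooth_at f x"
  shows "smooth_at g x"
proof -
  obtain N where "open N" "x \<in> N" "\<And>y. y \<in> N \<Longrightarrow> f y = g y" using assms(1) unfolding eventually_nhds by blast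
  from smooth_at_cong[OF this assms(2)] show ?thesis .
qed

lemma fd_cong_ev: "\<forall>\<^sub>F y in nhds x. f y = g y \<Longrightarrow> fd f x = fd g x"
  unfolding eventually_nhds by (blast intro: fd_cong_open)

lemma hadamard_exists:
  fixes f :: "'e::real_inner \<Rightarrow> real" and B :: "'e set"
  assumes "orthobasis B" "smooth_at f x0"
  shows "\<exists>h N. open N \<and> x0 \<in> N \<and> (\<forall>b. smooth_at (h b) x0 \<and> h b x0 = fd f x0 b) \<and>
    (\<forall>x\<in>N. f x = f x0 + (\<Sum>b\<in>B. ((x - x0) \<bullet> b) * h b x))"
proof (rule hadamard[OF assms])
  fix h N assume a: "open N" "x0 \<in> N" "\<And>b. smooth_at (h b) x0" "\<And>b. h b x0 = fd f x0 b"
    "\<And>x. x \<in> N \<Longrightarrow> f x = f x0 + (\<Sum>b\<in>B. ((x - x0) \<bullet> b) * h b x)"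
  show ?thesis
    by (rule exI[of _ h], rule exI[of _ N], intro conjI allI ballI a(1,2) a(3) a(4), erule a(5))
qed

context mfld
begin

abbreviation near :: "'a \<Rightarrow> 'a filter" where "near p \<equiv> nhdsin (mtop M) p"

lemma eventually_near:
  "p \<in> pts M \<Longrightarrow> eventually P (near p) \<longleftrightarrow> (\<exists>W. openin (mtop M) W \<and> p \<in> W \<and> (\<forall>q\<in>W. P q))"
  by (simp add: eventually_nhdsin)

lemma near_openI: "openin (mtop M) W \<Longrightarrow> p \<in> W \<Longrightarrow> (\<And>q. q \<in> W \<Longrightarrow> P q) \<Longrightarrow> eventually P (near p)"
  unfolding eventually_nhdsin by blast

lemma near_openE:
  assumes "p \<in> pts M" "eventually P (near p)"
  obtains W where "openin (mtop M) W" "p \<in> W" "\<forall>q\<in>W. P q" "W \<subseteq> pts M"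
  using assms openin_subset unfolding eventually_near[OF assms(1)] by blast

lemma near_self: "p \<in> pts M \<Longrightarrow> eventually P (near p) \<Longrightarrow> P p"
  by (auto simp: eventually_near)

lemma near_near: "p \<in> pts M \<Longrightarrow> eventually P (near p) \<Longrightarrow> \<forall>\<^sub>F q in near p. eventually P (near q)"
  by (erule (1) near_openE) (auto intro!: near_openI)

lemma near_pts: "p \<in> pts M \<Longrightarrow> \<forall>\<^sub>F q in near p. q \<in> pts M"
  by (rule near_openI[OF openin_topspace]) auto

lemma near_chart_dom: "(U, \<phi>) \<in> atlas M \<Longrightarrow> p \<in> U \<Longrightarrow> \<forall>\<^sub>F q in near p. q \<in> U"
  by (rule near_openI[OF chart_open]) auto

lemma near_chart:
  assumes c: "(U, \<phi>) \<in> atlas M" "p \<in> U" and P: "eventually P (nhds (\<phi> p))"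
  shows "\<forall>\<^sub>F q in near p. P (\<phi> q)"
proof -
  obtain N where N: "open N" "\<phi> p \<in> N" "\<And>x. x \<in> N \<Longrightarrow> P x" using P unfolding eventually_nhds by blast
  show ?thesis by (rule near_openI[OF chart_preimage_open[OF c(1) N(1)]]) (use c N in auto)
qed

lemma near_chart_inv:
  assumes c: "(U, \<phi>) \<in> atlas M" "p \<in> U" and Q: "eventually Q (near p)"
  shows "\<forall>\<^sub>F x in nhds (\<phi> p). x \<in> \<phi> ` U \<and> Q (inv_into U \<phi> x)"
proof -
  have "p \<in> pts M" using c chart_sub by blast
  then obtain W where W: "openin (mtop M) W" "p \<in> W" "\<forall>q\<in>W. Q q" "W \<subseteq> pts M"
    by (rule near_openE[OF _ Q])
  have "open (\<phi> ` (U \<inter> W))" using c W chart_open by (intro chart_image_open) auto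
  then show ?thesis unfolding eventually_nhds using W c
    by (intro exI[of _ "\<phi> ` (U \<inter> W)"]) auto
qed

lemma near_sfun:
  assumes p: "p \<in> pts M" and f: "sfun f p"
  shows "\<forall>\<^sub>F q in near p. sfun f q"
proof -
  obtain U \<phi> where c: "(U, \<phi>) \<in> atlas M" "p \<in> U" "smooth_at (f \<circ> inv_into U \<phi>) (\<phi> p)"
    using f by (auto simp: sfun_def)
  have "\<forall>\<^sub>F x in nhds (\<phi> p). smooth_at (f \<circ> inv_into U \<phi>) x"
    using smooth_at_open[OF c(3)] by (auto simp: eventually_nhds)
  from near_chart[OF c(1,2) this] near_chart_dom[OF c(1,2)] show ?thesis
  proof eventually_elim
    case (elim q)
    then show ?case using sfun_chart[OF c(1) elim(2), of f] by blast
  qed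
qed

lemma extend_germ:
  fixes g :: "'a \<Rightarrow> real"
  assumes p: "p \<in> pts M" and g: "sfun g p"
  obtains f where "f \<in> smooth_funs M" "\<forall>\<^sub>F q in near p. f q = g q"
proof -
  obtain W where W: "openin (mtop M) W" "p \<in> W" "\<forall>q\<in>W. sfun g q" "W \<subseteq> pts M"
    by (rule near_openE[OF p near_sfun[OF p g]])
  obtain f N where f: "f \<in> smooth_funs M" "openin (mtop M) N" "p \<in> N" "N \<subseteq> W" "\<And>q. q \<in> N \<Longrightarrow> f q = g q"
    using extend_fun[OF W(1,2), of g] W(3) by blast
  show ?thesis by (rule that[OF f(1) near_openI[OF f(2,3)]]) (rule f(5))
qed

lemma vf_near:
  assumes X: "X \<in> vfields M" and fg: "f \<in> smooth_funs M" "g \<in> smooth_funs M" and p: "p \<in> pts M"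
    and e: "\<forall>\<^sub>F q in near p. f q = g q"
  shows "X f p = X g p"
proof -
  obtain W where W: "openin (mtop M) W" "p \<in> W" "\<forall>q\<in>W. f q = g q" "W \<subseteq> pts M"
    by (rule near_openE[OF p e])
  show ?thesis by (rule vf_local[OF X fg W(1,2)]) (use W(3) in blast)
qed

text \<open>A coordinate of the chart is not a global function; a global function with the same germ
  takes its place, and by \<open>vf_near\<close> the choice does not matter.\<close>

definition cfun :: "'a set \<Rightarrow> ('a \<Rightarrow> 'e) \<Rightarrow> 'e \<Rightarrow> 'a \<Rightarrow> ('a \<Rightarrow> real) \<Rightarrow> bool" where
  "cfun U \<phi> b p c \<longleftrightarrow> c \<in> smooth_funs M \<and> (\<forall>\<^sub>F q in near p. c q = \<phi> q \<bullet> b)"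

text \<open>The principal part of \<open>X\<close> as a function of the coordinates. The stand-ins
  for the coordinate functions are chosen anew at every point, because a global function agrees with
  a coordinate only near that point; \<open>rep_inner\<close> removes the choice.\<close>

definition rep :: "'a set \<Rightarrow> ('a \<Rightarrow> 'e) \<Rightarrow> 'a vfield \<Rightarrow> 'e \<Rightarrow> 'e" where
  "rep U \<phi> X x = (\<Sum>b\<in>B. X (SOME c. cfun U \<phi> b (inv_into U \<phi> x) c) (inv_into U \<phi> x) *\<^sub>R b)"

lemma smooth_at_inner_const: "smooth_at (\<lambda>x. x \<bullet> b) x"
  by (rule smooth_at_linear) (rule bounded_linear_inner_left)

lemma cfun_exists:
  assumes c: "(U, \<phi>) \<in> atlas M" "p \<in> U"
  obtains f where "cfun U \<phi> b p f"
proof -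
  have p: "p \<in> pts M" using c chart_sub by blast
  obtain f where "f \<in> smooth_funs M" "\<forall>\<^sub>F q in near p. f q = \<phi> q \<bullet> b"
    by (rule extend_germ[OF p sfun_coord[OF c smooth_at_inner_const]])
  then show ?thesis using that unfolding cfun_def by blast
qed

lemma rep_inner:
  assumes c: "(U, \<phi>) \<in> atlas M" "p \<in> U" and X: "X \<in> vfields M" and b: "b \<in> B" and f: "cfun U \<phi> b p f"
  shows "rep U \<phi> X (\<phi> p) \<bullet> b = X f p"
proof -
  have p: "p \<in> pts M" using c chart_sub by blast
  let ?g = "SOME c. cfun U \<phi> b p c"
  have g: "cfun U \<phi> b p ?g" using someI[of "cfun U \<phi> b p", OF f] .
  have "rep U \<phi> X (\<phi> p) \<bullet> b = X ?g p"
    unfolding rep_def chart_inv[OF c] by (rule orthobasis_sum[OF onb b])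
  also have "\<dots> = X f p"
  proof (rule vf_near[OF X _ _ p])
    have "\<forall>\<^sub>F q in near p. ?g q = \<phi> q \<bullet> b" "\<forall>\<^sub>F q in near p. f q = \<phi> q \<bullet> b"
      using f g by (simp_all add: cfun_def)
    then show "\<forall>\<^sub>F q in near p. ?g q = f q" by eventually_elim simp
  qed (use f g in \<open>simp_all add: cfun_def\<close>)
  finally show ?thesis .
qed

text \<open>A derivation is a directional derivative: Hadamard's lemma writes \<open>f\<close> near
  \<open>p\<close> as a constant plus products of centred coordinates with smooth functions
  \<open>h b\<close>, and the Leibniz rule leaves the values of the \<open>h b\<close> at
  \<open>p\<close>, which are the partial derivatives.\<close>

lemma vf_apply:
  assumes c: "(U, \<phi>) \<in> atlas M" "p \<in> U" and X: "X \<in> vfields M" and f: "f \<in> smooth_funs M"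
  shows "X f p = fd (f \<circ> inv_into U \<phi>) (\<phi> p) (rep U \<phi> X (\<phi> p))"
proof -
  have p: "p \<in> pts M" using c chart_sub by blast
  have sm: "smooth_at (f \<circ> inv_into U \<phi>) (\<phi> p)" by (rule smooth_funs_smooth_at[OF f c])
  obtain h N where N: "open N" "\<phi> p \<in> N" and h': "\<forall>b. smooth_at (h b) (\<phi> p) \<and>
      h b (\<phi> p) = fd (f \<circ> inv_into U \<phi>) (\<phi> p) b"
    and eq: "\<forall>x\<in>N. (f \<circ> inv_into U \<phi>) x = (f \<circ> inv_into U \<phi>) (\<phi> p) + (\<Sum>b\<in>B. ((x - \<phi> p) \<bullet> b) * h b x)"
    using hadamard_exists[OF onb sm] by (elim exE conjE)
  have h: "smooth_at (h b) (\<phi> p)" "h b (\<phi> p) = fd (f \<circ> inv_into U \<phi>) (\<phi> p) b" for b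
    using h' by simp_all
  have "\<exists>H. H \<in> smooth_funs M \<and> (\<forall>\<^sub>F q in near p. H q = h b (\<phi> q))" for b
    by (rule extend_germ[OF p sfun_coord[OF c h(1)[of b]]]) blast
  then obtain H where H: "\<And>b. H b \<in> smooth_funs M" "\<And>b. \<forall>\<^sub>F q in near p. H b q = h b (\<phi> q)" by metis
  have "\<exists>C. cfun U \<phi> b p C" for b by (rule cfun_exists[OF c]) blast
  then obtain C where C: "\<And>b. cfun U \<phi> b p (C b)" by metis
  have Cs: "C b \<in> smooth_funs M" "\<forall>\<^sub>F q in near p. C b q = \<phi> q \<bullet> b" for b using C by (simp_all add: cfun_def)
  \<comment> \<open>The coordinate centred at \<open>p\<close>: as it vanishes there, the Leibniz
    rule for \<open>D b\<close> times \<open>H b\<close> has only one term.\<close>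
  define D where "D b = (\<lambda>q\<in>pts M. C b q - cst (\<phi> p \<bullet> b) q)" for b
  have D: "D b \<in> smooth_funs M" "D b p = 0" "X (D b) p = X (C b) p" for b
  proof -
    show "D b \<in> smooth_funs M" unfolding D_def by (rule smooth_funs_diff[OF Cs(1) cst_smooth])
    show "D b p = 0" using near_self[OF p Cs(2)] p by (simp add: D_def cst_def)
    show "X (D b) p = X (C b) p" unfolding D_def
      using vf_diff_fun[OF X Cs(1) cst_smooth p] vf_cst[OF X p] by simp
  qed
  define E where "E b = (\<lambda>q\<in>pts M. D b q * H b q)" for b
  have E: "E b \<in> smooth_funs M" "X (E b) p = X (C b) p * fd (f \<circ> inv_into U \<phi>) (\<phi> p) b" for b
  proof -
    show "E b \<in> smooth_funs M" unfolding E_def by (rule smooth_funs_mult[OF D(1) H(1)])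
    show "X (E b) p = X (C b) p * fd (f \<circ> inv_into U \<phi>) (\<phi> p) b"
      unfolding E_def vf_mult[OF X D(1) H(1) p] using D near_self[OF p H(2)] h(2) by simp
  qed
  define S where "S = (\<lambda>q\<in>pts M. \<Sum>b\<in>B. E b q)"
  have S: "S \<in> smooth_funs M" "X S p = (\<Sum>b\<in>B. X (E b) p)"
    unfolding S_def using vf_sum_fun[OF X p, of B E] E(1) by (simp_all del: restrict_apply)
  define g where "g = (\<lambda>q\<in>pts M. cst (f p) q + S q)"
  have g: "g \<in> smooth_funs M" "X g p = X S p"
    unfolding g_def using smooth_funs_add[OF cst_smooth S(1)] vf_add_fun[OF X cst_smooth S(1) p] vf_cst[OF X p] by auto
  have "\<forall>\<^sub>F q in near p. \<forall>b\<in>B. H b q = h b (\<phi> q) \<and> C b q = \<phi> q \<bullet> b"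
    by (rule eventually_ball_finite[OF orthobasis_finite[OF onb]]) (use H Cs in \<open>auto intro: eventually_conj\<close>)
  moreover have "\<forall>\<^sub>F x in nhds (\<phi> p). x \<in> N" using N by (auto simp: eventually_nhds)
  note near_chart[OF c this]
  ultimately have "\<forall>\<^sub>F q in near p. f q = g q"
    using near_pts[OF p] near_chart_dom[OF c]
  proof eventually_elim
    case (elim q)
    have "f q = f p + (\<Sum>b\<in>B. ((\<phi> q - \<phi> p) \<bullet> b) * h b (\<phi> q))"
      using bspec[OF eq elim(2)] elim c by simp
    also have "\<dots> = g q"
      using elim by (simp add: g_def S_def E_def D_def cst_def inner_diff_left)
    finally show ?case .
  qed
  from vf_near[OF X f g(1) p this] have "X f p = (\<Sum>b\<in>B. X (C b) p * fd (f \<circ> inv_into U \<phi>) (\<phi> p) b)"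
    by (simp add: g S E)
  also have "\<dots> = (\<Sum>b\<in>B. (rep U \<phi> X (\<phi> p) \<bullet> b) *\<^sub>R fd (f \<circ> inv_into U \<phi>) (\<phi> p) b)"
    using rep_inner[OF c X _ C] by simp
  also have "\<dots> = fd (f \<circ> inv_into U \<phi>) (\<phi> p) (rep U \<phi> X (\<phi> p))"
    by (rule orthobasis_linear[OF onb smooth_at_linear_fd[OF sm], symmetric])
  finally show ?thesis .
qed

lemma cfun_fd:
  assumes c: "(U, \<phi>) \<in> atlas M" "p \<in> U" and f: "cfun U \<phi> b p f"
  shows "fd (f \<circ> inv_into U \<phi>) (\<phi> p) v = v \<bullet> b"
proof -
  have "\<forall>\<^sub>F q in near p. f q = \<phi> q \<bullet> b" using f by (simp add: cfun_def)
  from near_chart_inv[OF c this] have "\<forall>\<^sub>F x in nhds (\<phi> p). (f \<circ> inv_into U \<phi>) x = x \<bullet> b"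
    by eventually_elim (auto simp: f_inv_into_f)
  then have "fd (f \<circ> inv_into U \<phi>) (\<phi> p) = fd (\<lambda>x. x \<bullet> b) (\<phi> p)" by (rule fd_cong_ev)
  then show ?thesis by (simp only: fd_eq[OF bounded_linear_imp_has_derivative[OF bounded_linear_inner_left]])
qed

text \<open>Converse of \<open>vf_apply\<close>: testing on the coordinate functions recovers every
  component of the vector.\<close>

lemma rep_unique:
  assumes c: "(U, \<phi>) \<in> atlas M" "p \<in> U" and X: "X \<in> vfields M"
    and v: "\<And>f. f \<in> smooth_funs M \<Longrightarrow> X f p = fd (f \<circ> inv_into U \<phi>) (\<phi> p) v"
  shows "rep U \<phi> X (\<phi> p) = v"
proof (rule orthobasis_eqI[OF onb])
  fix b assume b: "b \<in> B"
  obtain f where f: "cfun U \<phi> b p f" by (rule cfun_exists[OF c])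
  have fs: "f \<in> smooth_funs M" using f by (simp add: cfun_def)
  show "rep U \<phi> X (\<phi> p) \<bullet> b = v \<bullet> b"
    using rep_inner[OF c X b f] v[OF fs] cfun_fd[OF c f] by simp
qed

text \<open>The functions \<open>C b\<close> chosen at \<open>p\<close> serve for all points near
  \<open>p\<close>, which exhibits \<open>rep U \<phi> X\<close> as a finite sum of smooth functions
  there.\<close>

lemma rep_smooth:
  assumes c: "(U, \<phi>) \<in> atlas M" "p \<in> U" and X: "X \<in> vfields M"
  shows "smooth_at (rep U \<phi> X) (\<phi> p)"
proof -
  have p: "p \<in> pts M" using c chart_sub by blast
  have "\<exists>C. cfun U \<phi> b p C" for b by (rule cfun_exists[OF c]) blast
  then obtain C where C: "\<And>b. cfun U \<phi> b p (C b)" by metis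
  have Cs: "C b \<in> smooth_funs M" for b using C by (simp_all add: cfun_def)
  have "\<forall>\<^sub>F q in near p. C b q = \<phi> q \<bullet> b" for b using C by (simp add: cfun_def)
  from near_near[OF p this] have "\<forall>\<^sub>F q in near p. cfun U \<phi> b q (C b)" for b
    unfolding cfun_def using Cs by simp
  then have "\<forall>\<^sub>F q in near p. \<forall>b\<in>B. cfun U \<phi> b q (C b)"
    by (intro eventually_ball_finite orthobasis_finite[OF onb]) blast
  moreover note near_chart_dom[OF c]
  ultimately have "\<forall>\<^sub>F q in near p. (\<Sum>b\<in>B. X (C b) q *\<^sub>R b) = rep U \<phi> X (\<phi> q)"
  proof eventually_elim
    case (elim q)
    have "(\<Sum>b\<in>B. X (C b) q *\<^sub>R b) = (\<Sum>b\<in>B. (rep U \<phi> X (\<phi> q) \<bullet> b) *\<^sub>R b)"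
      using rep_inner[OF c(1) elim(2) X] elim by (intro sum.cong) auto
    then show ?case by (simp add: orthobasis_expand[OF onb])
  qed
  from near_chart_inv[OF c this]
  have e: "\<forall>\<^sub>F x in nhds (\<phi> p). (\<Sum>b\<in>B. (X (C b) \<circ> inv_into U \<phi>) x *\<^sub>R b) = rep U \<phi> X x"
    by eventually_elim (auto simp: f_inv_into_f)
  have "smooth_at (\<lambda>x. \<Sum>b\<in>B. (X (C b) \<circ> inv_into U \<phi>) x *\<^sub>R b) (\<phi> p)"
    by (rule smooth_at_sum, rule smooth_at_scaleR[OF smooth_funs_smooth_at[OF vf_smooth[OF X Cs] c] smooth_at_const])
  then show ?thesis by (rule smooth_at_cong_ev[OF e])
qed

lemma coord_add:
  assumes c: "(U, \<phi>) \<in> atlas M" "p \<in> U" and fg: "f \<in> smooth_funs M" "g \<in> smooth_funs M"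
  shows "fd ((\<lambda>p\<in>pts M. a * f p + g p) \<circ> inv_into U \<phi>) (\<phi> p) v =
    a * fd (f \<circ> inv_into U \<phi>) (\<phi> p) v + fd (g \<circ> inv_into U \<phi>) (\<phi> p) v"
proof -
  have "fd ((\<lambda>p\<in>pts M. a * f p + g p) \<circ> inv_into U \<phi>) (\<phi> p) =
      fd (\<lambda>x. a * (f \<circ> inv_into U \<phi>) x + (g \<circ> inv_into U \<phi>) x) (\<phi> p)"
    by (rule fd_cong_open[OF chart_open_image[OF c(1)]]) (use c chart_sub[OF c(1)] in auto)
  moreover have "((\<lambda>x. a * (f \<circ> inv_into U \<phi>) x + (g \<circ> inv_into U \<phi>) x) has_derivative
      (\<lambda>v. a * fd (f \<circ> inv_into U \<phi>) (\<phi> p) v + fd (g \<circ> inv_into U \<phi>) (\<phi> p) v)) (at (\<phi> p))"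
    using smooth_at_has_derivative[OF smooth_funs_smooth_at[OF fg(1) c]]
      smooth_at_has_derivative[OF smooth_funs_smooth_at[OF fg(2) c]]
    by (intro has_derivative_add has_derivative_mult_right)
  ultimately show ?thesis by (simp only: fd_eq)
qed

lemma coord_mult:
  assumes c: "(U, \<phi>) \<in> atlas M" "p \<in> U" and fg: "f \<in> smooth_funs M" "g \<in> smooth_funs M"
  shows "fd ((\<lambda>p\<in>pts M. f p * g p) \<circ> inv_into U \<phi>) (\<phi> p) v =
    fd (f \<circ> inv_into U \<phi>) (\<phi> p) v * g p + f p * fd (g \<circ> inv_into U \<phi>) (\<phi> p) v"
proof -
  have "fd ((\<lambda>p\<in>pts M. f p * g p) \<circ> inv_into U \<phi>) (\<phi> p) =
      fd (\<lambda>x. (f \<circ> inv_into U \<phi>) x * (g \<circ> inv_into U \<phi>) x) (\<phi> p)"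
    by (rule fd_cong_open[OF chart_open_image[OF c(1)]]) (use c chart_sub[OF c(1)] in auto)
  moreover have "((\<lambda>x. (f \<circ> inv_into U \<phi>) x * (g \<circ> inv_into U \<phi>) x) has_derivative
      (\<lambda>v. (f \<circ> inv_into U \<phi>) (\<phi> p) * fd (g \<circ> inv_into U \<phi>) (\<phi> p) v +
         fd (f \<circ> inv_into U \<phi>) (\<phi> p) v * (g \<circ> inv_into U \<phi>) (\<phi> p))) (at (\<phi> p))"
    using smooth_at_has_derivative[OF smooth_funs_smooth_at[OF fg(1) c]]
      smooth_at_has_derivative[OF smooth_funs_smooth_at[OF fg(2) c]]
    by (intro has_derivative_mult)
  ultimately show ?thesis using c by (simp add: fd_eq)
qed

text \<open>Prescribed coordinates near a point are realised by a global field: differentiate along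
  \<open>u\<close> in the chart and multiply by a cutoff that is 1 near \<open>p\<close>.\<close>

lemma mk_field:
  assumes c: "(U, \<phi>) \<in> atlas M" "p \<in> U" and u: "smooth_at u (\<phi> p)"
  obtains X where "X \<in> vfields M" "\<forall>\<^sub>F x in nhds (\<phi> p). rep U \<phi> X x = u x"
proof -
  obtain N where N: "open N" "\<phi> p \<in> N" "\<And>x. x \<in> N \<Longrightarrow> smooth_at u x" using smooth_at_open[OF u] by blast
  define W where "W = {q \<in> U. \<phi> q \<in> N}"
  have W: "openin (mtop M) W" "p \<in> W" "W \<subseteq> U"
    unfolding W_def using chart_preimage_open[OF c(1) N(1)] c N by auto
  obtain \<rho> K V where r: "\<rho> \<in> smooth_funs M" "closedin (mtop M) K" "K \<subseteq> W"
    "\<And>q. q \<in> pts M - K \<Longrightarrow> \<rho> q = 0" and V: "openin (mtop M) V" "p \<in> V" "V \<subseteq> K" "\<And>q. q \<in> V \<Longrightarrow> \<rho> q = 1"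
    using cutoff[OF W(1,2)] by blast
  define g where "g f q = fd (f \<circ> inv_into U \<phi>) (\<phi> q) (u (\<phi> q))" for f :: "'a \<Rightarrow> real" and q
  have g: "sfun (g f) q" if "f \<in> smooth_funs M" "q \<in> W" for f q
    unfolding g_def
  proof (rule sfun_coord[OF c(1)])
    show "q \<in> U" using that W by blast
    show "smooth_at (\<lambda>x. fd (f \<circ> inv_into U \<phi>) x (u x)) (\<phi> q)"
      using that W N(3) by (intro smooth_at_fd_linear[OF onb] smooth_at_ident smooth_funs_smooth_at[OF _ c(1)]) (auto simp: W_def)
  qed
  define X where "X = (\<lambda>f\<in>smooth_funs M. \<lambda>q\<in>pts M. if q \<in> W then \<rho> q * g f q else 0)"
  have Xap: "X f q = (if q \<in> W then \<rho> q * g f q else 0)" if "f \<in> smooth_funs M" "q \<in> pts M" for f q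
    using that by (simp add: X_def)
  have X: "X \<in> vfields M"
  proof (rule vfieldsI)
    show "X f \<in> smooth_funs M" if "f \<in> smooth_funs M" for f
      unfolding X_def using zero_extension[OF W(1) r(1-4) g[OF that]] that by simp
    show "X \<in> extensional (smooth_funs M)" by (simp add: X_def)
  next
    fix f h a q assume f: "f \<in> smooth_funs M" "h \<in> smooth_funs M" and q: "q \<in> pts M"
    show "X (\<lambda>p\<in>pts M. a * f p + h p) q = a * X f q + X h q"
    proof (cases "q \<in> W")
      case True
      then have "g (\<lambda>p\<in>pts M. a * f p + h p) q = a * g f q + g h q"
        unfolding g_def using W coord_add[OF c(1) _ f] by blast
      then show ?thesis by (simp only: Xap[OF smooth_funs_lin[OF f] q] Xap[OF f(1) q] Xap[OF f(2) q])
          (simp add: algebra_simps)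
    next
      case False
      then show ?thesis by (simp only: Xap[OF smooth_funs_lin[OF f] q] Xap[OF f(1) q] Xap[OF f(2) q]) simp
    qed
    show "X (\<lambda>p\<in>pts M. f p * h p) q = X f q * h q + f q * X h q"
    proof (cases "q \<in> W")
      case True
      then have "g (\<lambda>p\<in>pts M. f p * h p) q = g f q * h q + f q * g h q"
        unfolding g_def using W coord_mult[OF c(1) _ f] by blast
      then show ?thesis by (simp only: Xap[OF smooth_funs_mult[OF f] q] Xap[OF f(1) q] Xap[OF f(2) q])
          (simp add: algebra_simps)
    next
      case False
      then show ?thesis by (simp only: Xap[OF smooth_funs_mult[OF f] q] Xap[OF f(1) q] Xap[OF f(2) q]) simp
    qed
  qed
  have "\<forall>\<^sub>F q in near p. rep U \<phi> X (\<phi> q) = u (\<phi> q)"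
  proof (rule near_openI[OF V(1,2)])
    fix q assume q: "q \<in> V"
    then have qW: "q \<in> W" "q \<in> U" "q \<in> pts M"
      using V(3) r(3) W(3) chart_sub[OF c(1)] by blast+
    show "rep U \<phi> X (\<phi> q) = u (\<phi> q)"
      by (rule rep_unique[OF c(1) qW(2) X]) (simp add: Xap qW V(4)[OF q] g_def)
  qed
  from near_chart_inv[OF c this] have "\<forall>\<^sub>F x in nhds (\<phi> p). rep U \<phi> X x = u x"
    by eventually_elim (auto simp: f_inv_into_f)
  then show ?thesis by (rule that[OF X])
qed

lemma vf_add_apply [simp]: "f \<in> smooth_funs M \<Longrightarrow> p \<in> pts M \<Longrightarrow> vf_add M X Y f p = X f p + Y f p"
  by (simp add: vf_add_def)
lemma vf_diff_apply [simp]: "f \<in> smooth_funs M \<Longrightarrow> p \<in> pts M \<Longrightarrow> vf_diff M X Y f p = X f p - Y f p"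
  by (simp add: vf_diff_def)
lemma vf_scale_apply [simp]: "f \<in> smooth_funs M \<Longrightarrow> p \<in> pts M \<Longrightarrow> vf_scale M h X f p = h p * X f p"
  by (simp add: vf_scale_def)
lemma vf_zero_apply [simp]: "f \<in> smooth_funs M \<Longrightarrow> p \<in> pts M \<Longrightarrow> vf_zero M f p = 0"
  by (simp add: vf_zero_def)
lemma vf_bracket_apply [simp]: "f \<in> smooth_funs M \<Longrightarrow> p \<in> pts M \<Longrightarrow> vf_bracket M X Y f p = X (Y f) p - Y (X f) p"
  by (simp add: vf_bracket_def)

lemma vf_lin_eq: "X \<in> vfields M \<Longrightarrow> f \<in> smooth_funs M \<Longrightarrow> g \<in> smooth_funs M \<Longrightarrow>
  X (\<lambda>p\<in>pts M. a * f p + g p) = (\<lambda>p\<in>pts M. a * X f p + X g p)"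
  unfolding vfields_def by blast

lemma vf_mult_eq: "X \<in> vfields M \<Longrightarrow> f \<in> smooth_funs M \<Longrightarrow> g \<in> smooth_funs M \<Longrightarrow>
  X (\<lambda>p\<in>pts M. f p * g p) = (\<lambda>p\<in>pts M. X f p * g p + f p * X g p)"
  unfolding vfields_def by blast

lemma vf_add_mult:
  assumes X: "X \<in> vfields M" and s: "u \<in> smooth_funs M" "g \<in> smooth_funs M" "f \<in> smooth_funs M" "v \<in> smooth_funs M"
    and p: "p \<in> pts M"
  shows "X (\<lambda>p\<in>pts M. u p * g p + f p * v p) p = X u p * g p + u p * X g p + (X f p * v p + f p * X v p)"
proof -
  have "(\<lambda>p\<in>pts M. u p * g p + f p * v p) =
      (\<lambda>p\<in>pts M. (\<lambda>p\<in>pts M. u p * g p) p + (\<lambda>p\<in>pts M. f p * v p) p)" by (auto simp: fun_eq_iff)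
  then have "X (\<lambda>p\<in>pts M. u p * g p + f p * v p) p = X (\<lambda>p\<in>pts M. u p * g p) p + X (\<lambda>p\<in>pts M. f p * v p) p"
    using vf_add_fun[OF X smooth_funs_mult[OF s(1,2)] smooth_funs_mult[OF s(3,4)] p] by (simp only:)
  then show ?thesis using vf_mult[OF X s(1,2) p] vf_mult[OF X s(3,4) p] by (simp only:)
qed

lemma vf_combI:
  assumes X: "X \<in> vfields M" and Y: "Y \<in> vfields M" and h: "h \<in> smooth_funs M" and k: "k \<in> smooth_funs M"
  shows "(\<lambda>f\<in>smooth_funs M. \<lambda>p\<in>pts M. h p * X f p + k p * Y f p) \<in> vfields M" (is "?Z \<in> _")
proof (rule vfieldsI)
  have Z: "?Z f p = h p * X f p + k p * Y f p" if "f \<in> smooth_funs M" "p \<in> pts M" for f p using that by simp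
  show "?Z f \<in> smooth_funs M" if "f \<in> smooth_funs M" for f
    using that X Y h k by (simp add: smooth_funs_restrict sfun_add sfun_mult smooth_funs_sfun)
  show "?Z \<in> extensional (smooth_funs M)" by simp
  fix f g a p assume f: "f \<in> smooth_funs M" "g \<in> smooth_funs M" and p: "p \<in> pts M"
  show "?Z (\<lambda>p\<in>pts M. a * f p + g p) p = a * ?Z f p + ?Z g p"
    by (simp only: Z[OF smooth_funs_lin[OF f] p] Z[OF f(1) p] Z[OF f(2) p] vf_lin[OF X f p] vf_lin[OF Y f p])
      (simp add: algebra_simps)
  show "?Z (\<lambda>p\<in>pts M. f p * g p) p = ?Z f p * g p + f p * ?Z g p"
    by (simp only: Z[OF smooth_funs_mult[OF f] p] Z[OF f(1) p] Z[OF f(2) p] vf_mult[OF X f p] vf_mult[OF Y f p])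
      (simp add: algebra_simps)
qed

lemma vf_addI [simp]:
  assumes "X \<in> vfields M" "Y \<in> vfields M" shows "vf_add M X Y \<in> vfields M"
proof -
  have "vf_add M X Y = (\<lambda>f\<in>smooth_funs M. \<lambda>p\<in>pts M. cst 1 p * X f p + cst 1 p * Y f p)"
    by (auto simp: vf_add_def cst_def fun_eq_iff)
  then show ?thesis using vf_combI[OF assms cst_smooth cst_smooth] by (simp only:)
qed

lemma vf_diffI [simp]:
  assumes "X \<in> vfields M" "Y \<in> vfields M" shows "vf_diff M X Y \<in> vfields M"
proof -
  have "vf_diff M X Y = (\<lambda>f\<in>smooth_funs M. \<lambda>p\<in>pts M. cst 1 p * X f p + cst (-1) p * Y f p)"
    by (auto simp: vf_diff_def cst_def fun_eq_iff)
  then show ?thesis using vf_combI[OF assms cst_smooth cst_smooth] by (simp only:)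
qed

lemma vf_scaleI [simp]:
  assumes "h \<in> smooth_funs M" "X \<in> vfields M" shows "vf_scale M h X \<in> vfields M"
proof -
  have "vf_scale M h X = (\<lambda>f\<in>smooth_funs M. \<lambda>p\<in>pts M. h p * X f p + cst 0 p * X f p)"
    by (auto simp: vf_scale_def cst_def fun_eq_iff)
  then show ?thesis using vf_combI[OF assms(2,2,1) cst_smooth] by (simp only:)
qed

lemma vf_zeroI [simp]: "vf_zero M \<in> vfields M"
proof (rule vfieldsI)
  show "vf_zero M f \<in> smooth_funs M" if "f \<in> smooth_funs M" for f
    using that cst_smooth[of 0] by (simp add: vf_zero_def cst_def)
qed (simp_all only: vf_zero_apply smooth_funs_lin smooth_funs_mult, simp_all add: vf_zero_def)

lemma vf_bracketI [simp]:
  assumes X: "X \<in> vfields M" and Y: "Y \<in> vfields M"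
  shows "vf_bracket M X Y \<in> vfields M"
proof (rule vfieldsI)
  show "vf_bracket M X Y f \<in> smooth_funs M" if "f \<in> smooth_funs M" for f
    using that X Y by (simp add: vf_bracket_def)
  show "vf_bracket M X Y \<in> extensional (smooth_funs M)" by (simp add: vf_bracket_def)
next
  fix f g a p assume f: "f \<in> smooth_funs M" "g \<in> smooth_funs M" and p: "p \<in> pts M"
  note s = vf_smooth[OF X f(1)] vf_smooth[OF X f(2)] vf_smooth[OF Y f(1)] vf_smooth[OF Y f(2)]
  show "vf_bracket M X Y (\<lambda>p\<in>pts M. a * f p + g p) p = a * vf_bracket M X Y f p + vf_bracket M X Y g p"
    by (simp only: vf_bracket_apply[OF smooth_funs_lin[OF f] p] vf_bracket_apply[OF f(1) p] vf_bracket_apply[OF f(2) p]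
        vf_lin_eq[OF X f] vf_lin_eq[OF Y f] vf_lin[OF X s(3,4) p] vf_lin[OF Y s(1,2) p]) (simp add: algebra_simps)
  show "vf_bracket M X Y (\<lambda>p\<in>pts M. f p * g p) p = vf_bracket M X Y f p * g p + f p * vf_bracket M X Y g p"
    by (simp only: vf_bracket_apply[OF smooth_funs_mult[OF f] p] vf_bracket_apply[OF f(1) p] vf_bracket_apply[OF f(2) p]
        vf_mult_eq[OF X f] vf_mult_eq[OF Y f] vf_add_mult[OF X s(3) f(2) f(1) s(4) p]
        vf_add_mult[OF Y s(1) f(2) f(1) s(2) p]) (simp add: algebra_simps)
qed

end

section \<open>Product rules for families of linear and bilinear maps\<close>

text \<open>Smoothness is known only for fixed arguments \<open>w\<close>; linearity of
  \<open>A y\<close> near \<open>x\<close> reduces \<open>A y (g y)\<close> to the finitely many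
  basis vectors, weighted by the coordinates of \<open>g y\<close>.\<close>

lemma linear_family:
  fixes A :: "'a::real_normed_vector \<Rightarrow> 'f::real_inner \<Rightarrow> 'b::real_normed_vector" and B :: "'f set"
  assumes B: "orthobasis B" and lin: "\<forall>\<^sub>F y in nhds x. linear (A y)"
    and A: "\<And>w. smooth_at (\<lambda>y. A y w) x" and g: "smooth_at g x"
  shows "smooth_at (\<lambda>y. A y (g y)) x"
    and "fd (\<lambda>y. A y (g y)) x v = fd (\<lambda>y. A y (g x)) x v + A x (fd g x v)"
proof -
  have e: "\<forall>\<^sub>F y in nhds x. (\<Sum>b\<in>B. (h y \<bullet> b) *\<^sub>R A y b) = A y (h y)" for h
    using lin by eventually_elim (rule orthobasis_linear[OF B, symmetric])
  have gb: "smooth_at (\<lambda>y. g y \<bullet> b) x" for b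
    by (rule smooth_at_linear_compose[OF bounded_linear_inner_left g])
  show "smooth_at (\<lambda>y. A y (g y)) x"
    by (rule smooth_at_cong_ev[OF e]) (rule smooth_at_sum, rule smooth_at_scaleR[OF gb A])
  have lx: "linear (A x)" using lin eventually_nhds_x_imp_x by blast
  have Ab: "((\<lambda>y. A y b) has_derivative fd (\<lambda>y. A y b) x) (at x)" for b
    by (rule smooth_at_has_derivative[OF A])
  have "((\<lambda>y. \<Sum>b\<in>B. (g y \<bullet> b) *\<^sub>R A y b) has_derivative
     (\<lambda>v. \<Sum>b\<in>B. (g x \<bullet> b) *\<^sub>R fd (\<lambda>y. A y b) x v + (fd g x v \<bullet> b) *\<^sub>R A x b)) (at x)"
    by (rule has_derivative_sum, rule has_derivative_scaleR[OF has_derivative_inner_left[OF smooth_at_has_derivative[OF g]] Ab])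
  then have 1: "fd (\<lambda>y. A y (g y)) x v = (\<Sum>b\<in>B. (g x \<bullet> b) *\<^sub>R fd (\<lambda>y. A y b) x v + (fd g x v \<bullet> b) *\<^sub>R A x b)"
    unfolding fd_cong_ev[OF e, symmetric] by (simp only: fd_eq)
  have "((\<lambda>y. \<Sum>b\<in>B. (g x \<bullet> b) *\<^sub>R A y b) has_derivative
     (\<lambda>v. \<Sum>b\<in>B. (g x \<bullet> b) *\<^sub>R fd (\<lambda>y. A y b) x v)) (at x)"
    by (rule has_derivative_sum, rule has_derivative_scaleR_right[OF Ab])
  then have 2: "fd (\<lambda>y. A y (g x)) x v = (\<Sum>b\<in>B. (g x \<bullet> b) *\<^sub>R fd (\<lambda>y. A y b) x v)"
    unfolding fd_cong_ev[OF e, symmetric] by (simp only: fd_eq)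
  show "fd (\<lambda>y. A y (g y)) x v = fd (\<lambda>y. A y (g x)) x v + A x (fd g x v)"
    unfolding 1 2 by (simp add: sum.distrib orthobasis_linear[OF B lx, symmetric])
qed

lemma bilinear_family:
  fixes A :: "'a::real_normed_vector \<Rightarrow> 'f::real_inner \<Rightarrow> 'f \<Rightarrow> 'b::real_normed_vector" and B :: "'f set"
  assumes B: "orthobasis B" and lin: "\<forall>\<^sub>F y in nhds x. bilinear (A y)"
    and A: "\<And>u w. smooth_at (\<lambda>y. A y u w) x" and g: "smooth_at g x" and h: "smooth_at h x"
  shows "smooth_at (\<lambda>y. A y (g y) (h y)) x"
    and "fd (\<lambda>y. A y (g y) (h y)) x v = fd (\<lambda>y. A y (g x) (h x)) x v + A x (fd g x v) (h x) + A x (g x) (fd h x v)"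
proof -
  have l1: "\<forall>\<^sub>F y in nhds x. linear (\<lambda>u. A y u (h y))" and l2: "\<forall>\<^sub>F y in nhds x. linear (A y u)" for u
    using lin by (eventually_elim, simp add: bilinear_def)+
  have s: "smooth_at (\<lambda>y. A y u (h y)) x" for u
    by (rule linear_family(1)[OF B l2 A h])
  show "smooth_at (\<lambda>y. A y (g y) (h y)) x"
    by (rule linear_family(1)[OF B l1 s g])
  show "fd (\<lambda>y. A y (g y) (h y)) x v = fd (\<lambda>y. A y (g x) (h x)) x v + A x (fd g x v) (h x) + A x (g x) (fd h x v)"
    unfolding linear_family(2)[OF B l1 s g] linear_family(2)[OF B l2 A h] by simp
qed

lemma near_smooth_at: "smooth_at f x \<Longrightarrow> \<forall>\<^sub>F y in nhds x. smooth_at f y"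
  using smooth_at_open by (auto simp: eventually_nhds)

text \<open>The case \<open>A y = fd F y\<close>; the first summand of the derivative is the second
  derivative of \<open>F\<close>.\<close>

lemma fd_family:
  fixes F :: "'f::real_inner \<Rightarrow> 'b::real_normed_vector" and B :: "'f set"
  assumes B: "orthobasis B" and F: "smooth_at F x" and g: "smooth_at g x"
  shows "smooth_at (\<lambda>y. fd F y (g y)) x"
    and "fd (\<lambda>y. fd F y (g y)) x v = fd (\<lambda>y. fd F y (g x)) x v + fd F x (fd g x v)"
proof -
  have "\<forall>\<^sub>F y in nhds x. linear (fd F y)"
    using near_smooth_at[OF F] by eventually_elim (rule smooth_at_linear_fd)
  from linear_family[OF B this smooth_at_fd[OF F] g]
  show "smooth_at (\<lambda>y. fd F y (g y)) x"
    and "fd (\<lambda>y. fd F y (g y)) x v = fd (\<lambda>y. fd F y (g x)) x v + fd F x (fd g x v)" by simp_all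
qed

section \<open>Brackets and coordinate fields in charts\<close>

context mfld
begin

lemma rep_diff:
  assumes c: "(U, \<phi>) \<in> atlas M" "p \<in> U" and X: "X \<in> vfields M" and Y: "Y \<in> vfields M"
  shows "rep U \<phi> (vf_diff M X Y) (\<phi> p) = rep U \<phi> X (\<phi> p) - rep U \<phi> Y (\<phi> p)"
proof (rule rep_unique[OF c vf_diffI[OF X Y]])
  fix f assume f: "f \<in> smooth_funs M"
  have p: "p \<in> pts M" using c chart_sub by blast
  show "vf_diff M X Y f p = fd (f \<circ> inv_into U \<phi>) (\<phi> p) (rep U \<phi> X (\<phi> p) - rep U \<phi> Y (\<phi> p))"
    by (simp add: f p vf_apply[OF c X f] vf_apply[OF c Y f] linear_diff[OF smooth_at_linear_fd[OF smooth_funs_smooth_at[OF f c]]])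
qed

lemma rep_zero:
  assumes c: "(U, \<phi>) \<in> atlas M" "p \<in> U"
  shows "rep U \<phi> (vf_zero M) (\<phi> p) = 0"
proof (rule rep_unique[OF c vf_zeroI])
  fix f assume f: "f \<in> smooth_funs M"
  have p: "p \<in> pts M" using c chart_sub by blast
  show "vf_zero M f p = fd (f \<circ> inv_into U \<phi>) (\<phi> p) 0"
    by (simp add: f p linear_0[OF smooth_at_linear_fd[OF smooth_funs_smooth_at[OF f c]]])
qed

lemma vf_apply_near:
  assumes c: "(U, \<phi>) \<in> atlas M" "p \<in> U" and X: "X \<in> vfields M" and f: "f \<in> smooth_funs M"
  shows "\<forall>\<^sub>F x in nhds (\<phi> p). (X f \<circ> inv_into U \<phi>) x = fd (f \<circ> inv_into U \<phi>) x (rep U \<phi> X x)"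
proof -
  have "\<forall>\<^sub>F q in near p. X f q = fd (f \<circ> inv_into U \<phi>) (\<phi> q) (rep U \<phi> X (\<phi> q))"
    using near_chart_dom[OF c] by eventually_elim (rule vf_apply[OF c(1) _ X f])
  from near_chart_inv[OF c this] show ?thesis
    by eventually_elim (auto simp: f_inv_into_f)
qed

lemma vf_apply2:
  assumes c: "(U, \<phi>) \<in> atlas M" "p \<in> U" and X: "X \<in> vfields M" and Y: "Y \<in> vfields M" and f: "f \<in> smooth_funs M"
  shows "X (Y f) p = fd (\<lambda>x. fd (f \<circ> inv_into U \<phi>) x (rep U \<phi> Y (\<phi> p))) (\<phi> p) (rep U \<phi> X (\<phi> p))
     + fd (f \<circ> inv_into U \<phi>) (\<phi> p) (fd (rep U \<phi> Y) (\<phi> p) (rep U \<phi> X (\<phi> p)))"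
proof -
  have "X (Y f) p = fd (Y f \<circ> inv_into U \<phi>) (\<phi> p) (rep U \<phi> X (\<phi> p))"
    by (rule vf_apply[OF c X vf_smooth[OF Y f]])
  also have "fd (Y f \<circ> inv_into U \<phi>) (\<phi> p) = fd (\<lambda>x. fd (f \<circ> inv_into U \<phi>) x (rep U \<phi> Y x)) (\<phi> p)"
    by (rule fd_cong_ev[OF vf_apply_near[OF c Y f]])
  finally show ?thesis
    by (simp only: fd_family(2)[OF onb smooth_funs_smooth_at[OF f c] rep_smooth[OF c Y]])
qed

text \<open>The second derivatives of the test function cancel by symmetry, so a first order
  operator remains.\<close>

lemma rep_bracket:
  assumes c: "(U, \<phi>) \<in> atlas M" "p \<in> U" and X: "X \<in> vfields M" and Y: "Y \<in> vfields M"
  shows "rep U \<phi> (vf_bracket M X Y) (\<phi> p) =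
    fd (rep U \<phi> Y) (\<phi> p) (rep U \<phi> X (\<phi> p)) - fd (rep U \<phi> X) (\<phi> p) (rep U \<phi> Y (\<phi> p))"
proof (rule rep_unique[OF c vf_bracketI[OF X Y]])
  fix f assume f: "f \<in> smooth_funs M"
  have p: "p \<in> pts M" using c chart_sub by blast
  have s: "smooth_at (f \<circ> inv_into U \<phi>) (\<phi> p)" by (rule smooth_funs_smooth_at[OF f c])
  show "vf_bracket M X Y f p = fd (f \<circ> inv_into U \<phi>) (\<phi> p)
    (fd (rep U \<phi> Y) (\<phi> p) (rep U \<phi> X (\<phi> p)) - fd (rep U \<phi> X) (\<phi> p) (rep U \<phi> Y (\<phi> p)))"
    unfolding vf_bracket_apply[OF f p] vf_apply2[OF c X Y f] vf_apply2[OF c Y X f]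
      linear_diff[OF smooth_at_linear_fd[OF s]]
    using fd_symmetric_real[OF s, of "rep U \<phi> Y (\<phi> p)" "rep U \<phi> X (\<phi> p)"] by linarith
qed

definition vf_sum :: "'i set \<Rightarrow> ('i \<Rightarrow> 'a vfield) \<Rightarrow> 'a vfield" where
  "vf_sum I F = (\<lambda>f\<in>smooth_funs M. \<lambda>p\<in>pts M. \<Sum>i\<in>I. F i f p)"

lemma vf_sum_apply [simp]: "f \<in> smooth_funs M \<Longrightarrow> p \<in> pts M \<Longrightarrow> vf_sum I F f p = (\<Sum>i\<in>I. F i f p)"
  by (simp add: vf_sum_def)

lemma vf_sum_empty: "vf_sum {} F = vf_zero M"
  by (simp add: vf_sum_def vf_zero_def)

lemma vf_sum_insert: "finite I \<Longrightarrow> i \<notin> I \<Longrightarrow> vf_sum (insert i I) F = vf_add M (F i) (vf_sum I F)"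
  by (auto simp: vf_sum_def vf_add_def fun_eq_iff)

lemma vf_sumI: "finite I \<Longrightarrow> (\<And>i. i \<in> I \<Longrightarrow> F i \<in> vfields M) \<Longrightarrow> vf_sum I F \<in> vfields M"
  by (induction I rule: finite_induct) (simp_all add: vf_sum_empty vf_sum_insert)

text \<open>A global stand-in for a coordinate field of the chart, which itself exists on
  \<open>U\<close> only.\<close>

definition cfield :: "'a set \<Rightarrow> ('a \<Rightarrow> 'e) \<Rightarrow> 'e \<Rightarrow> 'e \<Rightarrow> 'a vfield \<Rightarrow> bool" where
  "cfield U \<phi> x b E \<longleftrightarrow> E \<in> vfields M \<and> (\<forall>\<^sub>F y in nhds x. rep U \<phi> E y = b)"

lemma cfield_exists: "(U, \<phi>) \<in> atlas M \<Longrightarrow> p \<in> U \<Longrightarrow> \<exists>E. cfield U \<phi> (\<phi> p) b E"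
  unfolding cfield_def by (rule mk_field[of U \<phi> p "\<lambda>_. b"]) auto

lemma cfield_vf: "cfield U \<phi> x b E \<Longrightarrow> E \<in> vfields M"
  by (simp add: cfield_def)

lemma cfield_rep: "cfield U \<phi> x b E \<Longrightarrow> rep U \<phi> E x = b"
  unfolding cfield_def using eventually_nhds_x_imp_x by blast

lemma cfield_near: "cfield U \<phi> x b E \<Longrightarrow> \<forall>\<^sub>F y in nhds x. cfield U \<phi> y b E"
  unfolding cfield_def by (simp add: eventually_eventually)

definition vf_agree :: "'a \<Rightarrow> 'a vfield \<Rightarrow> 'a vfield \<Rightarrow> bool" where
  "vf_agree p X Y \<longleftrightarrow> (\<forall>\<^sub>F q in near p. \<forall>f\<in>smooth_funs M. X f q = Y f q)"

end

section \<open>Linear connections in charts\<close>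

locale conn = mfld M B for M :: "('a, 'e::real_inner) manifold" and B :: "'e set" +
  fixes D :: "'a connection"
  assumes lc: "linear_connection M D"
begin

lemma D_vf [simp]: "X \<in> vfields M \<Longrightarrow> Y \<in> vfields M \<Longrightarrow> D X Y \<in> vfields M"
  using lc by (simp add: linear_connection_def)

lemma D_add1: "X \<in> vfields M \<Longrightarrow> Y \<in> vfields M \<Longrightarrow> Z \<in> vfields M \<Longrightarrow>
    D (vf_add M X Y) Z = vf_add M (D X Z) (D Y Z)"
  using lc unfolding linear_connection_def by blast

lemma D_add2: "X \<in> vfields M \<Longrightarrow> Y \<in> vfields M \<Longrightarrow> Z \<in> vfields M \<Longrightarrow>
    D X (vf_add M Y Z) = vf_add M (D X Y) (D X Z)"
  using lc unfolding linear_connection_def by blast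

lemma D_scale1: "X \<in> vfields M \<Longrightarrow> Y \<in> vfields M \<Longrightarrow> h \<in> smooth_funs M \<Longrightarrow>
    D (vf_scale M h X) Y = vf_scale M h (D X Y)"
  using lc unfolding linear_connection_def by blast

lemma D_scale2: "X \<in> vfields M \<Longrightarrow> Y \<in> vfields M \<Longrightarrow> h \<in> smooth_funs M \<Longrightarrow>
    D X (vf_scale M h Y) = vf_add M (vf_scale M (X h) Y) (vf_scale M h (D X Y))"
  using lc unfolding linear_connection_def by blast

text \<open>Scaling by the zero function lets the two scaling laws of \<open>D\<close> compute its
  values on the zero field.\<close>

lemma vf_zero_scale: "vf_zero M = vf_scale M (cst 0) (vf_zero M)"
  by (auto simp: vf_zero_def vf_scale_def cst_def fun_eq_iff)

lemma D_zero1: "Y \<in> vfields M \<Longrightarrow> f \<in> smooth_funs M \<Longrightarrow> p \<in> pts M \<Longrightarrow> D (vf_zero M) Y f p = 0"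
  by (subst vf_zero_scale) (simp add: D_scale1, simp add: cst_def)

lemma D_zero2: "X \<in> vfields M \<Longrightarrow> f \<in> smooth_funs M \<Longrightarrow> p \<in> pts M \<Longrightarrow> D X (vf_zero M) f p = 0"
  by (subst vf_zero_scale) (simp add: D_scale2 vf_cst, simp add: cst_def)

lemma D_sum1:
  assumes "finite I" "\<And>i. i \<in> I \<Longrightarrow> F i \<in> vfields M" "Y \<in> vfields M" "f \<in> smooth_funs M" "p \<in> pts M"
  shows "D (vf_sum I F) Y f p = (\<Sum>i\<in>I. D (F i) Y f p)"
  using assms
  by (induction I rule: finite_induct) (simp_all add: vf_sum_empty vf_sum_insert D_zero1 D_add1 vf_sumI)

lemma D_sum2:
  assumes "finite I" "\<And>i. i \<in> I \<Longrightarrow> F i \<in> vfields M" "X \<in> vfields M" "f \<in> smooth_funs M" "p \<in> pts M"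
  shows "D X (vf_sum I F) f p = (\<Sum>i\<in>I. D X (F i) f p)"
  using assms
  by (induction I rule: finite_induct) (simp_all add: vf_sum_empty vf_sum_insert D_zero2 D_add2 vf_sumI)

lemma vf_split: "X \<in> vfields M \<Longrightarrow> X' \<in> vfields M \<Longrightarrow> X = vf_add M X' (vf_diff M X X')"
  by (rule vf_eqI) simp_all

text \<open>If \<open>\<rho>\<close> is supported where two fields agree, their difference scaled by
  \<open>\<rho>\<close> is the zero field, and \<open>\<rho> p = 1\<close>. In the second argument
  the Leibniz rule leaves an extra term, which vanishes because the difference is zero at
  \<open>p\<close>.\<close>

lemma D_local:
  assumes X: "X \<in> vfields M" "X' \<in> vfields M" and Y: "Y \<in> vfields M" "Y' \<in> vfields M"
    and p: "p \<in> pts M" and aX: "vf_agree p X X'" and aY: "vf_agree p Y Y'" and f: "f \<in> smooth_funs M"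
  shows "D X Y f p = D X' Y' f p"
proof -
  have "\<forall>\<^sub>F q in near p. (\<forall>f\<in>smooth_funs M. X f q = X' f q) \<and> (\<forall>f\<in>smooth_funs M. Y f q = Y' f q)"
    using aX aY unfolding vf_agree_def by (rule eventually_conj)
  then obtain W where W: "openin (mtop M) W" "p \<in> W"
    "\<forall>q\<in>W. (\<forall>f\<in>smooth_funs M. X f q = X' f q) \<and> (\<forall>f\<in>smooth_funs M. Y f q = Y' f q)" "W \<subseteq> pts M"
    by (rule near_openE[OF p])
  obtain \<rho> K N where r: "\<rho> \<in> smooth_funs M" "closedin (mtop M) K" "K \<subseteq> W"
    "\<And>q. q \<in> pts M - K \<Longrightarrow> \<rho> q = 0" "openin (mtop M) N" "p \<in> N" "N \<subseteq> K" "\<And>q. q \<in> N \<Longrightarrow> \<rho> q = 1"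
    using cutoff[OF W(1,2)] by blast
  have z: "vf_scale M \<rho> (vf_diff M A A') = vf_zero M"
    if A: "A \<in> vfields M" "A' \<in> vfields M" "\<forall>q\<in>W. \<forall>f\<in>smooth_funs M. A f q = A' f q" for A A'
  proof (rule vf_eqI)
    fix f q assume "f \<in> smooth_funs M" "q \<in> pts M"
    then show "vf_scale M \<rho> (vf_diff M A A') f q = vf_zero M f q"
      using A(3) r(4)[of q] r(3) by (cases "q \<in> K") auto
  qed (use A r in simp_all)
  have rp: "\<rho> p = 1" using r by blast
  let ?Z = "vf_diff M X X'" and ?T = "vf_diff M Y Y'"
  have Z: "?Z \<in> vfields M" "?T \<in> vfields M" using X Y by simp_all
  have "D (vf_scale M \<rho> ?Z) Y f p = 0" using z[OF X] W(3) D_zero1[OF Y(1) f p] by simp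
  then have 1: "D ?Z Y f p = 0" using D_scale1[OF Z(1) Y(1) r(1)] f p rp by simp
  have "D X' (vf_scale M \<rho> ?T) f p = 0" using z[OF Y] W(3) D_zero2[OF X(2) f p] by simp
  moreover have "?T f p = 0" using W f p by simp
  ultimately have 2: "D X' ?T f p = 0" using D_scale2[OF X(2) Z(2) r(1)] f p rp by simp
  have "D X Y f p = D (vf_add M X' ?Z) Y f p" using vf_split[OF X] by simp
  also have "\<dots> = D X' Y f p" using D_add1[OF X(2) Z(1) Y(1)] 1 f p by simp
  also have "\<dots> = D X' (vf_add M Y' ?T) f p" using vf_split[OF Y] by simp
  also have "\<dots> = D X' Y' f p" using D_add2[OF X(2) Y(2) Z(2)] 2 f p by simp
  finally show ?thesis .
qed

text \<open>The components are extended from a neighbourhood of \<open>p\<close> to global smooth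
  functions, so that the axioms of a connection, which speak of global fields and functions, apply
  to the sum.\<close>

lemma frame_expansion:
  assumes c: "(U, \<phi>) \<in> atlas M" "p \<in> U" and X: "X \<in> vfields M" and E: "\<And>b. cfield U \<phi> (\<phi> p) b (E b)"
  shows "\<exists>x. (\<forall>b. x b \<in> smooth_funs M \<and> x b p = rep U \<phi> X (\<phi> p) \<bullet> b \<and>
      (\<forall>v. fd (x b \<circ> inv_into U \<phi>) (\<phi> p) v = fd (rep U \<phi> X) (\<phi> p) v \<bullet> b)) \<and>
    vf_agree p X (vf_sum B (\<lambda>b. vf_scale M (x b) (E b)))"
proof -
  have p: "p \<in> pts M" using c chart_sub by blast
  note fin = orthobasis_finite[OF onb]
  have "\<exists>x. x \<in> smooth_funs M \<and> (\<forall>\<^sub>F q in near p. x q = rep U \<phi> X (\<phi> q) \<bullet> b)" for b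
    by (rule extend_germ[OF p sfun_coord[OF c smooth_at_linear_compose[OF bounded_linear_inner_left[of b] rep_smooth[OF c X]]]]) blast
  then obtain x where x: "\<And>b. x b \<in> smooth_funs M" "\<And>b. \<forall>\<^sub>F q in near p. x b q = rep U \<phi> X (\<phi> q) \<bullet> b" by metis
  have Ev: "E b \<in> vfields M" for b using E cfield_vf by blast
  have S: "vf_sum B (\<lambda>b. vf_scale M (x b) (E b)) \<in> vfields M"
    by (rule vf_sumI[OF fin]) (simp add: x Ev)
  have "\<forall>\<^sub>F q in near p. \<forall>b\<in>B. x b q = rep U \<phi> X (\<phi> q) \<bullet> b \<and> rep U \<phi> (E b) (\<phi> q) = b"
    using x(2) near_chart[OF c, of "\<lambda>y. rep U \<phi> (E _) y = _"] E
    by (intro eventually_ball_finite[OF fin] ballI eventually_conj) (auto simp: cfield_def)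
  then have "vf_agree p X (vf_sum B (\<lambda>b. vf_scale M (x b) (E b)))"
    unfolding vf_agree_def using near_chart_dom[OF c] near_pts[OF p]
  proof eventually_elim
    case (elim q)
    show ?case
    proof
      fix f assume f: "f \<in> smooth_funs M"
      have "X f q = fd (f \<circ> inv_into U \<phi>) (\<phi> q) (rep U \<phi> X (\<phi> q))" by (rule vf_apply[OF c(1) elim(2) X f])
      also have "\<dots> = (\<Sum>b\<in>B. (rep U \<phi> X (\<phi> q) \<bullet> b) *\<^sub>R fd (f \<circ> inv_into U \<phi>) (\<phi> q) b)"
        by (rule orthobasis_linear[OF onb smooth_at_linear_fd[OF smooth_funs_smooth_at[OF f c(1) elim(2)]]])
      also have "\<dots> = (\<Sum>b\<in>B. x b q * E b f q)"
        using elim(1) by (intro sum.cong) (simp_all add: vf_apply[OF c(1) elim(2) Ev f])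
      finally show "X f q = vf_sum B (\<lambda>b. vf_scale M (x b) (E b)) f q" using f elim(3) by simp
    qed
  qed
  moreover have "fd (x b \<circ> inv_into U \<phi>) (\<phi> p) v = fd (rep U \<phi> X) (\<phi> p) v \<bullet> b" for b v
  proof -
    from near_chart_inv[OF c x(2)[of b]]
    have "\<forall>\<^sub>F y in nhds (\<phi> p). (x b \<circ> inv_into U \<phi>) y = rep U \<phi> X y \<bullet> b"
      by eventually_elim (auto simp: f_inv_into_f)
    then have "fd (x b \<circ> inv_into U \<phi>) (\<phi> p) = fd (\<lambda>y. rep U \<phi> X y \<bullet> b) (\<phi> p)" by (rule fd_cong_ev)
    then show ?thesis using fd_inner[OF smooth_at_differentiable[OF rep_smooth[OF c X]]] by simp
  qed
  ultimately show ?thesis using x(1) near_self[OF p x(2)] by (intro exI[of _ x]) simp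
qed

text \<open>By locality both fields may be replaced by their frame expansions. The Leibniz rule
  gives the derivative of the components of \<open>Y\<close>, and the products of the frame fields
  remain.\<close>

lemma conn_frame:
  assumes c: "(U, \<phi>) \<in> atlas M" "p \<in> U" and X: "X \<in> vfields M" and Y: "Y \<in> vfields M"
    and E: "\<And>b. cfield U \<phi> (\<phi> p) b (E b)"
  shows "rep U \<phi> (D X Y) (\<phi> p) = fd (rep U \<phi> Y) (\<phi> p) (rep U \<phi> X (\<phi> p)) +
    (\<Sum>b\<in>B. \<Sum>b'\<in>B. ((rep U \<phi> X (\<phi> p) \<bullet> b) * (rep U \<phi> Y (\<phi> p) \<bullet> b')) *\<^sub>R rep U \<phi> (D (E b) (E b')) (\<phi> p))"
proof (rule rep_unique[OF c D_vf[OF X Y]])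
  have p: "p \<in> pts M" using c chart_sub by blast
  note fin = orthobasis_finite[OF onb]
  have Ev: "E b \<in> vfields M" for b using E cfield_vf by blast
  from frame_expansion[OF c X E] obtain x where x': "\<forall>b. x b \<in> smooth_funs M \<and> x b p = rep U \<phi> X (\<phi> p) \<bullet> b \<and>
      (\<forall>v. fd (x b \<circ> inv_into U \<phi>) (\<phi> p) v = fd (rep U \<phi> X) (\<phi> p) v \<bullet> b)"
    and xa: "vf_agree p X (vf_sum B (\<lambda>b. vf_scale M (x b) (E b)))"
    by (elim exE conjE)
  from frame_expansion[OF c Y E] obtain y where y': "\<forall>b. y b \<in> smooth_funs M \<and> y b p = rep U \<phi> Y (\<phi> p) \<bullet> b \<and>
      (\<forall>v. fd (y b \<circ> inv_into U \<phi>) (\<phi> p) v = fd (rep U \<phi> Y) (\<phi> p) v \<bullet> b)"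
    and ya: "vf_agree p Y (vf_sum B (\<lambda>b. vf_scale M (y b) (E b)))"
    by (elim exE conjE)
  have x: "x b \<in> smooth_funs M" "x b p = rep U \<phi> X (\<phi> p) \<bullet> b" for b using x' by simp_all
  have y: "y b \<in> smooth_funs M" "y b p = rep U \<phi> Y (\<phi> p) \<bullet> b"
    "fd (y b \<circ> inv_into U \<phi>) (\<phi> p) v = fd (rep U \<phi> Y) (\<phi> p) v \<bullet> b" for b v using y' by simp_all
  fix f assume f: "f \<in> smooth_funs M"
  let ?F = "fd (f \<circ> inv_into U \<phi>) (\<phi> p)"
  have lF: "linear ?F" by (rule smooth_at_linear_fd[OF smooth_funs_smooth_at[OF f c]])
  let ?SX = "vf_sum B (\<lambda>b. vf_scale M (x b) (E b))" and ?SY = "vf_sum B (\<lambda>b. vf_scale M (y b) (E b))"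
  have SX: "?SX \<in> vfields M" by (rule vf_sumI[OF fin]) (simp add: x Ev)
  have SY: "?SY \<in> vfields M" by (rule vf_sumI[OF fin]) (simp add: y Ev)
  have axX: "vf_agree p X X" by (simp add: vf_agree_def)
  have "D X Y f p = D X ?SY f p" by (rule D_local[OF X X Y SY p axX ya f])
  also have "\<dots> = (\<Sum>b'\<in>B. D X (vf_scale M (y b') (E b')) f p)"
    by (rule D_sum2[OF fin _ X f p]) (simp add: y Ev)
  also have "\<dots> = (\<Sum>b'\<in>B. (fd (rep U \<phi> Y) (\<phi> p) (rep U \<phi> X (\<phi> p)) \<bullet> b') * ?F b' +
      (\<Sum>b\<in>B. (rep U \<phi> X (\<phi> p) \<bullet> b) * (rep U \<phi> Y (\<phi> p) \<bullet> b') * ?F (rep U \<phi> (D (E b) (E b')) (\<phi> p))))"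
  proof (rule sum.cong[OF refl])
    fix b' assume "b' \<in> B"
    have 1: "X (y b') p = fd (rep U \<phi> Y) (\<phi> p) (rep U \<phi> X (\<phi> p)) \<bullet> b'"
      by (simp only: vf_apply[OF c X y(1)] y(3))
    have 2: "E b' f p = ?F b'" by (simp only: vf_apply[OF c Ev f] cfield_rep[OF E])
    have "D X (E b') f p = D ?SX (E b') f p"
      by (rule D_local[OF X SX Ev Ev p xa _ f]) (simp add: vf_agree_def)
    also have "\<dots> = (\<Sum>b\<in>B. D (vf_scale M (x b) (E b)) (E b') f p)"
      by (rule D_sum1[OF fin _ Ev f p]) (simp add: x Ev)
    also have "\<dots> = (\<Sum>b\<in>B. (rep U \<phi> X (\<phi> p) \<bullet> b) * ?F (rep U \<phi> (D (E b) (E b')) (\<phi> p)))"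
      by (simp add: D_scale1[OF Ev Ev x(1)] f p x(2) vf_apply[OF c D_vf[OF Ev Ev] f])
    finally have 3: "D X (E b') f p = (\<Sum>b\<in>B. (rep U \<phi> X (\<phi> p) \<bullet> b) * ?F (rep U \<phi> (D (E b) (E b')) (\<phi> p)))" .
    show "D X (vf_scale M (y b') (E b')) f p = (fd (rep U \<phi> Y) (\<phi> p) (rep U \<phi> X (\<phi> p)) \<bullet> b') * ?F b' +
      (\<Sum>b\<in>B. (rep U \<phi> X (\<phi> p) \<bullet> b) * (rep U \<phi> Y (\<phi> p) \<bullet> b') * ?F (rep U \<phi> (D (E b) (E b')) (\<phi> p)))"
      by (simp add: D_scale2[OF X Ev y(1)] f p 1 2 3 y(2) sum_distrib_left mult_ac)
  qed
  also have "\<dots> = ?F (fd (rep U \<phi> Y) (\<phi> p) (rep U \<phi> X (\<phi> p))) + (\<Sum>b'\<in>B. \<Sum>b\<in>B. (rep U \<phi> X (\<phi> p) \<bullet> b) * (rep U \<phi> Y (\<phi> p) \<bullet> b') * ?F (rep U \<phi> (D (E b) (E b')) (\<phi> p)))"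
    using orthobasis_linear[OF onb lF, of "fd (rep U \<phi> Y) (\<phi> p) (rep U \<phi> X (\<phi> p))"]
    by (simp add: sum.distrib)
  also have "\<dots> = ?F (fd (rep U \<phi> Y) (\<phi> p) (rep U \<phi> X (\<phi> p)) +
    (\<Sum>b\<in>B. \<Sum>b'\<in>B. ((rep U \<phi> X (\<phi> p) \<bullet> b) * (rep U \<phi> Y (\<phi> p) \<bullet> b')) *\<^sub>R rep U \<phi> (D (E b) (E b')) (\<phi> p)))"
    by (subst sum.swap) (simp add: linear_add[OF lF] linear_sum[OF lF] linear_scale[OF lF])
  finally show "D X Y f p = \<dots>" .
qed

definition const_frame :: "'a set \<Rightarrow> ('a \<Rightarrow> 'e) \<Rightarrow> 'e \<Rightarrow> 'e \<Rightarrow> 'a vfield" where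
  "const_frame U \<phi> x b = (SOME E. cfield U \<phi> x b E)"

text \<open>The Christoffel symbols of a chart. Only the values of the frame near \<open>x\<close> matter.\<close>

definition chr :: "'a set \<Rightarrow> ('a \<Rightarrow> 'e) \<Rightarrow> 'e \<Rightarrow> 'e \<Rightarrow> 'e \<Rightarrow> 'e" where
  "chr U \<phi> x u v = (\<Sum>b\<in>B. \<Sum>b'\<in>B. ((u \<bullet> b) * (v \<bullet> b')) *\<^sub>R rep U \<phi> (D (const_frame U \<phi> x b) (const_frame U \<phi> x b')) x)"

lemma const_frame: "(U, \<phi>) \<in> atlas M \<Longrightarrow> p \<in> U \<Longrightarrow> cfield U \<phi> (\<phi> p) b (const_frame U \<phi> (\<phi> p) b)"
  unfolding const_frame_def by (rule someI_ex[OF cfield_exists])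

lemma chr_bilinear: "bilinear (chr U \<phi> x)"
  unfolding bilinear_def chr_def
  by (intro allI conjI linearI)
    (simp_all add: inner_add_left algebra_simps sum.distrib scaleR_sum_right)

lemma rep_conn:
  assumes c: "(U, \<phi>) \<in> atlas M" "p \<in> U" and X: "X \<in> vfields M" and Y: "Y \<in> vfields M"
  shows "rep U \<phi> (D X Y) (\<phi> p) = fd (rep U \<phi> Y) (\<phi> p) (rep U \<phi> X (\<phi> p)) +
    chr U \<phi> (\<phi> p) (rep U \<phi> X (\<phi> p)) (rep U \<phi> Y (\<phi> p))"
  unfolding chr_def by (rule conn_frame[OF c X Y const_frame[OF c]])

lemma rep_conn_const:
  assumes c: "(U, \<phi>) \<in> atlas M" "p \<in> U" and E: "cfield U \<phi> (\<phi> p) u E" and E': "cfield U \<phi> (\<phi> p) v E'"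
  shows "rep U \<phi> (D E E') (\<phi> p) = chr U \<phi> (\<phi> p) u v"
proof -
  have "fd (rep U \<phi> E') (\<phi> p) = fd (\<lambda>_. v) (\<phi> p)"
    using E' by (intro fd_cong_ev) (simp add: cfield_def)
  then show ?thesis
    using rep_conn[OF c cfield_vf[OF E] cfield_vf[OF E']] cfield_rep[OF E] cfield_rep[OF E'] by simp
qed

text \<open>\<open>const_frame\<close> is chosen separately at every point, but by
  \<open>rep_conn_const\<close> the fixed fields \<open>E\<close> and \<open>E'\<close> compute the
  symbols at all points near \<open>\<phi> p\<close>.\<close>

lemma chr_smooth:
  assumes c: "(U, \<phi>) \<in> atlas M" "p \<in> U"
  shows "smooth_at (\<lambda>x. chr U \<phi> x u v) (\<phi> p)"
proof -
  obtain E E' where E: "cfield U \<phi> (\<phi> p) u E" "cfield U \<phi> (\<phi> p) v E'" using cfield_exists[OF c] by blast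
  have "\<forall>\<^sub>F x in nhds (\<phi> p). x \<in> \<phi> ` U \<and> True" by (rule near_chart_inv[OF c]) simp
  then have "\<forall>\<^sub>F x in nhds (\<phi> p). rep U \<phi> (D E E') x = chr U \<phi> x u v"
    using cfield_near[OF E(1)] cfield_near[OF E(2)]
  proof eventually_elim
    case (elim x)
    then obtain q where q: "q \<in> U" "x = \<phi> q" by blast
    show ?case using rep_conn_const[OF c(1) q(1)] elim(2,3) unfolding q(2) by blast
  qed
  then show ?thesis
    by (rule smooth_at_cong_ev[OF _ rep_smooth[OF c D_vf[OF cfield_vf[OF E(1)] cfield_vf[OF E(2)]]]])
qed

end

section \<open>Flat Christoffel symbols on an open set\<close>

lemma fd_add: "smooth_at f x \<Longrightarrow> smooth_at g x \<Longrightarrow> fd (\<lambda>y. f y + g y) x v = fd f x v + fd g x v"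
  using fd_eq[OF has_derivative_add[OF smooth_at_has_derivative smooth_at_has_derivative], of f x g] by simp

text \<open>The situation inside one chart: \<open>sym\<close> is vanishing torsion and
  \<open>flat\<close> is vanishing curvature, both on coordinate fields.\<close>

locale christoffel =
  fixes B :: "'e::real_inner set" and S :: "'e set" and G :: "'e \<Rightarrow> 'e \<Rightarrow> 'e \<Rightarrow> 'e"
  assumes basis: "orthobasis B" and S: "open S" and bil: "\<And>x. bilinear (G x)"
    and G_smooth: "\<And>x u v. x \<in> S \<Longrightarrow> smooth_at (\<lambda>x. G x u v) x"
    and sym: "\<And>x u v. x \<in> S \<Longrightarrow> G x u v = G x v u"
    and flat: "\<And>x u v w. x \<in> S \<Longrightarrow> fd (\<lambda>y. G y v w) x u + G x u (G x v w) = fd (\<lambda>y. G y u w) x v + G x v (G x u w)"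
begin

text \<open>The endomorphism \<open>u \<mapsto> \<nabla>\<^sub>u f\<close> at \<open>x\<close> in
  coordinates.\<close>

definition cov_deriv :: "('e \<Rightarrow> 'e) \<Rightarrow> 'e \<Rightarrow> 'e \<Rightarrow> 'e" where
  "cov_deriv f x u = fd f x u + G x u (f x)"

text \<open>The Lie derivative along \<open>f\<close> of the connection with Christoffel symbols \<open>G\<close> vanishes.\<close>

definition affine_eq :: "('e \<Rightarrow> 'e) \<Rightarrow> 'e \<Rightarrow> bool" where
  "affine_eq f x \<longleftrightarrow> (\<forall>u w. fd (\<lambda>y. fd f y u) x w + fd (\<lambda>y. G y w u) x (f x) + G x (fd f x w) u + G x w (fd f x u)
     = fd f x (G x w u))"

text \<open>With \<open>A\<close> for \<open>cov_deriv f\<close> this is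
  \<open>\<nabla>\<^sub>w (A u) = A (\<nabla>\<^sub>w u)\<close> for constant \<open>u\<close>, that
  is, the covariant derivative of the endomorphism field vanishes.\<close>

definition parallel_deriv :: "('e \<Rightarrow> 'e) \<Rightarrow> 'e \<Rightarrow> bool" where
  "parallel_deriv f x \<longleftrightarrow> (\<forall>u w. fd (\<lambda>y. cov_deriv f y u) x w + G x w (cov_deriv f x u) = cov_deriv f x (G x w u))"

lemma eventually_S: "x \<in> S \<Longrightarrow> \<forall>\<^sub>F y in nhds x. y \<in> S"
  using S by (auto simp: eventually_nhds)

lemma G_linear: "linear (G x u)" "linear (\<lambda>u. G x u v)"
  using bil[of x] by (simp_all add: bilinear_def)

lemma cov_deriv_linear: "smooth_at f x \<Longrightarrow> linear (cov_deriv f x)"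
  unfolding cov_deriv_def by (intro linear_compose_add smooth_at_linear_fd G_linear(2))

lemma fd_cov_deriv:
  assumes x: "x \<in> S" and f: "smooth_at f x"
  shows "smooth_at (\<lambda>y. cov_deriv f y u) x"
    and "fd (\<lambda>y. cov_deriv f y u) x w = fd (\<lambda>y. fd f y u) x w + (fd (\<lambda>y. G y u (f x)) x w + G x u (fd f x w))"
proof -
  have l: "\<forall>\<^sub>F y in nhds x. linear (G y u)" by (rule always_eventually) (simp add: G_linear)
  note * = linear_family[OF basis l G_smooth[OF x] f]
  show "smooth_at (\<lambda>y. cov_deriv f y u) x"
    unfolding cov_deriv_def by (rule smooth_at_add[OF smooth_at_fd[OF f] *(1)])
  have "fd (\<lambda>y. cov_deriv f y u) x w = fd (\<lambda>y. fd f y u) x w + fd (\<lambda>y. G y u (f y)) x w"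
    unfolding cov_deriv_def by (rule fd_add[OF smooth_at_fd[OF f] *(1)])
  then show "fd (\<lambda>y. cov_deriv f y u) x w = fd (\<lambda>y. fd f y u) x w + (fd (\<lambda>y. G y u (f x)) x w + G x u (fd f x w))"
    by (simp add: *(2))
qed

text \<open>The defects of the two equations are equal term by term once the derivative of
  \<open>G\<close> and the iterated \<open>G\<close> are exchanged by flatness and symmetry.\<close>

lemma affine_eq_iff_parallel:
  assumes x: "x \<in> S" and f: "smooth_at f x"
  shows "affine_eq f x \<longleftrightarrow> parallel_deriv f x"
proof -
  \<comment> \<open>The symmetry of \<open>G\<close> holds near \<open>x\<close>, since
    \<open>S\<close> is open, and may be differentiated.\<close>
  have ds: "fd (\<lambda>y. G y u v) x w = fd (\<lambda>y. G y v u) x w" for u v w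
    using eventually_S[OF x] by (intro fun_cong[OF fd_cong_ev]) (auto elim!: eventually_mono simp: sym)
  have "fd (\<lambda>y. cov_deriv f y u) x w + G x w (cov_deriv f x u) - cov_deriv f x (G x w u) =
      fd (\<lambda>y. fd f y u) x w + fd (\<lambda>y. G y w u) x (f x) + G x (fd f x w) u + G x w (fd f x u) - fd f x (G x w u)" for u w
  proof -
    have "G x w (cov_deriv f x u) = G x w (fd f x u) + G x w (G x u (f x))"
      by (simp add: cov_deriv_def linear_add[OF G_linear(1)])
    \<comment> \<open>Flatness for the pair of directions \<open>w\<close> and \<open>f x\<close>
      trades the derivative of \<open>G\<close> along \<open>w\<close> for the one along
      \<open>f x\<close> that occurs in \<open>affine_eq\<close>.\<close>
    moreover have "fd (\<lambda>y. G y u (f x)) x w + G x w (G x u (f x)) = fd (\<lambda>y. G y w u) x (f x) + G x (f x) (G x w u)"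
      using flat[OF x, of "f x" u w] ds[of u "f x"] sym[OF x, of "f x" u] by simp
    ultimately show ?thesis
      unfolding fd_cov_deriv(2)[OF x f]
      using sym[OF x, of u "fd f x w"] sym[OF x, of "f x" "G x w u"]
      unfolding cov_deriv_def by (simp add: algebra_simps)
  qed
  then show ?thesis unfolding affine_eq_def parallel_deriv_def by (metis (no_types, lifting) eq_iff_diff_eq_0)
qed

lemma affine_eq_cong:
  assumes e: "\<forall>\<^sub>F y in nhds x. f y = g y"
  shows "affine_eq f x \<longleftrightarrow> affine_eq g x"
proof -
  have "\<forall>\<^sub>F y in nhds x. \<forall>\<^sub>F z in nhds y. f z = g z" using e by (simp add: eventually_eventually)
  then have "\<forall>\<^sub>F y in nhds x. fd f y u = fd g y u" for u
    by eventually_elim (simp add: fd_cong_ev)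
  then have "fd (\<lambda>y. fd f y u) x = fd (\<lambda>y. fd g y u) x" for u by (rule fd_cong_ev)
  then show ?thesis
    unfolding affine_eq_def by (simp add: fd_cong_ev[OF e] eventually_nhds_x_imp_x[OF e])
qed

text \<open>Product rule for evaluating an endomorphism field on a vector field; the term in which
  the endomorphism is differentiated vanishes because it is parallel.\<close>

lemma cov_deriv_comp:
  assumes x: "x \<in> S" and f: "smooth_at f x" and g: "smooth_at g x" and pg: "parallel_deriv g x"
  shows "smooth_at (\<lambda>y. cov_deriv g y (f y)) x" and "cov_deriv (\<lambda>y. cov_deriv g y (f y)) x u = cov_deriv g x (cov_deriv f x u)"
proof -
  have l: "\<forall>\<^sub>F y in nhds x. linear (cov_deriv g y)"
    using near_smooth_at[OF g] by eventually_elim (rule cov_deriv_linear)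
  note * = linear_family[OF basis l fd_cov_deriv(1)[OF x g] f]
  show "smooth_at (\<lambda>y. cov_deriv g y (f y)) x" by (rule *(1))
  have "fd (\<lambda>y. cov_deriv g y (f x)) x u = cov_deriv g x (G x u (f x)) - G x u (cov_deriv g x (f x))"
    using pg unfolding parallel_deriv_def by (metis add_diff_cancel_right')
  then have "cov_deriv (\<lambda>y. cov_deriv g y (f y)) x u = cov_deriv g x (G x u (f x)) + cov_deriv g x (fd f x u)"
    by (simp add: cov_deriv_def[of "\<lambda>y. cov_deriv g y (f y)"] *(2))
  then show "cov_deriv (\<lambda>y. cov_deriv g y (f y)) x u = cov_deriv g x (cov_deriv f x u)"
    by (simp add: cov_deriv_def[of f] linear_add[OF cov_deriv_linear[OF g]])
qed

text \<open>By \<open>cov_deriv_comp\<close> the endomorphism in question is a composition of two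
  parallel ones, and the product rule shows such a composition to be parallel.\<close>

lemma parallel_comp:
  assumes f: "\<And>x. x \<in> S \<Longrightarrow> smooth_at f x \<and> parallel_deriv f x" and g: "\<And>x. x \<in> S \<Longrightarrow> smooth_at g x \<and> parallel_deriv g x"
    and x: "x \<in> S"
  shows "parallel_deriv (\<lambda>y. cov_deriv g y (f y)) x"
  unfolding parallel_deriv_def
proof (intro allI)
  fix u w
  have fx: "smooth_at f x" "smooth_at g x" "parallel_deriv f x" "parallel_deriv g x" using f[OF x] g[OF x] by auto
  have l: "\<forall>\<^sub>F y in nhds x. linear (cov_deriv g y)"
    using near_smooth_at[OF fx(2)] by eventually_elim (rule cov_deriv_linear)
  have "\<forall>\<^sub>F y in nhds x. cov_deriv (\<lambda>y. cov_deriv g y (f y)) y u = cov_deriv g y (cov_deriv f y u)"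
    using eventually_S[OF x] by eventually_elim (use f g in \<open>auto intro: cov_deriv_comp(2)\<close>)
  then have "fd (\<lambda>y. cov_deriv (\<lambda>y. cov_deriv g y (f y)) y u) x = fd (\<lambda>y. cov_deriv g y (cov_deriv f y u)) x" by (rule fd_cong_ev)
  then have 1: "fd (\<lambda>y. cov_deriv (\<lambda>y. cov_deriv g y (f y)) y u) x w
      = fd (\<lambda>y. cov_deriv g y (cov_deriv f x u)) x w + cov_deriv g x (fd (\<lambda>y. cov_deriv f y u) x w)"
    by (simp only: linear_family(2)[OF basis l fd_cov_deriv(1)[OF x fx(2)] fd_cov_deriv(1)[OF x fx(1)]])
  have 2: "fd (\<lambda>y. cov_deriv f y u) x w = cov_deriv f x (G x w u) - G x w (cov_deriv f x u)"
    using fx(3) unfolding parallel_deriv_def by (metis add_diff_cancel_right')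
  have 3: "fd (\<lambda>y. cov_deriv g y (cov_deriv f x u)) x w = cov_deriv g x (G x w (cov_deriv f x u)) - G x w (cov_deriv g x (cov_deriv f x u))"
    using fx(4) unfolding parallel_deriv_def by (metis add_diff_cancel_right')
  show "fd (\<lambda>y. cov_deriv (\<lambda>y. cov_deriv g y (f y)) y u) x w + G x w (cov_deriv (\<lambda>y. cov_deriv g y (f y)) x u) =
      cov_deriv (\<lambda>y. cov_deriv g y (f y)) x (G x w u)"
    unfolding 1 2 3 cov_deriv_comp(2)[OF x fx(1,2,4)] linear_diff[OF cov_deriv_linear[OF fx(2)]] by simp
qed

end

section \<open>Flat connections and affine fields in charts\<close>

locale flat_conn = conn M B D for M :: "('a, 'e::real_inner) manifold" and B D +
  assumes fl: "flat_affine_connection M D"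
begin

text \<open>Torsion evaluated on coordinate fields, whose bracket vanishes at the point.\<close>

lemma chr_sym:
  assumes c: "(U, \<phi>) \<in> atlas M" "p \<in> U"
  shows "chr U \<phi> (\<phi> p) u v = chr U \<phi> (\<phi> p) v u"
proof -
  obtain E E' where E: "cfield U \<phi> (\<phi> p) u E" "cfield U \<phi> (\<phi> p) v E'" using cfield_exists[OF c] by blast
  note V = cfield_vf[OF E(1)] cfield_vf[OF E(2)]
  have d: "fd (rep U \<phi> E') (\<phi> p) = fd (\<lambda>_. v) (\<phi> p)" "fd (rep U \<phi> E) (\<phi> p) = fd (\<lambda>_. u) (\<phi> p)"
    using E by (intro fd_cong_ev; simp add: cfield_def)+
  have "torsion M D E E' = vf_zero M" using fl V unfolding flat_affine_connection_def by blast
  then have "rep U \<phi> (torsion M D E E') (\<phi> p) = 0" by (simp add: rep_zero[OF c])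
  then show ?thesis
    unfolding torsion_def
    by (simp add: rep_diff[OF c] V rep_bracket[OF c] d rep_conn_const[OF c E(1) E(2)] rep_conn_const[OF c E(2) E(1)])
qed

text \<open>Curvature evaluated on coordinate fields. For the term with the bracket it suffices that
  the bracket vanishes at the point, since by \<open>rep_conn\<close> only the value of the first
  argument there enters.\<close>

lemma chr_flat:
  assumes c: "(U, \<phi>) \<in> atlas M" "p \<in> U"
  shows "fd (\<lambda>y. chr U \<phi> y v w) (\<phi> p) u + chr U \<phi> (\<phi> p) u (chr U \<phi> (\<phi> p) v w) =
    fd (\<lambda>y. chr U \<phi> y u w) (\<phi> p) v + chr U \<phi> (\<phi> p) v (chr U \<phi> (\<phi> p) u w)"
proof -
  have "\<exists>E. cfield U \<phi> (\<phi> p) b E" for b by (rule cfield_exists[OF c])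
  then obtain E where E: "\<And>b. cfield U \<phi> (\<phi> p) b (E b)" by metis
  have V: "E b \<in> vfields M" for b by (rule cfield_vf[OF E])
  have d: "fd (rep U \<phi> (E b)) (\<phi> p) = fd (\<lambda>_. b) (\<phi> p)" for b
    using E[of b] by (intro fd_cong_ev) (simp add: cfield_def)
  have "\<forall>\<^sub>F x in nhds (\<phi> p). x \<in> \<phi> ` U \<and> True" by (rule near_chart_inv[OF c]) simp
  then have e: "\<forall>\<^sub>F x in nhds (\<phi> p). rep U \<phi> (D (E a) (E b)) x = chr U \<phi> x a b" for a b
    using cfield_near[OF E, of a] cfield_near[OF E, of b]
  proof eventually_elim
    case (elim x)
    then obtain q where q: "q \<in> U" "x = \<phi> q" by blast
    show ?case using rep_conn_const[OF c(1) q(1)] elim(2,3) unfolding q(2) by blast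
  qed
  have DD: "rep U \<phi> (D (E a) (D (E b) (E w))) (\<phi> p) =
      fd (\<lambda>y. chr U \<phi> y b w) (\<phi> p) a + chr U \<phi> (\<phi> p) a (chr U \<phi> (\<phi> p) b w)" for a b
    unfolding rep_conn[OF c V D_vf[OF V V]] cfield_rep[OF E] rep_conn_const[OF c E E] fd_cong_ev[OF e] ..
  have br: "rep U \<phi> (vf_bracket M (E u) (E v)) (\<phi> p) = 0"
    by (simp add: rep_bracket[OF c V V] d)
  have "rep U \<phi> (D (vf_bracket M (E u) (E v)) (E w)) (\<phi> p) = 0"
    using chr_bilinear[of U \<phi> "\<phi> p"] unfolding rep_conn[OF c vf_bracketI[OF V V] V] br
    by (simp add: d bilinear_lzero)
  moreover have "curvature M D (E u) (E v) (E w) = vf_zero M"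
    using fl V unfolding flat_affine_connection_def by blast
  then have "rep U \<phi> (curvature M D (E u) (E v) (E w)) (\<phi> p) = 0" by (simp add: rep_zero[OF c])
  ultimately show ?thesis
    unfolding curvature_def by (simp add: rep_diff[OF c] V DD)
qed

lemma chr_christoffel:
  assumes c: "(U, \<phi>) \<in> atlas M"
  shows "christoffel B (\<phi> ` U) (chr U \<phi>)"
proof
  show "open (\<phi> ` U)" by (rule chart_open_image[OF c])
qed (use onb chr_bilinear chr_smooth[OF c] chr_sym[OF c] chr_flat[OF c] in auto)

text \<open>The workable description of the Lie algebra; \<open>inf_affine_iff\<close> identifies it
  with \<open>inf_affine M D\<close> on a compact manifold.\<close>

definition affine_vf :: "'a vfield \<Rightarrow> bool" where
  "affine_vf X \<longleftrightarrow> X \<in> vfields M \<and>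
     (\<forall>U \<phi> p. (U, \<phi>) \<in> atlas M \<longrightarrow> p \<in> U \<longrightarrow> christoffel.affine_eq (chr U \<phi>) (rep U \<phi> X) (\<phi> p))"

text \<open>In a chart \<open>D X Y\<close> is the endomorphism of \<open>Y\<close> applied to
  \<open>X\<close>, which is the expression in \<open>parallel_comp\<close>;
  \<open>affine_eq_iff_parallel\<close> translates in both directions.\<close>

lemma affine_vf_product:
  assumes X: "affine_vf X" and Y: "affine_vf Y"
  shows "affine_vf (D X Y)"
  unfolding affine_vf_def
proof (intro conjI allI impI)
  have V: "X \<in> vfields M" "Y \<in> vfields M" using X Y by (simp_all add: affine_vf_def)
  show "D X Y \<in> vfields M" using V by simp
  fix U \<phi> p assume c: "(U, \<phi>) \<in> atlas M" "p \<in> U"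
  interpret christoffel B "\<phi> ` U" "chr U \<phi>" by (rule chr_christoffel[OF c(1)])
  have s: "smooth_at (rep U \<phi> Z) x" if "x \<in> \<phi> ` U" "Z \<in> vfields M" for x Z
    using that rep_smooth[OF c(1)] by blast
  have p: "smooth_at (rep U \<phi> Z) x \<and> parallel_deriv (rep U \<phi> Z) x" if "x \<in> \<phi> ` U" "affine_vf Z" for x Z
    using that s affine_eq_iff_parallel c(1) unfolding affine_vf_def by blast
  have ip: "\<phi> p \<in> \<phi> ` U" using c by blast
  have par: "parallel_deriv (\<lambda>y. cov_deriv (rep U \<phi> Y) y (rep U \<phi> X y)) (\<phi> p)"
    by (rule parallel_comp[OF p[OF _ X] p[OF _ Y] ip])
  have sm: "smooth_at (\<lambda>y. cov_deriv (rep U \<phi> Y) y (rep U \<phi> X y)) (\<phi> p)"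
    using cov_deriv_comp(1)[OF ip] p[OF ip X] p[OF ip Y] by blast
  have e: "\<forall>\<^sub>F x in nhds (\<phi> p). cov_deriv (rep U \<phi> Y) x (rep U \<phi> X x) = rep U \<phi> (D X Y) x"
    using eventually_S[OF ip]
  proof eventually_elim
    case (elim x)
    then obtain q where q: "q \<in> U" "x = \<phi> q" by blast
    show ?case unfolding q(2) rep_conn[OF c(1) q(1) V] cov_deriv_def ..
  qed
  have "affine_eq (\<lambda>y. cov_deriv (rep U \<phi> Y) y (rep U \<phi> X y)) (\<phi> p)"
    using affine_eq_iff_parallel[OF ip sm] par by simp
  then show "affine_eq (rep U \<phi> (D X Y)) (\<phi> p)" by (simp add: affine_eq_cong[OF e])
qed

end

section \<open>Smooth maps and products\<close>

locale mfld2 = M: mfld M A + N: mfld N B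
  for M :: "('a, 'e::real_inner) manifold" and A :: "'e set"
    and N :: "('b, 'f::real_inner) manifold" and B :: "'f set"
begin

lemma smooth_map_pts: "smooth_map M N F \<Longrightarrow> p \<in> pts M \<Longrightarrow> F p \<in> pts N"
  by (auto simp: smooth_map_def continuous_map_def)

lemma preimage_near:
  assumes F: "continuous_map (mtop M) (mtop N) F" and p: "p \<in> pts M" and P: "eventually P (nhdsin (mtop N) (F p))"
  shows "\<forall>\<^sub>F q in nhdsin (mtop M) p. P (F q)"
proof -
  have Fp: "F p \<in> pts N" using F p by (auto simp: continuous_map_def)
  obtain W where W: "openin (mtop N) W" "F p \<in> W" "\<forall>q\<in>W. P q" "W \<subseteq> pts N" by (rule N.near_openE[OF Fp P])
  have "openin (mtop M) {q \<in> pts M. F q \<in> W}" using F W(1) by (rule openin_continuous_map_preimage)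
  then show ?thesis by (rule M.near_openI) (use p W in auto)
qed

lemma smooth_map_at:
  assumes F: "smooth_map M N F" and c: "(U, \<phi>) \<in> atlas M" "p \<in> U" and d: "(V, \<psi>) \<in> atlas N" "F p \<in> V"
  shows "smooth_at (\<psi> \<circ> F \<circ> inv_into U \<phi>) (\<phi> p)"
proof -
  have p: "p \<in> pts M" using c M.chart_sub by blast
  have "openin (mtop M) {q \<in> pts M. F q \<in> V}"
    using F N.chart_open[OF d(1)] by (auto simp: smooth_map_def intro: openin_continuous_map_preimage)
  then have "openin (mtop M) (U \<inter> {q \<in> pts M. F q \<in> V})" using M.chart_open[OF c(1)] by blast
  moreover have "U \<inter> {q \<in> pts M. F q \<in> V} = U \<inter> F -` V" using M.chart_sub[OF c(1)] by auto
  ultimately have "open (\<phi> ` (U \<inter> F -` V))" using M.chart_image_open[OF c(1)] by simp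
  moreover have "smooth_on (\<phi> ` (U \<inter> F -` V)) (\<psi> \<circ> F \<circ> inv_into U \<phi>)"
    using F c d unfolding smooth_map_def by blast
  ultimately show ?thesis using c d by (auto simp: smooth_on_iff)
qed

lemma smooth_map_sfun:
  assumes F: "smooth_map M N F" and p: "p \<in> pts M" and f: "N.sfun f (F p)"
  shows "M.sfun (\<lambda>q. f (F q)) p"
proof -
  obtain U \<phi> where c: "(U, \<phi>) \<in> atlas M" "p \<in> U" using M.chart_exists[OF p] by blast
  obtain V \<psi> where d: "(V, \<psi>) \<in> atlas N" "F p \<in> V" "smooth_at (f \<circ> inv_into V \<psi>) (\<psi> (F p))"
    using f by (auto simp: N.sfun_def)
  have sm: "smooth_at (\<lambda>x. (f \<circ> inv_into V \<psi>) ((\<psi> \<circ> F \<circ> inv_into U \<phi>) x)) (\<phi> p)"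
    by (rule smooth_at_compose[OF N.onb smooth_map_at[OF F c d(1,2)]]) (use c d in \<open>simp add: o_def\<close>)
  have Fc: "continuous_map (mtop M) (mtop N) F" using F by (simp add: smooth_map_def)
  from M.near_chart_inv[OF c preimage_near[OF Fc p N.near_chart_dom[OF d(1,2)]]]
  have "\<forall>\<^sub>F x in nhds (\<phi> p). (f \<circ> inv_into V \<psi>) ((\<psi> \<circ> F \<circ> inv_into U \<phi>) x) = ((\<lambda>q. f (F q)) \<circ> inv_into U \<phi>) x"
    by eventually_elim (use d in auto)
  from smooth_at_cong_ev[OF this sm] show ?thesis unfolding M.sfun_chart[OF c] .
qed

lemma smooth_map_funs: "smooth_map M N F \<Longrightarrow> f \<in> smooth_funs N \<Longrightarrow> (\<lambda>p\<in>pts M. f (F p)) \<in> smooth_funs M"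
  by (intro M.smooth_funs_restrict smooth_map_sfun N.smooth_funs_sfun smooth_map_pts)

text \<open>One pair of charts at each point suffices: every other pair differs from it by
  transition maps.\<close>

lemma smooth_mapI:
  assumes F: "continuous_map (mtop M) (mtop N) F"
    and s: "\<And>p. p \<in> pts M \<Longrightarrow> \<exists>U \<phi> V \<psi>. (U, \<phi>) \<in> atlas M \<and> (V, \<psi>) \<in> atlas N \<and> p \<in> U \<and> F p \<in> V \<and>
      smooth_at (\<psi> \<circ> F \<circ> inv_into U \<phi>) (\<phi> p)"
  shows "smooth_map M N F"
proof -
  have "smooth_on (\<phi> ` (U \<inter> F -` V)) (\<psi> \<circ> F \<circ> inv_into U \<phi>)"
    if c: "(U, \<phi>) \<in> atlas M" and d: "(V, \<psi>) \<in> atlas N" for U \<phi> V \<psi>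
  proof -
    have "openin (mtop M) {q \<in> pts M. F q \<in> V}"
      using F N.chart_open[OF d] by (rule openin_continuous_map_preimage)
    then have "openin (mtop M) (U \<inter> {q \<in> pts M. F q \<in> V})" using M.chart_open[OF c] by blast
    moreover have "U \<inter> {q \<in> pts M. F q \<in> V} = U \<inter> F -` V" using M.chart_sub[OF c] by auto
    ultimately have o: "open (\<phi> ` (U \<inter> F -` V))" using M.chart_image_open[OF c] by simp
    show ?thesis unfolding smooth_on_iff[OF o]
    proof
      fix x assume "x \<in> \<phi> ` (U \<inter> F -` V)"
      then obtain p where p: "p \<in> U" "F p \<in> V" "x = \<phi> p" by blast
      then have pM: "p \<in> pts M" using M.chart_sub[OF c] by blast
      obtain U' \<phi>' V' \<psi>' where c': "(U', \<phi>') \<in> atlas M" "p \<in> U'" and d': "(V', \<psi>') \<in> atlas N" "F p \<in> V'"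
        and sm: "smooth_at (\<psi>' \<circ> F \<circ> inv_into U' \<phi>') (\<phi>' p)" using s[OF pM] by blast
      have 1: "smooth_at (\<lambda>x. (\<psi>' \<circ> F \<circ> inv_into U' \<phi>') ((\<phi>' \<circ> inv_into U \<phi>) x)) (\<phi> p)"
        by (rule smooth_at_compose[OF M.onb M.transition_smooth_at[OF c c'(1) p(1) c'(2)]]) (use c p sm in \<open>simp add: o_def\<close>)
      have 2: "smooth_at (\<lambda>x. (\<psi> \<circ> inv_into V' \<psi>') ((\<psi>' \<circ> F \<circ> inv_into U' \<phi>') ((\<phi>' \<circ> inv_into U \<phi>) x))) (\<phi> p)"
        by (rule smooth_at_compose[OF N.onb 1])
          (use N.transition_smooth_at[OF d'(1) d d'(2) p(2)] c c' p in \<open>simp add: o_def\<close>)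
      have "\<forall>\<^sub>F q in nhdsin (mtop M) p. q \<in> U' \<and> F q \<in> V'"
        by (intro eventually_conj M.near_chart_dom[OF c'] preimage_near[OF F pM N.near_chart_dom[OF d']])
      from M.near_chart_inv[OF c p(1) this]
      have "\<forall>\<^sub>F x in nhds (\<phi> p). (\<psi> \<circ> inv_into V' \<psi>') ((\<psi>' \<circ> F \<circ> inv_into U' \<phi>') ((\<phi>' \<circ> inv_into U \<phi>) x))
         = (\<psi> \<circ> F \<circ> inv_into U \<phi>) x"
        by eventually_elim (use c' d' in auto)
      then show "smooth_at (\<psi> \<circ> F \<circ> inv_into U \<phi>) x" unfolding p(3) using 2 by (rule smooth_at_cong_ev)
    qed
  qed
  then show ?thesis using F unfolding smooth_map_def by blast
qed

text \<open>Smoothness tested on functions: near \<open>F p\<close> the coordinates of the target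
  are restrictions of global smooth functions, so their compositions with \<open>F\<close> are
  smooth.\<close>

lemma smooth_mapI_funs:
  assumes F: "continuous_map (mtop M) (mtop N) F"
    and s: "\<And>p f. p \<in> pts M \<Longrightarrow> f \<in> smooth_funs N \<Longrightarrow> M.sfun (\<lambda>q. f (F q)) p"
  shows "smooth_map M N F"
proof (rule smooth_mapI[OF F])
  fix p assume p: "p \<in> pts M"
  have Fp: "F p \<in> pts N" using F p by (auto simp: continuous_map_def)
  obtain U \<phi> where c: "(U, \<phi>) \<in> atlas M" "p \<in> U" using M.chart_exists[OF p] by blast
  obtain V \<psi> where d: "(V, \<psi>) \<in> atlas N" "F p \<in> V" using N.chart_exists[OF Fp] by blast
  have "\<exists>C. N.cfun V \<psi> b (F p) C" for b by (rule N.cfun_exists[OF d]) blast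
  then obtain C where C: "\<And>b. N.cfun V \<psi> b (F p) (C b)" by metis
  have Cs: "C b \<in> smooth_funs N" "\<forall>\<^sub>F q in nhdsin (mtop N) (F p). C b q = \<psi> q \<bullet> b" for b
    using C by (simp_all add: N.cfun_def)
  have sC: "smooth_at ((\<lambda>q. C b (F q)) \<circ> inv_into U \<phi>) (\<phi> p)" for b
    using s[OF p Cs(1)] unfolding M.sfun_chart[OF c] .
  have sm: "smooth_at (\<lambda>x. \<Sum>b\<in>B. ((\<lambda>q. C b (F q)) \<circ> inv_into U \<phi>) x *\<^sub>R b) (\<phi> p)"
    by (rule smooth_at_sum, rule smooth_at_scaleR[OF sC smooth_at_const])
  have "\<forall>\<^sub>F q in nhdsin (mtop N) (F p). \<forall>b\<in>B. C b q = \<psi> q \<bullet> b"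
    by (intro eventually_ball_finite orthobasis_finite[OF N.onb] ballI Cs)
  from M.near_chart_inv[OF c preimage_near[OF F p this]]
  have "\<forall>\<^sub>F x in nhds (\<phi> p). (\<Sum>b\<in>B. ((\<lambda>q. C b (F q)) \<circ> inv_into U \<phi>) x *\<^sub>R b) = (\<psi> \<circ> F \<circ> inv_into U \<phi>) x"
    by eventually_elim (simp add: orthobasis_expand[OF N.onb])
  from smooth_at_cong_ev[OF this sm]
  show "\<exists>U \<phi> V \<psi>. (U, \<phi>) \<in> atlas M \<and> (V, \<psi>) \<in> atlas N \<and> p \<in> U \<and> F p \<in> V \<and>
      smooth_at (\<psi> \<circ> F \<circ> inv_into U \<phi>) (\<phi> p)" using c d by blast
qed

lemma smooth_map_const: "c \<in> pts N \<Longrightarrow> smooth_map M N (\<lambda>_. c)"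
  by (rule smooth_mapI_funs) (auto intro: M.sfun_const)

lemma smooth_map_cong:
  assumes F: "smooth_map M N F" and e: "\<And>p. p \<in> pts M \<Longrightarrow> F p = G p"
  shows "smooth_map M N G"
proof (rule smooth_mapI_funs)
  show "continuous_map (mtop M) (mtop N) G"
    using F e by (auto simp: smooth_map_def intro: continuous_map_eq)
  fix p f assume p: "p \<in> pts M" and f: "f \<in> smooth_funs N"
  show "M.sfun (\<lambda>q. f (G q)) p"
    by (rule M.sfun_cong[OF openin_topspace p _ smooth_map_sfun[OF F p N.smooth_funs_sfun[OF f smooth_map_pts[OF F p]]]])
      (simp add: e)
qed

end

section \<open>Composition and products\<close>

lemma smooth_map_id: assumes "mfld M A" shows "smooth_map M M (\<lambda>x. x)"
proof -
  interpret mfld2 M A M A using assms by (simp add: mfld2_def)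
  show ?thesis by (rule smooth_mapI_funs) (auto intro: M.smooth_funs_sfun)
qed

lemma smooth_map_comp:
  assumes "mfld M A" "mfld N B" "mfld P C" and F: "smooth_map M N F" and G: "smooth_map N P G"
  shows "smooth_map M P (\<lambda>x. G (F x))"
proof -
  interpret MN: mfld2 M A N B using assms by (simp add: mfld2_def)
  interpret NP: mfld2 N B P C using assms by (simp add: mfld2_def)
  interpret MP: mfld2 M A P C using assms by (simp add: mfld2_def)
  show ?thesis
  proof (rule MP.smooth_mapI_funs)
    show "continuous_map (mtop M) (mtop P) (\<lambda>x. G (F x))"
      using F G continuous_map_compose[of "mtop M" "mtop N" F "mtop P" G] by (simp add: smooth_map_def o_def)
    fix p f assume p: "p \<in> pts M" and f: "f \<in> smooth_funs P"
    have q: "F p \<in> pts N" by (rule MN.smooth_map_pts[OF F p])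
    show "MN.M.sfun (\<lambda>q. f (G (F q))) p"
      by (rule MN.smooth_map_sfun[OF F p NP.smooth_map_sfun[OF G q NP.N.smooth_funs_sfun[OF f NP.smooth_map_pts[OF G q]]]])
  qed
qed

definition prod_basis :: "'e::real_inner set \<Rightarrow> 'f::real_inner set \<Rightarrow> ('e \<times> 'f) set" where
  "prod_basis A B = (\<lambda>a. (a, 0)) ` A \<union> (\<lambda>b. (0, b)) ` B"

lemma inv_into_map_prod:
  assumes "inj_on \<phi> U" "inj_on \<psi> V" "x \<in> \<phi> ` U" "y \<in> \<psi> ` V"
  shows "inv_into (U \<times> V) (map_prod \<phi> \<psi>) (x, y) = (inv_into U \<phi> x, inv_into V \<psi> y)"
proof (rule inv_into_f_eq)
  show "inj_on (map_prod \<phi> \<psi>) (U \<times> V)" using assms by (intro map_prod_inj_on)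
qed (use assms in \<open>auto simp: f_inv_into_f intro: inv_into_into\<close>)

lemma atlas_prod: "(W, \<theta>) \<in> atlas (prod_manifold M N) \<longleftrightarrow>
    (\<exists>U \<phi> V \<psi>. (U, \<phi>) \<in> atlas M \<and> (V, \<psi>) \<in> atlas N \<and> W = U \<times> V \<and> \<theta> = map_prod \<phi> \<psi>)"
  by (simp add: prod_manifold_def image_iff Bex_def split_paired_Ex)

lemma mtop_prod [simp]: "mtop (prod_manifold M N) = prod_topology (mtop M) (mtop N)"
  by (simp add: prod_manifold_def)

lemma mfld_prod:
  assumes "mfld M A" "mfld N B"
  shows "mfld (prod_manifold M N) (prod_basis A B)"
proof -
  interpret M: mfld M A by fact
  interpret N: mfld N B by fact
  have homeo: "homeomorphic_map (subtopology (prod_topology (mtop M) (mtop N)) (U \<times> V))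
      (top_of_set (map_prod \<phi> \<psi> ` (U \<times> V))) (map_prod \<phi> \<psi>)"
    if c: "(U, \<phi>) \<in> atlas M" and d: "(V, \<psi>) \<in> atlas N" for U \<phi> V \<psi>
  proof -
    obtain f g where "homeomorphic_maps (subtopology (mtop M) U) (top_of_set (\<phi> ` U)) \<phi> f"
      "homeomorphic_maps (subtopology (mtop N) V) (top_of_set (\<psi> ` V)) \<psi> g"
      using M.chart_homeo[OF c] N.chart_homeo[OF d] by (auto simp: homeomorphic_map_maps)
    then have "homeomorphic_maps (prod_topology (subtopology (mtop M) U) (subtopology (mtop N) V))
       (prod_topology (top_of_set (\<phi> ` U)) (top_of_set (\<psi> ` V))) (\<lambda>(x, y). (\<phi> x, \<psi> y)) (\<lambda>(x, y). (f x, g y))"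
      by (simp only: homeomorphic_maps_prod) blast
    moreover have "(\<lambda>(x, y). (\<phi> x, \<psi> y)) = map_prod \<phi> \<psi>" by auto
    moreover have "map_prod \<phi> \<psi> ` (U \<times> V) = \<phi> ` U \<times> \<psi> ` V" by (rule map_prod_surj_on) auto
    ultimately show ?thesis unfolding subtopology_Times homeomorphic_map_maps by (metis prod_topology_subtopology_eu)
  qed
  show ?thesis
  proof
    show "orthobasis (prod_basis A B)" unfolding prod_basis_def by (rule orthobasis_Times[OF M.onb N.onb])
    show "Hausdorff_space (mtop (prod_manifold M N))" using M.haus N.haus by (simp add: Hausdorff_space_prod_topology)
    show "(\<Union>(U, \<phi>)\<in>atlas (prod_manifold M N). U) = pts (prod_manifold M N)"
    proof
      show "(\<Union>(U, \<phi>)\<in>atlas (prod_manifold M N). U) \<subseteq> pts (prod_manifold M N)"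
        using M.chart_sub N.chart_sub by (fastforce simp: atlas_prod)
      show "pts (prod_manifold M N) \<subseteq> (\<Union>(U, \<phi>)\<in>atlas (prod_manifold M N). U)"
      proof
        fix z assume "z \<in> pts (prod_manifold M N)"
        then obtain p q where z: "z = (p, q)" "p \<in> pts M" "q \<in> pts N" by auto
        obtain U \<phi> V \<psi> where "(U, \<phi>) \<in> atlas M" "p \<in> U" "(V, \<psi>) \<in> atlas N" "q \<in> V"
          using M.chart_exists[OF z(2)] N.chart_exists[OF z(3)] by blast
        then have "(U \<times> V, map_prod \<phi> \<psi>) \<in> atlas (prod_manifold M N)" "z \<in> U \<times> V"
          using z by (auto simp: atlas_prod)
        then show "z \<in> (\<Union>(U, \<phi>)\<in>atlas (prod_manifold M N). U)" by blast
      qed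
    qed
  next
    fix W \<theta> assume "(W, \<theta>) \<in> atlas (prod_manifold M N)"
    then obtain U \<phi> V \<psi> where c: "(U, \<phi>) \<in> atlas M" "(V, \<psi>) \<in> atlas N" "W = U \<times> V" "\<theta> = map_prod \<phi> \<psi>"
      by (auto simp: atlas_prod)
    show "openin (mtop (prod_manifold M N)) W"
      using c M.chart_open N.chart_open by (auto simp: openin_prod_Times_iff)
    have "map_prod \<phi> \<psi> ` (U \<times> V) = \<phi> ` U \<times> \<psi> ` V" by (rule map_prod_surj_on) auto
    then show "open (\<theta> ` W)" using c M.chart_open_image N.chart_open_image by (simp add: open_Times)
    show "homeomorphic_map (subtopology (mtop (prod_manifold M N)) W) (top_of_set (\<theta> ` W)) \<theta>"
      using homeo[OF c(1,2)] c by simp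
    fix W' \<theta>' assume "(W', \<theta>') \<in> atlas (prod_manifold M N)"
    then obtain U' \<phi>' V' \<psi>' where c': "(U', \<phi>') \<in> atlas M" "(V', \<psi>') \<in> atlas N" "W' = U' \<times> V'" "\<theta>' = map_prod \<phi>' \<psi>'"
      by (auto simp: atlas_prod)
    have eq: "\<theta> ` (W \<inter> W') = \<phi> ` (U \<inter> U') \<times> \<psi> ` (V \<inter> V')"
      unfolding c c' by (subst Times_Int_Times) (rule map_prod_surj_on; simp)
    have o: "open (\<phi> ` (U \<inter> U') \<times> \<psi> ` (V \<inter> V'))"
      using c c' M.chart_open N.chart_open by (intro open_Times M.chart_image_open N.chart_image_open) auto
    show "smooth_on (\<theta> ` (W \<inter> W')) (\<theta>' \<circ> inv_into W \<theta>)"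
      unfolding eq smooth_on_iff[OF o]
    proof
      fix z assume z: "z \<in> \<phi> ` (U \<inter> U') \<times> \<psi> ` (V \<inter> V')"
      then obtain p q where pq: "p \<in> U" "p \<in> U'" "q \<in> V" "q \<in> V'" "z = (\<phi> p, \<psi> q)" by auto
      have "smooth_at (\<lambda>z. (\<phi>' \<circ> inv_into U \<phi>) (fst z)) z"
        by (rule smooth_at_compose[OF M.onb smooth_at_linear[OF bounded_linear_fst]])
          (use M.transition_smooth_at[OF c(1) c'(1) pq(1,2)] pq in \<open>simp add: o_def\<close>)
      moreover have "smooth_at (\<lambda>z. (\<psi>' \<circ> inv_into V \<psi>) (snd z)) z"
        by (rule smooth_at_compose[OF N.onb smooth_at_linear[OF bounded_linear_snd]])
          (use N.transition_smooth_at[OF c(2) c'(2) pq(3,4)] pq in \<open>simp add: o_def\<close>)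
      ultimately have "smooth_at (\<lambda>z. ((\<phi>' \<circ> inv_into U \<phi>) (fst z), (\<psi>' \<circ> inv_into V \<psi>) (snd z))) z"
        by (rule smooth_at_prod)
      then show "smooth_at (\<theta>' \<circ> inv_into W \<theta>) z"
      proof (rule smooth_at_cong[OF o z, rotated])
        fix y assume "y \<in> \<phi> ` (U \<inter> U') \<times> \<psi> ` (V \<inter> V')"
        then have y: "fst y \<in> \<phi> ` U" "snd y \<in> \<psi> ` V" by auto
        show "((\<phi>' \<circ> inv_into U \<phi>) (fst y), (\<psi>' \<circ> inv_into V \<psi>) (snd y)) = (\<theta>' \<circ> inv_into W \<theta>) y"
          using inv_into_map_prod[OF M.chart_inj[OF c(1)] N.chart_inj[OF c(2)] y] by (simp add: c c')
      qed
    qed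
  qed
qed

lemma prod_chart:
  assumes "mfld M A" "mfld N B" "(U, \<phi>) \<in> atlas M" "p \<in> U" "(V, \<psi>) \<in> atlas N" "q \<in> V"
  shows "(U \<times> V, map_prod \<phi> \<psi>) \<in> atlas (prod_manifold M N)" "(p, q) \<in> U \<times> V"
    and "\<forall>\<^sub>F z in nhds (\<phi> p, \<psi> q). inv_into (U \<times> V) (map_prod \<phi> \<psi>) z = (inv_into U \<phi> (fst z), inv_into V \<psi> (snd z))"
proof -
  interpret M: mfld M A by fact
  interpret N: mfld N B by fact
  have "open (\<phi> ` U \<times> \<psi> ` V)" using assms M.chart_open_image N.chart_open_image by (intro open_Times) auto
  moreover have "(\<phi> p, \<psi> q) \<in> \<phi> ` U \<times> \<psi> ` V" using assms by auto
  moreover have "inv_into (U \<times> V) (map_prod \<phi> \<psi>) z = (inv_into U \<phi> (fst z), inv_into V \<psi> (snd z))"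
    if "z \<in> \<phi> ` U \<times> \<psi> ` V" for z
    using inv_into_map_prod[OF M.chart_inj[OF assms(3)] N.chart_inj[OF assms(5)], of "fst z" "snd z"] that by auto
  ultimately show "\<forall>\<^sub>F z in nhds (\<phi> p, \<psi> q). inv_into (U \<times> V) (map_prod \<phi> \<psi>) z = (inv_into U \<phi> (fst z), inv_into V \<psi> (snd z))"
    unfolding eventually_nhds by blast
qed (use assms in \<open>auto simp: atlas_prod\<close>)

lemma smooth_map_fst:
  assumes "mfld M A" "mfld N B" shows "smooth_map (prod_manifold M N) M fst"
proof -
  interpret P: mfld2 "prod_manifold M N" "prod_basis A B" M A using assms mfld_prod by (simp add: mfld2_def)
  interpret N: mfld N B by fact
  show ?thesis
  proof (rule P.smooth_mapI)
    show "continuous_map (mtop (prod_manifold M N)) (mtop M) fst" by (simp add: continuous_map_fst)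
    fix z assume "z \<in> pts (prod_manifold M N)"
    then obtain p q where z: "z = (p, q)" "p \<in> pts M" "q \<in> pts N" by auto
    obtain U \<phi> V \<psi> where c: "(U, \<phi>) \<in> atlas M" "p \<in> U" "(V, \<psi>) \<in> atlas N" "q \<in> V"
      using P.N.chart_exists[OF z(2)] N.chart_exists[OF z(3)] by blast
    note pc = prod_chart[OF assms c]
    have "open (\<phi> ` U \<times> \<psi> ` V)" using c P.N.chart_open_image N.chart_open_image by (intro open_Times) auto
    then have "\<forall>\<^sub>F z in nhds (\<phi> p, \<psi> q). z \<in> \<phi> ` U \<times> \<psi> ` V" using c by (auto simp: eventually_nhds)
    then have "\<forall>\<^sub>F z in nhds (\<phi> p, \<psi> q). fst z = (\<phi> \<circ> fst \<circ> inv_into (U \<times> V) (map_prod \<phi> \<psi>)) z"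
      using pc(3) by eventually_elim (auto simp: f_inv_into_f)
    from smooth_at_cong_ev[OF this smooth_at_linear[OF bounded_linear_fst]]
    show "\<exists>W \<theta> V \<psi>. (W, \<theta>) \<in> atlas (prod_manifold M N) \<and> (V, \<psi>) \<in> atlas M \<and> z \<in> W \<and> fst z \<in> V \<and>
      smooth_at (\<psi> \<circ> fst \<circ> inv_into W \<theta>) (\<theta> z)"
      using pc(1,2) c z by (intro exI[of _ "U \<times> V"] exI[of _ "map_prod \<phi> \<psi>"] exI[of _ U] exI[of _ \<phi>]) (simp add: o_def)
  qed
qed

lemma smooth_map_snd:
  assumes "mfld M A" "mfld N B" shows "smooth_map (prod_manifold M N) N snd"
proof -
  interpret P: mfld2 "prod_manifold M N" "prod_basis A B" N B using assms mfld_prod by (simp add: mfld2_def)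
  interpret M: mfld M A by fact
  show ?thesis
  proof (rule P.smooth_mapI)
    show "continuous_map (mtop (prod_manifold M N)) (mtop N) snd" by (simp add: continuous_map_snd)
    fix z assume "z \<in> pts (prod_manifold M N)"
    then obtain p q where z: "z = (p, q)" "p \<in> pts M" "q \<in> pts N" by auto
    obtain U \<phi> V \<psi> where c: "(U, \<phi>) \<in> atlas M" "p \<in> U" "(V, \<psi>) \<in> atlas N" "q \<in> V"
      using M.chart_exists[OF z(2)] P.N.chart_exists[OF z(3)] by blast
    note pc = prod_chart[OF assms c]
    have "open (\<phi> ` U \<times> \<psi> ` V)" using c M.chart_open_image P.N.chart_open_image by (intro open_Times) auto
    then have "\<forall>\<^sub>F z in nhds (\<phi> p, \<psi> q). z \<in> \<phi> ` U \<times> \<psi> ` V" using c by (auto simp: eventually_nhds)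
    then have "\<forall>\<^sub>F z in nhds (\<phi> p, \<psi> q). snd z = (\<psi> \<circ> snd \<circ> inv_into (U \<times> V) (map_prod \<phi> \<psi>)) z"
      using pc(3) by eventually_elim (auto simp: f_inv_into_f)
    from smooth_at_cong_ev[OF this smooth_at_linear[OF bounded_linear_snd]]
    show "\<exists>W \<theta> V \<psi>. (W, \<theta>) \<in> atlas (prod_manifold M N) \<and> (V, \<psi>) \<in> atlas N \<and> z \<in> W \<and> snd z \<in> V \<and>
      smooth_at (\<psi> \<circ> snd \<circ> inv_into W \<theta>) (\<theta> z)"
      using pc(1,2) c z by (intro exI[of _ "U \<times> V"] exI[of _ "map_prod \<phi> \<psi>"] exI[of _ V] exI[of _ \<psi>]) (simp add: o_def)
  qed
qed

lemma smooth_map_pair: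
  assumes "mfld M A" "mfld N B" "mfld P C" and F: "smooth_map M N F" and G: "smooth_map M P G"
  shows "smooth_map M (prod_manifold N P) (\<lambda>x. (F x, G x))"
proof -
  interpret X: mfld2 M A "prod_manifold N P" "prod_basis B C" using assms mfld_prod by (simp add: mfld2_def)
  interpret MN: mfld2 M A N B using assms by (simp add: mfld2_def)
  interpret MP: mfld2 M A P C using assms by (simp add: mfld2_def)
  show ?thesis
  proof (rule X.smooth_mapI)
    show "continuous_map (mtop M) (mtop (prod_manifold N P)) (\<lambda>x. (F x, G x))"
      using F G by (simp add: smooth_map_def continuous_map_paired)
    fix p assume p: "p \<in> pts M"
    obtain U \<phi> where c: "(U, \<phi>) \<in> atlas M" "p \<in> U" using X.M.chart_exists[OF p] by blast
    obtain V \<psi> V' \<psi>' where d: "(V, \<psi>) \<in> atlas N" "F p \<in> V" and d': "(V', \<psi>') \<in> atlas P" "G p \<in> V'"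
      using MN.N.chart_exists[OF MN.smooth_map_pts[OF F p]] MP.N.chart_exists[OF MP.smooth_map_pts[OF G p]] by blast
    note pc = prod_chart[OF assms(2,3) d d']
    have "smooth_at (\<lambda>x. ((\<psi> \<circ> F \<circ> inv_into U \<phi>) x, (\<psi>' \<circ> G \<circ> inv_into U \<phi>) x)) (\<phi> p)"
      by (rule smooth_at_prod[OF MN.smooth_map_at[OF F c d] MP.smooth_map_at[OF G c d']])
    moreover have "(\<lambda>x. ((\<psi> \<circ> F \<circ> inv_into U \<phi>) x, (\<psi>' \<circ> G \<circ> inv_into U \<phi>) x)) =
        map_prod \<psi> \<psi>' \<circ> (\<lambda>x. (F x, G x)) \<circ> inv_into U \<phi>" by (simp add: fun_eq_iff)
    ultimately have "smooth_at (map_prod \<psi> \<psi>' \<circ> (\<lambda>x. (F x, G x)) \<circ> inv_into U \<phi>) (\<phi> p)" by (simp only:)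
    then show "\<exists>U \<phi> V \<psi>. (U, \<phi>) \<in> atlas M \<and> (V, \<psi>) \<in> atlas (prod_manifold N P) \<and> p \<in> U \<and> (F p, G p) \<in> V \<and>
      smooth_at (\<psi> \<circ> (\<lambda>x. (F x, G x)) \<circ> inv_into U \<phi>) (\<phi> p)"
      using c pc(1,2) by blast
  qed
qed

lemma slice_smooth:
  assumes MN: "mfld M A" "mfld N B" and F: "F \<in> smooth_funs (prod_manifold M N)" and n: "n \<in> pts N"
  shows "(\<lambda>p\<in>pts M. F (p, n)) \<in> smooth_funs M"
proof -
  interpret MN: mfld2 M A N B using MN by (simp add: mfld2_def)
  interpret X: mfld2 M A "prod_manifold M N" "prod_basis A B" using MN mfld_prod by (simp add: mfld2_def)
  show ?thesis
    by (rule X.smooth_map_funs[OF smooth_map_pair[OF MN(1) MN(1) MN(2) smooth_map_id[OF MN(1)] MN.smooth_map_const[OF n]] F])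
qed

text \<open>In a product chart the function is the derivative of \<open>F\<close> in the direction
  of \<open>H\<close> in the first factor and 0 in the second; this is smooth in both variables
  together.\<close>

lemma parametric_derivative:
  assumes MN: "mfld M A" "mfld N B" and F: "F \<in> smooth_funs (prod_manifold M N)" and H: "H \<in> vfields M"
  shows "(\<lambda>z\<in>pts (prod_manifold M N). H (\<lambda>p\<in>pts M. F (p, snd z)) (fst z)) \<in> smooth_funs (prod_manifold M N)"
proof -
  interpret MN: mfld2 M A N B using MN by (simp add: mfld2_def)
  interpret P: mfld "prod_manifold M N" "prod_basis A B" by (rule mfld_prod[OF MN])
  show ?thesis
  proof (rule P.smooth_funs_restrict)
    fix z assume z: "z \<in> pts (prod_manifold M N)"
    then obtain p q where pq: "z = (p, q)" "p \<in> pts M" "q \<in> pts N" by auto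
    obtain U \<phi> V \<psi> where c: "(U, \<phi>) \<in> atlas M" "p \<in> U" and d: "(V, \<psi>) \<in> atlas N" "q \<in> V"
      using MN.M.chart_exists[OF pq(2)] MN.N.chart_exists[OF pq(3)] by blast
    note pc = prod_chart[OF MN c d]
    define W where "W = U \<times> V"
    define \<theta> where "\<theta> = map_prod \<phi> \<psi>"
    have pc': "(W, \<theta>) \<in> atlas (prod_manifold M N)" "z \<in> W" using pc pq by (simp_all add: W_def \<theta>_def)
    let ?F = "F \<circ> inv_into W \<theta>"
    have sF: "smooth_at ?F (\<theta> z')" if "z' \<in> W" for z' by (rule P.smooth_funs_smooth_at[OF F pc'(1) that])
    have "smooth_at (\<lambda>x. fd ?F x (rep_part x, 0)) (\<theta> z)" if "smooth_at rep_part (\<theta> z)" for rep_part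
      by (rule fd_family(1)[OF P.onb sF[OF pc'(2)] smooth_at_prod[OF that smooth_at_const]])
    moreover have "smooth_at (\<lambda>x. MN.M.rep U \<phi> H (fst x)) (\<theta> z)"
      by (rule smooth_at_compose[OF MN.M.onb smooth_at_linear[OF bounded_linear_fst]])
        (use MN.M.rep_smooth[OF c H] in \<open>simp add: \<theta>_def pq\<close>)
    ultimately have sm: "smooth_at (\<lambda>x. fd ?F x (MN.M.rep U \<phi> H (fst x), 0)) (\<theta> z)" .
    show "P.sfun (\<lambda>z. H (\<lambda>p\<in>pts M. F (p, snd z)) (fst z)) z"
    proof (rule P.sfun_cong[OF P.chart_open[OF pc'(1)] pc'(2) _ P.sfun_coord[OF pc' sm]])
      fix y assume y: "y \<in> W"
      then have y': "fst y \<in> U" "snd y \<in> V" "snd y \<in> pts N" using MN.N.chart_sub[OF d(1)] by (auto simp: W_def)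
      have "H (\<lambda>p\<in>pts M. F (p, snd y)) (fst y) =
          fd ((\<lambda>p\<in>pts M. F (p, snd y)) \<circ> inv_into U \<phi>) (\<phi> (fst y)) (MN.M.rep U \<phi> H (\<phi> (fst y)))"
        by (rule MN.M.vf_apply[OF c(1) y'(1) H slice_smooth[OF MN F y'(3)]])
      also have "fd ((\<lambda>p\<in>pts M. F (p, snd y)) \<circ> inv_into U \<phi>) (\<phi> (fst y)) = fd (\<lambda>x. ?F (x, \<psi> (snd y))) (\<phi> (fst y))"
      proof (rule fd_cong_open[OF MN.M.chart_open_image[OF c(1)]])
        show "\<phi> (fst y) \<in> \<phi> ` U" using y' by simp
        fix x assume x: "x \<in> \<phi> ` U"
        then have "inv_into U \<phi> x \<in> pts M" using MN.M.chart_sub[OF c(1)] by (metis inv_into_into subsetD)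
        then show "((\<lambda>p\<in>pts M. F (p, snd y)) \<circ> inv_into U \<phi>) x = ?F (x, \<psi> (snd y))"
          using inv_into_map_prod[OF MN.M.chart_inj[OF c(1)] MN.N.chart_inj[OF d(1)] x, of "\<psi> (snd y)"] y' d
          by (simp add: W_def \<theta>_def)
      qed
      also have "\<dots> = (\<lambda>v. fd ?F (\<theta> y) (v, 0))"
      proof -
        have "((\<lambda>x. (x, \<psi> (snd y))) has_derivative (\<lambda>v. (v, 0))) (at (\<phi> (fst y)))"
          by (intro has_derivative_Pair has_derivative_ident has_derivative_const)
        moreover have "(?F has_derivative fd ?F (\<theta> y)) (at (\<phi> (fst y), \<psi> (snd y)))"
          using smooth_at_has_derivative[OF sF[OF y]] by (cases y) (simp add: \<theta>_def)
        ultimately have "((\<lambda>x. ?F (x, \<psi> (snd y))) has_derivative (\<lambda>v. fd ?F (\<theta> y) (v, 0))) (at (\<phi> (fst y)))"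
          using diff_chain_at[of "\<lambda>x. (x, \<psi> (snd y))" _ "\<phi> (fst y)" ?F] by (simp add: o_def)
        then show ?thesis by (rule fd_eq)
      qed
      finally have "fd ?F (\<theta> y) (MN.M.rep U \<phi> H (\<phi> (fst y)), 0) = H (\<lambda>p\<in>pts M. F (p, snd y)) (fst y)"
        by (rule sym)
      moreover have "fst (\<theta> y) = \<phi> (fst y)" by (cases y) (simp add: \<theta>_def)
      ultimately show "fd ?F (\<theta> y) (MN.M.rep U \<phi> H (fst (\<theta> y)), 0) = H (\<lambda>p\<in>pts M. F (p, snd y)) (fst y)"
        by (simp only:)
    qed
  qed
qed

section \<open>Affine maps and affine fields\<close>

context mfld
begin

lemma mfld2_self: "mfld2 M B M B"
  by (simp add: mfld2_def mfld_axioms)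

lemma diffeo_facts:
  assumes "diffeo M M F"
  shows "smooth_map M M F" "smooth_map M M (inv_into (pts M) F)"
    "\<And>p. p \<in> pts M \<Longrightarrow> F p \<in> pts M" "\<And>p. p \<in> pts M \<Longrightarrow> inv_into (pts M) F p \<in> pts M"
    "\<And>p. p \<in> pts M \<Longrightarrow> inv_into (pts M) F (F p) = p" "\<And>p. p \<in> pts M \<Longrightarrow> F (inv_into (pts M) F p) = p"
  using assms unfolding diffeo_def
  by (auto simp: bij_betw_def f_inv_into_f intro: inv_into_into)

lemma diffeo_near:
  assumes "diffeo M M F" "p \<in> pts M" "eventually P (near (F p))"
  shows "\<forall>\<^sub>F q in near p. P (F q)"
  by (rule mfld2.preimage_near[where F=F and P=P, OF mfld2_self _ assms(2,3)])
    (use diffeo_facts(1)[OF assms(1)] in \<open>simp add: smooth_map_def\<close>)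

lemma pullback_smooth: "diffeo M M F \<Longrightarrow> f \<in> smooth_funs M \<Longrightarrow> (\<lambda>p\<in>pts M. f (F p)) \<in> smooth_funs M"
  by (rule mfld2.smooth_map_funs[OF mfld2_self diffeo_facts(1)])

lemma pushforward_apply:
  assumes "diffeo M M F" "f \<in> smooth_funs M" "p \<in> pts M"
  shows "pushforward M F X f (F p) = X (\<lambda>p\<in>pts M. f (F p)) p"
  using assms by (simp add: pushforward_def diffeo_facts del: restrict_apply) (simp add: diffeo_facts)

lemma pushforward_vf:
  assumes F: "diffeo M M F" and X: "X \<in> vfields M"
  shows "pushforward M F X \<in> vfields M"
proof (rule vfieldsI)
  note s = pullback_smooth[OF F]
  have ap: "pushforward M F X f p = X (\<lambda>p\<in>pts M. f (F p)) (inv_into (pts M) F p)"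
    if "f \<in> smooth_funs M" "p \<in> pts M" for f p
    using pushforward_apply[OF F that(1) diffeo_facts(4)[OF F that(2)], of X] diffeo_facts(6)[OF F that(2)] by simp
  show "pushforward M F X f \<in> smooth_funs M" if f: "f \<in> smooth_funs M" for f
  proof -
    have "pushforward M F X f = (\<lambda>q\<in>pts M. X (\<lambda>p\<in>pts M. f (F p)) (inv_into (pts M) F q))"
      using f by (simp add: pushforward_def)
    then show ?thesis
      using mfld2.smooth_map_funs[OF mfld2_self diffeo_facts(2)[OF F] vf_smooth[OF X s[OF f]]] by (simp only:)
  qed
  show "pushforward M F X \<in> extensional (smooth_funs M)" by (simp add: pushforward_def)
  fix f g a p assume f: "f \<in> smooth_funs M" "g \<in> smooth_funs M" and p: "p \<in> pts M"
  have q: "inv_into (pts M) F p \<in> pts M" by (rule diffeo_facts(4)[OF F p])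
  have 1: "(\<lambda>p\<in>pts M. (\<lambda>p\<in>pts M. a * f p + g p) (F p)) =
      (\<lambda>p\<in>pts M. a * (\<lambda>p\<in>pts M. f (F p)) p + (\<lambda>p\<in>pts M. g (F p)) p)"
    by (auto simp: fun_eq_iff diffeo_facts[OF F])
  have 2: "(\<lambda>p\<in>pts M. (\<lambda>p\<in>pts M. f p * g p) (F p)) =
      (\<lambda>p\<in>pts M. (\<lambda>p\<in>pts M. f (F p)) p * (\<lambda>p\<in>pts M. g (F p)) p)"
    by (auto simp: fun_eq_iff diffeo_facts[OF F])
  show "pushforward M F X (\<lambda>p\<in>pts M. a * f p + g p) p = a * pushforward M F X f p + pushforward M F X g p"
    unfolding ap[OF smooth_funs_lin[OF f] p] ap[OF f(1) p] ap[OF f(2) p] 1 by (rule vf_lin[OF X s s q]) fact+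
  have "pushforward M F X (\<lambda>p\<in>pts M. f p * g p) p =
     X (\<lambda>p\<in>pts M. f (F p)) (inv_into (pts M) F p) * (\<lambda>p\<in>pts M. g (F p)) (inv_into (pts M) F p) +
     (\<lambda>p\<in>pts M. f (F p)) (inv_into (pts M) F p) * X (\<lambda>p\<in>pts M. g (F p)) (inv_into (pts M) F p)"
    unfolding ap[OF smooth_funs_mult[OF f] p] 2 by (rule vf_mult[OF X s s q]) fact+
  then show "pushforward M F X (\<lambda>p\<in>pts M. f p * g p) p = pushforward M F X f p * g p + f p * pushforward M F X g p"
    unfolding ap[OF f(1) p] ap[OF f(2) p] by (simp add: q diffeo_facts(6)[OF F p] del: restrict_apply) (simp add: q diffeo_facts(6)[OF F p])
qed

lemma rep_pushforward:
  assumes F: "diffeo M M F" and X: "X \<in> vfields M" and c: "(U, \<phi>) \<in> atlas M" "p \<in> U" and d: "(V, \<psi>) \<in> atlas M" "F p \<in> V"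
  shows "rep V \<psi> (pushforward M F X) (\<psi> (F p)) = fd (\<psi> \<circ> F \<circ> inv_into U \<phi>) (\<phi> p) (rep U \<phi> X (\<phi> p))"
proof (rule rep_unique[OF d pushforward_vf[OF F X]])
  fix f assume f: "f \<in> smooth_funs M"
  have p: "p \<in> pts M" using c chart_sub by blast
  let ?F = "\<psi> \<circ> F \<circ> inv_into U \<phi>"
  have sF: "smooth_at ?F (\<phi> p)"
    by (rule mfld2.smooth_map_at[OF mfld2_self diffeo_facts(1)[OF F] c d])
  have "\<forall>\<^sub>F q in near p. F q \<in> V"
    by (rule diffeo_near[OF F p near_chart_dom[OF d]])
  then have "\<forall>\<^sub>F q in near p. F q \<in> V \<and> q \<in> pts M" using near_pts[OF p] by (rule eventually_conj)
  from near_chart_inv[OF c this]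
  have "\<forall>\<^sub>F x in nhds (\<phi> p). ((\<lambda>p\<in>pts M. f (F p)) \<circ> inv_into U \<phi>) x = (f \<circ> inv_into V \<psi>) (?F x)"
    by eventually_elim (use d in auto)
  then have e: "fd ((\<lambda>p\<in>pts M. f (F p)) \<circ> inv_into U \<phi>) (\<phi> p) = fd (\<lambda>x. (f \<circ> inv_into V \<psi>) (?F x)) (\<phi> p)"
    by (rule fd_cong_ev)
  have sf: "smooth_at (f \<circ> inv_into V \<psi>) (?F (\<phi> p))" using smooth_funs_smooth_at[OF f d] c by simp
  have "pushforward M F X f (F p) = fd ((\<lambda>p\<in>pts M. f (F p)) \<circ> inv_into U \<phi>) (\<phi> p) (rep U \<phi> X (\<phi> p))"
    unfolding pushforward_apply[OF F f p] by (rule vf_apply[OF c X pullback_smooth[OF F f]])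
  also have "\<dots> = fd (f \<circ> inv_into V \<psi>) (?F (\<phi> p)) (fd ?F (\<phi> p) (rep U \<phi> X (\<phi> p)))"
    unfolding e by (rule fd_compose(1)[OF smooth_at_differentiable[OF sF] smooth_at_differentiable[OF sf]])
  finally show "pushforward M F X f (F p) = fd (f \<circ> inv_into V \<psi>) (\<psi> (F p)) (fd ?F (\<phi> p) (rep U \<phi> X (\<phi> p)))"
    using c by simp
qed

end

text \<open>The coordinate form of the condition that \<open>F\<close> preserves the connection with Christoffel
  symbols \<open>G\<close>.\<close>

definition preserves_eq :: "('e::real_inner \<Rightarrow> 'e \<Rightarrow> 'e \<Rightarrow> 'e) \<Rightarrow> ('e \<Rightarrow> 'e) \<Rightarrow> 'e \<Rightarrow> bool" where
  "preserves_eq G F x \<longleftrightarrow> (\<forall>u v. fd (\<lambda>y. fd F y v) x u + G (F x) (fd F x u) (fd F x v) = fd F x (G x u v))"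

context conn
begin

text \<open>Differentiating \<open>fd Fc x (rep U \<phi> Y x)\<close> gives two terms; the one with
  the derivative of \<open>Y\<close> also occurs in the pushforward of \<open>D X Y\<close> and
  cancels. What remains depends on the values \<open>u\<close> and \<open>v\<close> only and is the
  defect of \<open>preserves_eq\<close>.\<close>

lemma pushforward_conn_rep:
  assumes F: "diffeo M M F" and X: "X \<in> vfields M" and Y: "Y \<in> vfields M"
    and c: "(U, \<phi>) \<in> atlas M" "p \<in> U" "F p \<in> U"
  defines "Fc \<equiv> \<phi> \<circ> F \<circ> inv_into U \<phi>" and "u \<equiv> rep U \<phi> X (\<phi> p)" and "v \<equiv> rep U \<phi> Y (\<phi> p)"
  shows "rep U \<phi> (D (pushforward M F X) (pushforward M F Y)) (\<phi> (F p)) - rep U \<phi> (pushforward M F (D X Y)) (\<phi> (F p))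
    = fd (\<lambda>y. fd Fc y v) (\<phi> p) u + chr U \<phi> (Fc (\<phi> p)) (fd Fc (\<phi> p) u) (fd Fc (\<phi> p) v) - fd Fc (\<phi> p) (chr U \<phi> (\<phi> p) u v)"
proof -
  have p: "p \<in> pts M" using c chart_sub by blast
  have sF: "smooth_at Fc (\<phi> p)" unfolding Fc_def
    by (rule mfld2.smooth_map_at[OF mfld2_self diffeo_facts(1)[OF F] c(1,2) c(1,3)])
  have Fp: "Fc (\<phi> p) = \<phi> (F p)" using c by (simp add: Fc_def)
  note pX = pushforward_vf[OF F X] and pY = pushforward_vf[OF F Y]
  have rX: "rep U \<phi> (pushforward M F X) (\<phi> (F p)) = fd Fc (\<phi> p) u"
    and rY: "rep U \<phi> (pushforward M F Y) (\<phi> (F p)) = fd Fc (\<phi> p) v"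
    and rD: "rep U \<phi> (pushforward M F (D X Y)) (\<phi> (F p)) = fd Fc (\<phi> p) (rep U \<phi> (D X Y) (\<phi> p))"
    unfolding Fc_def u_def v_def by (rule rep_pushforward[OF F _ c(1,2) c(1,3)]; simp add: X Y)+
  have "\<forall>\<^sub>F q in near p. F q \<in> U"
    by (rule diffeo_near[OF F p near_chart_dom[OF c(1,3)]])
  from near_chart_inv[OF c(1,2) this]
  have "\<forall>\<^sub>F x in nhds (\<phi> p). rep U \<phi> (pushforward M F Y) (Fc x) = fd Fc x (rep U \<phi> Y x)"
  proof eventually_elim
    case (elim x)
    then obtain q where q: "q \<in> U" "x = \<phi> q" by blast
    then have "F q \<in> U" using elim c by simp
    with rep_pushforward[OF F Y c(1) q(1) c(1)] show ?case using q c by (simp add: Fc_def)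
  qed
  then have "fd (\<lambda>x. rep U \<phi> (pushforward M F Y) (Fc x)) (\<phi> p) u = fd (\<lambda>x. fd Fc x (rep U \<phi> Y x)) (\<phi> p) u"
    by (simp only: fd_cong_ev)
  moreover have "smooth_at (rep U \<phi> (pushforward M F Y)) (Fc (\<phi> p))"
    unfolding Fp by (rule rep_smooth[OF c(1,3) pY])
  from fd_compose(1)[OF smooth_at_differentiable[OF sF] smooth_at_differentiable[OF this]]
  have "fd (\<lambda>x. rep U \<phi> (pushforward M F Y) (Fc x)) (\<phi> p) u = fd (rep U \<phi> (pushforward M F Y)) (\<phi> (F p)) (fd Fc (\<phi> p) u)"
    unfolding Fp .
  ultimately have 1: "fd (rep U \<phi> (pushforward M F Y)) (\<phi> (F p)) (fd Fc (\<phi> p) u) =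
      fd (\<lambda>y. fd Fc y v) (\<phi> p) u + fd Fc (\<phi> p) (fd (rep U \<phi> Y) (\<phi> p) u)"
    by (simp add: fd_family(2)[OF onb sF rep_smooth[OF c(1,2) Y]] v_def)
  have "rep U \<phi> (D (pushforward M F X) (pushforward M F Y)) (\<phi> (F p)) =
     fd (\<lambda>y. fd Fc y v) (\<phi> p) u + fd Fc (\<phi> p) (fd (rep U \<phi> Y) (\<phi> p) u) + chr U \<phi> (Fc (\<phi> p)) (fd Fc (\<phi> p) u) (fd Fc (\<phi> p) v)"
    unfolding rep_conn[OF c(1,3) pX pY] rX rY 1 Fp ..
  moreover have "rep U \<phi> (pushforward M F (D X Y)) (\<phi> (F p)) = fd Fc (\<phi> p) (fd (rep U \<phi> Y) (\<phi> p) u) + fd Fc (\<phi> p) (chr U \<phi> (\<phi> p) u v)"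
    unfolding rD rep_conn[OF c(1,2) X Y] by (simp add: linear_add[OF smooth_at_linear_fd[OF sF]] u_def v_def)
  ultimately show ?thesis by simp
qed

text \<open>Coordinate fields with values \<open>u\<close> and \<open>v\<close> isolate the defect
  computed in \<open>pushforward_conn_rep\<close>.\<close>

lemma preserves_preserves_eq:
  assumes F: "diffeo M M F" and pres: "preserves_connection M D F" and c: "(U, \<phi>) \<in> atlas M" "p \<in> U" "F p \<in> U"
  shows "preserves_eq (chr U \<phi>) (\<phi> \<circ> F \<circ> inv_into U \<phi>) (\<phi> p)"
  unfolding preserves_eq_def
proof (intro allI)
  fix u v
  obtain E E' where E: "cfield U \<phi> (\<phi> p) u E" "cfield U \<phi> (\<phi> p) v E'" using cfield_exists[OF c(1,2)] by blast
  note V = cfield_vf[OF E(1)] cfield_vf[OF E(2)]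
  have "pushforward M F (D E E') = D (pushforward M F E) (pushforward M F E')"
    using pres V unfolding preserves_connection_def by blast
  then show "fd (\<lambda>y. fd (\<phi> \<circ> F \<circ> inv_into U \<phi>) y v) (\<phi> p) u +
     chr U \<phi> ((\<phi> \<circ> F \<circ> inv_into U \<phi>) (\<phi> p)) (fd (\<phi> \<circ> F \<circ> inv_into U \<phi>) (\<phi> p) u) (fd (\<phi> \<circ> F \<circ> inv_into U \<phi>) (\<phi> p) v)
     = fd (\<phi> \<circ> F \<circ> inv_into U \<phi>) (\<phi> p) (chr U \<phi> (\<phi> p) u v)"
    using pushforward_conn_rep[OF F V c] unfolding cfield_rep[OF E(1)] cfield_rep[OF E(2)] by simp
qed

text \<open>Each point is tested in a single chart that contains both \<open>p\<close> and
  \<open>F p\<close>; flow maps for short times provide such charts.\<close>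

lemma preserves_eq_preserves:
  assumes F: "diffeo M M F"
    and k: "\<And>p. p \<in> pts M \<Longrightarrow> \<exists>U \<phi>. (U, \<phi>) \<in> atlas M \<and> p \<in> U \<and> F p \<in> U \<and> preserves_eq (chr U \<phi>) (\<phi> \<circ> F \<circ> inv_into U \<phi>) (\<phi> p)"
  shows "preserves_connection M D F"
  unfolding preserves_connection_def
proof (intro ballI)
  fix X Y assume X: "X \<in> vfields M" and Y: "Y \<in> vfields M"
  note P = pushforward_vf[OF F X] pushforward_vf[OF F Y]
  show "pushforward M F (D X Y) = D (pushforward M F X) (pushforward M F Y)"
  proof (rule vf_eqI[OF pushforward_vf[OF F D_vf[OF X Y]] D_vf[OF P]])
    fix f q assume f: "f \<in> smooth_funs M" and q: "q \<in> pts M"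
    define p where "p = inv_into (pts M) F q"
    have p: "p \<in> pts M" "F p = q" unfolding p_def by (simp_all add: diffeo_facts[OF F] q)
    obtain U \<phi> where c: "(U, \<phi>) \<in> atlas M" "p \<in> U" "F p \<in> U" and ke: "preserves_eq (chr U \<phi>) (\<phi> \<circ> F \<circ> inv_into U \<phi>) (\<phi> p)"
      using k[OF p(1)] by blast
    have "rep U \<phi> (D (pushforward M F X) (pushforward M F Y)) (\<phi> (F p)) = rep U \<phi> (pushforward M F (D X Y)) (\<phi> (F p))"
      using pushforward_conn_rep[OF F X Y c] ke unfolding preserves_eq_def by simp
    then show "pushforward M F (D X Y) f q = D (pushforward M F X) (pushforward M F Y) f q"
      unfolding p(2)[symmetric] vf_apply[OF c(1,3) pushforward_vf[OF F D_vf[OF X Y]] f] vf_apply[OF c(1,3) D_vf[OF P] f]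
      by simp
  qed
qed

end

lemma fd_fst_slice:
  assumes "smooth_at H (t, x)"
  shows "fd (\<lambda>s. H (s, x)) t v = fd H (t, x) (v, 0)"
proof -
  have "((\<lambda>s. (s, x)) has_derivative (\<lambda>v. (v, 0))) (at t)"
    by (intro has_derivative_Pair has_derivative_ident has_derivative_const)
  from diff_chain_at[OF this smooth_at_has_derivative[OF assms]]
  show ?thesis by (simp add: o_def fd_eq)
qed

lemma fd_snd_slice:
  assumes "smooth_at H (t, x)"
  shows "fd (\<lambda>y. H (t, y)) x v = fd H (t, x) (0, v)"
proof -
  have "((\<lambda>y. (t, y)) has_derivative (\<lambda>v. (0, v))) (at x)"
    by (intro has_derivative_Pair has_derivative_ident has_derivative_const)
  from diff_chain_at[OF this smooth_at_has_derivative[OF assms]]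
  show ?thesis by (simp add: o_def fd_eq)
qed

lemma smooth_at_fst_slice:
  fixes A :: "'a::real_inner set" and B :: "'b::real_inner set" and H :: "'a \<times> 'b \<Rightarrow> 'c::real_normed_vector"
  assumes "orthobasis A" "orthobasis B" "smooth_at H (t, x)"
  shows "smooth_at (\<lambda>s. H (s, x)) t"
  by (rule smooth_at_compose[where f="\<lambda>s. (s, x)", OF orthobasis_Times[OF assms(1,2)] _ assms(3)])
    (rule smooth_at_prod[OF smooth_at_ident smooth_at_const])

lemma nhds_nhds: "eventually P (nhds x) \<Longrightarrow> \<forall>\<^sub>F y in nhds x. eventually P (nhds y)"
  by (simp add: eventually_eventually)

lemma nhds_prod_snd: "eventually P (nhds (t, x)) \<Longrightarrow> \<forall>\<^sub>F y in nhds x. P (t, y)"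
  unfolding nhds_prod eventually_prod_filter
  by (auto elim!: eventually_mono dest: eventually_nhds_x_imp_x)

lemma nhds_prod_fst: "eventually P (nhds (t, x)) \<Longrightarrow> \<forall>\<^sub>F s in nhds t. P (s, x)"
  unfolding nhds_prod eventually_prod_filter
  by (auto elim!: eventually_mono dest: eventually_nhds_x_imp_x)

context christoffel
begin

text \<open>The equation for affine fields is the derivative at time 0 of the equation for affine maps.\<close>

lemma affine_eq_of_curve:
  fixes F :: "real \<times> 'e \<Rightarrow> 'e"
  assumes F: "smooth_at F (0, x0)" and x0: "x0 \<in> S"
    and F0: "\<forall>\<^sub>F x in nhds x0. F (0, x) = x" and f: "\<forall>\<^sub>F x in nhds x0. fd F (0, x) (1, 0) = f x"
    and k: "\<forall>\<^sub>F t in nhds 0. preserves_eq G (\<lambda>x. F (t, x)) x0"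
  shows "affine_eq f x0"
  unfolding affine_eq_def
proof (intro allI)
  fix u w :: 'e
  let ?z = "(0 :: real, x0)"
  note ev = near_smooth_at[OF F]
  have Fz: "F ?z = x0" using eventually_nhds_x_imp_x[OF F0] .
  have sF: "smooth_at (\<lambda>z. fd F z d) ?z" for d by (rule smooth_at_fd[OF F])
  have d0: "fd F (0, x) (0, v) = v" if "smooth_at F (0, x)" "\<forall>\<^sub>F x in nhds x. F (0, x) = x" for x v
    using fd_snd_slice[OF that(1), of v] fd_cong_ev[OF that(2)] by simp
  have d0z: "fd F ?z (0, v) = v" for v by (rule d0[OF F F0])
  have f1: "\<forall>\<^sub>F x in nhds x0. fd (\<lambda>z. fd F z (1, 0)) (0, x) (0, v) = fd f x v" for v
    using nhds_prod_snd[OF ev] nhds_nhds[OF f]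
  proof eventually_elim
    case (elim x)
    show ?case using fd_snd_slice[OF smooth_at_fd[OF elim(1)], of "(1, 0)" v] fd_cong_ev[OF elim(2)] by simp
  qed
  have f1z: "fd (\<lambda>z. fd F z (1, 0)) ?z (0, v) = fd f x0 v" for v by (rule eventually_nhds_x_imp_x[OF f1])
  have f0z: "fd F ?z (1, 0) = f x0" by (rule eventually_nhds_x_imp_x[OF f])
  \<comment> \<open>By symmetry of second derivatives the velocity of \<open>fd F (t, x0)\<close> at
    time 0 is the derivative of the velocity field.\<close>
  have sw: "fd (\<lambda>z. fd F z (0, v)) ?z (1, 0) = fd f x0 v" for v
    using fd_symmetric[OF basis F, of "(0, v)" "(1, 0)"] f1z by simp
  have s2: "smooth_at (\<lambda>z. fd (\<lambda>z. fd F z (0, u)) z d) ?z" for d by (rule smooth_at_fd[OF sF])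
  \<comment> \<open>The time derivative is moved past the two space derivatives one at a
    time.\<close>
  have third: "fd (\<lambda>z. fd (\<lambda>z. fd F z (0, u)) z (0, w)) ?z (1, 0) = fd (\<lambda>y. fd f y u) x0 w"
  proof -
    have "fd (\<lambda>z. fd (\<lambda>z. fd F z (0, u)) z (0, w)) ?z (1, 0) = fd (\<lambda>z. fd (\<lambda>z. fd F z (0, u)) z (1, 0)) ?z (0, w)"
      by (rule fd_symmetric[OF basis sF])
    also have "fd (\<lambda>z. fd (\<lambda>z. fd F z (0, u)) z (1, 0)) ?z = fd (\<lambda>z. fd (\<lambda>z. fd F z (1, 0)) z (0, u)) ?z"
      by (rule fd_cong_ev) (use ev in \<open>auto elim!: eventually_mono intro: fd_symmetric[OF basis]\<close>)
    also have "\<dots> (0, w) = fd (\<lambda>x. fd (\<lambda>z. fd F z (1, 0)) (0, x) (0, u)) x0 w"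
      by (rule fd_snd_slice[symmetric]) (rule smooth_at_fd[OF sF])
    also have "\<dots> = fd (\<lambda>y. fd f y u) x0 w" by (simp only: fd_cong_ev[OF f1])
    finally show ?thesis .
  qed
  \<comment> \<open>The equation of affine maps at time \<open>t\<close>, rewritten with derivatives
    of \<open>F\<close> on the product so that it can be differentiated in \<open>t\<close>.\<close>
  have keqt: "\<forall>\<^sub>F t in nhds 0. fd (\<lambda>z. fd F z (0, u)) (t, x0) (0, w) +
      G (F (t, x0)) (fd F (t, x0) (0, w)) (fd F (t, x0) (0, u)) = fd F (t, x0) (0, G x0 w u)"
    using k nhds_prod_fst[OF nhds_nhds[OF ev]]
  proof eventually_elim
    case (elim t)
    have s: "smooth_at F (t, x0)" using eventually_nhds_x_imp_x[OF elim(2)] .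
    have e: "\<forall>\<^sub>F y in nhds x0. fd (\<lambda>x. F (t, x)) y u = fd F (t, y) (0, u)"
      using nhds_prod_snd[OF elim(2)] by eventually_elim (rule fd_snd_slice)
    have "fd (\<lambda>y. fd (\<lambda>x. F (t, x)) y u) x0 w = fd (\<lambda>y. fd F (t, y) (0, u)) x0 w" by (simp only: fd_cong_ev[OF e])
    also have "\<dots> = fd (\<lambda>z. fd F z (0, u)) (t, x0) (0, w)" by (rule fd_snd_slice[OF smooth_at_fd[OF s]])
    finally have *: "fd (\<lambda>y. fd (\<lambda>x. F (t, x)) y u) x0 w = fd (\<lambda>z. fd F z (0, u)) (t, x0) (0, w)" .
    from elim(1) have "fd (\<lambda>y. fd (\<lambda>x. F (t, x)) y u) x0 w + G (F (t, x0)) (fd (\<lambda>x. F (t, x)) x0 w) (fd (\<lambda>x. F (t, x)) x0 u)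
      = fd (\<lambda>x. F (t, x)) x0 (G x0 w u)" unfolding preserves_eq_def by blast
    then show ?case unfolding * fd_snd_slice[OF s] .
  qed
  have slice: "smooth_at (\<lambda>t. H (t, x0)) 0" "fd (\<lambda>t. H (t, x0)) 0 1 = fd H ?z (1, 0)"
    if "smooth_at H ?z" for H :: "real \<times> 'e \<Rightarrow> 'e"
    using smooth_at_fst_slice[OF orthobasis_real basis that] fd_fst_slice[OF that] by simp_all
  have bG: "smooth_at (\<lambda>t. G (F (t, x0)) a b) 0" "fd (\<lambda>t. G (F (t, x0)) a b) 0 1 = fd (\<lambda>y. G y a b) x0 (f x0)" for a b
  proof -
    have sG: "smooth_at (\<lambda>y. G y a b) (F (0, x0))" unfolding Fz by (rule G_smooth[OF x0])
    show "smooth_at (\<lambda>t. G (F (t, x0)) a b) 0"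
      by (rule smooth_at_compose[OF basis slice(1)[OF F] sG])
    show "fd (\<lambda>t. G (F (t, x0)) a b) 0 1 = fd (\<lambda>y. G y a b) x0 (f x0)"
      using fd_compose(1)[OF smooth_at_differentiable[OF slice(1)[OF F]] smooth_at_differentiable[OF sG], of 1]
      unfolding slice(2)[OF F] f0z Fz .
  qed
  have bb: "\<forall>\<^sub>F t in nhds 0. bilinear (G (F (t, x0)))" by (rule always_eventually) (simp add: bil)
  note BF = bilinear_family[OF basis bb bG(1) slice(1)[OF sF] slice(1)[OF sF], of "(0, w)" "(0, u)"]
  have "fd (\<lambda>t. fd (\<lambda>z. fd F z (0, u)) (t, x0) (0, w) + G (F (t, x0)) (fd F (t, x0) (0, w)) (fd F (t, x0) (0, u))) 0 1
      = fd (\<lambda>t. fd F (t, x0) (0, G x0 w u)) 0 1"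
    by (simp only: fd_cong_ev[OF keqt])
  then show "fd (\<lambda>y. fd f y u) x0 w + fd (\<lambda>y. G y w u) x0 (f x0) + G x0 (fd f x0 w) u + G x0 w (fd f x0 u) = fd f x0 (G x0 w u)"
    unfolding fd_add[OF slice(1)[OF s2] BF(1)] BF(2) slice(2)[OF s2] slice(2)[OF sF] third sw Fz d0z bG(2)
    by (simp add: add.assoc)
qed

end

lemma preserves_eq_cong:
  assumes e: "\<forall>\<^sub>F y in nhds x. f y = g y"
  shows "preserves_eq G f x \<longleftrightarrow> preserves_eq G g x"
proof -
  have "\<forall>\<^sub>F y in nhds x. fd f y u = fd g y u" for u
    using nhds_nhds[OF e] by eventually_elim (simp add: fd_cong_ev)
  then have "fd (\<lambda>y. fd f y u) x = fd (\<lambda>y. fd g y u) x" for u by (rule fd_cong_ev)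
  then show ?thesis
    unfolding preserves_eq_def by (simp add: fd_cong_ev[OF e] eventually_nhds_x_imp_x[OF e])
qed

section \<open>The group of affine maps and its induced fields\<close>

locale aff_group = flat_conn M B D + G: mfld G C
  for M :: "('a, 'e::real_inner) manifold" and B :: "'e set" and D :: "'a connection"
    and G :: "('a \<Rightarrow> 'a, 'f::real_inner) manifold" and C :: "'f set" +
  fixes k :: nat
  assumes alg: "affine_lie_group k M D G"
begin

abbreviation \<Gamma> where "\<Gamma> \<equiv> Aff_group M D"
definition e :: "'a \<Rightarrow> 'a" where "e = (\<lambda>x\<in>pts M. x)"

lemma lg: "lie_group k G \<Gamma>"
  using alg by (simp add: affine_lie_group_def)

lemma group_G: "group \<Gamma>"
  using lg by (simp add: lie_group_def)

lemma carrier_G: "carrier \<Gamma> = pts G"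
  using lg by (simp add: lie_group_def)

lemma pts_G: "pts G = Aff M D"
  using carrier_G by (simp add: Aff_group_def)

lemma one_G: "\<one>\<^bsub>\<Gamma>\<^esub> = e"
  by (simp add: Aff_group_def BijGroup_def e_def)

lemma e_in [simp]: "e \<in> pts G"
  using group.is_monoid[OF group_G] monoid.one_closed one_G carrier_G by metis

lemma e_apply [simp]: "p \<in> pts M \<Longrightarrow> e p = p"
  by (simp add: e_def)

lemma act_smooth: "smooth_map (prod_manifold G M) M (\<lambda>(g, p). g p)"
  using alg by (simp add: affine_lie_group_def)

lemma G_diffeo: "g \<in> pts G \<Longrightarrow> diffeo M M g"
  by (simp add: pts_G Aff_def)

lemma G_preserves: "g \<in> pts G \<Longrightarrow> preserves_connection M D g"
  by (simp add: pts_G Aff_def)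

lemma G_Bij: "g \<in> pts G \<Longrightarrow> g \<in> Bij (pts M)"
  by (simp add: pts_G Aff_def)

lemma G_pts: "g \<in> pts G \<Longrightarrow> p \<in> pts M \<Longrightarrow> g p \<in> pts M"
  by (rule diffeo_facts(3)[OF G_diffeo])

lemma mult_G: "g \<in> pts G \<Longrightarrow> h \<in> pts G \<Longrightarrow> g \<otimes>\<^bsub>\<Gamma>\<^esub> h = compose (pts M) g h"
  by (simp add: Aff_group_def BijGroup_def G_Bij)

lemma GM: "mfld2 G C M B" and MM: "mfld M B" and GG: "mfld G C"
  by (simp_all add: mfld2_def mfld_axioms G.mfld_axioms)

lemma orbit_smooth_map:
  assumes p: "p \<in> pts M" shows "smooth_map G M (\<lambda>g. g p)"
proof -
  have "smooth_map G (prod_manifold G M) (\<lambda>g. (g, p))"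
    by (rule smooth_map_pair[OF GG GG MM smooth_map_id[OF GG] mfld2.smooth_map_const[OF GM p]])
  from smooth_map_comp[OF GG mfld_prod[OF GG MM] MM this act_smooth] show ?thesis by simp
qed

lemma orbit_fun: "p \<in> pts M \<Longrightarrow> f \<in> smooth_funs M \<Longrightarrow> (\<lambda>g\<in>pts G. f (g p)) \<in> smooth_funs G"
  by (rule mfld2.smooth_map_funs[OF GM orbit_smooth_map])

lemma induced_apply: "f \<in> smooth_funs M \<Longrightarrow> p \<in> pts M \<Longrightarrow>
    induced_vfield M G \<xi> f p = \<xi> (\<lambda>g\<in>pts G. f (g p)) e"
  by (simp add: induced_vfield_def e_def)

text \<open>In a chart of \<open>G\<close> the straight line through the identity with the direction
  of \<open>\<xi>\<close> is a curve of affine maps whose velocity at time 0 is the induced field,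
  so \<open>affine_eq_of_curve\<close> applies.\<close>

lemma induced_affine_vf:
  assumes \<xi>: "\<xi> \<in> vfields G" and X: "induced_vfield M G \<xi> \<in> vfields M"
  shows "affine_vf (induced_vfield M G \<xi>)"
  unfolding affine_vf_def
proof (intro conjI allI impI X)
  fix U \<phi> p assume c: "(U, \<phi>) \<in> atlas M" "p \<in> U"
  interpret ch: christoffel B "\<phi> ` U" "chr U \<phi>" by (rule chr_christoffel[OF c(1)])
  have p: "p \<in> pts M" using c chart_sub by blast
  obtain V \<theta> where d: "(V, \<theta>) \<in> atlas G" "e \<in> V" using G.chart_exists[OF e_in] by blast
  \<comment> \<open>The action in product coordinates, smooth by the assumption on the
    action.\<close>
  define a where "a = \<phi> \<circ> (\<lambda>(g, p). g p) \<circ> inv_into (V \<times> U) (map_prod \<theta> \<phi>)"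
  define v where "v = G.rep V \<theta> \<xi> (\<theta> e)"
  interpret PM: mfld2 "prod_manifold G M" "prod_basis C B" M B
    using mfld_prod[OF GG MM] MM by (simp add: mfld2_def)
  note pc = prod_chart[OF GG MM d c]
  have oP: "orthobasis (prod_basis C B)" by (rule PM.M.onb)
  have a_s: "smooth_at a (\<theta> e, \<phi> p)"
    using PM.smooth_map_at[OF act_smooth pc(1) pc(2) c(1)] c p unfolding a_def by simp
  have a_eq: "a (s, x) = \<phi> ((inv_into V \<theta> s) (inv_into U \<phi> x))" if "s \<in> \<theta> ` V" "x \<in> \<phi> ` U" for s x
    using inv_into_map_prod[OF G.chart_inj[OF d(1)] chart_inj[OF c(1)] that] by (simp add: a_def)
  have near_a: "\<forall>\<^sub>F x in nhds (\<phi> p). smooth_at a (\<theta> e, x)"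
    by (rule nhds_prod_snd[OF near_smooth_at[OF a_s]])
  \<comment> \<open>Only the velocity at time 0 and the fact that nearby points are affine maps
    matter, so the curve may be a straight line rather than a one-parameter group.\<close>
  define F where "F = (\<lambda>(t :: real, x). a (\<theta> e + t *\<^sub>R v, x))"
  have l_s: "smooth_at (\<lambda>(t :: real, x). (\<theta> e + t *\<^sub>R v, x)) (t, x)" for t and x :: 'e
    unfolding case_prod_unfold
    by (intro smooth_at_prod smooth_at_add smooth_at_scaleR smooth_at_const smooth_at_linear
        bounded_linear_fst bounded_linear_snd)
  have F_s: "smooth_at F (0, x)" if "smooth_at a (\<theta> e, x)" for x
  proof -
    have "smooth_at (\<lambda>z. a ((\<lambda>(t :: real, x). (\<theta> e + t *\<^sub>R v, x)) z)) (0, x)"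
      by (rule smooth_at_compose[OF oP l_s]) (use that in simp)
    then show ?thesis by (simp add: F_def case_prod_unfold)
  qed
  have F0: "\<forall>\<^sub>F x in nhds (\<phi> p). F (0, x) = x"
  proof -
    have "F (0, x) = x" if "x \<in> \<phi> ` U" for x
    proof -
      obtain q where q: "q \<in> U" "x = \<phi> q" using \<open>x \<in> \<phi> ` U\<close> by blast
      have "q \<in> pts M" using q chart_sub[OF c(1)] by blast
      then show ?thesis using a_eq[of "\<theta> e" x] q d c by (simp add: F_def)
    qed
    then show ?thesis using ch.eventually_S[of "\<phi> p"] c by (auto elim: eventually_mono)
  qed
  have pp: "(e, p) \<in> pts (prod_manifold G M)" using p by simp
  \<comment> \<open>A product neighbourhood of \<open>(e, p)\<close> that the action maps into
    \<open>U\<close>: for \<open>q\<close> near \<open>p\<close> the orbit map sends a neighbourhood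
    of \<open>e\<close> into the same chart.\<close>
  have orb_near: "\<forall>\<^sub>F q in near p. \<forall>\<^sub>F g in G.near e. g q \<in> U"
  proof -
    have "\<forall>\<^sub>F z in PM.M.near (e, p). (case z of (g, p) \<Rightarrow> g p) \<in> U"
      using PM.preimage_near[of "\<lambda>(g, p). g p" "(e, p)" "\<lambda>q. q \<in> U"] act_smooth near_chart_dom[OF c] p
      by (simp add: smooth_map_def)
    then obtain W where W: "openin (mtop (prod_manifold G M)) W" "(e, p) \<in> W"
      "\<forall>z\<in>W. (case z of (g, p) \<Rightarrow> g p) \<in> U" "W \<subseteq> pts (prod_manifold G M)"
      by (rule PM.M.near_openE[OF pp])
    from W(1)[unfolded mtop_prod openin_prod_topology_alt, rule_format, OF W(2)]
    obtain W1 W2 where WW: "openin (mtop G) W1" "openin (mtop M) W2" "e \<in> W1" "p \<in> W2" "W1 \<times> W2 \<subseteq> W"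
      by (elim exE conjE)
    show ?thesis
    proof (rule near_openI[OF WW(2,4)])
      fix q assume "q \<in> W2"
      then have "g q \<in> U" if "g \<in> W1" for g using that WW(5) W(3) by fastforce
      then show "\<forall>\<^sub>F g in G.near e. g q \<in> U" by (rule G.near_openI[OF WW(1,3)])
    qed
  qed
  have f: "\<forall>\<^sub>F x in nhds (\<phi> p). fd F (0, x) (1, 0) = rep U \<phi> (induced_vfield M G \<xi>) x"
  proof -
    have "\<forall>\<^sub>F x in nhds (\<phi> p). smooth_at a (\<theta> e, x) \<and> x \<in> \<phi> ` U \<and> (\<forall>\<^sub>F g in G.near e. g (inv_into U \<phi> x) \<in> U)"
      using near_a near_chart_inv[OF c orb_near] by (rule eventually_conj)
    then show ?thesis
    proof eventually_elim
      case (elim x)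
      then obtain q where q: "q \<in> U" "x = \<phi> q" by blast
      have sa: "smooth_at a (\<theta> e, \<phi> q)" using elim q by simp
      have qM: "q \<in> pts M" using q chart_sub[OF c(1)] by blast
      have "((\<lambda>(t :: real, x). (\<theta> e + t *\<^sub>R v, x)) has_derivative (\<lambda>(s, h). (s *\<^sub>R v, h))) (at (0, \<phi> q))"
        unfolding case_prod_unfold
        by (auto intro!: derivative_eq_intros)
      from diff_chain_at[OF this, of a "fd a (\<theta> e, \<phi> q)"] smooth_at_has_derivative[OF sa]
      have "fd F (0, \<phi> q) = fd a (\<theta> e, \<phi> q) \<circ> (\<lambda>(s, h). (s *\<^sub>R v, h))"
        by (intro fd_eq) (simp add: F_def o_def case_prod_unfold)
      then have Fa: "fd F (0, \<phi> q) (1, 0) = fd a (\<theta> e, \<phi> q) (v, 0)" by simp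
      have "rep U \<phi> (induced_vfield M G \<xi>) (\<phi> q) = fd a (\<theta> e, \<phi> q) (v, 0)"
      proof (rule rep_unique[OF c(1) q(1) X])
        fix f assume f: "f \<in> smooth_funs M"
        let ?s = "\<lambda>s. a (s, \<phi> q)"
        have ss: "smooth_at ?s (\<theta> e)" by (rule smooth_at_fst_slice[OF G.onb onb sa])
        have s0: "?s (\<theta> e) = \<phi> q" using a_eq[of "\<theta> e" "\<phi> q"] d q c qM by simp
        have sf: "smooth_at (f \<circ> inv_into U \<phi>) (\<phi> q)" by (rule smooth_funs_smooth_at[OF f c(1) q(1)])
        have "\<forall>\<^sub>F g in G.near e. g q \<in> U" using elim q c by simp
        from G.near_chart_inv[OF d this]
        have "\<forall>\<^sub>F s in nhds (\<theta> e). ((\<lambda>g\<in>pts G. f (g q)) \<circ> inv_into V \<theta>) s = (f \<circ> inv_into U \<phi>) (?s s)"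
        proof eventually_elim
          case (elim s)
          then obtain g where g: "g \<in> V" "s = \<theta> g" by blast
          have "g \<in> pts G" using g G.chart_sub[OF d(1)] by blast
          moreover have "g q \<in> U" using elim g d by simp
          ultimately show ?case using a_eq[of s "\<phi> q"] g q d c by simp
        qed
        then have ee: "fd ((\<lambda>g\<in>pts G. f (g q)) \<circ> inv_into V \<theta>) (\<theta> e) = fd (\<lambda>s. (f \<circ> inv_into U \<phi>) (?s s)) (\<theta> e)"
          by (rule fd_cong_ev)
        have "induced_vfield M G \<xi> f q = fd ((\<lambda>g\<in>pts G. f (g q)) \<circ> inv_into V \<theta>) (\<theta> e) v"
          unfolding induced_apply[OF f qM] v_def by (rule G.vf_apply[OF d \<xi> orbit_fun[OF qM f]])
        also have "\<dots> = fd (f \<circ> inv_into U \<phi>) (\<phi> q) (fd ?s (\<theta> e) v)"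
          unfolding ee using fd_compose(1)[OF smooth_at_differentiable[OF ss], of "f \<circ> inv_into U \<phi>" v]
            smooth_at_differentiable[OF sf] unfolding s0 by blast
        finally show "induced_vfield M G \<xi> f q = fd (f \<circ> inv_into U \<phi>) (\<phi> q) (fd a (\<theta> e, \<phi> q) (v, 0))"
          unfolding fd_fst_slice[OF sa] .
      qed
      then show ?case using Fa q by simp
    qed
  qed
  \<comment> \<open>For small \<open>t\<close> the point of the line is the coordinate of an element
    of \<open>G\<close>, and the slice of \<open>F\<close> at \<open>t\<close> is the expression of
    this affine map in the chart.\<close>
  have k: "\<forall>\<^sub>F t in nhds 0. preserves_eq (chr U \<phi>) (\<lambda>x. F (t, x)) (\<phi> p)"
  proof -
    have "\<forall>\<^sub>F s in nhds (\<theta> e). s \<in> \<theta> ` V \<and> (inv_into V \<theta> s) p \<in> U"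
      using G.near_chart_inv[OF d near_self[OF p orb_near]] .
    moreover have "((\<lambda>t. \<theta> e + t *\<^sub>R v) \<longlongrightarrow> \<theta> e) (nhds 0)"
    proof -
      have "((\<lambda>t. \<theta> e + t *\<^sub>R v) \<longlongrightarrow> \<theta> e + 0 *\<^sub>R v) (nhds 0)"
        by (intro tendsto_intros filterlim_ident)
      then show ?thesis by simp
    qed
    ultimately have "\<forall>\<^sub>F t in nhds 0. \<theta> e + t *\<^sub>R v \<in> \<theta> ` V \<and> (inv_into V \<theta> (\<theta> e + t *\<^sub>R v)) p \<in> U"
      by (rule eventually_compose_filterlim)
    then show ?thesis
    proof eventually_elim
      case (elim t)
      define g where "g = inv_into V \<theta> (\<theta> e + t *\<^sub>R v)"
      have "g \<in> V" using elim by (simp add: g_def inv_into_into)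
      then have g: "g \<in> pts G" using G.chart_sub[OF d(1)] by blast
      have "preserves_eq (chr U \<phi>) (\<phi> \<circ> g \<circ> inv_into U \<phi>) (\<phi> p)"
        using elim by (intro preserves_preserves_eq[OF G_diffeo[OF g] G_preserves[OF g] c]) (simp add: g_def)
      moreover have ge: "\<forall>\<^sub>F x in nhds (\<phi> p). (\<phi> \<circ> g \<circ> inv_into U \<phi>) x = F (t, x)"
        using ch.eventually_S[of "\<phi> p"] c elim by (auto elim!: eventually_mono simp: F_def a_eq g_def)
      ultimately show ?case by (simp only: preserves_eq_cong[OF ge])
    qed
  qed
  show "ch.affine_eq (rep U \<phi> (induced_vfield M G \<xi>)) (\<phi> p)"
    by (rule ch.affine_eq_of_curve[OF F_s[OF a_s] _ F0 f k]) (use c in simp)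
qed

end

section \<open>The local flow of an affine field\<close>

lemma quadratic_has_derivative:
  fixes F :: "'e::real_inner \<Rightarrow> 'b::real_normed_vector" and B :: "'e set"
  assumes B: "orthobasis B" and A: "linear A" and N: "open N" "x \<in> N"
    and q: "\<And>y. y \<in> N \<Longrightarrow> norm (F y - F x - A (y - x)) \<le> K * (norm (y - x))\<^sup>2"
  shows "(F has_derivative A) (at x)"
  unfolding has_derivative_at_within
proof (intro conjI orthobasis_bounded_linear[OF B A])
  have "\<forall>\<^sub>F y in at x. norm (((F y - F x) - A (y - x)) /\<^sub>R norm (y - x)) \<le> \<bar>K\<bar> * norm (y - x)"
    unfolding eventually_at_topological
  proof (intro exI[of _ N] conjI ballI impI N)
    fix y assume y: "y \<in> N" "y \<noteq> x"
    have "norm (F y - F x - A (y - x)) \<le> \<bar>K\<bar> * (norm (y - x))\<^sup>2"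
      using q[OF y(1)] mult_right_mono[OF abs_ge_self, of "(norm (y - x))\<^sup>2" K] by simp
    then have "norm (F y - F x - A (y - x)) / norm (y - x) \<le> \<bar>K\<bar> * (norm (y - x))\<^sup>2 / norm (y - x)"
      by (rule divide_right_mono) simp
    moreover have "norm (((F y - F x) - A (y - x)) /\<^sub>R norm (y - x)) = norm (F y - F x - A (y - x)) / norm (y - x)"
      by (simp only: norm_scaleR) (simp add: divide_inverse)
    ultimately show "norm (((F y - F x) - A (y - x)) /\<^sub>R norm (y - x)) \<le> \<bar>K\<bar> * norm (y - x)"
      using y(2) by (simp add: power2_eq_square)
  qed
  moreover have "((\<lambda>y. \<bar>K\<bar> * norm (y - x)) \<longlongrightarrow> 0) (at x)"
    by (auto intro!: tendsto_eq_intros)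
  ultimately show "((\<lambda>y. ((F y - F x) - A (y - x)) /\<^sub>R norm (y - x)) \<longlongrightarrow> 0) (at x)"
    by (rule Lim_null_comparison)
qed

text \<open>Only a Lipschitz bound along the two curves is assumed, so the lemma serves nonlinear
  autonomous equations as well as linear ones.\<close>

lemma linear_ode_unique:
  fixes w :: "real \<Rightarrow> 'e::real_inner"
  assumes w: "\<And>t. \<bar>t\<bar> < \<tau> \<Longrightarrow> (w has_vector_derivative A t (w t)) (at t)"
    and v: "\<And>t. \<bar>t\<bar> < \<tau> \<Longrightarrow> (v has_vector_derivative A t (v t)) (at t)"
    and A: "\<And>t. \<bar>t\<bar> < \<tau> \<Longrightarrow> norm (A t (w t) - A t (v t)) \<le> L * norm (w t - v t)"
    and L: "L \<ge> 0" and i: "w 0 = v 0" and t: "\<bar>t\<bar> < \<tau>"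
  shows "w t = v t"
proof -
  have "(norm (w t - v t))\<^sup>2 \<le> ((norm (w 0 - v 0))\<^sup>2 + 0\<^sup>2) * exp ((2 * L + 1) * \<bar>t\<bar>)"
    by (rule gronwall_norm[of \<tau> "\<lambda>t. w t - v t" "\<lambda>t. A t (w t) - A t (v t)" L 0])
      (use w v A L t in \<open>auto intro!: has_vector_derivative_diff\<close>)
  then show ?thesis by (simp add: i)
qed

section \<open>Affine fields have affine local flows\<close>

context christoffel
begin

lemma G_curve:
  assumes x: "y t \<in> S" and y: "(y has_vector_derivative y') (at t)"
    and a: "(a has_vector_derivative a') (at t)" and b: "(b has_vector_derivative b') (at t)"
  shows "((\<lambda>t. G (y t) (a t) (b t)) has_vector_derivative
    fd (\<lambda>z. G z (a t) (b t)) (y t) y' + G (y t) a' (b t) + G (y t) (a t) b') (at t)"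
proof -
  let ?z = "(y t, a t, b t)"
  let ?H = "\<lambda>z. G (fst z) (fst (snd z)) (snd (snd z))"
  have l: "smooth_at (fst :: 'e \<times> 'e \<times> 'e \<Rightarrow> 'e) z" "smooth_at (\<lambda>z :: 'e \<times> 'e \<times> 'e. fst (snd z)) z"
    "smooth_at (\<lambda>z :: 'e \<times> 'e \<times> 'e. snd (snd z)) z" for z
    by (intro smooth_at_linear bounded_linear_fst bounded_linear_snd
        bounded_linear_compose[OF bounded_linear_fst bounded_linear_snd]
        bounded_linear_compose[OF bounded_linear_snd bounded_linear_snd])+
  have fl: "fd (fst :: 'e \<times> 'e \<times> 'e \<Rightarrow> 'e) z = fst" "fd (\<lambda>z :: 'e \<times> 'e \<times> 'e. fst (snd z)) z = (\<lambda>z. fst (snd z))"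
    "fd (\<lambda>z :: 'e \<times> 'e \<times> 'e. snd (snd z)) z = (\<lambda>z. snd (snd z))" for z
    by (intro fd_eq bounded_linear_imp_has_derivative bounded_linear_fst bounded_linear_snd
        bounded_linear_compose[OF bounded_linear_fst bounded_linear_snd]
        bounded_linear_compose[OF bounded_linear_snd bounded_linear_snd])+
  have bb: "\<forall>\<^sub>F z in nhds ?z. bilinear (G (fst z))" by (rule always_eventually) (simp add: bil)
  have sG: "smooth_at (\<lambda>z. G z u w) (fst ?z)" for u w using G_smooth[OF x] by simp
  have sA: "smooth_at (\<lambda>z. G (fst z) u w) ?z" for u w
    by (rule smooth_at_compose[OF basis l(1) sG])
  note H = bilinear_family[OF basis bb sA l(2) l(3)]
  have "((\<lambda>t. (y t, a t, b t)) has_vector_derivative (y', a', b')) (at t)"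
    by (intro has_vector_derivative_Pair y a b)
  from vector_derivative_diff_chain_within[OF this, of ?H] has_derivative_at_withinI[OF smooth_at_has_derivative[OF H(1)]]
  have 1: "((\<lambda>t. G (y t) (a t) (b t)) has_vector_derivative fd ?H ?z (y', a', b')) (at t)"
    by (simp add: o_def)
  have "fd (\<lambda>z. G (fst z) (a t) (b t)) ?z (y', a', b') = fd (\<lambda>z. G z (a t) (b t)) (y t) y'"
    using fd_compose(1)[OF smooth_at_differentiable[OF l(1)] smooth_at_differentiable[OF sG], where v="(y', a', b')"]
    by (simp add: fl)
  then have "fd ?H ?z (y', a', b') = fd (\<lambda>z. G z (a t) (b t)) (y t) y' + G (y t) a' (b t) + G (y t) (a t) b'"
    unfolding H(2) by (simp add: fl)
  then show ?thesis using 1 by simp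
qed

text \<open>The flow of \<open>f\<close> and its derivative solve the first order system of the field below.\<close>

definition ext :: "('e \<Rightarrow> 'e) \<Rightarrow> 'e \<times> 'e \<Rightarrow> 'e \<times> 'e" where
  "ext f z = (f (fst z), fd f (fst z) (snd z))"

lemma ext_smooth:
  assumes f: "smooth_at f (fst z)"
  shows "smooth_at (ext f) z"
    and "fd (ext f) z d = (fd f (fst z) (fst d), fd (\<lambda>y. fd f y (snd z)) (fst z) (fst d) + fd f (fst z) (snd d))"
proof -
  have l: "smooth_at (fst :: 'e \<times> 'e \<Rightarrow> 'e) z" "smooth_at (snd :: 'e \<times> 'e \<Rightarrow> 'e) z"
    by (intro smooth_at_linear bounded_linear_fst bounded_linear_snd)+
  have fl: "fd (fst :: 'e \<times> 'e \<Rightarrow> 'e) z = fst" "fd (snd :: 'e \<times> 'e \<Rightarrow> 'e) z = snd"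
    by (intro fd_eq bounded_linear_imp_has_derivative bounded_linear_fst bounded_linear_snd)+
  have 1: "smooth_at (\<lambda>z. f (fst z)) z" by (rule smooth_at_compose[OF basis l(1) f])
  have sA: "smooth_at (\<lambda>z. fd f (fst z) w) z" for w by (rule smooth_at_compose[OF basis l(1) smooth_at_fd[OF f]])
  have "isCont (fst :: 'e \<times> 'e \<Rightarrow> 'e) z" by simp
  then have "\<forall>\<^sub>F y in nhds z. smooth_at f (fst y)"
    using near_smooth_at[OF f] by (metis isCont_def tendsto_at_iff_tendsto_nhds filterlim_iff)
  then have lin: "\<forall>\<^sub>F y in nhds z. linear (fd f (fst y))"
    by eventually_elim (rule smooth_at_linear_fd)
  note 2 = linear_family[OF basis lin sA l(2)]
  show "smooth_at (ext f) z" unfolding ext_def by (rule smooth_at_prod[OF 1 2(1)])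
  have "((\<lambda>z. (f (fst z), fd f (fst z) (snd z))) has_derivative
      (\<lambda>d. (fd (\<lambda>z. f (fst z)) z d, fd (\<lambda>z. fd f (fst z) (snd z)) z d))) (at z)"
    by (intro has_derivative_Pair smooth_at_has_derivative 1 2(1))
  then have "fd (ext f) z d = (fd (\<lambda>z. f (fst z)) z d, fd (\<lambda>z. fd f (fst z) (snd z)) z d)"
    unfolding ext_def by (simp only: fd_eq)
  also have "fd (\<lambda>z. f (fst z)) z d = fd f (fst z) (fst d)"
    using fd_compose(1)[OF smooth_at_differentiable[OF l(1)] smooth_at_differentiable[OF f]] by (simp add: fl)
  also have "fd (\<lambda>z. fd f (fst z) (snd z)) z d = fd (\<lambda>y. fd f y (snd z)) (fst z) (fst d) + fd f (fst z) (snd d)"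
    unfolding 2(2)
    using fd_compose(1)[OF smooth_at_differentiable[OF l(1)] smooth_at_differentiable[OF smooth_at_fd[OF f]]] by (simp add: fl)
  finally show "fd (ext f) z d = (fd f (fst z) (fst d), fd (\<lambda>y. fd f y (snd z)) (fst z) (fst d) + fd f (fst z) (snd d))" .
qed

text \<open>A map whose derivative \<open>J\<close> satisfies the equation of affine maps is smooth, because that
  equation expresses the derivative of \<open>J\<close> through \<open>J\<close> and the map itself.\<close>

lemma bootstrap:
  assumes N: "open N" "\<And>x. x \<in> N \<Longrightarrow> x \<in> S \<and> y x \<in> S"
    and y: "\<And>x. x \<in> N \<Longrightarrow> (y has_derivative J x) (at x)"
    and J: "\<And>x v. x \<in> N \<Longrightarrow> ((\<lambda>x. J x v) has_derivative (\<lambda>u. J x (G x u v) - G (y x) (J x u) (J x v))) (at x)"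
  shows "smooth_on N y" and "\<And>x. x \<in> N \<Longrightarrow> preserves_eq G y x"
proof -
  have lJ: "linear (J x)" if "x \<in> N" for x
    using y[OF that] has_derivative_linear by blast
  have GS: "Ck_on k S (\<lambda>x. G x u v)" for k u v
    using smooth_on_iff[OF S, of "\<lambda>x. G x u v"] G_smooth by (auto simp: smooth_on_def)
  \<comment> \<open>Smoothness of \<open>G\<close> is known for fixed arguments, so the term with
    \<open>J\<close> in both arguments is expanded in the basis.\<close>
  have G_expand: "G z u v = (\<Sum>a\<in>B. \<Sum>b\<in>B. ((u \<bullet> a) * (v \<bullet> b)) *\<^sub>R G z a b)" for z u v
  proof -
    have "G z u v = (\<Sum>a\<in>B. (u \<bullet> a) *\<^sub>R G z a v)" by (rule orthobasis_linear[OF basis G_linear(2)])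
    also have "\<dots> = (\<Sum>a\<in>B. (u \<bullet> a) *\<^sub>R (\<Sum>b\<in>B. (v \<bullet> b) *\<^sub>R G z a b))"
      by (subst orthobasis_linear[OF basis G_linear(1)]) (rule refl)
    finally show ?thesis by (simp add: scaleR_sum_right)
  qed
  have "Ck_on k N y \<and> (\<forall>v. Ck_on k N (\<lambda>x. J x v))" for k
  proof (induction k)
    case 0
    show ?case using y J by (auto intro!: differentiable_imp_cont_on differentiableI)
  next
    case (Suc k)
    have yk: "Ck_on k N y" and Jk: "Ck_on k N (\<lambda>x. J x v)" for v using Suc by auto
    have Gk: "Ck_on k N (\<lambda>x. G x u v)" for u v by (rule Ck_on_subset[OF GS]) (use N in blast)
    have Gyk: "Ck_on k N (\<lambda>x. G (y x) u v)" for u v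
      by (rule Ck_on_compose[OF basis N(1) S _ yk GS]) (use N in blast)
    have in_k: "Ck_on k N (\<lambda>x. g x \<bullet> b)" if "Ck_on k N g" for g :: "'e \<Rightarrow> 'e" and b
      by (rule Ck_on_linear_compose[OF N(1) bounded_linear_inner_left that])
    have "Ck_on k N (\<lambda>x. fd (\<lambda>x. J x v) x u)" for u v
    proof (rule Ck_on_cong[OF N(1)])
      show "Ck_on k N (\<lambda>x. (\<Sum>b\<in>B. (G x u v \<bullet> b) *\<^sub>R J x b) +
         (\<Sum>a\<in>B. \<Sum>b\<in>B. ((- 1) * ((J x u \<bullet> a) * (J x v \<bullet> b))) *\<^sub>R G (y x) a b))"
        by (intro Ck_on_add[OF N(1)] Ck_on_sum[OF N(1)] Ck_on_bilinear[OF N(1) bounded_bilinear_scaleR]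
            Ck_on_bilinear[OF N(1) bounded_bilinear_mult] Ck_on_const in_k Gk Jk Gyk)
      fix x assume x: "x \<in> N"
      show "(\<Sum>b\<in>B. (G x u v \<bullet> b) *\<^sub>R J x b) +
         (\<Sum>a\<in>B. \<Sum>b\<in>B. ((- 1) * ((J x u \<bullet> a) * (J x v \<bullet> b))) *\<^sub>R G (y x) a b) = fd (\<lambda>x. J x v) x u"
        unfolding fd_eq[OF J[OF x]] orthobasis_linear[OF basis lJ[OF x], of "G x u v"]
          G_expand[of "y x" "J x u" "J x v"] by (simp add: sum_negf)
    qed
    moreover have "Ck_on k N (\<lambda>x. fd y x v)" for v
      by (rule Ck_on_cong[OF N(1) _ Jk]) (simp add: fd_eq[OF y])
    moreover have "y differentiable (at x)" "(\<lambda>x. J x v) differentiable (at x)" if "x \<in> N" for x v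
      by (rule differentiableI[OF y[OF that]], rule differentiableI[OF J[OF that]])
    ultimately show ?case by simp
  qed
  then show "smooth_on N y" by (simp add: smooth_on_def)
  fix x assume x: "x \<in> N"
  have "fd (\<lambda>z. fd y z v) x = fd (\<lambda>z. J z v) x" for v
    by (rule fd_cong_open[OF N(1) x]) (simp add: fd_eq[OF y])
  then show "preserves_eq G y x"
    unfolding preserves_eq_def by (simp add: fd_eq[OF y[OF x]] fd_eq[OF J[OF x]])
qed

end

lemma picard_exists:
  fixes F :: "'e::real_inner \<Rightarrow> 'e" and B :: "'e set"
  assumes "orthobasis B" "r > 0"
    and "\<And>a b. a \<in> ball x0 r \<Longrightarrow> b \<in> ball x0 r \<Longrightarrow> norm (F a - F b) \<le> L * norm (a - b)"
  shows "\<exists>\<tau> \<rho>. \<tau> > 0 \<and> \<rho> > 0 \<and> (\<forall>x\<in>ball x0 \<rho>.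
    \<exists>y. y 0 = x \<and> (\<forall>t. \<bar>t\<bar> < \<tau> \<longrightarrow> y t \<in> ball x0 r \<and> (y has_vector_derivative F (y t)) (at t)))"
proof (rule picard[OF assms])
  fix \<tau> \<rho> :: real
  assume a: "\<tau> > 0" "\<rho> > 0" and b: "\<And>x. x \<in> ball x0 \<rho> \<Longrightarrow>
    \<exists>y. y 0 = x \<and> (\<forall>t. \<bar>t\<bar> < \<tau> \<longrightarrow> y t \<in> ball x0 r \<and> (y has_vector_derivative F (y t)) (at t))"
  show ?thesis by (intro exI[of _ \<tau>] exI[of _ \<rho>] conjI ballI a b)
qed

context christoffel
begin

text \<open>The system \<open>ext f\<close> is solved near \<open>(x0, 0)\<close>; a solution
  consists of a flow line and a vector transported by \<open>J\<close>.
  \<open>flow_variation_bound\<close> shows first that \<open>J\<close> is the derivative of the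
  flow and then, applied to \<open>ext f\<close> itself, that \<open>Q\<close> is the derivative of
  \<open>J\<close>. \<open>affine_eq\<close> enters in the proof that \<open>Q\<close> solves the
  linearised equation, and \<open>bootstrap\<close> concludes.\<close>

lemma affine_local_flow:
  assumes f: "\<And>x. x \<in> S \<Longrightarrow> smooth_at f x" and aff: "\<And>x. x \<in> S \<Longrightarrow> affine_eq f x" and x0: "x0 \<in> S"
  obtains \<tau> N y where "\<tau> > 0" "open N" "x0 \<in> N" "N \<subseteq> S"
    "\<And>x. x \<in> N \<Longrightarrow> y 0 x = x"
    "\<And>x t. x \<in> N \<Longrightarrow> \<bar>t\<bar> < \<tau> \<Longrightarrow> y t x \<in> S \<and> ((\<lambda>t. y t x) has_vector_derivative f (y t x)) (at t)"
    "\<And>t. \<bar>t\<bar> < \<tau> \<Longrightarrow> smooth_on N (y t) \<and> (\<forall>x\<in>N. preserves_eq G (y t) x)"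
proof -
  let ?F = "ext f"
  let ?z0 = "(x0, 0 :: 'e)"
  have Fs: "smooth_at ?F ?z0" by (rule ext_smooth(1)) (simp add: f x0)
  have oB: "orthobasis ((\<lambda>a. (a, 0)) ` B \<union> (\<lambda>b. (0, b)) ` B)" by (rule orthobasis_Times[OF basis basis])
  obtain r1 L K where r1: "r1 > 0" and L: "L \<ge> 0" and K: "K \<ge> 0"
    and LF: "\<And>a w. a \<in> ball ?z0 r1 \<Longrightarrow> norm (fd ?F a w) \<le> L * norm w"
    and FL: "\<And>a b. a \<in> ball ?z0 r1 \<Longrightarrow> b \<in> ball ?z0 r1 \<Longrightarrow> norm (?F a - ?F b) \<le> L * norm (a - b)"
    and FT: "\<And>a b. a \<in> ball ?z0 r1 \<Longrightarrow> b \<in> ball ?z0 r1 \<Longrightarrow> norm (?F b - ?F a - fd ?F a (b - a)) \<le> K * (norm (b - a))\<^sup>2"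
    by (rule taylor_locally_bounded[OF oB Fs]) blast
  obtain r2 where r2: "r2 > 0" "ball x0 r2 \<subseteq> S" using S x0 openE by blast
  define r where "r = min r1 r2"
  have r: "r > 0" "ball ?z0 r \<subseteq> ball ?z0 r1" using r1 r2 by (auto simp: r_def)
  have fstb: "fst z \<in> ball x0 r" if "z \<in> ball ?z0 r" for z
    using that dist_fst_le[of ?z0 z] by auto
  have bS: "a \<in> S" if "a \<in> ball x0 r" for a using that r2 by (auto simp: r_def)
  have pairb: "(a, 0) \<in> ball ?z0 r" if "a \<in> ball x0 r" for a using that by (simp add: dist_Pair_Pair)
  have pairb1: "(a, 0) \<in> ball ?z0 r1" if "a \<in> ball x0 r" for a using pairb[OF that] r(2) by blast
  have Ff: "?F (a, 0) = (f a, 0)" if "a \<in> ball x0 r" for a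
    using linear_0[OF smooth_at_linear_fd[OF f[OF bS[OF that]]]] by (simp add: ext_def)
  have f0: "fd f a 0 = 0" if "a \<in> S" for a using linear_0[OF smooth_at_linear_fd[OF f[OF that]]] .
  have ddf0: "fd (\<lambda>y. fd f y 0) a h = 0" if "a \<in> S" for a h
  proof -
    have "fd (\<lambda>y. fd f y 0) a = fd (\<lambda>y. 0) a" by (rule fd_cong_open[OF S that]) (rule f0)
    then show ?thesis by simp
  qed
  have fdF: "fd ?F (a, w) (h, k) = (fd f a h, fd (\<lambda>y. fd f y w) a h + fd f a k)" if "a \<in> S" for a w h k
    using ext_smooth(2)[of f "(a, w)" "(h, k)"] f[OF that] by simp
  have fL: "norm (f a - f b) \<le> L * norm (a - b)" if "a \<in> ball x0 r" "b \<in> ball x0 r" for a b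
    using FL[OF pairb1[OF that(1)] pairb1[OF that(2)]] by (simp add: norm_Pair Ff[OF that(1)] Ff[OF that(2)])
  have fT: "norm (f b - f a - fd f a (b - a)) \<le> K * (norm (b - a))\<^sup>2" if "a \<in> ball x0 r" "b \<in> ball x0 r" for a b
    using FT[OF pairb1[OF that(1)] pairb1[OF that(2)]]
    by (simp add: norm_Pair Ff[OF that(1)] Ff[OF that(2)] fdF[OF bS[OF that(1)]] ddf0[OF bS[OF that(1)]] f0[OF bS[OF that(1)]])
  have Lf: "norm (fd f a w) \<le> L * norm w" if "a \<in> ball x0 r" for a w
    using LF[OF pairb1[OF that], of "(0, w)"]
    by (simp add: norm_Pair fdF[OF bS[OF that]] ddf0[OF bS[OF that]] f0[OF bS[OF that]])
  have lf: "linear (fd f a)" if "a \<in> ball x0 r" for a by (rule smooth_at_linear_fd[OF f[OF bS[OF that]]])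
  have FLr: "norm (?F a - ?F b) \<le> L * norm (a - b)" if "a \<in> ball ?z0 r" "b \<in> ball ?z0 r" for a b
    using FL that r(2) by blast
  have "\<exists>\<tau> \<rho>. \<tau> > 0 \<and> \<rho> > 0 \<and> (\<forall>z\<in>ball ?z0 \<rho>.
    \<exists>y. y 0 = z \<and> (\<forall>t. \<bar>t\<bar> < \<tau> \<longrightarrow> y t \<in> ball ?z0 r \<and> (y has_vector_derivative ?F (y t)) (at t)))"
    by (rule picard_exists[OF oB r(1)]) (rule FLr)
  then obtain \<tau> \<rho> where \<tau>: "\<tau> > 0" and \<rho>: "\<rho> > 0" and ex: "\<forall>z\<in>ball ?z0 \<rho>.
    \<exists>y. y 0 = z \<and> (\<forall>t. \<bar>t\<bar> < \<tau> \<longrightarrow> y t \<in> ball ?z0 r \<and> (y has_vector_derivative ?F (y t)) (at t))"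
    by (elim exE conjE)
  from ex obtain Y where Y': "\<forall>z\<in>ball ?z0 \<rho>. Y z 0 = z \<and> (\<forall>t. \<bar>t\<bar> < \<tau> \<longrightarrow> Y z t \<in> ball ?z0 r \<and> (Y z has_vector_derivative ?F (Y z t)) (at t))"
    unfolding bchoice_iff by (elim exE)
  have Y: "Y z 0 = z" "\<bar>t\<bar> < \<tau> \<Longrightarrow> Y z t \<in> ball ?z0 r" "\<bar>t\<bar> < \<tau> \<Longrightarrow> (Y z has_vector_derivative ?F (Y z t)) (at t)"
    if "z \<in> ball ?z0 \<rho>" for z t using Y' that by blast+
  define s where "s = \<rho> / 2"
  have s: "s > 0" using \<rho> by (simp add: s_def)
  define N where "N = ball x0 (min s r)"
  have Nr: "x \<in> ball x0 r" if "x \<in> N" for x using that by (simp add: N_def)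
  have zb: "(x, v) \<in> ball ?z0 \<rho>" if "x \<in> N" "norm v < s" for x v
  proof -
    have "dist ?z0 (x, v) \<le> dist x0 x + norm v"
      using norm_Pair_le[of "x0 - x" "0 - v"] by (simp add: dist_norm)
    also have "\<dots> < \<rho>" using that by (simp add: N_def s_def)
    finally show ?thesis by simp
  qed
  define y where "y t x = fst (Y (x, 0) t)" for t x
  have yd: "y 0 x = x" "\<bar>t\<bar> < \<tau> \<Longrightarrow> y t x \<in> ball x0 r" "\<bar>t\<bar> < \<tau> \<Longrightarrow> ((\<lambda>t. y t x) has_vector_derivative f (y t x)) (at t)"
    if "x \<in> N" for x t
  proof -
    have z: "(x, 0) \<in> ball ?z0 \<rho>" using zb[OF that, of 0] s by simp
    show "y 0 x = x" using Y(1)[OF z] by (simp add: y_def)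
    show "y t x \<in> ball x0 r" if "\<bar>t\<bar> < \<tau>" unfolding y_def by (rule fstb[OF Y(2)[OF z that]])
    show "((\<lambda>t. y t x) has_vector_derivative f (y t x)) (at t)" if "\<bar>t\<bar> < \<tau>"
      using bounded_linear.has_vector_derivative[OF bounded_linear_fst Y(3)[OF z that]] by (simp add: y_def ext_def)
  qed
  \<comment> \<open>The first component solves the equation of the flow alone, so it does not depend
    on the initial vector.\<close>
  have Yfst: "fst (Y (x, v) t) = y t x" if x: "x \<in> N" and v: "norm v < s" and t: "\<bar>t\<bar> < \<tau>" for x v t
  proof (rule linear_ode_unique[of \<tau> "\<lambda>t. fst (Y (x, v) t)" "\<lambda>t. f" "\<lambda>t. y t x" L])
    note z = zb[OF x v]
    fix t :: real assume t: "\<bar>t\<bar> < \<tau>"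
    show "((\<lambda>t. fst (Y (x, v) t)) has_vector_derivative f (fst (Y (x, v) t))) (at t)"
      using bounded_linear.has_vector_derivative[OF bounded_linear_fst Y(3)[OF z t]] by (simp add: ext_def)
    show "((\<lambda>t. y t x) has_vector_derivative f (y t x)) (at t)" by (rule yd(3)[OF x t])
    show "norm (f (fst (Y (x, v) t)) - f (y t x)) \<le> L * norm (fst (Y (x, v) t) - y t x)"
      by (rule fL[OF fstb[OF Y(2)[OF z t]] yd(2)[OF x t]])
  qed (use L Y(1)[OF zb[OF x v]] yd(1)[OF x] t in simp_all)
  \<comment> \<open>Solutions are available for initial vectors shorter than \<open>s\<close>;
    \<open>c v\<close> scales an arbitrary \<open>v\<close> into this range and \<open>J\<close>
    scales back. The summand 1 covers \<open>v = 0\<close>.\<close>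
  define c where "c v = s / (2 * (norm v + 1))" for v :: 'e
  have c: "c v > 0" "norm (c v *\<^sub>R v) < s" for v
  proof -
    have n: "norm v + 1 > 0" using norm_ge_zero[of v] by linarith
    show "c v > 0" using s n by (simp add: c_def)
    have "norm v / (2 * (norm v + 1)) < 1" using n by (simp add: field_simps)
    then have "s * (norm v / (2 * (norm v + 1))) < s * 1" using s by (intro mult_strict_left_mono)
    then show "norm (c v *\<^sub>R v) < s" using s n by (simp add: c_def)
  qed
  define J where "J t x v = (1 / c v) *\<^sub>R snd (Y (x, c v *\<^sub>R v) t)" for t x v
  have Ysnd: "((\<lambda>t. snd (Y (x, v) t)) has_vector_derivative fd f (y t x) (snd (Y (x, v) t))) (at t)"
    if x: "x \<in> N" and v: "norm v < s" and t: "\<bar>t\<bar> < \<tau>" for x v t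
    using bounded_linear.has_vector_derivative[OF bounded_linear_snd Y(3)[OF zb[OF x v] t]] Yfst[OF x v t]
    by (simp add: ext_def)
  have Jd: "J 0 x v = v" "\<bar>t\<bar> < \<tau> \<Longrightarrow> ((\<lambda>t. J t x v) has_vector_derivative fd f (y t x) (J t x v)) (at t)"
    if x: "x \<in> N" for x v t
  proof -
    show "J 0 x v = v" using Y(1)[OF zb[OF x c(2)]] c(1)[of v] by (simp add: J_def)
    assume t: "\<bar>t\<bar> < \<tau>"
    have "((\<lambda>t. J t x v) has_vector_derivative (1 / c v) *\<^sub>R fd f (y t x) (snd (Y (x, c v *\<^sub>R v) t))) (at t)"
      unfolding J_def using Ysnd[OF x c(2) t] by (rule bounded_linear.has_vector_derivative[OF bounded_linear_scaleR_right])
    then show "((\<lambda>t. J t x v) has_vector_derivative fd f (y t x) (J t x v)) (at t)"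
      unfolding J_def by (simp add: linear_scale[OF lf[OF yd(2)[OF x t]]])
  qed
  \<comment> \<open>Uniqueness for the linear equation characterises \<open>J t x v\<close>; its
    linearity in \<open>v\<close> and its independence of the scaling both follow.\<close>
  have lin_uniq: "w t = J t x v" if x: "x \<in> N" and w: "\<And>t. \<bar>t\<bar> < \<tau> \<Longrightarrow> (w has_vector_derivative fd f (y t x) (w t)) (at t)"
    and i: "w 0 = v" and t: "\<bar>t\<bar> < \<tau>" for w x v t
  proof (rule linear_ode_unique[of \<tau> w "\<lambda>t. fd f (y t x)" "\<lambda>t. J t x v" L])
    fix t :: real assume t: "\<bar>t\<bar> < \<tau>"
    show "(w has_vector_derivative fd f (y t x) (w t)) (at t)" by (rule w[OF t])
    show "((\<lambda>t. J t x v) has_vector_derivative fd f (y t x) (J t x v)) (at t)" by (rule Jd(2)[OF x t])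
    show "norm (fd f (y t x) (w t) - fd f (y t x) (J t x v)) \<le> L * norm (w t - J t x v)"
      using Lf[OF yd(2)[OF x t], of "w t - J t x v"] by (simp add: linear_diff[OF lf[OF yd(2)[OF x t]]])
  qed (use i Jd(1)[OF x] t L in simp_all)
  have Jlin: "linear (J t x)" if x: "x \<in> N" and t: "\<bar>t\<bar> < \<tau>" for x t
  proof (rule linearI)
    fix v w
    have "J t x v + J t x w = J t x (v + w)"
      by (rule lin_uniq[OF x _ _ t, of "\<lambda>t. J t x v + J t x w"])
        (auto simp: Jd[OF x] linear_add[OF lf[OF yd(2)[OF x]]] intro!: has_vector_derivative_add Jd(2)[OF x])
    then show "J t x (v + w) = J t x v + J t x w" ..
    fix a :: real
    have "a *\<^sub>R J t x v = J t x (a *\<^sub>R v)"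
      by (rule lin_uniq[OF x _ _ t, of "\<lambda>t. a *\<^sub>R J t x v"])
        (auto simp: Jd[OF x] linear_scale[OF lf[OF yd(2)[OF x]]]
          intro!: bounded_linear.has_vector_derivative[OF bounded_linear_scaleR_right] Jd(2)[OF x])
    then show "J t x (a *\<^sub>R v) = a *\<^sub>R J t x v" ..
  qed
  have Ysmall: "Y (x, v) t = (y t x, J t x v)" if x: "x \<in> N" and v: "norm v < s" and t: "\<bar>t\<bar> < \<tau>" for x v t
  proof (rule prod_eqI)
    show "snd (Y (x, v) t) = snd (y t x, J t x v)"
      using lin_uniq[OF x Ysnd[OF x v], of v t] Y(1)[OF zb[OF x v]] t by simp
  qed (use Yfst[OF x v t] in simp)
  have oN: "open N" by (simp add: N_def)
  have y_der: "(y t has_derivative J t x) (at x)" if x: "x \<in> N" and t: "\<bar>t\<bar> < \<tau>" for x t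
  proof (rule quadratic_has_derivative[OF basis Jlin[OF x t] oN x])
    fix x' assume x': "x' \<in> N"
    have "norm (y t x' - y t x - J t x (x' - x)) \<le> K * (exp ((2 * L + 1) * \<tau>))\<^sup>2 * (norm (J 0 x (x' - x)))\<^sup>2"
      by (rule flow_variation_bound[where S="ball x0 r" and F=f and F'="fd f" and L=L and C=K and \<tau>=\<tau>
            and y="\<lambda>t. y t x'" and x="\<lambda>t. y t x" and z="\<lambda>t. J t x (x' - x)", OF fL Lf lf fT L K _ _ _ _ t])
        (simp_all add: yd(1,2)[OF x] yd(1,2)[OF x'] yd(3)[OF x] yd(3)[OF x'] Jd[OF x] del: mem_ball)
    then show "norm (y t x' - y t x - J t x (x' - x)) \<le> (K * (exp ((2 * L + 1) * \<tau>))\<^sup>2) * (norm (x' - x))\<^sup>2"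
      by (simp add: Jd(1)[OF x])
  qed
  \<comment> \<open>The derivative that \<open>J t x v\<close> must have in direction
    \<open>u\<close> if \<open>y t\<close> is affine; it vanishes at time 0.\<close>
  define Q where "Q t x u v = J t x (G x u v) - G (y t x) (J t x u) (J t x v)" for t x u v
  have Qlin: "linear (\<lambda>u. Q t x u v)" "Q t x u (a *\<^sub>R v) = a *\<^sub>R Q t x u v"
    if x: "x \<in> N" and t: "\<bar>t\<bar> < \<tau>" for x t u v a
  proof -
    show "linear (\<lambda>u. Q t x u v)" unfolding Q_def
      by (rule linearI)
        (simp_all add: linear_add[OF G_linear(2)] linear_scale[OF G_linear(2)] linear_add[OF Jlin[OF x t]]
          linear_scale[OF Jlin[OF x t]] scaleR_diff_right)
    show "Q t x u (a *\<^sub>R v) = a *\<^sub>R Q t x u v" unfolding Q_def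
      by (simp add: linear_scale[OF G_linear(1)] linear_scale[OF Jlin[OF x t]] scaleR_diff_right)
  qed
  \<comment> \<open>\<open>affine_eq\<close> at the point \<open>y t x\<close>, with the transported
    vectors as arguments, turns the derivative of \<open>Q\<close> into the second component of the
    linearisation of \<open>ext f\<close>.\<close>
  have Qd: "((\<lambda>t. Q t x u v) has_vector_derivative
      fd (\<lambda>z. fd f z (J t x v)) (y t x) (J t x u) + fd f (y t x) (Q t x u v)) (at t)"
    if x: "x \<in> N" and t: "\<bar>t\<bar> < \<tau>" for x t u v
  proof -
    have yS: "y t x \<in> S" using yd(2)[OF x t] bS by blast
    have "((\<lambda>t. Q t x u v) has_vector_derivative fd f (y t x) (J t x (G x u v)) -
       (fd (\<lambda>z. G z (J t x u) (J t x v)) (y t x) (f (y t x)) + G (y t x) (fd f (y t x) (J t x u)) (J t x v)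
        + G (y t x) (J t x u) (fd f (y t x) (J t x v)))) (at t)"
      unfolding Q_def
      by (intro has_vector_derivative_diff Jd(2)[OF x t] G_curve[OF yS yd(3)[OF x t] Jd(2)[OF x t] Jd(2)[OF x t]])
    moreover have "fd (\<lambda>z. fd f z (J t x v)) (y t x) (J t x u) + fd (\<lambda>z. G z (J t x u) (J t x v)) (y t x) (f (y t x))
        + G (y t x) (fd f (y t x) (J t x u)) (J t x v) + G (y t x) (J t x u) (fd f (y t x) (J t x v))
        = fd f (y t x) (G (y t x) (J t x u) (J t x v))"
      using aff[OF yS] unfolding affine_eq_def by blast
    then have "fd f (y t x) (J t x (G x u v)) -
       (fd (\<lambda>z. G z (J t x u) (J t x v)) (y t x) (f (y t x)) + G (y t x) (fd f (y t x) (J t x u)) (J t x v)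
        + G (y t x) (J t x u) (fd f (y t x) (J t x v)))
       = fd (\<lambda>z. fd f z (J t x v)) (y t x) (J t x u) + fd f (y t x) (Q t x u v)"
      unfolding Q_def linear_diff[OF lf[OF yd(2)[OF x t]]] by (simp add: algebra_simps)
    ultimately show ?thesis by simp
  qed
  \<comment> \<open>The pair of \<open>J\<close> and \<open>Q\<close> solves the linearisation of
    \<open>ext f\<close> along the solution through \<open>(x, v)\<close>, with initial value
    \<open>(x' - x, 0)\<close>, so it is the first order change of that solution.\<close>
  have J_small: "((\<lambda>x. J t x v) has_derivative (\<lambda>u. Q t x u v)) (at x)"
    if x: "x \<in> N" and t: "\<bar>t\<bar> < \<tau>" and v: "norm v < s" for x t v
  proof (rule quadratic_has_derivative[OF basis Qlin(1)[OF x t] oN x])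
    fix x' assume x': "x' \<in> N"
    let ?h = "x' - x"
    let ?E = "K * (exp ((2 * L + 1) * \<tau>))\<^sup>2"
    have "norm (Y (x', v) t - Y (x, v) t - (J t x ?h, Q t x ?h v)) \<le> ?E * (norm (J 0 x ?h, Q 0 x ?h v))\<^sup>2"
    proof (rule flow_variation_bound[where S="ball ?z0 r" and F="?F" and F'="fd ?F" and L=L and C=K and \<tau>=\<tau>
            and y="Y (x', v)" and x="Y (x, v)" and z="\<lambda>t. (J t x ?h, Q t x ?h v)", OF _ _ _ _ L K _ _ _ _ t])
      show "Y (x', v) 0 - Y (x, v) 0 = (J 0 x ?h, Q 0 x ?h v)"
        by (simp add: Y(1)[OF zb[OF x' v]] Y(1)[OF zb[OF x v]] Jd(1)[OF x] Q_def yd(1)[OF x])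
      fix a assume a: "a \<in> ball ?z0 r"
      show "linear (fd ?F a)"
        by (rule smooth_at_linear_fd[OF ext_smooth(1)[OF f[OF bS[OF fstb[OF a]]]]])
    next
      fix t :: real assume t: "\<bar>t\<bar> < \<tau>"
      show "Y (x', v) t \<in> ball ?z0 r \<and> (Y (x', v) has_vector_derivative ?F (Y (x', v) t)) (at t)"
        using Y(2,3)[OF zb[OF x' v] t] by blast
      show "Y (x, v) t \<in> ball ?z0 r \<and> (Y (x, v) has_vector_derivative ?F (Y (x, v) t)) (at t)"
        using Y(2,3)[OF zb[OF x v] t] by blast
      show "((\<lambda>t. (J t x ?h, Q t x ?h v)) has_vector_derivative fd ?F (Y (x, v) t) (J t x ?h, Q t x ?h v)) (at t)"
        unfolding Ysmall[OF x v t] fdF[OF bS[OF yd(2)[OF x t]]]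
        by (intro has_vector_derivative_Pair Jd(2)[OF x t] Qd[OF x t])
    qed (use LF FL FT r(2) in \<open>blast+\<close>)
    moreover have "norm (J t x' v - J t x v - Q t x ?h v) \<le> norm (Y (x', v) t - Y (x, v) t - (J t x ?h, Q t x ?h v))"
      unfolding Ysmall[OF x v t] Ysmall[OF x' v t]
      by (simp add: norm_snd_le)
    moreover have "norm (J 0 x ?h, Q 0 x ?h v) = norm ?h"
      by (simp add: Jd(1)[OF x] Q_def yd(1)[OF x] norm_Pair)
    ultimately show "norm (J t x' v - J t x v - Q t x ?h v) \<le> ?E * (norm ?h)\<^sup>2" by simp
  qed
  \<comment> \<open>Linearity in \<open>v\<close> removes the restriction to short vectors.\<close>
  have J_der: "((\<lambda>x. J t x v) has_derivative (\<lambda>u. J t x (G x u v) - G (y t x) (J t x u) (J t x v))) (at x)"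
    if x: "x \<in> N" and t: "\<bar>t\<bar> < \<tau>" for x t v
  proof -
    have "((\<lambda>x. (1 / c v) *\<^sub>R J t x (c v *\<^sub>R v)) has_derivative (\<lambda>u. (1 / c v) *\<^sub>R Q t x u (c v *\<^sub>R v))) (at x)"
      by (rule has_derivative_scaleR_right[OF J_small[OF x t c(2)]])
    then have "((\<lambda>x. (1 / c v) *\<^sub>R J t x (c v *\<^sub>R v)) has_derivative (\<lambda>u. Q t x u v)) (at x)"
      using c(1)[of v] by (simp add: Qlin(2)[OF x t])
    then have "((\<lambda>x. J t x v) has_derivative (\<lambda>u. Q t x u v)) (at x)"
      by (rule has_derivative_transform_within_open[OF _ oN x])
        (use c(1)[of v] in \<open>simp add: linear_scale[OF Jlin[OF _ t]]\<close>)
    then show ?thesis by (simp only: Q_def)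
  qed
  have boot: "smooth_on N (y t) \<and> (\<forall>x\<in>N. preserves_eq G (y t) x)" if t: "\<bar>t\<bar> < \<tau>" for t
  proof -
    have NS: "x \<in> S \<and> y t x \<in> S" if "x \<in> N" for x using bS Nr[OF that] yd(2)[OF that t] by blast
    show ?thesis using bootstrap[OF oN NS y_der[OF _ t] J_der[OF _ t]] by blast
  qed
  have N0: "x0 \<in> N" using s r by (simp add: N_def)
  have NS: "N \<subseteq> S" using Nr bS by blast
  have fl: "y t x \<in> S \<and> ((\<lambda>t. y t x) has_vector_derivative f (y t x)) (at t)" if "x \<in> N" "\<bar>t\<bar> < \<tau>" for x t
    using yd(2,3)[OF that] bS by blast
  show ?thesis by (rule that[OF \<tau> oN N0 NS yd(1) fl boot])
qed

end

section \<open>Integral curves\<close>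

lemma locally_lipschitz:
  fixes B :: "'e::real_inner set" and F :: "'e \<Rightarrow> 'b::real_normed_vector"
  assumes "orthobasis B" "smooth_at F x0"
  shows "\<exists>r L. r > 0 \<and> L \<ge> 0 \<and> (\<forall>a\<in>ball x0 r. \<forall>b\<in>ball x0 r. norm (F a - F b) \<le> L * norm (a - b))"
proof (rule fd_locally_bounded[OF assms])
  fix r L assume "r > 0" "L \<ge> 0"
    "\<And>a b. a \<in> ball x0 r \<Longrightarrow> b \<in> ball x0 r \<Longrightarrow> norm (F a - F b) \<le> L * norm (a - b)"
  then show ?thesis by (intro exI[of _ r] exI[of _ L]) simp
qed

context mfld
begin

lemma separating_fun:
  assumes W: "openin (mtop M) W" "p \<in> W"
  obtains \<rho> where "\<rho> \<in> smooth_funs M" "\<rho> p = 1" "\<And>q. q \<in> pts M \<Longrightarrow> q \<notin> W \<Longrightarrow> \<rho> q = 0"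
proof -
  obtain \<rho> K N where r: "\<rho> \<in> smooth_funs M" "closedin (mtop M) K" "K \<subseteq> W"
    "\<And>q. q \<in> pts M - K \<Longrightarrow> \<rho> q = 0" "openin (mtop M) N" "p \<in> N" "N \<subseteq> K" "\<And>q. q \<in> N \<Longrightarrow> \<rho> q = 1"
    using cutoff[OF W] by blast
  show ?thesis by (rule that[OF r(1) r(8)[OF r(6)]]) (use r(3,4) in blast)
qed

lemma integral_curve_pts: "integral_curve M X I \<gamma> \<Longrightarrow> t \<in> I \<Longrightarrow> \<gamma> t \<in> pts M"
  by (auto simp: integral_curve_def)

lemma integral_curve_deriv:
  "integral_curve M X I \<gamma> \<Longrightarrow> t \<in> I \<Longrightarrow> f \<in> smooth_funs M \<Longrightarrow>
    ((\<lambda>s. f (\<gamma> s)) has_real_derivative X f (\<gamma> t)) (at t)"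
  by (simp add: integral_curve_def)

text \<open>Continuity of integral curves has to be derived, as \<open>integral_curve\<close> speaks
  only of compositions with smooth functions: a function that is 1 at \<open>\<gamma> t\<close> and
  0 off the neighbourhood stays positive along the curve for nearby times.\<close>

lemma integral_curve_near:
  assumes g: "integral_curve M X I \<gamma>" "open I" "t \<in> I" and P: "eventually P (near (\<gamma> t))"
  shows "\<forall>\<^sub>F s in nhds t. P (\<gamma> s)"
proof -
  obtain W where W: "openin (mtop M) W" "\<gamma> t \<in> W" "\<forall>q\<in>W. P q" "W \<subseteq> pts M"
    by (rule near_openE[OF integral_curve_pts[OF g(1,3)] P])
  obtain \<rho> where r: "\<rho> \<in> smooth_funs M" "\<rho> (\<gamma> t) = 1" "\<And>q. q \<in> pts M \<Longrightarrow> q \<notin> W \<Longrightarrow> \<rho> q = 0"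
    using separating_fun[OF W(1,2)] by blast
  have "isCont (\<lambda>s. \<rho> (\<gamma> s)) t" by (rule DERIV_isCont[OF integral_curve_deriv[OF g(1,3) r(1)]])
  then have "((\<lambda>s. \<rho> (\<gamma> s)) \<longlongrightarrow> \<rho> (\<gamma> t)) (nhds t)"
    unfolding isCont_def using tendsto_at_iff_tendsto_nhds[of "\<lambda>s. \<rho> (\<gamma> s)" t] by blast
  then have "\<forall>\<^sub>F s in nhds t. \<rho> (\<gamma> s) > 0" using r(2) by (intro order_tendstoD(1)) auto
  moreover have "\<forall>\<^sub>F s in nhds t. s \<in> I" using g by (auto simp: eventually_nhds)
  ultimately show ?thesis
  proof eventually_elim
    case (elim s)
    then have "\<gamma> s \<in> W" using r(3)[of "\<gamma> s"] integral_curve_pts[OF g(1) elim(2)] by auto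
    then show ?case using W(3) by blast
  qed
qed

lemma integral_curve_chart:
  assumes g: "integral_curve M X I \<gamma>" "open I" "t \<in> I" and X: "X \<in> vfields M"
    and c: "(U, \<phi>) \<in> atlas M" "\<gamma> t \<in> U"
  shows "((\<lambda>s. \<phi> (\<gamma> s)) has_vector_derivative rep U \<phi> X (\<phi> (\<gamma> t))) (at t)"
proof -
  have "\<exists>C. cfun U \<phi> b (\<gamma> t) C" for b by (rule cfun_exists[OF c]) blast
  then obtain C where C: "\<And>b. cfun U \<phi> b (\<gamma> t) (C b)" by metis
  have Cs: "C b \<in> smooth_funs M" "\<forall>\<^sub>F q in near (\<gamma> t). C b q = \<phi> q \<bullet> b" for b using C by (simp_all add: cfun_def)
  have d: "((\<lambda>s. C b (\<gamma> s)) has_vector_derivative X (C b) (\<gamma> t)) (at t)" for b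
    using integral_curve_deriv[OF g(1,3) Cs(1)] by (simp add: has_real_derivative_iff_has_vector_derivative)
  have der: "((\<lambda>s. \<Sum>b\<in>B. C b (\<gamma> s) *\<^sub>R b) has_vector_derivative (\<Sum>b\<in>B. X (C b) (\<gamma> t) *\<^sub>R b)) (at t)"
    by (intro has_vector_derivative_sum bounded_linear.has_vector_derivative[OF bounded_linear_scaleR_left] d)
  have eqn: "(\<Sum>b\<in>B. X (C b) (\<gamma> t) *\<^sub>R b) = rep U \<phi> X (\<phi> (\<gamma> t))"
  proof -
    have "(\<Sum>b\<in>B. X (C b) (\<gamma> t) *\<^sub>R b) = (\<Sum>b\<in>B. (rep U \<phi> X (\<phi> (\<gamma> t)) \<bullet> b) *\<^sub>R b)"
      by (rule sum.cong[OF refl]) (simp add: rep_inner[OF c X _ C])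
    then show ?thesis by (simp add: orthobasis_expand[OF onb])
  qed
  have "\<forall>\<^sub>F q in near (\<gamma> t). \<forall>b\<in>B. C b q = \<phi> q \<bullet> b"
    by (intro eventually_ball_finite orthobasis_finite[OF onb] ballI Cs)
  from integral_curve_near[OF g this]
  have "\<forall>\<^sub>F s in nhds t. (\<Sum>b\<in>B. C b (\<gamma> s) *\<^sub>R b) = \<phi> (\<gamma> s)"
    by eventually_elim (simp add: orthobasis_expand[OF onb])
  then obtain T where T: "open T" "t \<in> T" "\<forall>s\<in>T. (\<Sum>b\<in>B. C b (\<gamma> s) *\<^sub>R b) = \<phi> (\<gamma> s)"
    unfolding eventually_nhds by blast
  show ?thesis
    by (rule has_vector_derivative_transform_within_open[OF der[unfolded eqn] T(1,2)]) (rule bspec[OF T(3)])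
qed

lemma chart_integral_curve:
  assumes c: "(U, \<phi>) \<in> atlas M" and X: "X \<in> vfields M"
    and x: "\<And>t. t \<in> I \<Longrightarrow> x t \<in> \<phi> ` U \<and> (x has_vector_derivative rep U \<phi> X (x t)) (at t)"
  shows "integral_curve M X I (\<lambda>t. inv_into U \<phi> (x t))"
  unfolding integral_curve_def
proof (intro conjI ballI)
  show "(\<lambda>t. inv_into U \<phi> (x t)) ` I \<subseteq> pts M"
    using x chart_sub[OF c] by (auto intro: inv_into_into)
  fix f t assume f: "f \<in> smooth_funs M" and t: "t \<in> I"
  obtain p where p: "p \<in> U" "x t = \<phi> p" using x[OF t] by blast
  have "((f \<circ> inv_into U \<phi>) has_derivative fd (f \<circ> inv_into U \<phi>) (x t)) (at (x t))"
    unfolding p(2) by (rule smooth_at_has_derivative[OF smooth_funs_smooth_at[OF f c p(1)]])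
  from vector_derivative_diff_chain_within[OF conjunct2[OF x[OF t]] has_derivative_at_withinI[OF this]]
  show "((\<lambda>s. f (inv_into U \<phi> (x s))) has_real_derivative X f (inv_into U \<phi> (x t))) (at t)"
    using vf_apply[OF c p(1) X f] p c by (simp add: has_real_derivative_iff_has_vector_derivative o_def)
qed

lemma integral_curve_subset: "integral_curve M X I \<gamma> \<Longrightarrow> J \<subseteq> I \<Longrightarrow> integral_curve M X J \<gamma>"
  by (auto simp: integral_curve_def)

lemma integral_curve_shift:
  assumes "integral_curve M X I \<gamma>"
  shows "integral_curve M X {t. t + a \<in> I} (\<lambda>t. \<gamma> (t + a))"
  unfolding integral_curve_def
proof (intro conjI ballI)
  fix f t assume f: "f \<in> smooth_funs M" and t: "t \<in> {t. t + a \<in> I}"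
  then have "((\<lambda>s. f (\<gamma> s)) has_real_derivative X f (\<gamma> (t + a))) (at (t + a))"
    using integral_curve_deriv[OF assms] by simp
  then show "((\<lambda>s. f (\<gamma> (s + a))) has_real_derivative X f (\<gamma> (t + a))) (at t)"
    by (simp add: DERIV_shift)
qed (use assms in \<open>auto simp: integral_curve_def\<close>)

lemma integral_curve_local:
  assumes "\<And>t. t \<in> I \<Longrightarrow> \<exists>J \<delta>. open J \<and> t \<in> J \<and> integral_curve M X J \<delta> \<and> (\<forall>s\<in>J. \<gamma> s = \<delta> s)"
  shows "integral_curve M X I \<gamma>"
  unfolding integral_curve_def
proof (intro conjI ballI)
  show "\<gamma> ` I \<subseteq> pts M"
  proof (intro image_subsetI)
    fix t assume "t \<in> I"
    then obtain J \<delta> where "t \<in> J" "integral_curve M X J \<delta>" "\<forall>s\<in>J. \<gamma> s = \<delta> s" using assms by blast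
    then show "\<gamma> t \<in> pts M" using integral_curve_pts by metis
  qed
  fix f t assume f: "f \<in> smooth_funs M" and t: "t \<in> I"
  obtain J \<delta> where J: "open J" "t \<in> J" "integral_curve M X J \<delta>" "\<forall>s\<in>J. \<gamma> s = \<delta> s" using assms[OF t] by blast
  have "((\<lambda>s. f (\<delta> s)) has_real_derivative X f (\<gamma> t)) (at t)"
    using integral_curve_deriv[OF J(3,2) f] J(2,4) by simp
  then show "((\<lambda>s. f (\<gamma> s)) has_real_derivative X f (\<gamma> t)) (at t)"
    by (rule has_field_derivative_transform_within_open[OF _ J(1,2)]) (use J(4) in simp)
qed

lemma integral_curve_unique_local:
  assumes X: "X \<in> vfields M" and g: "integral_curve M X I \<gamma>" and d: "integral_curve M X I \<delta>"
    and I: "open I" "t0 \<in> I" and eq: "\<gamma> t0 = \<delta> t0"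
  shows "\<forall>\<^sub>F t in nhds t0. \<gamma> t = \<delta> t"
proof -
  let ?p = "\<gamma> t0"
  obtain U \<phi> where c: "(U, \<phi>) \<in> atlas M" "?p \<in> U" using chart_exists[OF integral_curve_pts[OF g I(2)]] by blast
  obtain r L where r: "r > 0" "L \<ge> 0"
    "\<forall>a\<in>ball (\<phi> ?p) r. \<forall>b\<in>ball (\<phi> ?p) r. norm (rep U \<phi> X a - rep U \<phi> X b) \<le> L * norm (a - b)"
    using locally_lipschitz[OF onb rep_smooth[OF c X]] by (elim exE conjE)
  have "\<forall>\<^sub>F x in nhds (\<phi> ?p). x \<in> ball (\<phi> ?p) r"
    unfolding eventually_nhds using r(1) by (intro exI[of _ "ball (\<phi> ?p) r"]) simp
  from near_chart[OF c this] near_chart_dom[OF c]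
  have nr: "\<forall>\<^sub>F q in near ?p. \<phi> q \<in> ball (\<phi> ?p) r \<and> q \<in> U" by (rule eventually_conj)
  have "\<forall>\<^sub>F s in nhds t0. (\<phi> (\<gamma> s) \<in> ball (\<phi> ?p) r \<and> \<gamma> s \<in> U) \<and> (\<phi> (\<delta> s) \<in> ball (\<phi> ?p) r \<and> \<delta> s \<in> U) \<and> s \<in> I"
    using integral_curve_near[OF g I nr] integral_curve_near[OF d I nr[unfolded eq], folded eq] I
    by (intro eventually_conj) (auto simp: eventually_nhds)
  then obtain \<epsilon> where e: "\<epsilon> > 0" "\<And>s. dist s t0 < \<epsilon> \<Longrightarrow>
      (\<phi> (\<gamma> s) \<in> ball (\<phi> ?p) r \<and> \<gamma> s \<in> U) \<and> (\<phi> (\<delta> s) \<in> ball (\<phi> ?p) r \<and> \<delta> s \<in> U) \<and> s \<in> I"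
    unfolding eventually_nhds_metric by blast
  have "\<gamma> s = \<delta> s" if s: "dist s t0 < \<epsilon>" for s
  proof -
    have "\<phi> (\<gamma> (t0 + (s - t0))) = \<phi> (\<delta> (t0 + (s - t0)))"
    proof (rule linear_ode_unique[of \<epsilon> "\<lambda>t. \<phi> (\<gamma> (t0 + t))" "\<lambda>_. rep U \<phi> X" "\<lambda>t. \<phi> (\<delta> (t0 + t))" L])
      fix t :: real assume t: "\<bar>t\<bar> < \<epsilon>"
      have tt: "dist (t0 + t) t0 < \<epsilon>" using t by (simp add: dist_norm)
      have "((\<lambda>s. \<phi> (\<gamma> s)) has_vector_derivative rep U \<phi> X (\<phi> (\<gamma> (t0 + t)))) (at (t0 + t))"
        using e(2)[OF tt] by (intro integral_curve_chart[OF g I(1) _ X c(1)]) auto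
      then have "(((\<lambda>s. \<phi> (\<gamma> s)) \<circ> (\<lambda>t. t0 + t)) has_vector_derivative 1 *\<^sub>R rep U \<phi> X (\<phi> (\<gamma> (t0 + t)))) (at t)"
        by (intro vector_diff_chain_at) (auto intro!: derivative_eq_intros)
      then show "((\<lambda>t. \<phi> (\<gamma> (t0 + t))) has_vector_derivative rep U \<phi> X (\<phi> (\<gamma> (t0 + t)))) (at t)" by (simp add: o_def)
      have "((\<lambda>s. \<phi> (\<delta> s)) has_vector_derivative rep U \<phi> X (\<phi> (\<delta> (t0 + t)))) (at (t0 + t))"
        using e(2)[OF tt] by (intro integral_curve_chart[OF d I(1) _ X c(1)]) auto
      then have "(((\<lambda>s. \<phi> (\<delta> s)) \<circ> (\<lambda>t. t0 + t)) has_vector_derivative 1 *\<^sub>R rep U \<phi> X (\<phi> (\<delta> (t0 + t)))) (at t)"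
        by (intro vector_diff_chain_at) (auto intro!: derivative_eq_intros)
      then show "((\<lambda>t. \<phi> (\<delta> (t0 + t))) has_vector_derivative rep U \<phi> X (\<phi> (\<delta> (t0 + t)))) (at t)" by (simp add: o_def)
      show "norm (rep U \<phi> X (\<phi> (\<gamma> (t0 + t))) - rep U \<phi> X (\<phi> (\<delta> (t0 + t)))) \<le> L * norm (\<phi> (\<gamma> (t0 + t)) - \<phi> (\<delta> (t0 + t)))"
        using e(2)[OF tt] r(3) by blast
    qed (use r eq s in \<open>auto simp: dist_norm\<close>)
    then show ?thesis using e(2)[OF s] chart_inj[OF c(1)] by (auto simp: inj_on_def)
  qed
  then show ?thesis using e(1) unfolding eventually_nhds_metric by blast
qed

text \<open>By connectedness it suffices that the truth value of
  \<open>\<gamma> s = \<delta> s\<close> is locally constant: local uniqueness where the curves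
  meet, the Hausdorff property where they differ.\<close>

lemma integral_curve_unique:
  assumes X: "X \<in> vfields M" and g: "integral_curve M X I \<gamma>" and d: "integral_curve M X I \<delta>"
    and I: "open I" "connected I" "t0 \<in> I" and eq: "\<gamma> t0 = \<delta> t0" and t: "t \<in> I"
  shows "\<gamma> t = \<delta> t"
proof (rule connected_induction_simple[OF I(2) I(3) t, of "\<lambda>t. \<gamma> t = \<delta> t"])
  show "\<gamma> t0 = \<delta> t0" by (rule eq)
  fix a assume a: "a \<in> I"
  have "\<exists>N. open N \<and> a \<in> N \<and> (\<forall>x\<in>N. \<forall>y\<in>N. \<gamma> x = \<delta> x \<longrightarrow> \<gamma> y = \<delta> y)"
  proof (cases "\<gamma> a = \<delta> a")
    case True
    from integral_curve_unique_local[OF X g d I(1) a True] show ?thesis unfolding eventually_nhds by blast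
  next
    case False
    obtain W W' where W: "openin (mtop M) W" "openin (mtop M) W'" "\<gamma> a \<in> W" "\<delta> a \<in> W'" "disjnt W W'"
      using haus False integral_curve_pts[OF g a] integral_curve_pts[OF d a] unfolding Hausdorff_space_def by metis
    have "\<forall>\<^sub>F s in nhds a. \<gamma> s \<in> W" "\<forall>\<^sub>F s in nhds a. \<delta> s \<in> W'"
      by (rule integral_curve_near[OF g I(1) a near_openI[OF W(1,3)]], assumption)
        (rule integral_curve_near[OF d I(1) a near_openI[OF W(2,4)]], assumption)
    then have "\<forall>\<^sub>F s in nhds a. \<gamma> s \<noteq> \<delta> s"
      by eventually_elim (use W(5) in \<open>auto simp: disjnt_def\<close>)
    then show ?thesis unfolding eventually_nhds by blast
  qed
  then obtain N where N: "open N" "a \<in> N" "\<forall>x\<in>N. \<forall>y\<in>N. \<gamma> x = \<delta> x \<longrightarrow> \<gamma> y = \<delta> y" by blast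
  show "\<exists>T. openin (top_of_set I) T \<and> a \<in> T \<and> (\<forall>x\<in>T. \<forall>y\<in>T. \<gamma> x = \<delta> x \<longrightarrow> \<gamma> y = \<delta> y)"
    by (rule exI[of _ "I \<inter> N"]) (use N a in \<open>auto simp: openin_open_Int\<close>)
qed

text \<open>One \<open>\<tau>\<close> serves all starting points near \<open>p\<close>, which is the
  form that \<open>uniform_time\<close> requires.\<close>

lemma integral_curve_exists:
  assumes X: "X \<in> vfields M" and p: "p \<in> pts M"
  shows "\<exists>\<tau>>0. \<forall>\<^sub>F q in near p. \<exists>\<gamma>. \<gamma> 0 = q \<and> integral_curve M X {-\<tau><..<\<tau>} \<gamma>"
proof -
  obtain U \<phi> where c: "(U, \<phi>) \<in> atlas M" "p \<in> U" using chart_exists[OF p] by blast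
  obtain r1 L where r1: "r1 > 0" "L \<ge> 0"
    "\<forall>a\<in>ball (\<phi> p) r1. \<forall>b\<in>ball (\<phi> p) r1. norm (rep U \<phi> X a - rep U \<phi> X b) \<le> L * norm (a - b)"
    using locally_lipschitz[OF onb rep_smooth[OF c X]] by (elim exE conjE)
  obtain r2 where r2: "r2 > 0" "ball (\<phi> p) r2 \<subseteq> \<phi> ` U" using chart_open_image[OF c(1)] c(2) by (meson imageI openE)
  define r where "r = min r1 r2"
  have r: "r > 0" using r1 r2 by (simp add: r_def)
  have "\<exists>\<tau> \<rho>. \<tau> > 0 \<and> \<rho> > 0 \<and> (\<forall>x\<in>ball (\<phi> p) \<rho>. \<exists>y. y 0 = x \<and>
      (\<forall>t. \<bar>t\<bar> < \<tau> \<longrightarrow> y t \<in> ball (\<phi> p) r \<and> (y has_vector_derivative rep U \<phi> X (y t)) (at t)))"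
    by (rule picard_exists[OF onb r, of _ _ L]) (use r1(3) in \<open>auto simp: r_def\<close>)
  then obtain \<tau> \<rho> where tr: "\<tau> > 0" "\<rho> > 0" and ex: "\<forall>x\<in>ball (\<phi> p) \<rho>. \<exists>y. y 0 = x \<and>
      (\<forall>t. \<bar>t\<bar> < \<tau> \<longrightarrow> y t \<in> ball (\<phi> p) r \<and> (y has_vector_derivative rep U \<phi> X (y t)) (at t))"
    by (elim exE conjE)
  have "\<forall>\<^sub>F x in nhds (\<phi> p). x \<in> ball (\<phi> p) \<rho>"
    unfolding eventually_nhds using tr(2) by (intro exI[of _ "ball (\<phi> p) \<rho>"]) simp
  from near_chart[OF c this] near_chart_dom[OF c]
  have "\<forall>\<^sub>F q in near p. \<exists>\<gamma>. \<gamma> 0 = q \<and> integral_curve M X {-\<tau><..<\<tau>} \<gamma>"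
  proof eventually_elim
    case (elim q)
    obtain y where y: "y 0 = \<phi> q"
      "\<forall>t. \<bar>t\<bar> < \<tau> \<longrightarrow> y t \<in> ball (\<phi> p) r \<and> (y has_vector_derivative rep U \<phi> X (y t)) (at t)"
      using bspec[OF ex elim(1)] by (elim exE conjE)
    have "integral_curve M X {-\<tau><..<\<tau>} (\<lambda>t. inv_into U \<phi> (y t))"
    proof (rule chart_integral_curve[OF c(1) X])
      fix t assume "t \<in> {-\<tau><..<\<tau>}"
      then have "\<bar>t\<bar> < \<tau>" by auto
      then have "y t \<in> ball (\<phi> p) r" "(y has_vector_derivative rep U \<phi> X (y t)) (at t)" using y(2) by blast+
      moreover have "ball (\<phi> p) r \<subseteq> \<phi> ` U" using r2(2) by (auto simp: r_def)
      ultimately show "y t \<in> \<phi> ` U \<and> (y has_vector_derivative rep U \<phi> X (y t)) (at t)" by blast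
    qed
    moreover have "inv_into U \<phi> (y 0) = q" using y(1) elim c by simp
    ultimately show ?case by (intro exI[of _ "\<lambda>t. inv_into U \<phi> (y t)"]) simp
  qed
  then show ?thesis using tr(1) by blast
qed

section \<open>Completeness on compact manifolds\<close>

text \<open>Minimum over a finite subcover. The property is arbitrary because the argument is used
  for the existence time of integral curves and for the time during which flow maps are
  affine.\<close>

lemma uniform_time:
  assumes comp: "compact_space (mtop M)"
    and mono: "\<And>\<tau> \<tau>' p. P \<tau> p \<Longrightarrow> 0 < \<tau>' \<Longrightarrow> \<tau>' \<le> \<tau> \<Longrightarrow> P \<tau>' p"
    and loc: "\<And>p. p \<in> pts M \<Longrightarrow> \<exists>\<tau>>0. \<forall>\<^sub>F q in near p. P \<tau> q"
  shows "\<exists>\<tau>>(0::real). \<forall>p\<in>pts M. P \<tau> p"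
proof -
  have "\<forall>p\<in>pts M. \<exists>\<tau> W. \<tau> > 0 \<and> openin (mtop M) W \<and> p \<in> W \<and> (\<forall>q\<in>W. P \<tau> q)"
    using loc by (metis eventually_near)
  then obtain \<tau> W where W: "\<forall>p\<in>pts M. \<tau> p > 0 \<and> openin (mtop M) (W p) \<and> p \<in> W p \<and> (\<forall>q\<in>W p. P (\<tau> p) q)"
    by metis
  have "compactin (mtop M) (pts M)" using comp by (simp add: compact_space_def)
  then have "\<exists>\<F>. finite \<F> \<and> \<F> \<subseteq> W ` pts M \<and> pts M \<subseteq> \<Union>\<F>"
    by (rule compactinD) (use W in auto)
  then obtain \<F> where FF: "finite \<F>" "\<F> \<subseteq> W ` pts M" "pts M \<subseteq> \<Union>\<F>" by (elim exE conjE)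
  obtain F where F': "F \<subseteq> pts M" "finite F" "\<F> = W ` F" using finite_subset_image[OF FF(1,2)] by blast
  have F: "finite F" "F \<subseteq> pts M" "pts M \<subseteq> (\<Union>p\<in>F. W p)" using F' FF(3) by auto
  \<comment> \<open>The inserted 1 covers an empty manifold, where the subcover may be
    empty.\<close>
  define \<tau>0 where "\<tau>0 = Min (insert 1 (\<tau> ` F))"
  have fin: "finite (insert 1 (\<tau> ` F))" using F by simp
  have t0: "\<tau>0 > 0" unfolding \<tau>0_def using F W by (subst Min_gr_iff[OF fin]) auto
  moreover have "P \<tau>0 q" if q: "q \<in> pts M" for q
  proof -
    obtain p where p: "p \<in> F" "q \<in> W p" using F(3) q by blast
    have "\<tau>0 \<le> \<tau> p" unfolding \<tau>0_def using p fin by (intro Min_le) auto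
    then show ?thesis using mono[OF _ t0] W p F(2) by blast
  qed
  ultimately show ?thesis by blast
qed

lemma integral_curve_extend:
  assumes X: "X \<in> vfields M" and tau: "\<tau> > 0" "\<And>p. p \<in> pts M \<Longrightarrow> \<exists>\<gamma>. \<gamma> 0 = p \<and> integral_curve M X {-\<tau><..<\<tau>} \<gamma>"
    and g: "integral_curve M X {-T<..<T} \<gamma>" and T: "T \<ge> \<tau>"
  shows "\<exists>\<gamma>'. \<gamma>' 0 = \<gamma> 0 \<and> integral_curve M X {-(T + \<tau> / 2)<..<T + \<tau> / 2} \<gamma>'"
proof -
  \<comment> \<open>Curves restarted at \<open>a\<close> and \<open>-a\<close> last for time
    \<open>\<tau>\<close>: they reach \<open>T + \<tau> / 2\<close> on either side and overlap the
    given curve in an interval, where uniqueness glues them.\<close>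
  define a where "a = T - \<tau> / 2"
  have a: "a > 0" "a < T" "-T < -a" using tau T by (auto simp: a_def)
  have aI: "a \<in> {-T<..<T}" "-a \<in> {-T<..<T}" using a by auto
  obtain \<delta>1 where d1: "\<delta>1 0 = \<gamma> a" "integral_curve M X {-\<tau><..<\<tau>} \<delta>1"
    using tau(2)[OF integral_curve_pts[OF g aI(1)]] by blast
  obtain \<delta>2 where d2: "\<delta>2 0 = \<gamma> (-a)" "integral_curve M X {-\<tau><..<\<tau>} \<delta>2"
    using tau(2)[OF integral_curve_pts[OF g aI(2)]] by blast
  have s1: "integral_curve M X {a - \<tau><..<a + \<tau>} (\<lambda>t. \<delta>1 (t + (- a)))"
    by (rule integral_curve_subset[OF integral_curve_shift[OF d1(2)]]) auto
  have s2: "integral_curve M X {-a - \<tau><..<-a + \<tau>} (\<lambda>t. \<delta>2 (t + a))"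
    by (rule integral_curve_subset[OF integral_curve_shift[OF d2(2)]]) auto
  have e1: "\<gamma> t = \<delta>1 (t + (- a))" if "t \<in> {a - \<tau> / 2<..<T}" for t
  proof (rule integral_curve_unique[OF X, of "{a - \<tau> / 2<..<T}" \<gamma> "\<lambda>t. \<delta>1 (t + (- a))" a])
    show "integral_curve M X {a - \<tau> / 2<..<T} \<gamma>" by (rule integral_curve_subset[OF g]) (use a T tau in \<open>auto simp: a_def\<close>)
    show "integral_curve M X {a - \<tau> / 2<..<T} (\<lambda>t. \<delta>1 (t + (- a)))"
      by (rule integral_curve_subset[OF s1]) (use tau in \<open>auto simp: a_def\<close>)
  qed (use that tau a d1 in auto)
  have e2: "\<gamma> t = \<delta>2 (t + a)" if "t \<in> {-T<..<-a + \<tau> / 2}" for t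
  proof (rule integral_curve_unique[OF X, of "{-T<..<-a + \<tau> / 2}" \<gamma> "\<lambda>t. \<delta>2 (t + a)" "-a"])
    show "integral_curve M X {-T<..<-a + \<tau> / 2} \<gamma>" by (rule integral_curve_subset[OF g]) (use a T tau in \<open>auto simp: a_def\<close>)
    show "integral_curve M X {-T<..<-a + \<tau> / 2} (\<lambda>t. \<delta>2 (t + a))"
      by (rule integral_curve_subset[OF s2]) (use tau in \<open>auto simp: a_def\<close>)
  qed (use that tau a d2 in auto)
  define \<gamma>' where "\<gamma>' t = (if \<bar>t\<bar> < T then \<gamma> t else if t > 0 then \<delta>1 (t + (- a)) else \<delta>2 (t + a))" for t
  have "integral_curve M X {-(T + \<tau> / 2)<..<T + \<tau> / 2} \<gamma>'"
  proof (rule integral_curve_local)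
    fix t assume t: "t \<in> {-(T + \<tau> / 2)<..<T + \<tau> / 2}"
    consider "\<bar>t\<bar> < T" | "t \<ge> T" | "t \<le> -T" by linarith
    then show "\<exists>J \<delta>. open J \<and> t \<in> J \<and> integral_curve M X J \<delta> \<and> (\<forall>s\<in>J. \<gamma>' s = \<delta> s)"
    proof cases
      case 1
      then show ?thesis by (intro exI[of _ "{-T<..<T}"] exI[of _ \<gamma>]) (auto simp: g \<gamma>'_def)
    next
      case 2
      have "integral_curve M X {a - \<tau> / 2<..<T + \<tau> / 2} (\<lambda>t. \<delta>1 (t + (- a)))"
        by (rule integral_curve_subset[OF s1]) (use tau in \<open>auto simp: a_def\<close>)
      moreover have "\<gamma>' s = \<delta>1 (s + (- a))" if "s \<in> {a - \<tau> / 2<..<T + \<tau> / 2}" for s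
        using that e1[of s] tau T by (auto simp: \<gamma>'_def a_def)
      moreover have "t \<in> {a - \<tau> / 2<..<T + \<tau> / 2}" using 2 t tau by (auto simp: a_def)
      ultimately show ?thesis by (intro exI[of _ "{a - \<tau> / 2<..<T + \<tau> / 2}"] exI[of _ "\<lambda>t. \<delta>1 (t + (- a))"]) auto
    next
      case 3
      have "integral_curve M X {-(T + \<tau> / 2)<..<-a + \<tau> / 2} (\<lambda>t. \<delta>2 (t + a))"
        by (rule integral_curve_subset[OF s2]) (use tau in \<open>auto simp: a_def\<close>)
      moreover have "\<gamma>' s = \<delta>2 (s + a)" if "s \<in> {-(T + \<tau> / 2)<..<-a + \<tau> / 2}" for s
        using that e2[of s] tau T by (auto simp: \<gamma>'_def a_def)
      moreover have "t \<in> {-(T + \<tau> / 2)<..<-a + \<tau> / 2}" using 3 t tau by (auto simp: a_def)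
      ultimately show ?thesis by (intro exI[of _ "{-(T + \<tau> / 2)<..<-a + \<tau> / 2}"] exI[of _ "\<lambda>t. \<delta>2 (t + a)"]) auto
    qed
  qed
  moreover have "\<gamma>' 0 = \<gamma> 0" using T tau by (simp add: \<gamma>'_def)
  ultimately show ?thesis by blast
qed

lemma compact_complete:
  assumes comp: "compact_space (mtop M)" and X: "X \<in> vfields M"
  shows "complete_vf M X"
  unfolding complete_vf_def
proof
  fix p assume p: "p \<in> pts M"
  have "\<exists>\<tau>>0. \<forall>p\<in>pts M. \<exists>\<gamma>. \<gamma> 0 = p \<and> integral_curve M X {-\<tau><..<\<tau>} \<gamma>"
  proof (rule uniform_time[OF comp _ integral_curve_exists[OF X]])
    fix \<tau> \<tau>' p assume "\<exists>\<gamma>. \<gamma> 0 = p \<and> integral_curve M X {-\<tau><..<\<tau>} \<gamma>" "0 < \<tau>'" "\<tau>' \<le> \<tau>"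
    moreover from this have "{-\<tau>'<..<\<tau>'} \<subseteq> {-\<tau><..<\<tau>}" by auto
    ultimately show "\<exists>\<gamma>. \<gamma> 0 = p \<and> integral_curve M X {-\<tau>'<..<\<tau>'} \<gamma>" using integral_curve_subset by blast
  qed
  then obtain \<tau> where tau: "\<tau> > 0" "\<And>p. p \<in> pts M \<Longrightarrow> \<exists>\<gamma>. \<gamma> 0 = p \<and> integral_curve M X {-\<tau><..<\<tau>} \<gamma>" by blast
  \<comment> \<open>The half-length reached after \<open>n\<close> extensions; each one adds
    \<open>\<tau> / 2\<close>.\<close>
  define T where "T n = \<tau> + real n * (\<tau> / 2)" for n
  have "\<exists>\<gamma>. \<gamma> 0 = p \<and> integral_curve M X {-T n<..<T n} \<gamma>" for n
  proof (induction n)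
    case 0
    then show ?case using tau(2)[OF p] by (simp add: T_def)
  next
    case (Suc n)
    then obtain \<gamma> where "\<gamma> 0 = p" "integral_curve M X {-T n<..<T n} \<gamma>" by blast
    moreover have "T n \<ge> \<tau>" using tau(1) by (simp add: T_def)
    ultimately have "\<exists>\<gamma>'. \<gamma>' 0 = p \<and> integral_curve M X {-(T n + \<tau> / 2)<..<T n + \<tau> / 2} \<gamma>'"
      using integral_curve_extend[OF X tau] by metis
    moreover have "T n + \<tau> / 2 = T (Suc n)" unfolding T_def of_nat_Suc by (simp add: field_simps)
    ultimately show ?case by simp
  qed
  then obtain \<gamma> where g: "\<And>n. \<gamma> n 0 = p" "\<And>n. integral_curve M X {-T n<..<T n} (\<gamma> n)" by metis
  have T0: "T n > 0" for n using tau(1) by (simp add: T_def add_pos_nonneg)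
  have TT: "T m \<le> T n" if "m \<le> n" for m n using that tau(1) by (simp add: T_def)
  have agree: "\<gamma> m t = \<gamma> n t" if "\<bar>t\<bar> < T m" "m \<le> n" for m n t
  proof (rule integral_curve_unique[OF X g(2)[of m], of _ 0])
    show "integral_curve M X {-T m<..<T m} (\<gamma> n)"
      by (rule integral_curve_subset[OF g(2)]) (use TT[OF that(2)] in auto)
  qed (use that T0[of m] g(1) in auto)
  have unb: "\<exists>n. \<bar>t\<bar> < T n" for t
  proof -
    obtain n where "\<bar>t\<bar> / (\<tau> / 2) < real n" using reals_Archimedean2 by blast
    then have "\<bar>t\<bar> < real n * (\<tau> / 2)" using tau(1) by (simp add: field_simps)
    then show ?thesis using tau(1) by (intro exI[of _ n]) (simp add: T_def)
  qed
  \<comment> \<open>The curves of different lengths agree where both are defined; the least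
    admissible index selects one for each time.\<close>
  define N where "N t = (LEAST n. \<bar>t\<bar> < T n)" for t
  have N: "\<bar>t\<bar> < T (N t)" "\<bar>t\<bar> < T n \<Longrightarrow> N t \<le> n" for t n
    unfolding N_def using LeastI_ex[OF unb] by (auto intro: Least_le)
  have "integral_curve M X UNIV (\<lambda>t. \<gamma> (N t) t)"
  proof (rule integral_curve_local)
    fix t :: real
    let ?n = "N t"
    have "\<gamma> (N s) s = \<gamma> ?n s" if "s \<in> {-T ?n<..<T ?n}" for s
      using that agree[OF N(1)[of s] N(2)[of s ?n]] by auto
    then show "\<exists>J \<delta>. open J \<and> t \<in> J \<and> integral_curve M X J \<delta> \<and> (\<forall>s\<in>J. \<gamma> (N s) s = \<delta> s)"
      using N(1)[of t] g(2)[of ?n] by (intro exI[of _ "{-T ?n<..<T ?n}"] exI[of _ "\<gamma> ?n"]) auto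
  qed
  then show "\<exists>\<gamma>. \<gamma> 0 = p \<and> integral_curve M X UNIV \<gamma>"
    using g(1) by (intro exI[of _ "\<lambda>t. \<gamma> (N t) t"]) simp
qed

end

section \<open>Affine fields generate affine transformations\<close>

context mfld
begin

text \<open>Continuity is part of the conclusion: since \<open>F\<close> maps a neighbourhood of
  \<open>p\<close> into the same chart, it follows from the continuity of the coordinate
  expression.\<close>

lemma smooth_map_local:
  assumes F: "\<And>p. p \<in> pts M \<Longrightarrow> F p \<in> pts M"
    and s: "\<And>p. p \<in> pts M \<Longrightarrow> \<exists>U \<phi>. (U, \<phi>) \<in> atlas M \<and> p \<in> U \<and> F p \<in> U \<and>
      (\<forall>\<^sub>F q in near p. F q \<in> U) \<and> smooth_at (\<phi> \<circ> F \<circ> inv_into U \<phi>) (\<phi> p)"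
  shows "smooth_map M M F"
proof (rule mfld2.smooth_mapI[OF mfld2_self])
  show "continuous_map (mtop M) (mtop M) F"
    unfolding continuous_map_def
  proof (intro conjI allI impI)
    show "F \<in> pts M \<rightarrow> pts M" using F by blast
    fix W assume W: "openin (mtop M) W"
    show "openin (mtop M) {p \<in> pts M. F p \<in> W}"
    proof (subst openin_subopen, intro ballI)
      fix p assume "p \<in> {p \<in> pts M. F p \<in> W}"
      then have p: "p \<in> pts M" "F p \<in> W" by auto
      obtain U \<phi> where c: "(U, \<phi>) \<in> atlas M" "p \<in> U" "F p \<in> U" and n: "\<forall>\<^sub>F q in near p. F q \<in> U"
        and sm: "smooth_at (\<phi> \<circ> F \<circ> inv_into U \<phi>) (\<phi> p)" using s[OF p(1)] by (elim exE conjE)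
      have "((\<phi> \<circ> F \<circ> inv_into U \<phi>) \<longlongrightarrow> (\<phi> \<circ> F \<circ> inv_into U \<phi>) (\<phi> p)) (nhds (\<phi> p))"
        using smooth_at_isCont[OF sm] unfolding isCont_def
        using tendsto_at_iff_tendsto_nhds[of "\<phi> \<circ> F \<circ> inv_into U \<phi>" "\<phi> p"] by blast
      moreover have "open (\<phi> ` (U \<inter> W))"
        by (rule chart_image_open[OF c(1)]) (use W chart_open[OF c(1)] in auto)
      ultimately have "\<forall>\<^sub>F x in nhds (\<phi> p). (\<phi> \<circ> F \<circ> inv_into U \<phi>) x \<in> \<phi> ` (U \<inter> W)"
        by (rule topological_tendstoD) (use c p in auto)
      from near_chart[OF c(1,2) this] near_chart_dom[OF c(1,2)] n
      have "\<forall>\<^sub>F q in near p. F q \<in> W"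
      proof eventually_elim
        case (elim q)
        then obtain r where "r \<in> U" "r \<in> W" "\<phi> (F q) = \<phi> r" using c by auto
        then show ?case using elim chart_inj[OF c(1)] by (auto simp: inj_on_def)
      qed
      then obtain T where "openin (mtop M) T" "p \<in> T" "\<forall>q\<in>T. F q \<in> W" "T \<subseteq> pts M" by (rule near_openE[OF p(1)])
      then show "\<exists>T. openin (mtop M) T \<and> p \<in> T \<and> T \<subseteq> {p \<in> pts M. F p \<in> W}" by blast
    qed
  qed
  fix p assume "p \<in> pts M"
  then show "\<exists>U \<phi> V \<psi>. (U, \<phi>) \<in> atlas M \<and> (V, \<psi>) \<in> atlas M \<and> p \<in> U \<and> F p \<in> V \<and>
      smooth_at (\<psi> \<circ> F \<circ> inv_into U \<phi>) (\<phi> p)" using s by meson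
qed

lemma smooth_map_submanifold:
  assumes F: "smooth_map M M F" and U: "openin (mtop M) U" and W: "openin (mtop M) W"
    and e: "\<And>p. p \<in> U \<Longrightarrow> F' p = F p \<and> F p \<in> W"
  shows "smooth_map (open_submanifold M U) (open_submanifold M W) F'"
  unfolding smooth_map_def
proof (intro conjI)
  have UM: "U \<subseteq> pts M" "W \<subseteq> pts M" using U W openin_subset by auto
  have Fc: "continuous_map (mtop M) (mtop M) F" using F by (simp add: smooth_map_def)
  then have "continuous_map (subtopology (mtop M) U) (mtop M) F'"
    by (intro continuous_map_eq[OF continuous_map_from_subtopology[OF Fc]]) (use e in auto)
  then show "continuous_map (mtop (open_submanifold M U)) (mtop (open_submanifold M W)) F'"
    using e UM by (auto simp: open_submanifold_def continuous_map_in_subtopology)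
  have "smooth_on (\<phi> ` (V \<inter> U \<inter> F' -` (V' \<inter> W))) (\<psi> \<circ> F' \<circ> inv_into (V \<inter> U) \<phi>)"
    if c: "(V, \<phi>) \<in> atlas M" and d: "(V', \<psi>) \<in> atlas M" for V \<phi> V' \<psi>
  proof -
    let ?A = "V \<inter> U \<inter> F' -` (V' \<inter> W)"
    have "?A = V \<inter> U \<inter> {q \<in> pts M. F q \<in> V'}" using e UM by auto
    moreover have "openin (mtop M) {q \<in> pts M. F q \<in> V'}"
      using Fc chart_open[OF d] by (rule openin_continuous_map_preimage)
    ultimately have A: "openin (mtop M) ?A" using U chart_open[OF c] by auto
    have o: "open (\<phi> ` ?A)" by (rule chart_image_open[OF c A]) auto
    show ?thesis unfolding smooth_on_iff[OF o]
    proof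
      fix x assume x: "x \<in> \<phi> ` ?A"
      then obtain p where p: "p \<in> V" "p \<in> U" "F p \<in> V'" "x = \<phi> p" using e by auto
      have "smooth_at (\<psi> \<circ> F \<circ> inv_into V \<phi>) x"
        unfolding p(4) by (rule mfld2.smooth_map_at[OF mfld2_self F c p(1) d p(3)])
      then show "smooth_at (\<psi> \<circ> F' \<circ> inv_into (V \<inter> U) \<phi>) x"
      proof (rule smooth_at_cong[OF o x, rotated])
        fix y assume "y \<in> \<phi> ` ?A"
        then obtain q where q: "q \<in> V" "q \<in> U" "y = \<phi> q" by auto
        have "inj_on \<phi> (V \<inter> U)" using chart_inj[OF c] by (rule inj_on_subset) auto
        then have "inv_into (V \<inter> U) \<phi> y = q" using q by (simp add: inv_into_f_f)
        then show "(\<psi> \<circ> F \<circ> inv_into V \<phi>) y = (\<psi> \<circ> F' \<circ> inv_into (V \<inter> U) \<phi>) y"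
          using q c e by simp
      qed
    qed
  qed
  then show "\<forall>(V, \<phi>)\<in>atlas (open_submanifold M U). \<forall>(V', \<psi>)\<in>atlas (open_submanifold M W).
      smooth_on (\<phi> ` (V \<inter> F' -` V')) (\<psi> \<circ> F' \<circ> inv_into V \<phi>)"
    by (auto simp: open_submanifold_def)
qed

end

context conn
begin

text \<open>\<open>related_on\<close> determines \<open>X'\<close> only over the image of
  \<open>W\<close>, where it agrees with the pushforward of \<open>X\<close>; locality of
  \<open>D\<close> then replaces one by the other.\<close>

lemma affine_diffeo_local_affine:
  assumes F: "diffeo M M F" and pres: "preserves_connection M D F" and U: "openin (mtop M) U"
    and e: "\<And>p. p \<in> U \<Longrightarrow> F' p = F p"
  shows "local_affine M D U F'"
proof -
  have UM: "U \<subseteq> pts M" using U openin_subset by auto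
  let ?I = "inv_into (pts M) F"
  note df = diffeo_facts[OF F]
  have im: "F' ` W = {q \<in> pts M. ?I q \<in> W}" if "W \<subseteq> U" for W
  proof -
    have "F' ` W = F ` W" using e that by (intro image_cong) auto
    also have "\<dots> = {q \<in> pts M. ?I q \<in> W}"
    proof
      show "F ` W \<subseteq> {q \<in> pts M. ?I q \<in> W}" using that UM df(3,5) by auto
      show "{q \<in> pts M. ?I q \<in> W} \<subseteq> F ` W" using df(6) by (auto intro!: image_eqI)
    qed
    finally show ?thesis .
  qed
  have Ic: "continuous_map (mtop M) (mtop M) ?I" using df(2) by (simp add: smooth_map_def)
  have op: "openin (mtop M) (F' ` W)" if "openin (mtop M) W" "W \<subseteq> U" for W
    unfolding im[OF that(2)] by (rule openin_continuous_map_preimage[OF Ic that(1)])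
  have FU: "openin (mtop M) (F' ` U)" by (rule op[OF U]) simp
  have tp: "pts (open_submanifold M W) = W" if "openin (mtop M) W" for W
    using openin_subset[OF that] by (auto simp: open_submanifold_def)
  have inj: "inj_on F' U"
  proof (rule inj_onI)
    fix x y assume "x \<in> U" "y \<in> U" "F' x = F' y"
    then show "x = y" using e UM df(5)[of x] df(5)[of y] by auto
  qed
  have inv: "inv_into U F' q = ?I q \<and> ?I q \<in> U" if q: "q \<in> F' ` U" for q
  proof -
    obtain p where "p \<in> U" "q = F' p" using q by blast
    then show ?thesis using inv_into_f_f[OF inj] e UM df(5) by auto
  qed
  have "diffeo (open_submanifold M U) (open_submanifold M (F' ` U)) F'"
    unfolding diffeo_def tp[OF U] tp[OF FU]
  proof (intro conjI)
    show "bij_betw F' U (F' ` U)" using inj by (simp add: bij_betw_def)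
    show "smooth_map (open_submanifold M U) (open_submanifold M (F' ` U)) F'"
      by (rule smooth_map_submanifold[OF df(1) U FU]) (use e in force)
    show "smooth_map (open_submanifold M (F' ` U)) (open_submanifold M U) (inv_into U F')"
      by (rule smooth_map_submanifold[OF df(2) FU U inv])
  qed
  moreover have "related_on M W F' (D X Y) (D X' Y')"
    if W: "openin (mtop M) W" "W \<subseteq> U" and V: "X \<in> vfields M" "Y \<in> vfields M" "X' \<in> vfields M" "Y' \<in> vfields M"
      and r: "related_on M W F' X X'" "related_on M W F' Y Y'" for W X Y X' Y'
    unfolding related_on_def
  proof (intro ballI allI impI, elim conjE)
    fix g h T p assume g: "g \<in> smooth_funs M" and h: "h \<in> smooth_funs M" and T: "openin (mtop M) T" "T \<subseteq> W"
      and hg: "\<forall>q\<in>T. h q = g (F' q)" and p: "p \<in> T"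
    have pM: "p \<in> pts M" and pU: "p \<in> U" using p T W UM by auto
    \<comment> \<open>The image of \<open>W\<close> is an open neighbourhood of \<open>F p\<close>,
      so agreement there is what \<open>D_local\<close> asks for.\<close>
    have ag: "vf_agree (F p) (pushforward M F Z) Z'" if "related_on M W F' Z Z'" for Z Z'
      unfolding vf_agree_def
    proof (rule near_openI[OF op[OF W]])
      show "F p \<in> F' ` W" using p T e W by force
      fix q assume "q \<in> F' ` W"
      then obtain r where r: "r \<in> W" "q = F r" using e W by auto
      have rM: "r \<in> pts M" using r W UM by auto
      show "\<forall>f\<in>smooth_funs M. pushforward M F Z f q = Z' f q"
      proof
        fix f assume f: "f \<in> smooth_funs M"
        have "Z (\<lambda>p\<in>pts M. f (F p)) r = Z' f (F' r)"
          by (rule that[unfolded related_on_def, rule_format, OF f pullback_smooth[OF F f], of W])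
            (use W e UM r in auto)
        then show "pushforward M F Z f q = Z' f q"
          unfolding r(2) pushforward_apply[OF F f rM] using e r W by auto
      qed
    qed
    have "D X Y h p = D X Y (\<lambda>p\<in>pts M. g (F p)) p"
      by (rule vf_local[OF D_vf[OF V(1,2)] h pullback_smooth[OF F g] T(1) p]) (use hg e T W UM in auto)
    also have "\<dots> = pushforward M F (D X Y) g (F p)" by (rule pushforward_apply[OF F g pM, symmetric])
    also have "\<dots> = D (pushforward M F X) (pushforward M F Y) g (F p)"
      using pres V unfolding preserves_connection_def by simp
    also have "\<dots> = D X' Y' g (F p)"
      by (rule D_local[OF pushforward_vf[OF F V(1)] V(3) pushforward_vf[OF F V(2)] V(4) df(3)[OF pM] ag[OF r(1)] ag[OF r(2)] g])
    finally show "D X Y h p = D X' Y' g (F' p)" using e[OF pU] by simp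
  qed
  ultimately show ?thesis using U FU unfolding local_affine_def by blast
qed

end

context aff_group
begin

text \<open>In charts \<open>affine_local_flow\<close> makes the flow maps smooth and affine for
  short times, compactness makes these times uniform, and the group law of the flow extends the
  result to all times.\<close>

lemma affine_flow:
  assumes comp: "compact_space (mtop M)" and Z: "affine_vf Z"
  shows "\<exists>\<Phi>. (\<forall>t. \<Phi> t \<in> pts G) \<and> (\<forall>p\<in>pts M. \<Phi> 0 p = p \<and> integral_curve M Z UNIV (\<lambda>t. \<Phi> t p))"
proof -
  have ZV: "Z \<in> vfields M" using Z by (simp add: affine_vf_def)
  have "\<forall>p\<in>pts M. \<exists>\<gamma>. \<gamma> 0 = p \<and> integral_curve M Z UNIV \<gamma>"
    using compact_complete[OF comp ZV] by (simp add: complete_vf_def)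
  then obtain \<gamma> where g: "\<forall>p\<in>pts M. \<gamma> p 0 = p \<and> integral_curve M Z UNIV (\<gamma> p)" by metis
  define \<Phi> where "\<Phi> t = (\<lambda>p\<in>pts M. \<gamma> p t)" for t
  have ext: "\<Phi> t \<in> extensional (pts M)" for t by (simp add: \<Phi>_def)
  have \<Phi>g: "(\<lambda>t. \<Phi> t p) = \<gamma> p" if "p \<in> pts M" for p using that by (simp add: \<Phi>_def)
  have F: "\<Phi> 0 p = p" "integral_curve M Z UNIV (\<lambda>t. \<Phi> t p)" if "p \<in> pts M" for p
    unfolding \<Phi>g[OF that] using g that by (auto simp: \<Phi>_def)
  have Fp: "\<Phi> t p \<in> pts M" if "p \<in> pts M" for t p
    using integral_curve_pts[OF F(2)[OF that]] by simp
  \<comment> \<open>As functions of \<open>s\<close>, both sides are integral curves through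
    \<open>\<Phi> t p\<close>.\<close>
  have grp: "\<Phi> s (\<Phi> t p) = \<Phi> (s + t) p" if p: "p \<in> pts M" for s t p
  proof (rule integral_curve_unique[OF ZV, of UNIV "\<lambda>s. \<Phi> s (\<Phi> t p)" "\<lambda>s. \<Phi> (s + t) p" 0 s])
    show "integral_curve M Z UNIV (\<lambda>s. \<Phi> (s + t) p)" using integral_curve_shift[OF F(2)[OF p], of t] by simp
  qed (use F Fp p in auto)
  \<comment> \<open>The local conclusion for which a uniform time is sought; a single chart contains
    \<open>q\<close> and its image, as \<open>smooth_map_local\<close> and
    \<open>preserves_eq_preserves\<close> require.\<close>
  define loc where "loc \<tau> q \<longleftrightarrow> (\<forall>t. \<bar>t\<bar> < \<tau> \<longrightarrow> (\<exists>U \<phi>. (U, \<phi>) \<in> atlas M \<and> q \<in> U \<and> \<Phi> t q \<in> U \<and>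
      (\<forall>\<^sub>F r in near q. \<Phi> t r \<in> U) \<and> smooth_at (\<phi> \<circ> \<Phi> t \<circ> inv_into U \<phi>) (\<phi> q) \<and>
      preserves_eq (chr U \<phi>) (\<phi> \<circ> \<Phi> t \<circ> inv_into U \<phi>) (\<phi> q)))" for \<tau> q
  have loc: "\<exists>\<tau>>0. \<forall>\<^sub>F q in near p0. loc \<tau> q" if p0: "p0 \<in> pts M" for p0
  proof -
    obtain U \<phi> where c: "(U, \<phi>) \<in> atlas M" "p0 \<in> U" using chart_exists[OF p0] by blast
    interpret ch: christoffel B "\<phi> ` U" "chr U \<phi>" by (rule chr_christoffel[OF c(1)])
    have a: "smooth_at (rep U \<phi> Z) x" "ch.affine_eq (rep U \<phi> Z) x" if "x \<in> \<phi> ` U" for x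
      using that Z rep_smooth[OF c(1) _ ZV] c(1) unfolding affine_vf_def by auto
    have i: "\<phi> p0 \<in> \<phi> ` U" using c by blast
    show ?thesis
    proof (rule ch.affine_local_flow[OF a i])
      fix \<tau> N y assume tau: "\<tau> > 0" and N: "open N" "\<phi> p0 \<in> N" "N \<subseteq> \<phi> ` U"
        and y0: "\<And>x. x \<in> N \<Longrightarrow> y 0 x = x"
        and y: "\<And>x t. x \<in> N \<Longrightarrow> \<bar>t\<bar> < \<tau> \<Longrightarrow> y t x \<in> \<phi> ` U \<and> ((\<lambda>t. y t x) has_vector_derivative rep U \<phi> Z (y t x)) (at t)"
        and k: "\<And>t. \<bar>t\<bar> < \<tau> \<Longrightarrow> smooth_on N (y t) \<and> (\<forall>x\<in>N. preserves_eq (chr U \<phi>) (y t) x)"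
      have eq: "\<Phi> t q = inv_into U \<phi> (y t (\<phi> q))" if q: "q \<in> U" "\<phi> q \<in> N" and t: "\<bar>t\<bar> < \<tau>" for q t
      proof (rule integral_curve_unique[OF ZV, of "{-\<tau><..<\<tau>}" "\<lambda>t. \<Phi> t q" "\<lambda>t. inv_into U \<phi> (y t (\<phi> q))" 0 t])
        have qM: "q \<in> pts M" using q chart_sub[OF c(1)] by blast
        show "integral_curve M Z {-\<tau><..<\<tau>} (\<lambda>t. \<Phi> t q)" by (rule integral_curve_subset[OF F(2)[OF qM]]) simp
        show "integral_curve M Z {-\<tau><..<\<tau>} (\<lambda>t. inv_into U \<phi> (y t (\<phi> q)))"
          by (rule chart_integral_curve[OF c(1) ZV]) (rule y[OF q(2)], auto)
        show "\<Phi> 0 q = inv_into U \<phi> (y 0 (\<phi> q))" using F(1)[OF qM] y0[OF q(2)] q c by simp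
      qed (use t tau in auto)
      have inU: "\<Phi> t q \<in> U" "\<phi> (\<Phi> t q) = y t (\<phi> q)" if "q \<in> U" "\<phi> q \<in> N" "\<bar>t\<bar> < \<tau>" for q t
        unfolding eq[OF that] using y[OF that(2,3)] by (auto simp: f_inv_into_f inv_into_into)
      have op: "openin (mtop M) {q \<in> U. \<phi> q \<in> N}" by (rule chart_preimage_open[OF c(1) N(1)])
      have "loc \<tau> q" if q: "q \<in> {q \<in> U. \<phi> q \<in> N}" for q
        unfolding loc_def
      proof (intro allI impI)
        fix t assume t: "\<bar>t\<bar> < \<tau>"
        have e: "y t x = (\<phi> \<circ> \<Phi> t \<circ> inv_into U \<phi>) x" if x: "x \<in> N" for x
        proof -
          obtain r where "r \<in> U" "x = \<phi> r" using x N by blast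
          then show ?thesis using inU(2)[of r t] c x t by simp
        qed
        have "smooth_at (y t) (\<phi> q)" using k[OF t] q by (simp add: smooth_on_iff[OF N(1)])
        then have "smooth_at (\<phi> \<circ> \<Phi> t \<circ> inv_into U \<phi>) (\<phi> q)"
          by (rule smooth_at_cong[OF N(1) _ e, rotated 2]) (use q in auto)
        moreover have "\<forall>\<^sub>F x in nhds (\<phi> q). y t x = (\<phi> \<circ> \<Phi> t \<circ> inv_into U \<phi>) x"
          unfolding eventually_nhds using N(1) q e by blast
        from preserves_eq_cong[OF this] have "preserves_eq (chr U \<phi>) (\<phi> \<circ> \<Phi> t \<circ> inv_into U \<phi>) (\<phi> q)" using k[OF t] q by blast
        moreover have "\<forall>\<^sub>F r in near q. \<Phi> t r \<in> U" by (rule near_openI[OF op q]) (use inU t in auto)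
        ultimately show "\<exists>U \<phi>. (U, \<phi>) \<in> atlas M \<and> q \<in> U \<and> \<Phi> t q \<in> U \<and>
          (\<forall>\<^sub>F r in near q. \<Phi> t r \<in> U) \<and> smooth_at (\<phi> \<circ> \<Phi> t \<circ> inv_into U \<phi>) (\<phi> q) \<and>
          preserves_eq (chr U \<phi>) (\<phi> \<circ> \<Phi> t \<circ> inv_into U \<phi>) (\<phi> q)"
          using c q inU(1)[OF _ _ t] by (intro exI[of _ U] exI[of _ \<phi>]) auto
      qed
      then have "\<forall>\<^sub>F q in near p0. loc \<tau> q" by (intro near_openI[OF op]) (use c N in auto)
      then show ?thesis using tau by blast
    qed
  qed
  have mono: "loc \<tau>' p" if "loc \<tau> p" "\<tau>' \<le> \<tau>" for \<tau> \<tau>' p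
    using that unfolding loc_def by (meson order_less_le_trans)
  have "\<exists>\<tau>>0. \<forall>p\<in>pts M. loc \<tau> p" by (rule uniform_time[OF comp mono loc])
  then obtain \<tau> where tau: "\<tau> > 0" "\<forall>p\<in>pts M. loc \<tau> p" by (elim exE conjE)
  have small: "\<Phi> t \<in> pts G" if t: "\<bar>t\<bar> < \<tau>" for t
  proof -
    have sm: "smooth_map M M (\<Phi> s)" if "\<bar>s\<bar> < \<tau>" for s
    proof (rule smooth_map_local[OF Fp])
      fix p assume "p \<in> pts M"
      then have "loc \<tau> p" using tau(2) by blast
      from this[unfolded loc_def, rule_format, OF that]
      show "\<exists>U \<phi>. (U, \<phi>) \<in> atlas M \<and> p \<in> U \<and> \<Phi> s p \<in> U \<and>
        (\<forall>\<^sub>F q in near p. \<Phi> s q \<in> U) \<and> smooth_at (\<phi> \<circ> \<Phi> s \<circ> inv_into U \<phi>) (\<phi> p)" by meson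
    qed
    \<comment> \<open>The inverse is the flow at time \<open>- t\<close>, so its smoothness is again
      the short time statement.\<close>
    have inv: "inv_into (pts M) (\<Phi> t) p = \<Phi> (- t) p" if "p \<in> pts M" for p
      by (rule inv_into_f_eq) (use that grp F Fp in \<open>auto intro!: inj_on_inverseI[of _ "\<Phi> (- t)"]\<close>)
    have bij: "bij_betw (\<Phi> t) (pts M) (pts M)"
      by (rule bij_betw_byWitness[of _ "\<Phi> (- t)"]) (use grp F Fp in auto)
    have dif: "diffeo M M (\<Phi> t)"
      unfolding diffeo_def
    proof (intro conjI bij)
      show "smooth_map M M (\<Phi> t)" by (rule sm[OF t])
      show "smooth_map M M (inv_into (pts M) (\<Phi> t))"
        by (rule mfld2.smooth_map_cong[OF mfld2_self sm[of "- t"]]) (use t inv in auto)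
    qed
    have "preserves_connection M D (\<Phi> t)"
    proof (rule preserves_eq_preserves[OF dif])
      fix p assume "p \<in> pts M"
      then have "loc \<tau> p" using tau(2) by blast
      from this[unfolded loc_def, rule_format, OF t]
      show "\<exists>U \<phi>. (U, \<phi>) \<in> atlas M \<and> p \<in> U \<and> \<Phi> t p \<in> U \<and>
        preserves_eq (chr U \<phi>) (\<phi> \<circ> \<Phi> t \<circ> inv_into U \<phi>) (\<phi> p)" by meson
    qed
    then show ?thesis using dif bij ext by (simp add: pts_G Aff_def Bij_def)
  qed
  have "\<Phi> t \<in> pts G" for t
  proof -
    \<comment> \<open>\<open>\<Phi> t\<close> is the \<open>N\<close>-fold composition of the flow
      map at time \<open>t / N\<close>, which lies in the short range, and the group is closed under
      composition.\<close>
    obtain N where N: "\<bar>t\<bar> / \<tau> < real N" using reals_Archimedean2 by blast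
    have N0: "real N > 0" using N tau(1) by (meson abs_ge_zero divide_nonneg_pos le_less_trans)
    have s: "\<Phi> (t / real N) \<in> pts G"
      by (rule small) (use N tau(1) N0 in \<open>simp add: field_simps\<close>)
    have "\<Phi> (real m * (t / real N)) \<in> pts G" for m
    proof (induction m)
      case 0
      show ?case using small[of 0] tau(1) by simp
    next
      case (Suc m)
      have "\<Phi> (real (Suc m) * (t / real N)) = compose (pts M) (\<Phi> (t / real N)) (\<Phi> (real m * (t / real N)))"
        by (rule extensionalityI[of _ "pts M"]) (simp_all add: compose_eq grp ext distrib_right flip: add_divide_distrib)
      moreover have "\<dots> \<in> pts G"
        using group.is_monoid[OF group_G, THEN monoid.m_closed, of "\<Phi> (t / real N)" "\<Phi> (real m * (t / real N))"] s Suc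
        by (simp add: mult_G carrier_G)
      ultimately show ?case by simp
    qed
    from this[of N] show ?thesis using N0 by simp
  qed
  then show ?thesis using F by (intro exI[of _ \<Phi>]) simp
qed

text \<open>By uniqueness of integral curves every local flow is a restriction of the global affine
  flow.\<close>

lemma affine_vf_inf_affine:
  assumes comp: "compact_space (mtop M)" and Z: "affine_vf Z"
  shows "Z \<in> inf_affine M D"
proof -
  have ZV: "Z \<in> vfields M" using Z by (simp add: affine_vf_def)
  obtain \<Phi> where "\<forall>t. \<Phi> t \<in> pts G" "\<forall>p\<in>pts M. \<Phi> 0 p = p \<and> integral_curve M Z UNIV (\<lambda>t. \<Phi> t p)"
    using affine_flow[OF comp Z] by (elim exE conjE)
  then have F: "\<Phi> t \<in> pts G" "p \<in> pts M \<Longrightarrow> \<Phi> 0 p = p \<and> integral_curve M Z UNIV (\<lambda>t. \<Phi> t p)" for t p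
    by blast+
  have "local_affine M D U (\<phi> t)" if l: "local_flow M Z \<epsilon> U \<phi>" and t: "t \<in> {-\<epsilon><..<\<epsilon>}" for \<epsilon> U \<phi> t
  proof (rule affine_diffeo_local_affine[OF G_diffeo[OF F(1)] G_preserves[OF F(1)]])
    show U: "openin (mtop M) U" using l by (simp add: local_flow_def)
    fix p assume p: "p \<in> U"
    then have pM: "p \<in> pts M" using openin_subset[OF U] by blast
    show "\<phi> t p = \<Phi> t p"
    proof (rule integral_curve_unique[OF ZV, of "{-\<epsilon><..<\<epsilon>}" "\<lambda>t. \<phi> t p" "\<lambda>t. \<Phi> t p" 0 t])
      show "integral_curve M Z {-\<epsilon><..<\<epsilon>} (\<lambda>t. \<Phi> t p)"
        by (rule integral_curve_subset[OF conjunct2[OF F(2)[OF pM]]]) simp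
    qed (use l p pM t F in \<open>auto simp: local_flow_def\<close>)
  qed
  then show ?thesis using ZV unfolding inf_affine_def by blast
qed

text \<open>From left to right the group is used: \<open>Z\<close> is complete, hence induced by a
  right invariant field, and \<open>induced_affine_vf\<close> applies.\<close>

lemma inf_affine_iff:
  assumes comp: "compact_space (mtop M)"
  shows "Z \<in> inf_affine M D \<longleftrightarrow> affine_vf Z"
proof
  assume Z: "Z \<in> inf_affine M D"
  then have ZV: "Z \<in> vfields M" by (simp add: inf_affine_def)
  have "Z \<in> induced_vfield M G ` right_invariant_vfields G \<Gamma>"
    using alg Z compact_complete[OF comp ZV] by (simp add: affine_lie_group_def bij_betw_def)
  then obtain \<xi> where "\<xi> \<in> right_invariant_vfields G \<Gamma>" "Z = induced_vfield M G \<xi>" by blast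
  then show "affine_vf Z" using induced_affine_vf[of \<xi>] ZV by (simp add: right_invariant_vfields_def)
qed (rule affine_vf_inf_affine[OF comp])

end

section \<open>Right invariant frames on Lie groups\<close>

lemma smooth_map_swap_slice:
  assumes "mfld M A" "mfld N B" "F \<in> smooth_funs (prod_manifold M N)" "m \<in> pts M"
  shows "(\<lambda>q\<in>pts N. F (m, q)) \<in> smooth_funs N"
  using assms
  by (intro mfld2.smooth_map_funs[of N B "prod_manifold M N" "prod_basis A B"] smooth_map_pair[of N B M A N B]
      mfld2.smooth_map_const[of N B M A] smooth_map_id) (auto simp: mfld2_def mfld_prod)

locale lgroup = mfld G C for G :: "('g, 'f::real_inner) manifold" and C :: "'f set" +
  fixes \<Gamma> :: "('g, 'b) monoid_scheme" and k :: nat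
  assumes lie: "lie_group k G \<Gamma>"
begin

sublocale gr: group \<Gamma> using lie by (simp add: lie_group_def)

abbreviation R where "R \<equiv> right_invariant_vfields G \<Gamma>"
abbreviation mul (infixl "\<odot>" 70) where "x \<odot> y \<equiv> x \<otimes>\<^bsub>\<Gamma>\<^esub> y"

lemma carrier [simp]: "carrier \<Gamma> = pts G"
  using lie by (simp add: lie_group_def)

lemma group_rules [simp]:
  "x \<in> pts G \<Longrightarrow> y \<in> pts G \<Longrightarrow> x \<odot> y \<in> pts G" "\<one>\<^bsub>\<Gamma>\<^esub> \<in> pts G" "x \<in> pts G \<Longrightarrow> inv\<^bsub>\<Gamma>\<^esub> x \<in> pts G"
  "x \<in> pts G \<Longrightarrow> \<one>\<^bsub>\<Gamma>\<^esub> \<odot> x = x" "x \<in> pts G \<Longrightarrow> x \<odot> \<one>\<^bsub>\<Gamma>\<^esub> = x"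
  "x \<in> pts G \<Longrightarrow> inv\<^bsub>\<Gamma>\<^esub> x \<odot> x = \<one>\<^bsub>\<Gamma>\<^esub>" "x \<in> pts G \<Longrightarrow> x \<odot> inv\<^bsub>\<Gamma>\<^esub> x = \<one>\<^bsub>\<Gamma>\<^esub>"
  "x \<in> pts G \<Longrightarrow> y \<in> pts G \<Longrightarrow> z \<in> pts G \<Longrightarrow> x \<odot> y \<odot> z = x \<odot> (y \<odot> z)"
  "x \<in> pts G \<Longrightarrow> y \<in> pts G \<Longrightarrow> x \<odot> (inv\<^bsub>\<Gamma>\<^esub> x \<odot> y) = y" "x \<in> pts G \<Longrightarrow> y \<in> pts G \<Longrightarrow> inv\<^bsub>\<Gamma>\<^esub> x \<odot> (x \<odot> y) = y"
  using gr.m_closed gr.one_closed gr.inv_closed gr.l_one gr.r_one gr.l_inv gr.r_inv gr.m_assoc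
    gr.inv_solve_left' gr.l_one by (simp_all flip: gr.m_assoc)

lemma GG: "mfld G C" by (rule mfld_axioms)

lemma mul_smooth:
  assumes N: "mfld N A" and F: "smooth_map N G F" and H: "smooth_map N G H"
  shows "smooth_map N G (\<lambda>z. F z \<odot> H z)"
proof -
  have "smooth_map (prod_manifold G G) G (\<lambda>(x, y). x \<odot> y)" using lie by (simp add: lie_group_def)
  from smooth_map_comp[OF N mfld_prod[OF GG GG] GG smooth_map_pair[OF N GG GG F H] this]
  show ?thesis by simp
qed

lemma inv_smooth:
  assumes N: "mfld N A" and F: "smooth_map N G F"
  shows "smooth_map N G (\<lambda>z. inv\<^bsub>\<Gamma>\<^esub> (F z))"
  by (rule smooth_map_comp[OF N GG GG F]) (use lie in \<open>simp add: lie_group_def\<close>)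

lemma const_smooth: "mfld N A \<Longrightarrow> a \<in> pts G \<Longrightarrow> smooth_map N G (\<lambda>_. a)"
  by (rule mfld2.smooth_map_const[of N A G C]) (simp_all add: mfld2_def GG)

lemma comp_fun: "mfld N A \<Longrightarrow> smooth_map N G F \<Longrightarrow> f \<in> smooth_funs G \<Longrightarrow> (\<lambda>z\<in>pts N. f (F z)) \<in> smooth_funs N"
  by (rule mfld2.smooth_map_funs[of N A G C]) (simp_all add: mfld2_def GG)

lemma right_apply: "x \<in> pts G \<Longrightarrow> right_translation \<Gamma> a x = x \<odot> a"
  and left_apply: "x \<in> pts G \<Longrightarrow> left_translation \<Gamma> a x = a \<odot> x"
  by (simp_all add: right_translation_def left_translation_def)

lemma translation_diffeo:
  assumes a: "a \<in> pts G"
  shows "diffeo G G (right_translation \<Gamma> a)" "diffeo G G (left_translation \<Gamma> a)"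
proof -
  have r: "smooth_map G G (right_translation \<Gamma> b)" "smooth_map G G (left_translation \<Gamma> b)" if "b \<in> pts G" for b
    by (rule mfld2.smooth_map_cong[OF mfld2_self mul_smooth[OF GG smooth_map_id[OF GG] const_smooth[OF GG that]]],
        simp add: right_apply that)
      (rule mfld2.smooth_map_cong[OF mfld2_self mul_smooth[OF GG const_smooth[OF GG that] smooth_map_id[OF GG]]],
        simp add: left_apply that)
  have d: "diffeo G G F" if F: "smooth_map G G F" "smooth_map G G H"
    and h: "\<And>x. x \<in> pts G \<Longrightarrow> H (F x) = x" "\<And>x. x \<in> pts G \<Longrightarrow> F (H x) = x" for F H
  proof -
    have p: "F x \<in> pts G" "H x \<in> pts G" if "x \<in> pts G" for x using mfld2.smooth_map_pts[OF mfld2_self] F that by blast+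
    have b: "bij_betw F (pts G) (pts G)" by (rule bij_betw_byWitness[of _ H]) (use h p in auto)
    have "inv_into (pts G) F x = H x" if "x \<in> pts G" for x
      by (rule inv_into_f_eq) (use b p h that in \<open>auto simp: bij_betw_def\<close>)
    then have "smooth_map G G (inv_into (pts G) F)" by (intro mfld2.smooth_map_cong[OF mfld2_self F(2)]) simp
    then show ?thesis using b F(1) by (simp add: diffeo_def)
  qed
  show "diffeo G G (right_translation \<Gamma> a)"
    by (rule d[OF r(1)[OF a] r(1)[of "inv\<^bsub>\<Gamma>\<^esub> a"]]) (simp_all add: a right_apply)
  show "diffeo G G (left_translation \<Gamma> a)"
    by (rule d[OF r(2)[OF a] r(2)[of "inv\<^bsub>\<Gamma>\<^esub> a"]]) (simp_all add: a left_apply)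
qed

lemma pushforward_right: "a \<in> pts G \<Longrightarrow> f \<in> smooth_funs G \<Longrightarrow> x \<in> pts G \<Longrightarrow>
    pushforward G (right_translation \<Gamma> a) X f (x \<odot> a) = X (\<lambda>q\<in>pts G. f (q \<odot> a)) x"
  using pushforward_apply[OF translation_diffeo(1), of a f x X] by (simp add: right_apply cong: restrict_cong)

lemma pushforward_left: "a \<in> pts G \<Longrightarrow> f \<in> smooth_funs G \<Longrightarrow> x \<in> pts G \<Longrightarrow>
    pushforward G (left_translation \<Gamma> a) X f (a \<odot> x) = X (\<lambda>q\<in>pts G. f (a \<odot> q)) x"
  using pushforward_apply[OF translation_diffeo(2), of a f x X] by (simp add: left_apply cong: restrict_cong)

lemma R_vf: "\<xi> \<in> R \<Longrightarrow> \<xi> \<in> vfields G"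
  by (simp add: right_invariant_vfields_def)

lemma R_apply: "\<xi> \<in> R \<Longrightarrow> a \<in> pts G \<Longrightarrow> f \<in> smooth_funs G \<Longrightarrow> x \<in> pts G \<Longrightarrow>
    \<xi> (\<lambda>q\<in>pts G. f (q \<odot> a)) x = \<xi> f (x \<odot> a)"
  using pushforward_right[of a f x \<xi>] by (simp add: right_invariant_vfields_def)

lemma RI:
  assumes \<xi>: "\<xi> \<in> vfields G"
    and r: "\<And>a f x. a \<in> pts G \<Longrightarrow> f \<in> smooth_funs G \<Longrightarrow> x \<in> pts G \<Longrightarrow> \<xi> (\<lambda>q\<in>pts G. f (q \<odot> a)) x = \<xi> f (x \<odot> a)"
  shows "\<xi> \<in> R"
  unfolding right_invariant_vfields_def
proof (intro CollectI conjI ballI \<xi>)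
  fix a assume "a \<in> carrier \<Gamma>"
  then have a: "a \<in> pts G" by simp
  show "pushforward G (right_translation \<Gamma> a) \<xi> = \<xi>"
  proof (rule vf_eqI[OF pushforward_vf[OF translation_diffeo(1)[OF a] \<xi>] \<xi>])
    fix f p assume f: "f \<in> smooth_funs G" and p: "p \<in> pts G"
    show "pushforward G (right_translation \<Gamma> a) \<xi> f p = \<xi> f p"
      using pushforward_right[OF a f, of "p \<odot> inv\<^bsub>\<Gamma>\<^esub> a" \<xi>] r[OF a f, of "p \<odot> inv\<^bsub>\<Gamma>\<^esub> a"] a p by simp
  qed
qed

lemma translate_fun [simp]: "a \<in> pts G \<Longrightarrow> f \<in> smooth_funs G \<Longrightarrow> (\<lambda>q\<in>pts G. f (q \<odot> a)) \<in> smooth_funs G"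
  by (rule comp_fun[OF GG mul_smooth[OF GG smooth_map_id[OF GG] const_smooth[OF GG]]])

lemma R_translate:
  assumes "\<xi> \<in> R" "a \<in> pts G" "f \<in> smooth_funs G"
  shows "\<xi> (\<lambda>q\<in>pts G. f (q \<odot> a)) = (\<lambda>q\<in>pts G. \<xi> f (q \<odot> a))"
  by (rule smooth_funs_eqI) (use assms R_vf[OF assms(1)] in \<open>simp_all add: R_apply del: restrict_apply\<close>, simp)

lemma R_add: "\<xi> \<in> R \<Longrightarrow> \<eta> \<in> R \<Longrightarrow> vf_add G \<xi> \<eta> \<in> R"
  and R_diff: "\<xi> \<in> R \<Longrightarrow> \<eta> \<in> R \<Longrightarrow> vf_diff G \<xi> \<eta> \<in> R"
  by (rule RI; simp add: R_vf R_apply del: restrict_apply)+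

lemma R_zero: "vf_zero G \<in> R"
  by (rule RI; simp del: restrict_apply)

lemma R_scale: "\<xi> \<in> R \<Longrightarrow> vf_scale G (cst c) \<xi> \<in> R"
  by (rule RI; simp add: R_vf R_apply del: restrict_apply; simp add: cst_def)

lemma R_bracket:
  assumes x: "\<xi> \<in> R" and y: "\<eta> \<in> R" shows "vf_bracket G \<xi> \<eta> \<in> R"
proof (rule RI)
  note v = R_vf[OF x] R_vf[OF y]
  show "vf_bracket G \<xi> \<eta> \<in> vfields G" using v by simp
  fix a f p assume a: "a \<in> pts G" and f: "f \<in> smooth_funs G" and p: "p \<in> pts G"
  note t = translate_fun[OF a f]
  show "vf_bracket G \<xi> \<eta> (\<lambda>q\<in>pts G. f (q \<odot> a)) p = vf_bracket G \<xi> \<eta> f (p \<odot> a)"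
    unfolding vf_bracket_apply[OF t p] vf_bracket_apply[OF f group_rules(1)[OF p a]] R_translate[OF x a f] R_translate[OF y a f]
      R_apply[OF x a vf_smooth[OF v(2) f] p] R_apply[OF y a vf_smooth[OF v(1) f] p] ..
qed

lemma R_sum: "finite I \<Longrightarrow> (\<And>i. i \<in> I \<Longrightarrow> \<xi> i \<in> R) \<Longrightarrow> vf_sum I \<xi> \<in> R"
  by (induction I rule: finite_induct) (simp_all add: vf_sum_empty vf_sum_insert R_zero R_add)

text \<open>Used with the product for the right invariant extension of \<open>H\<close>, and with
  the product by the inverse for the coefficients in \<open>right_frame\<close>.\<close>

lemma parametric_translate:
  assumes f: "f \<in> smooth_funs G" and F: "smooth_map (prod_manifold G G) G F" and H: "H \<in> vfields G"
  shows "(\<lambda>z\<in>pts (prod_manifold G G). H (\<lambda>p\<in>pts G. f (F (p, snd z))) (fst z)) \<in> smooth_funs (prod_manifold G G)"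
proof -
  note P = mfld_prod[OF GG GG]
  have "(\<lambda>z\<in>pts (prod_manifold G G). f (F z)) \<in> smooth_funs (prod_manifold G G)"
    by (rule comp_fun[OF P F f])
  note * = parametric_derivative[OF GG GG this H]
  have "(\<lambda>z\<in>pts (prod_manifold G G). H (\<lambda>p\<in>pts G. (\<lambda>z\<in>pts (prod_manifold G G). f (F z)) (p, snd z)) (fst z)) =
    (\<lambda>z\<in>pts (prod_manifold G G). H (\<lambda>p\<in>pts G. f (F (p, snd z))) (fst z))"
  proof (rule restrict_ext)
    fix z assume "z \<in> pts (prod_manifold G G)"
    then have "(\<lambda>p\<in>pts G. (\<lambda>z\<in>pts (prod_manifold G G). f (F z)) (p, snd z)) = (\<lambda>p\<in>pts G. f (F (p, snd z)))"
      by (intro restrict_ext) auto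
    then show "H (\<lambda>p\<in>pts G. (\<lambda>z\<in>pts (prod_manifold G G). f (F z)) (p, snd z)) (fst z) =
      H (\<lambda>p\<in>pts G. f (F (p, snd z))) (fst z)" by (simp only:)
  qed
  then show ?thesis using * by (simp only:)
qed

text \<open>The right invariant field whose value at the identity is that of
  \<open>H\<close>.\<close>

definition right_extension :: "'g vfield \<Rightarrow> 'g vfield" where
  "right_extension H = (\<lambda>f\<in>smooth_funs G. \<lambda>g\<in>pts G. H (\<lambda>p\<in>pts G. f (p \<odot> g)) \<one>\<^bsub>\<Gamma>\<^esub>)"

lemma right_extension_apply: "f \<in> smooth_funs G \<Longrightarrow> g \<in> pts G \<Longrightarrow>
    right_extension H f g = H (\<lambda>p\<in>pts G. f (p \<odot> g)) \<one>\<^bsub>\<Gamma>\<^esub>"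
  by (simp add: right_extension_def)

lemma right_extension_R:
  assumes H: "H \<in> vfields G" shows "right_extension H \<in> R"
proof (rule RI)
  show "right_extension H \<in> vfields G"
  proof (rule vfieldsI)
    show "right_extension H \<in> extensional (smooth_funs G)" by (simp add: right_extension_def)
    fix f assume f: "f \<in> smooth_funs G"
    have m: "smooth_map (prod_manifold G G) G (\<lambda>z. fst z \<odot> snd z)"
      by (rule mul_smooth[OF mfld_prod[OF GG GG] smooth_map_fst[OF GG GG] smooth_map_snd[OF GG GG]])
    from smooth_map_swap_slice[OF GG GG parametric_translate[OF f m H] group_rules(2)]
    show "right_extension H f \<in> smooth_funs G" using f by (simp add: right_extension_def cong: restrict_cong)
  next
    fix f g a p assume f: "f \<in> smooth_funs G" "g \<in> smooth_funs G" and p: "p \<in> pts G"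
    note t = translate_fun[OF p f(1)] translate_fun[OF p f(2)]
    show "right_extension H (\<lambda>p\<in>pts G. a * f p + g p) p = a * right_extension H f p + right_extension H g p"
      using vf_lin[OF H t group_rules(2), of a] f p by (simp add: right_extension_apply cong: restrict_cong)
    show "right_extension H (\<lambda>p\<in>pts G. f p * g p) p = right_extension H f p * g p + f p * right_extension H g p"
      using vf_mult[OF H t group_rules(2)] f p by (simp add: right_extension_apply cong: restrict_cong)
  qed
  fix a f x assume "a \<in> pts G" "f \<in> smooth_funs G" "x \<in> pts G"
  then show "right_extension H (\<lambda>q\<in>pts G. f (q \<odot> a)) x = right_extension H f (x \<odot> a)"
    by (simp add: right_extension_apply cong: restrict_cong)
qed

text \<open>The frame consists of the right invariant extensions of coordinate fields at the
  identity. The coefficients are given by an explicit formula in \<open>X\<close>, from which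
  additivity, homogeneity over functions and constancy on right invariant fields can be read
  off.\<close>

lemma right_frame:
  "\<exists>\<xi> \<kappa>. (\<forall>b\<in>C. \<xi> b \<in> R) \<and> (\<forall>X\<in>vfields G. \<forall>b. \<kappa> X b \<in> smooth_funs G) \<and>
    (\<forall>X\<in>vfields G. \<forall>f\<in>smooth_funs G. \<forall>g\<in>pts G. X f g = (\<Sum>b\<in>C. \<kappa> X b g * \<xi> b f g)) \<and>
    (\<forall>X\<in>vfields G. \<forall>Y\<in>vfields G. \<forall>b. \<forall>g\<in>pts G. \<kappa> (vf_add G X Y) b g = \<kappa> X b g + \<kappa> Y b g) \<and>
    (\<forall>X\<in>vfields G. \<forall>h\<in>smooth_funs G. \<forall>b. \<forall>g\<in>pts G. \<kappa> (vf_scale G h X) b g = h g * \<kappa> X b g) \<and>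
    (\<forall>X\<in>R. \<forall>b. \<exists>c. \<kappa> X b = cst c)"
proof -
  let ?e = "\<one>\<^bsub>\<Gamma>\<^esub>"
  have e: "?e \<in> pts G" by simp
  obtain V \<theta> where d: "(V, \<theta>) \<in> atlas G" "?e \<in> V" using chart_exists[OF e] by blast
  have "\<exists>H. cfield V \<theta> (\<theta> ?e) b H" for b by (rule cfield_exists[OF d])
  then obtain H where H: "\<And>b. cfield V \<theta> (\<theta> ?e) b (H b)" by metis
  have HV: "H b \<in> vfields G" for b by (rule cfield_vf[OF H])
  have "\<exists>x. cfun V \<theta> b ?e x" for b by (rule cfun_exists[OF d]) blast
  then obtain x where x: "\<And>b. cfun V \<theta> b ?e (x b)" by metis
  have xs: "x b \<in> smooth_funs G" for b using x by (simp add: cfun_def)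
  \<comment> \<open>Expansion at the identity in the coordinate fields; the coefficients are the
    derivatives of the coordinates.\<close>
  have dec: "X f ?e = (\<Sum>b\<in>C. X (x b) ?e * H b f ?e)" if X: "X \<in> vfields G" and f: "f \<in> smooth_funs G" for X f
  proof -
    let ?L = "fd (f \<circ> inv_into V \<theta>) (\<theta> ?e)"
    have L: "linear ?L" by (rule smooth_at_linear_fd[OF smooth_funs_smooth_at[OF f d]])
    have "X f ?e = ?L (rep V \<theta> X (\<theta> ?e))" by (rule vf_apply[OF d X f])
    also have "\<dots> = ?L (\<Sum>b\<in>C. (rep V \<theta> X (\<theta> ?e) \<bullet> b) *\<^sub>R b)" by (simp add: orthobasis_expand[OF onb])
    also have "\<dots> = (\<Sum>b\<in>C. (rep V \<theta> X (\<theta> ?e) \<bullet> b) * ?L b)"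
      by (simp add: linear_sum[OF L] linear_scale[OF L])
    also have "\<dots> = (\<Sum>b\<in>C. X (x b) ?e * H b f ?e)"
      by (rule sum.cong[OF refl]) (simp add: rep_inner[OF d X _ x] vf_apply[OF d HV f] cfield_rep[OF H])
    finally show ?thesis .
  qed
  \<comment> \<open>The coefficient at \<open>g\<close> is read off after the vector has been moved
    to the identity by right translation with the inverse of \<open>g\<close>.\<close>
  define \<kappa> :: "'g vfield \<Rightarrow> 'f \<Rightarrow> 'g \<Rightarrow> real" where "\<kappa> X b = (\<lambda>g\<in>pts G. X (\<lambda>q\<in>pts G. x b (q \<odot> inv\<^bsub>\<Gamma>\<^esub> g)) g)" for X b
  have xt: "(\<lambda>q\<in>pts G. x b (q \<odot> inv\<^bsub>\<Gamma>\<^esub> g)) \<in> smooth_funs G" if "g \<in> pts G" for b g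
    by (rule translate_fun) (use that xs in auto)
  \<comment> \<open>\<open>g\<close> enters both as a parameter and as the base point, so a smooth
    function of two variables is restricted to the diagonal.\<close>
  have ks: "\<kappa> X b \<in> smooth_funs G" if X: "X \<in> vfields G" for X b
  proof -
    note P = mfld_prod[OF GG GG]
    have m: "smooth_map (prod_manifold G G) G (\<lambda>z. fst z \<odot> inv\<^bsub>\<Gamma>\<^esub> (snd z))"
      by (rule mul_smooth[OF P smooth_map_fst[OF GG GG] inv_smooth[OF P smooth_map_snd[OF GG GG]]])
    have dg: "smooth_map G (prod_manifold G G) (\<lambda>g. (g, g))"
      by (rule smooth_map_pair[OF GG GG GG smooth_map_id[OF GG] smooth_map_id[OF GG]])
    have GP: "mfld2 G C (prod_manifold G G) (prod_basis C C)" by (simp add: mfld2_def GG P)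
    from mfld2.smooth_map_funs[OF GP dg parametric_translate[OF xs m X]]
    show ?thesis by (simp add: \<kappa>_def cong: restrict_cong)
  qed
  have exp: "X f g = (\<Sum>b\<in>C. \<kappa> X b g * right_extension (H b) f g)"
    if X: "X \<in> vfields G" and f: "f \<in> smooth_funs G" and g: "g \<in> pts G" for X f g
  proof -
    have ig: "inv\<^bsub>\<Gamma>\<^esub> g \<in> pts G" using g by simp
    define X' where "X' = pushforward G (right_translation \<Gamma> (inv\<^bsub>\<Gamma>\<^esub> g)) X"
    have X': "X' \<in> vfields G" unfolding X'_def by (rule pushforward_vf[OF translation_diffeo(1)[OF ig] X])
    have ev: "X' h ?e = X (\<lambda>q\<in>pts G. h (q \<odot> inv\<^bsub>\<Gamma>\<^esub> g)) g" if "h \<in> smooth_funs G" for h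
      using pushforward_right[OF ig that g, of X] g by (simp add: X'_def)
    have "X' (\<lambda>q\<in>pts G. f (q \<odot> g)) ?e = X f g"
      unfolding ev[OF translate_fun[OF g f]] using g smooth_funs_ext[OF f] by (simp cong: restrict_cong)
    with dec[OF X' translate_fun[OF g f]] show ?thesis
      by (simp add: ev[OF xs] \<kappa>_def g right_extension_apply[OF f g])
  qed
  have cn: "\<kappa> X b = cst (X (x b) ?e)" if X: "X \<in> R" for X b
    using R_apply[OF X _ xs] by (auto simp: \<kappa>_def cst_def intro!: restrict_ext)
  show ?thesis
    by (intro exI[of _ "\<lambda>b. right_extension (H b)"] exI[of _ \<kappa>] conjI ballI allI right_extension_R HV ks exp)
      (use xt in \<open>simp_all add: \<kappa>_def\<close>, use cn in \<open>auto simp: \<kappa>_def\<close>)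
qed

text \<open>Every field is a finite sum of right invariant fields scaled by functions, so a property
  that survives sums and scaling passes from \<open>R\<close> to all fields.\<close>

lemma right_frame_induct:
  assumes X: "X \<in> vfields G" and R: "\<And>\<xi>. \<xi> \<in> R \<Longrightarrow> P \<xi>"
    and a: "\<And>X Y. X \<in> vfields G \<Longrightarrow> Y \<in> vfields G \<Longrightarrow> P X \<Longrightarrow> P Y \<Longrightarrow> P (vf_add G X Y)"
    and s: "\<And>X h. X \<in> vfields G \<Longrightarrow> h \<in> smooth_funs G \<Longrightarrow> P X \<Longrightarrow> P (vf_scale G h X)"
  shows "P X"
proof -
  obtain \<xi> \<kappa> where f: "\<forall>b\<in>C. \<xi> b \<in> R" "\<forall>X\<in>vfields G. \<forall>b. \<kappa> X b \<in> smooth_funs G"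
    "\<forall>X\<in>vfields G. \<forall>f\<in>smooth_funs G. \<forall>g\<in>pts G. X f g = (\<Sum>b\<in>C. \<kappa> X b g * \<xi> b f g)"
    using right_frame by (elim exE conjE)
  have V: "vf_scale G (\<kappa> X b) (\<xi> b) \<in> vfields G" if "b \<in> C" for b using f X R_vf that by simp
  have "J \<subseteq> C \<Longrightarrow> vf_sum J (\<lambda>b. vf_scale G (\<kappa> X b) (\<xi> b)) \<in> vfields G \<and> P (vf_sum J (\<lambda>b. vf_scale G (\<kappa> X b) (\<xi> b)))"
    if "finite J" for J using that
  proof (induction J rule: finite_induct)
    case empty
    then show ?case using R[OF R_zero] R_vf[OF R_zero] by (simp add: vf_sum_empty)
  next
    case (insert b J)
    then have "P (vf_scale G (\<kappa> X b) (\<xi> b))" using f X by (intro s R_vf R) auto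
    then show ?case using insert V by (auto simp: vf_sum_insert intro: a)
  qed
  moreover have "X = vf_sum C (\<lambda>b. vf_scale G (\<kappa> X b) (\<xi> b))"
    by (rule vf_eqI[OF X vf_sumI[OF orthobasis_finite[OF onb] V]]) (use f(3) X in auto)
  ultimately show ?thesis using orthobasis_finite[OF onb] by (metis order_refl)
qed

text \<open>The Leibniz rule forces the connection once its values on the frame are given.
  Bilinearity \<open>bil\<close> over constants then shows that it agrees with \<open>m\<close> on
  all right invariant fields, whose coefficients are constant.\<close>

lemma frame_connection:
  assumes m: "\<And>\<xi> \<eta>. \<xi> \<in> R \<Longrightarrow> \<eta> \<in> R \<Longrightarrow> m \<xi> \<eta> \<in> R"
    and bil: "\<And>\<xi> c d f g. (\<forall>b\<in>C. \<xi> b \<in> R) \<Longrightarrow> f \<in> smooth_funs G \<Longrightarrow> g \<in> pts G \<Longrightarrow>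
      m (vf_sum C (\<lambda>a. vf_scale G (cst (c a)) (\<xi> a))) (vf_sum C (\<lambda>b. vf_scale G (cst (d b)) (\<xi> b))) f g
      = (\<Sum>a\<in>C. \<Sum>b\<in>C. c a * d b * m (\<xi> a) (\<xi> b) f g)"
  shows "\<exists>D'. linear_connection G D' \<and> (\<forall>\<xi>\<in>R. \<forall>\<eta>\<in>R. D' \<xi> \<eta> = m \<xi> \<eta>)"
proof -
  obtain \<xi> and \<kappa> :: "'g vfield \<Rightarrow> 'f \<Rightarrow> 'g \<Rightarrow> real" where fr: "\<forall>b\<in>C. \<xi> b \<in> R" "\<forall>X\<in>vfields G. \<forall>b. \<kappa> X b \<in> smooth_funs G"
    "\<forall>X\<in>vfields G. \<forall>f\<in>smooth_funs G. \<forall>g\<in>pts G. X f g = (\<Sum>b\<in>C. \<kappa> X b g * \<xi> b f g)"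
    "\<forall>X\<in>vfields G. \<forall>Y\<in>vfields G. \<forall>b. \<forall>g\<in>pts G. \<kappa> (vf_add G X Y) b g = \<kappa> X b g + \<kappa> Y b g"
    "\<forall>X\<in>vfields G. \<forall>h\<in>smooth_funs G. \<forall>b. \<forall>g\<in>pts G. \<kappa> (vf_scale G h X) b g = h g * \<kappa> X b g"
    "\<forall>X\<in>R. \<forall>b. \<exists>c. \<kappa> X b = cst c"
    using right_frame by (elim exE conjE)
  note fin = orthobasis_finite[OF onb]
  have \<xi>: "\<xi> b \<in> R" "\<xi> b \<in> vfields G" if "b \<in> C" for b using fr(1) R_vf that by auto
  have \<kappa>: "\<kappa> X b \<in> smooth_funs G" if "X \<in> vfields G" for X b using fr(2) that by blast
  have mv: "m (\<xi> a) (\<xi> b) \<in> vfields G" if "a \<in> C" "b \<in> C" for a b by (intro R_vf m \<xi> that)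
  have ka: "\<kappa> (vf_add G X Y) b = (\<lambda>g\<in>pts G. \<kappa> X b g + \<kappa> Y b g)" if "X \<in> vfields G" "Y \<in> vfields G" for X Y b
    by (rule smooth_funs_eqI) (use fr(4) \<kappa> that in auto)
  have ks: "\<kappa> (vf_scale G h X) b = (\<lambda>g\<in>pts G. h g * \<kappa> X b g)" if "X \<in> vfields G" "h \<in> smooth_funs G" for X h b
    by (rule smooth_funs_eqI) (use fr(5) \<kappa> that in auto)
  \<comment> \<open>Expand \<open>X\<close> and \<open>Y\<close> in the frame, apply the Leibniz
    rule to the coefficients of \<open>Y\<close>, and insert \<open>m\<close> for the products of
    frame fields.\<close>
  define D' :: "'g connection" where "D' X Y = (\<lambda>f\<in>smooth_funs G. \<lambda>g\<in>pts G. (\<Sum>b\<in>C. X (\<kappa> Y b) g * \<xi> b f g) +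
      (\<Sum>a\<in>C. \<Sum>b\<in>C. \<kappa> X a g * \<kappa> Y b g * m (\<xi> a) (\<xi> b) f g))" for X Y
  have ap: "D' X Y f g = (\<Sum>b\<in>C. X (\<kappa> Y b) g * \<xi> b f g) + (\<Sum>a\<in>C. \<Sum>b\<in>C. \<kappa> X a g * \<kappa> Y b g * m (\<xi> a) (\<xi> b) f g)"
    if "f \<in> smooth_funs G" "g \<in> pts G" for X Y f g using that by (simp add: D'_def)
  have vf: "D' X Y \<in> vfields G" if "X \<in> vfields G" "Y \<in> vfields G" for X Y
  proof -
    have "D' X Y = vf_add G (vf_sum C (\<lambda>b. vf_scale G (X (\<kappa> Y b)) (\<xi> b)))
        (vf_sum C (\<lambda>a. vf_sum C (\<lambda>b. vf_scale G (\<lambda>g\<in>pts G. \<kappa> X a g * \<kappa> Y b g) (m (\<xi> a) (\<xi> b)))))"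
      by (simp add: D'_def vf_add_def cong: restrict_cong)
    also have "\<dots> \<in> vfields G"
      using that \<kappa> \<xi> mv by (intro vf_addI vf_sumI fin vf_scaleI) auto
    finally show ?thesis .
  qed
  have "linear_connection G D'"
    unfolding linear_connection_def
  proof (intro conjI ballI)
    fix X Y assume X: "X \<in> vfields G" and Y: "Y \<in> vfields G"
    show "D' X Y \<in> vfields G" by (rule vf[OF X Y])
    fix Z assume Z: "Z \<in> vfields G"
    show "D' (vf_add G X Y) Z = vf_add G (D' X Z) (D' Y Z)"
    proof (rule vf_eqI)
      fix f g assume "f \<in> smooth_funs G" "g \<in> pts G"
      then show "D' (vf_add G X Y) Z f g = vf_add G (D' X Z) (D' Y Z) f g"
        using X Y Z \<kappa> by (simp add: ap ka distrib_right sum.distrib)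
    qed (use X Y Z vf in auto)
    show "D' X (vf_add G Y Z) = vf_add G (D' X Y) (D' X Z)"
    proof (rule vf_eqI)
      fix f g assume "f \<in> smooth_funs G" "g \<in> pts G"
      then show "D' X (vf_add G Y Z) f g = vf_add G (D' X Y) (D' X Z) f g"
        using X Y Z \<kappa> by (simp add: ap ka vf_add_fun distrib_right distrib_left sum.distrib)
    qed (use X Y Z vf in auto)
  next
    fix X Y h assume X: "X \<in> vfields G" and Y: "Y \<in> vfields G" and h: "h \<in> smooth_funs G"
    show "D' (vf_scale G h X) Y = vf_scale G h (D' X Y)"
    proof (rule vf_eqI)
      fix f g assume "f \<in> smooth_funs G" "g \<in> pts G"
      then show "D' (vf_scale G h X) Y f g = vf_scale G h (D' X Y) f g"
        using X Y h \<kappa> by (simp add: ap ks distrib_left sum_distrib_left mult.assoc)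
    qed (use X Y h vf in auto)
    show "D' X (vf_scale G h Y) = vf_add G (vf_scale G (X h) Y) (vf_scale G h (D' X Y))"
    proof (rule vf_eqI)
      fix f g assume f: "f \<in> smooth_funs G" and g: "g \<in> pts G"
      have "Y f g = (\<Sum>b\<in>C. \<kappa> Y b g * \<xi> b f g)" using fr(3) Y f g by blast
      then show "D' X (vf_scale G h Y) f g = vf_add G (vf_scale G (X h) Y) (vf_scale G h (D' X Y)) f g"
        using X Y h \<kappa> f g
        by (simp add: ap ks vf_mult distrib_left distrib_right sum_distrib_left sum.distrib mult.assoc mult.left_commute)
    qed (use X Y h vf in auto)
  qed
  moreover have "D' \<eta> \<zeta> = m \<eta> \<zeta>" if \<eta>: "\<eta> \<in> R" and \<zeta>: "\<zeta> \<in> R" for \<eta> \<zeta>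
  proof (rule vf_eqI[OF vf[OF R_vf[OF \<eta>] R_vf[OF \<zeta>]] R_vf[OF m[OF \<eta> \<zeta>]]])
    fix f g assume f: "f \<in> smooth_funs G" and g: "g \<in> pts G"
    obtain c where c: "\<And>b. \<kappa> \<eta> b = cst (c b)" using fr(6) \<eta> by metis
    obtain d where d: "\<And>b. \<kappa> \<zeta> b = cst (d b)" using fr(6) \<zeta> by metis
    have s: "X = vf_sum C (\<lambda>b. vf_scale G (\<kappa> X b) (\<xi> b))" if "X \<in> vfields G" for X
      by (rule vf_eqI[OF that vf_sumI[OF fin]]) (use fr(3) that \<kappa> \<xi> in auto)
    have "m \<eta> \<zeta> f g = (\<Sum>a\<in>C. \<Sum>b\<in>C. c a * d b * m (\<xi> a) (\<xi> b) f g)"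
      using bil[OF fr(1) f g, of c d] s[OF R_vf[OF \<eta>]] s[OF R_vf[OF \<zeta>]] by (simp add: c d)
    then show "D' \<eta> \<zeta> f g = m \<eta> \<zeta> f g"
      by (simp add: ap[OF f g] c d vf_cst[OF R_vf[OF \<eta>] g], simp add: cst_def g)
  qed
  ultimately show ?thesis by blast
qed

end

section \<open>The inherited connection\<close>

context conn
begin

lemma vf_scale_fun: "f \<in> smooth_funs M \<Longrightarrow> vf_scale M h X f = (\<lambda>p\<in>pts M. h p * X f p)"
  and vf_add_eq: "f \<in> smooth_funs M \<Longrightarrow> vf_add M X Y f = (\<lambda>p\<in>pts M. X f p + Y f p)"
  by (simp_all add: vf_scale_def vf_add_def)

lemma D_diff1:
  assumes "X \<in> vfields M" "Y \<in> vfields M" "Z \<in> vfields M" "f \<in> smooth_funs M" "p \<in> pts M"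
  shows "D (vf_diff M X Y) Z f p = D X Z f p - D Y Z f p"
proof -
  have "D X Z = vf_add M (D Y Z) (D (vf_diff M X Y) Z)"
    using D_add1[of Y "vf_diff M X Y" Z] vf_split[of X Y] assms by simp
  then show ?thesis using assms by simp
qed

section \<open>Torsion and curvature are tensors\<close>

lemma torsion_vf: "X \<in> vfields M \<Longrightarrow> Y \<in> vfields M \<Longrightarrow> torsion M D X Y \<in> vfields M"
  by (simp add: torsion_def)

lemma torsion_apply: "X \<in> vfields M \<Longrightarrow> Y \<in> vfields M \<Longrightarrow> f \<in> smooth_funs M \<Longrightarrow> p \<in> pts M \<Longrightarrow>
    torsion M D X Y f p = D X Y f p - D Y X f p - (X (Y f) p - Y (X f) p)"
  by (simp add: torsion_def)

lemma torsion_swap: "X \<in> vfields M \<Longrightarrow> Y \<in> vfields M \<Longrightarrow> f \<in> smooth_funs M \<Longrightarrow> p \<in> pts M \<Longrightarrow>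
    torsion M D X Y f p = - torsion M D Y X f p"
  by (simp add: torsion_apply)

lemma torsion_add: "X \<in> vfields M \<Longrightarrow> X' \<in> vfields M \<Longrightarrow> Y \<in> vfields M \<Longrightarrow> f \<in> smooth_funs M \<Longrightarrow> p \<in> pts M \<Longrightarrow>
    torsion M D (vf_add M X X') Y f p = torsion M D X Y f p + torsion M D X' Y f p"
  by (simp add: torsion_apply D_add1 D_add2 vf_add_eq vf_add_fun)

lemma torsion_scale: "X \<in> vfields M \<Longrightarrow> Y \<in> vfields M \<Longrightarrow> h \<in> smooth_funs M \<Longrightarrow> f \<in> smooth_funs M \<Longrightarrow> p \<in> pts M \<Longrightarrow>
    torsion M D (vf_scale M h X) Y f p = h p * torsion M D X Y f p"
  by (simp add: torsion_apply D_scale1 D_scale2 vf_scale_fun vf_mult algebra_simps)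

lemma curvature_vf: "X \<in> vfields M \<Longrightarrow> Y \<in> vfields M \<Longrightarrow> Z \<in> vfields M \<Longrightarrow> curvature M D X Y Z \<in> vfields M"
  by (simp add: curvature_def)

lemma curvature_apply: "X \<in> vfields M \<Longrightarrow> Y \<in> vfields M \<Longrightarrow> Z \<in> vfields M \<Longrightarrow> f \<in> smooth_funs M \<Longrightarrow> p \<in> pts M \<Longrightarrow>
    curvature M D X Y Z f p = D X (D Y Z) f p - D Y (D X Z) f p - D (vf_bracket M X Y) Z f p"
  by (simp add: curvature_def)

lemma bracket_swap: "X \<in> vfields M \<Longrightarrow> Y \<in> vfields M \<Longrightarrow> vf_bracket M X Y = vf_scale M (cst (-1)) (vf_bracket M Y X)"
  by (rule vf_eqI) (simp_all, simp add: cst_def)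

lemma curvature_swap:
  assumes "X \<in> vfields M" "Y \<in> vfields M" "Z \<in> vfields M" "f \<in> smooth_funs M" "p \<in> pts M"
  shows "curvature M D X Y Z f p = - curvature M D Y X Z f p"
proof -
  have "D (vf_bracket M X Y) Z f p = - D (vf_bracket M Y X) Z f p"
    unfolding bracket_swap[OF assms(1,2)] using assms by (simp add: D_scale1) (simp add: cst_def)
  then show ?thesis using assms by (simp add: curvature_apply)
qed

lemma curvature_add1:
  assumes "X \<in> vfields M" "X' \<in> vfields M" "Y \<in> vfields M" "Z \<in> vfields M" "f \<in> smooth_funs M" "p \<in> pts M"
  shows "curvature M D (vf_add M X X') Y Z f p = curvature M D X Y Z f p + curvature M D X' Y Z f p"
proof -
  have "vf_bracket M (vf_add M X X') Y = vf_add M (vf_bracket M X Y) (vf_bracket M X' Y)"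
    by (rule vf_eqI) (use assms in \<open>simp_all add: vf_add_eq vf_add_fun\<close>)
  then show ?thesis using assms by (simp add: curvature_apply D_add1 D_add2)
qed

text \<open>The bracket of \<open>vf_scale M h X\<close> with \<open>Y\<close> contains the extra
  term \<open>- (Y h) X\<close>; it cancels the Leibniz term that arises when \<open>D Y\<close>
  meets the factor \<open>h\<close>.\<close>

lemma curvature_scale1:
  assumes "X \<in> vfields M" "Y \<in> vfields M" "Z \<in> vfields M" "h \<in> smooth_funs M" "f \<in> smooth_funs M" "p \<in> pts M"
  shows "curvature M D (vf_scale M h X) Y Z f p = h p * curvature M D X Y Z f p"
proof -
  have "vf_bracket M (vf_scale M h X) Y = vf_diff M (vf_scale M h (vf_bracket M X Y)) (vf_scale M (Y h) X)"
    by (rule vf_eqI) (use assms in \<open>simp_all add: vf_scale_fun vf_mult algebra_simps\<close>)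
  then show ?thesis using assms by (simp add: curvature_apply D_scale1 D_scale2 D_diff1 algebra_simps)
qed

lemma curvature_add3: "X \<in> vfields M \<Longrightarrow> Y \<in> vfields M \<Longrightarrow> Z \<in> vfields M \<Longrightarrow> Z' \<in> vfields M \<Longrightarrow> f \<in> smooth_funs M \<Longrightarrow> p \<in> pts M \<Longrightarrow>
    curvature M D X Y (vf_add M Z Z') f p = curvature M D X Y Z f p + curvature M D X Y Z' f p"
  by (simp add: curvature_apply D_add2)

lemma curvature_scale3: "X \<in> vfields M \<Longrightarrow> Y \<in> vfields M \<Longrightarrow> Z \<in> vfields M \<Longrightarrow> h \<in> smooth_funs M \<Longrightarrow> f \<in> smooth_funs M \<Longrightarrow> p \<in> pts M \<Longrightarrow>
    curvature M D X Y (vf_scale M h Z) f p = h p * curvature M D X Y Z f p"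
  by (simp add: curvature_apply D_add2 D_scale2 algebra_simps)

end

section \<open>From right invariant fields to all fields\<close>

context lgroup
begin

text \<open>One argument at a time is extended from \<open>R\<close> to all fields by
  \<open>right_frame_induct\<close>; antisymmetry lets the rules for the first argument reach the
  second.\<close>

lemma frame_flat:
  assumes L: "linear_connection G D'"
    and t: "\<And>X Y. X \<in> R \<Longrightarrow> Y \<in> R \<Longrightarrow> torsion G D' X Y = vf_zero G"
    and c: "\<And>X Y Z. X \<in> R \<Longrightarrow> Y \<in> R \<Longrightarrow> Z \<in> R \<Longrightarrow> curvature G D' X Y Z = vf_zero G"
  shows "flat_affine_connection G D'"
proof -
  interpret conn G C D' by (unfold_locales) (rule L)
  have t1: "\<forall>f\<in>smooth_funs G. \<forall>g\<in>pts G. torsion G D' X Y f g = 0" if X: "X \<in> vfields G" and Y: "Y \<in> R" for X Y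
    by (rule right_frame_induct[OF X]) (simp_all add: t Y R_vf torsion_add torsion_scale)
  have t2: "\<forall>f\<in>smooth_funs G. \<forall>g\<in>pts G. torsion G D' Y X f g = 0" if X: "X \<in> vfields G" and Y: "Y \<in> vfields G" for X Y
  proof (rule right_frame_induct[OF Y])
    show "\<forall>f\<in>smooth_funs G. \<forall>g\<in>pts G. torsion G D' \<xi> X f g = 0" if "\<xi> \<in> R" for \<xi>
      using t1[OF X that] torsion_swap[OF R_vf[OF that] X] by simp
  qed (simp_all add: X torsion_add torsion_scale)
  have c3: "\<forall>f\<in>smooth_funs G. \<forall>g\<in>pts G. curvature G D' X Y Z f g = 0"
    if "X \<in> R" "Y \<in> R" and Z: "Z \<in> vfields G" for X Y Z
    by (rule right_frame_induct[OF Z]) (simp_all add: c that R_vf curvature_add3 curvature_scale3)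
  have c1: "\<forall>f\<in>smooth_funs G. \<forall>g\<in>pts G. curvature G D' X Y Z f g = 0"
    if X: "X \<in> vfields G" and Y: "Y \<in> R" and Z: "Z \<in> vfields G" for X Y Z
    by (rule right_frame_induct[OF X]) (simp_all add: c3 Y Z R_vf curvature_add1 curvature_scale1)
  have c2: "\<forall>f\<in>smooth_funs G. \<forall>g\<in>pts G. curvature G D' Y X Z f g = 0"
    if X: "X \<in> vfields G" and Y: "Y \<in> vfields G" and Z: "Z \<in> vfields G" for X Y Z
  proof (rule right_frame_induct[OF Y])
    show "\<forall>f\<in>smooth_funs G. \<forall>g\<in>pts G. curvature G D' \<xi> X Z f g = 0" if "\<xi> \<in> R" for \<xi>
      using c1[OF X that Z] curvature_swap[OF R_vf[OF that] X Z] by simp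
  qed (simp_all add: X Z curvature_add1 curvature_scale1)
  show ?thesis
    unfolding flat_affine_connection_def
  proof (intro conjI ballI L)
    fix X Y assume X: "X \<in> vfields G" and Y: "Y \<in> vfields G"
    show "torsion G D' X Y = vf_zero G"
      by (rule vf_eqI[OF torsion_vf[OF X Y]]) (use t2[OF Y X] in simp_all)
    fix Z assume Z: "Z \<in> vfields G"
    show "curvature G D' X Y Z = vf_zero G"
      by (rule vf_eqI[OF curvature_vf[OF X Y Z]]) (use c2[OF Y X Z] in simp_all)
  qed
qed

text \<open>The pushforward is additive and turns scaling by \<open>h\<close> into scaling by
  \<open>h\<close> composed with the inverse of \<open>F\<close>, so both sides change alike under
  sums and scaling, first in \<open>X\<close> and then in \<open>Y\<close>.\<close>

lemma frame_preserves:
  assumes L: "linear_connection G D'" and F: "diffeo G G F"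
    and p: "\<And>X Y. X \<in> R \<Longrightarrow> Y \<in> R \<Longrightarrow> pushforward G F (D' X Y) = D' (pushforward G F X) (pushforward G F Y)"
  shows "preserves_connection G D' F"
proof -
  interpret conn G C D' by (unfold_locales) (rule L)
  let ?P = "pushforward G F" and ?I = "inv_into (pts G) F"
  note pv = pushforward_vf[OF F]
  have ap: "?P X f g = X (\<lambda>p\<in>pts G. f (F p)) (?I g)" if "f \<in> smooth_funs G" "g \<in> pts G" for X f g
    using that by (simp add: pushforward_def)
  have hs: "(\<lambda>g\<in>pts G. h (?I g)) \<in> smooth_funs G" if "h \<in> smooth_funs G" for h
    by (rule mfld2.smooth_map_funs[OF mfld2_self diffeo_facts(2)[OF F] that])
  have hi: "(\<lambda>p\<in>pts G. (\<lambda>g\<in>pts G. h (?I g)) (F p)) = h" if "h \<in> smooth_funs G" for h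
    by (rule smooth_funs_eqI[OF pullback_smooth[OF F hs[OF that]] that]) (simp add: diffeo_facts[OF F])
  have Pa: "?P (vf_add G X Y) = vf_add G (?P X) (?P Y)" if "X \<in> vfields G" "Y \<in> vfields G" for X Y
    by (rule vf_eqI) (use that pv pullback_smooth[OF F] diffeo_facts(4)[OF F] in \<open>simp_all add: ap del: restrict_apply\<close>)
  have Ps: "?P (vf_scale G h X) = vf_scale G (\<lambda>g\<in>pts G. h (?I g)) (?P X)"
    if "X \<in> vfields G" "h \<in> smooth_funs G" for X h
  proof (rule vf_eqI)
    show "?P (vf_scale G h X) f g = vf_scale G (\<lambda>g\<in>pts G. h (?I g)) (?P X) f g"
      if "f \<in> smooth_funs G" "g \<in> pts G" for f g
      using that vf_scale_apply[OF pullback_smooth[OF F that(1)] diffeo_facts(4)[OF F that(2)]] by (simp add: ap)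
  qed (use that pv hs in auto)
  \<comment> \<open>Compatibility of the Leibniz terms: the transported derivative
    \<open>X h\<close> is the derivative of the transported function along the transported
    field.\<close>
  have Ph: "(\<lambda>g\<in>pts G. X h (?I g)) = ?P X (\<lambda>g\<in>pts G. h (?I g))" if "X \<in> vfields G" "h \<in> smooth_funs G" for X h
    using ap[OF hs[OF that(2)]] hi[OF that(2)] that pv hs
    by (intro smooth_funs_eqI hs) auto
  have 1: "?P (D' X Y) = D' (?P X) (?P Y)" if X: "X \<in> vfields G" and Y: "Y \<in> R" for X Y
    by (rule right_frame_induct[OF X]) (simp_all add: p Y R_vf D_add1 D_scale1 Pa Ps pv hs)
  show ?thesis
    unfolding preserves_connection_def
  proof (intro ballI)
    fix X Y assume X: "X \<in> vfields G" and Y: "Y \<in> vfields G"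
    show "?P (D' X Y) = D' (?P X) (?P Y)"
      by (rule right_frame_induct[OF Y]) (simp_all add: 1 X D_add2 D_scale2 Pa Ps Ph pv hs)
  qed
qed

text \<open>Left and right translations commute.\<close>

lemma pushforward_left_R:
  assumes a: "a \<in> pts G" and \<xi>: "\<xi> \<in> R" shows "pushforward G (left_translation \<Gamma> a) \<xi> \<in> R"
proof (rule RI)
  let ?P = "pushforward G (left_translation \<Gamma> a) \<xi>"
  show "?P \<in> vfields G" by (rule pushforward_vf[OF translation_diffeo(2)[OF a] R_vf[OF \<xi>]])
  fix b f x assume b: "b \<in> pts G" and f: "f \<in> smooth_funs G" and x: "x \<in> pts G"
  define y where "y = inv\<^bsub>\<Gamma>\<^esub> a \<odot> x"
  have y: "y \<in> pts G" "x = a \<odot> y" using a x by (simp_all add: y_def)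
  have af: "(\<lambda>q\<in>pts G. f (a \<odot> q)) \<in> smooth_funs G"
    using pullback_smooth[OF translation_diffeo(2)[OF a] f] by (simp add: left_apply cong: restrict_cong)
  have "?P (\<lambda>q\<in>pts G. f (q \<odot> b)) x = \<xi> (\<lambda>q\<in>pts G. (\<lambda>q\<in>pts G. f (q \<odot> b)) (a \<odot> q)) y"
    unfolding y(2) by (rule pushforward_left[OF a translate_fun[OF b f] y(1)])
  also have "(\<lambda>q\<in>pts G. (\<lambda>q\<in>pts G. f (q \<odot> b)) (a \<odot> q)) = (\<lambda>q\<in>pts G. (\<lambda>q\<in>pts G. f (a \<odot> q)) (q \<odot> b))"
    by (rule restrict_ext) (simp add: a b)
  also have "\<xi> \<dots> y = \<xi> (\<lambda>q\<in>pts G. f (a \<odot> q)) (y \<odot> b)" by (rule R_apply[OF \<xi> b af y(1)])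
  also have "\<dots> = ?P f (x \<odot> b)"
    using pushforward_left[OF a f group_rules(1)[OF y(1) b], of \<xi>] a b y by simp
  finally show "?P (\<lambda>q\<in>pts G. f (q \<odot> b)) x = ?P f (x \<odot> b)" .
qed

end

section \<open>Transport of the product to the group\<close>

context aff_group
begin

sublocale L: lgroup G C "Aff_group M D" k
  by unfold_locales (rule lg)

abbreviation ind where "ind \<equiv> induced_vfield M G"

lemma mult_apply: "g \<in> pts G \<Longrightarrow> h \<in> pts G \<Longrightarrow> p \<in> pts M \<Longrightarrow> (g \<otimes>\<^bsub>\<Gamma>\<^esub> h) p = g (h p)"
  by (simp add: mult_G compose_eq)

text \<open>Right invariance moves the evaluation from the identity to \<open>g\<close>, so
  \<open>\<xi>\<close> and its induced field are related by the orbit map of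
  \<open>p\<close>.\<close>

lemma induced_orbit:
  assumes \<xi>: "\<xi> \<in> L.R" and f: "f \<in> smooth_funs M" and p: "p \<in> pts M" and g: "g \<in> pts G"
  shows "\<xi> (\<lambda>h\<in>pts G. f (h p)) g = ind \<xi> f (g p)"
proof -
  have "(\<lambda>q\<in>pts G. (\<lambda>h\<in>pts G. f (h p)) (q \<otimes>\<^bsub>\<Gamma>\<^esub> g)) = (\<lambda>q\<in>pts G. f (q (g p)))"
    by (rule restrict_ext) (simp add: g p mult_apply)
  then show ?thesis
    using L.R_apply[OF \<xi> g orbit_fun[OF p f] e_in] L.group_rules(4)[OF g]
    by (simp add: induced_apply[OF f G_pts[OF g p]] one_G)
qed

text \<open>Fields related by a map have related brackets; here the map is the orbit map of
  \<open>p\<close>, and the brackets are compared at the identity.\<close>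

lemma induced_bracket:
  assumes \<xi>: "\<xi> \<in> L.R" and \<eta>: "\<eta> \<in> L.R" and I: "ind \<xi> \<in> vfields M" "ind \<eta> \<in> vfields M"
    and f: "f \<in> smooth_funs M" and p: "p \<in> pts M"
  shows "ind (vf_bracket G \<xi> \<eta>) f p = vf_bracket M (ind \<xi>) (ind \<eta>) f p"
proof -
  have o: "\<zeta> (\<lambda>h\<in>pts G. f (h p)) = (\<lambda>h\<in>pts G. ind \<zeta> f (h p))" if "\<zeta> \<in> L.R" "ind \<zeta> \<in> vfields M" for \<zeta>
    by (rule G.smooth_funs_eqI[OF G.vf_smooth[OF L.R_vf[OF that(1)] orbit_fun[OF p f]] orbit_fun[OF p vf_smooth[OF that(2) f]]])
      (simp add: induced_orbit[OF that(1) f p])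
  show ?thesis
    unfolding induced_apply[OF f p] G.vf_bracket_apply[OF orbit_fun[OF p f] e_in] vf_bracket_apply[OF f p] o[OF \<xi> I(1)] o[OF \<eta> I(2)]
    by (simp only: induced_apply[OF vf_smooth[OF I(1) f] p] induced_apply[OF vf_smooth[OF I(2) f] p])
qed

text \<open>Evaluating the left translate at the identity means evaluating \<open>\<xi>\<close> at
  the inverse of \<open>a\<close>; \<open>induced_orbit\<close> moves this to the point
  \<open>r\<close> with \<open>a r = p\<close>.\<close>

lemma induced_pushforward:
  assumes \<xi>: "\<xi> \<in> L.R" and I: "ind \<xi> \<in> vfields M" and a: "a \<in> pts G"
    and I': "ind (pushforward G (left_translation \<Gamma> a) \<xi>) \<in> vfields M"
  shows "ind (pushforward G (left_translation \<Gamma> a) \<xi>) = pushforward M a (ind \<xi>)"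
proof (rule vf_eqI[OF I' pushforward_vf[OF G_diffeo[OF a] I]])
  fix f p assume f: "f \<in> smooth_funs M" and p: "p \<in> pts M"
  define r where "r = inv_into (pts M) a p"
  have r: "r \<in> pts M" "p = a r" unfolding r_def using diffeo_facts(4,6)[OF G_diffeo[OF a] p] by simp_all
  let ?i = "inv\<^bsub>\<Gamma>\<^esub> a"
  have i: "?i \<in> pts G" using a by simp
  have ir: "?i p = r" using mult_apply[OF i a r(1)] a r by (simp add: one_G)
  note fa = pullback_smooth[OF G_diffeo[OF a] f]
  have "ind (pushforward G (left_translation \<Gamma> a) \<xi>) f p = \<xi> (\<lambda>q\<in>pts G. (\<lambda>h\<in>pts G. f (h p)) (a \<otimes>\<^bsub>\<Gamma>\<^esub> q)) ?i"
    using L.pushforward_left[OF a orbit_fun[OF p f] i, of \<xi>] a by (simp add: induced_apply[OF f p] one_G)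
  also have "(\<lambda>q\<in>pts G. (\<lambda>h\<in>pts G. f (h p)) (a \<otimes>\<^bsub>\<Gamma>\<^esub> q)) = (\<lambda>q\<in>pts G. (\<lambda>p\<in>pts M. f (a p)) (q p))"
    by (rule restrict_ext) (simp add: a p mult_apply G_pts)
  also have "\<xi> \<dots> ?i = ind \<xi> (\<lambda>p\<in>pts M. f (a p)) r"
    using induced_orbit[OF \<xi> fa p i] ir by simp
  also have "\<dots> = pushforward M a (ind \<xi>) f p"
    unfolding r(2) by (rule pushforward_apply[OF G_diffeo[OF a] f r(1), symmetric])
  finally show "ind (pushforward G (left_translation \<Gamma> a) \<xi>) f p = pushforward M a (ind \<xi>) f p" .
qed

lemma D_cst:
  assumes "X \<in> vfields M" "Y \<in> vfields M" "f \<in> smooth_funs M" "p \<in> pts M"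
  shows "D (vf_scale M (cst c) X) Y f p = c * D X Y f p" "D X (vf_scale M (cst c) Y) f p = c * D X Y f p"
  using assms by (simp_all add: D_scale1 D_scale2 vf_cst) (simp_all add: cst_def)

text \<open>Completeness is automatic on a compact manifold, so \<open>ind\<close> is a bijection
  onto all of \<open>inf_affine M D\<close>, which is closed under \<open>D\<close>;
  \<open>m\<close> is the product carried back through this bijection.\<close>

lemma inherited_connection_exists:
  assumes comp: "compact_space (mtop M)"
  shows "\<exists>D'. flat_affine_connection G D' \<and> bi_invariant G \<Gamma> D' \<and> inherited_connection M D G D'"
proof -
  have "{X \<in> inf_affine M D. complete_vf M X} = inf_affine M D"
    using compact_complete[OF comp] by (auto simp: inf_affine_def)
  then have bij: "bij_betw ind L.R (inf_affine M D)" using alg by (simp add: affine_lie_group_def)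
  have Ia: "ind \<xi> \<in> inf_affine M D" if "\<xi> \<in> L.R" for \<xi> using bij that by (auto simp: bij_betw_def)
  then have Iv: "ind \<xi> \<in> vfields M" if "\<xi> \<in> L.R" for \<xi> using that by (auto simp: inf_affine_def)
  \<comment> \<open>Injectivity of \<open>ind\<close> allows identities between right invariant
    fields on \<open>G\<close> to be checked on \<open>M\<close>.\<close>
  have Ieq: "\<xi> = \<eta>" if "\<xi> \<in> L.R" "\<eta> \<in> L.R"
    and "\<And>f p. f \<in> smooth_funs M \<Longrightarrow> p \<in> pts M \<Longrightarrow> ind \<xi> f p = ind \<eta> f p" for \<xi> \<eta>
    using bij that vf_eqI[OF Iv[OF that(1)] Iv[OF that(2)]] by (auto simp: bij_betw_def inj_on_def)
  have Id: "D (ind \<xi>) (ind \<eta>) \<in> inf_affine M D" if "\<xi> \<in> L.R" "\<eta> \<in> L.R" for \<xi> \<eta>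
    using affine_vf_product Ia that inf_affine_iff[OF comp] by blast
  define m where "m \<xi> \<eta> = inv_into L.R ind (D (ind \<xi>) (ind \<eta>))" for \<xi> \<eta>
  have mR: "m \<xi> \<eta> \<in> L.R" and mI: "ind (m \<xi> \<eta>) = D (ind \<xi>) (ind \<eta>)" if "\<xi> \<in> L.R" "\<eta> \<in> L.R" for \<xi> \<eta>
    using Id[OF that] bij unfolding m_def bij_betw_def by (metis inv_into_into, metis f_inv_into_f)
  have Il: "ind (vf_diff G \<xi> \<eta>) f p = ind \<xi> f p - ind \<eta> f p" "ind (vf_zero G) f p = 0"
    "ind (vf_scale G (G.cst c) \<xi>) f p = c * ind \<xi> f p"
    "ind (G.vf_sum C F) f p = (\<Sum>b\<in>C. ind (F b) f p)"
    if "f \<in> smooth_funs M" "p \<in> pts M" for \<xi> \<eta> f p c F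
    using orbit_fun[OF that(2,1)] that by (simp_all add: induced_apply G.cst_def)
  have bil: "m (G.vf_sum C (\<lambda>a. vf_scale G (G.cst (c a)) (\<xi> a))) (G.vf_sum C (\<lambda>b. vf_scale G (G.cst (d b)) (\<xi> b))) f g
      = (\<Sum>a\<in>C. \<Sum>b\<in>C. c a * d b * m (\<xi> a) (\<xi> b) f g)"
    if \<xi>: "\<forall>b\<in>C. \<xi> b \<in> L.R" and f: "f \<in> smooth_funs G" and g: "g \<in> pts G" for \<xi> c d f g
  proof -
    note fin = orthobasis_finite[OF G.onb]
    let ?S = "\<lambda>c. G.vf_sum C (\<lambda>a. vf_scale G (G.cst (c a)) (\<xi> a))"
    let ?I = "\<lambda>c. vf_sum C (\<lambda>a. vf_scale M (cst (c a)) (ind (\<xi> a)))"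
    let ?T = "G.vf_sum C (\<lambda>a. G.vf_sum C (\<lambda>b. vf_scale G (G.cst (c a * d b)) (m (\<xi> a) (\<xi> b))))"
    have S: "?S c \<in> L.R" for c using \<xi> by (intro L.R_sum fin L.R_scale) auto
    have T: "?T \<in> L.R" using \<xi> by (intro L.R_sum fin L.R_scale mR) auto
    have Ix: "ind (\<xi> b) \<in> vfields M" if "b \<in> C" for b using Iv \<xi> that by blast
    have IV: "?I c \<in> vfields M" for c by (rule vf_sumI[OF fin]) (simp add: Ix)
    have IS: "ind (?S c) = ?I c" for c
      by (rule vf_eqI[OF Iv[OF S] IV]) (simp add: Il, simp add: cst_def)
    have "m (?S c) (?S d) = ?T"
    proof (rule Ieq[OF mR[OF S S] T])
      fix f p assume f: "f \<in> smooth_funs M" and p: "p \<in> pts M"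
      have "ind (m (?S c) (?S d)) f p = D (?I c) (?I d) f p" by (simp only: mI[OF S S] IS)
      also have "\<dots> = (\<Sum>a\<in>C. D (vf_scale M (cst (c a)) (ind (\<xi> a))) (?I d) f p)"
        by (rule D_sum1[OF fin _ IV f p]) (simp add: Ix)
      also have "\<dots> = (\<Sum>a\<in>C. c a * D (ind (\<xi> a)) (?I d) f p)"
        by (rule sum.cong[OF refl]) (rule D_cst(1)[OF Ix IV f p])
      also have "\<dots> = (\<Sum>a\<in>C. c a * (\<Sum>b\<in>C. d b * ind (m (\<xi> a) (\<xi> b)) f p))"
      proof (rule sum.cong[OF refl])
        fix a assume a: "a \<in> C"
        have "D (ind (\<xi> a)) (?I d) f p = (\<Sum>b\<in>C. D (ind (\<xi> a)) (vf_scale M (cst (d b)) (ind (\<xi> b))) f p)"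
          by (rule D_sum2[OF fin _ Ix[OF a] f p]) (simp add: Ix)
        also have "\<dots> = (\<Sum>b\<in>C. d b * ind (m (\<xi> a) (\<xi> b)) f p)"
          by (rule sum.cong[OF refl]) (use \<xi> a in \<open>simp add: D_cst(2)[OF Ix[OF a] Ix f p] mI\<close>)
        finally show "c a * D (ind (\<xi> a)) (?I d) f p = c a * (\<Sum>b\<in>C. d b * ind (m (\<xi> a) (\<xi> b)) f p)" by simp
      qed
      also have "\<dots> = ind ?T f p"
        by (simp add: Il[OF f p] sum_distrib_left mult.assoc)
      finally show "ind (m (?S c) (?S d)) f p = ind ?T f p" .
    qed
    then show ?thesis using f g by simp (simp add: G.cst_def g)
  qed
  have "\<exists>D'. linear_connection G D' \<and> (\<forall>\<xi>\<in>L.R. \<forall>\<eta>\<in>L.R. D' \<xi> \<eta> = m \<xi> \<eta>)"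
    by (rule L.frame_connection) (rule mR, assumption, assumption, rule bil)
  then obtain D' where L: "linear_connection G D'" and D': "\<forall>\<xi>\<in>L.R. \<forall>\<eta>\<in>L.R. D' \<xi> \<eta> = m \<xi> \<eta>"
    by (elim exE conjE)
  have D'': "D' \<xi> \<eta> = m \<xi> \<eta>" if "\<xi> \<in> L.R" "\<eta> \<in> L.R" for \<xi> \<eta> using D' that by blast
  have flat: "flat_affine_connection G D'"
  proof (rule L.frame_flat[OF L])
    fix X Y assume X: "X \<in> L.R" and Y: "Y \<in> L.R"
    note m = mR[OF X Y] mR[OF Y X] and b = L.R_bracket[OF X Y]
    show "torsion G D' X Y = vf_zero G"
      unfolding torsion_def D''[OF X Y] D''[OF Y X]
    proof (rule Ieq[OF L.R_diff[OF L.R_diff[OF m] b] L.R_zero])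
      fix f p assume f: "f \<in> smooth_funs M" and p: "p \<in> pts M"
      have "torsion M D (ind X) (ind Y) f p = 0"
        using fl Iv X Y f p by (simp add: flat_affine_connection_def)
      then show "ind (vf_diff G (vf_diff G (m X Y) (m Y X)) (vf_bracket G X Y)) f p = ind (vf_zero G) f p"
        using X Y Iv by (simp add: Il f p mI torsion_def induced_bracket)
    qed
    fix Z assume Z: "Z \<in> L.R"
    note n = mR[OF X mR[OF Y Z]] mR[OF Y mR[OF X Z]] mR[OF b Z]
    have Ib: "ind (vf_bracket G X Y) = vf_bracket M (ind X) (ind Y)"
      by (rule vf_eqI[OF Iv[OF b]]) (use X Y Iv in \<open>simp_all add: induced_bracket\<close>)
    show "curvature G D' X Y Z = vf_zero G"
      unfolding curvature_def D''[OF Y Z] D''[OF X Z] D''[OF b Z] D''[OF X mR[OF Y Z]] D''[OF Y mR[OF X Z]]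
    proof (rule Ieq[OF L.R_diff[OF L.R_diff[OF n(1,2)] n(3)] L.R_zero])
      fix f p assume f: "f \<in> smooth_funs M" and p: "p \<in> pts M"
      have "curvature M D (ind X) (ind Y) (ind Z) f p = 0"
        using fl Iv X Y Z f p by (simp add: flat_affine_connection_def)
      then show "ind (vf_diff G (vf_diff G (m X (m Y Z)) (m Y (m X Z))) (m (vf_bracket G X Y) Z)) f p = ind (vf_zero G) f p"
        using X Y Z b mR by (simp add: Il f p mI curvature_def Ib)
    qed
  qed
  have "bi_invariant G \<Gamma> D'"
    unfolding bi_invariant_def
  proof (intro ballI conjI)
    fix a assume "a \<in> carrier \<Gamma>"
    then have a: "a \<in> pts G" by simp
    have r: "pushforward G (right_translation \<Gamma> a) \<xi> = \<xi>" if "\<xi> \<in> L.R" for \<xi>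
      using that a by (simp add: right_invariant_vfields_def)
    show "preserves_connection G D' (right_translation \<Gamma> a)"
      by (rule L.frame_preserves[OF L L.translation_diffeo(1)[OF a]]) (simp add: r D'' mR)
    let ?P = "pushforward G (left_translation \<Gamma> a)"
    note P = L.pushforward_left_R[OF a]
    have IP: "ind (?P \<xi>) = pushforward M a (ind \<xi>)" if "\<xi> \<in> L.R" for \<xi>
      by (rule induced_pushforward[OF that Iv[OF that] a Iv[OF P[OF that]]])
    show "preserves_connection G D' (left_translation \<Gamma> a)"
    proof (rule L.frame_preserves[OF L L.translation_diffeo(2)[OF a]])
      fix X Y assume X: "X \<in> L.R" and Y: "Y \<in> L.R"
      have "ind (?P (m X Y)) = ind (m (?P X) (?P Y))"
        using G_preserves[OF a] Iv[OF X] Iv[OF Y]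
        by (simp add: IP mI mR X Y P preserves_connection_def)
      then have "?P (m X Y) = m (?P X) (?P Y)" by (intro Ieq P mR X Y) simp
      then show "?P (D' X Y) = D' (?P X) (?P Y)" by (simp add: D'' X Y P)
    qed
  qed
  moreover have "inherited_connection M D G D'"
    unfolding inherited_connection_def
  proof (intro ballI)
    fix X Y assume X: "X \<in> inf_affine M D" and Y: "Y \<in> inf_affine M D"
    note im = bij_betw_imp_surj_on[OF bij]
    note x = inv_into_into[of X ind L.R, unfolded im, OF X] f_inv_into_f[of X ind L.R, unfolded im, OF X]
    note y = inv_into_into[of Y ind L.R, unfolded im, OF Y] f_inv_into_f[of Y ind L.R, unfolded im, OF Y]
    show "\<exists>\<xi>\<in>L.R. \<exists>\<eta>\<in>L.R. ind \<xi> = X \<and> ind \<eta> = Y \<and> D' \<xi> \<eta> \<in> L.R \<and> ind (D' \<xi> \<eta>) = D X Y"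
      by (intro bexI[OF _ x(1)] bexI[OF _ y(1)]) (simp add: D'' x y mR mI)
  qed
  ultimately show ?thesis using flat by (intro exI[of _ D'] conjI)
qed

end

theorem proposition4p1:
  fixes M :: "('a, 'e::real_inner) manifold"
    and D :: "'a connection"
    and G :: "('a \<Rightarrow> 'a, 'f::real_inner) manifold"
    and n k :: nat
  assumes "smooth_manifold n M" and "connected_space (mtop M)"
    and "flat_affine_connection M D"
    and "affine_lie_group k M D G"
    and "compact_space (mtop M)"
  shows "\<exists>D'. flat_affine_connection G D' \<and> bi_invariant G (Aff_group M D) D' \<and>
              inherited_connection M D G D'"
proof -
  obtain B where B: "mfld M B" by (rule smooth_manifold_mfld[OF assms(1)])
  have "smooth_manifold k G" using assms(4) by (simp add: affine_lie_group_def lie_group_def)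
  then obtain C where C: "mfld G C" by (rule smooth_manifold_mfld)
  have "aff_group M B D G C k"
    using B C assms(3,4)
    by (simp add: aff_group_def aff_group_axioms_def flat_conn_def flat_conn_axioms_def conn_def conn_axioms_def
        flat_affine_connection_def)
  then show ?thesis by (rule aff_group.inherited_connection_exists[OF _ assms(5)])
qed

end
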